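(* Let $(X_i,Y_i)$, $i=1,\dots,n$, be i.i.d. with $X_i\sim\mathcal N(0,M)$ in $\mathbb R^d$, $M\succ0$, and $Y_i\mid X_i\sim\mathrm{Bernoulli}(\sigma(\beta^\top X_i))$, and let $\pi\propto e^{-V}$ on $\mathbb R^d$ be the logistic regression posterior with Gaussian prior $\mathcal N(0,\Sigma_0)$ or flat prior ($\Sigma_0^{-1}=0$), where $$V(b)=nv(b)=-\sum_{i=1}^nY_iX_i^\top b+\sum_{i=1}^n\psi(X_i^\top b)+\frac12b^\top\Sigma_0^{-1}b .$$ Let $\epsilon=d/\sqrt n$ and $\tau=d\exp(-Cn^{1/4}\sqrt d)$. Suppose $\|\beta\|_M\le C$. If $\epsilon$ and $n^{-1}\|\Sigma_0^{-1}\|_M$ are smaller than sufficiently small absolute constants, then on an event of probability at least $1-C\exp(-C\max(\sqrt d,\log n))$ (with respect to the joint distribution of $(X_i,Y_i)_{i=1}^n$) the function $v$ has a unique global minimizer $\hat b$ and the following bounds hold. For every standardized function $g$ (as defined in the context, with constant $a_g$): $$\Big|\int g\,d\pi-\int g\,d\hat\gamma\Big|\lesssim(a_g\vee1)\tau+\begin{cases}\epsilon & \text{in general},\\ \epsilon^2 & \text{if } g \text{ is even about }\hat b,\end{cases}$$ $$\Big|\int g\,d\pi-\int g\,d\hat\gamma_S\Big|\lesssim(a_g\vee1)\tau+\begin{cases}\epsilon^2 & \text{in general},\\ \epsilon^3 & \text{if } g \text{ is odd about }\hat b.\end{cases}$$ Furthermore, the following total variation bounds hold: $$|L_{\mathrm{TV}}|\lesssim\epsilon,\qquad|\mathrm{TV}(\pi,\hat\gamma)-L_{\mathrm{TV}}|\le\mathrm{TV}(\pi,\hat\gamma_S)\lesssim\epsilon^2+\tau,$$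 the following mean bounds hold: $$\|\delta\hat b\|_{H_V}\lesssim\epsilon,\qquad\|\bar b-\hat b-\delta\hat b\|_{H_V}\lesssim\epsilon^3+\tau,$$ and the following covariance bound holds: $$\|H_V^{1/2}(\Sigma_\pi-H_V^{-1})H_V^{1/2}\|\lesssim\epsilon^2+\tau .$$ In each bound, the absolute constant suppressed by $\lesssim$ is deterministic (independent of the data realization).
   Context: $\sigma(t)=(1+e^{-t})^{-1}$, $\psi(t)=\log(1+e^t)$. For symmetric positive definite $H$, $\|x\|_H=\sqrt{x^\top Hx}$ for vectors and $\|A\|_H=\sup_{\|u\|_H=1}|u^\top Au|$ for symmetric matrices; $\|\cdot\|$ is the operator norm. $a\vee b=\max(a,b)$. $C$ denotes positive absolute constants which may differ at each occurrence; $a\lesssim b$ means $a\le Cb$. $H_V=\nabla^2V(\hat b)$; $\hat\gamma=\mathcal N(\hat b,H_V^{-1})$ is the Laplace approximation; $S(b)=-\frac16\langle\nabla^3V(\hat b),(b-\hat b)^{\otimes3}\rangle$; $\hat\gamma_S$ is the signed measure $d\hat\gamma_S=(1+S)d\hat\gamma$; $L_{\mathrm{TV}}=\frac12\int|S|\,d\hat\gamma$; $\mathrm{TV}(\mu,\nu)=\sup_A|\mu(A)-\nu(A)|$ over Borel sets; $\bar b=\int b\,d\pi(b)$; $\Sigma_\pi$ is the covariance matrix of $\pi$; $\delta\hat b=-\frac12H_V^{-1}\langle\nabla^3V(\hat b),H_V^{-1}\rangle$, where $\langle T,A\rangle_i=\sum_{j,k}T_{ijk}A_{jk}$. A standardized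 function is $g=(G-\int G\,d\hat\gamma)/\sqrt{\mathrm{Var}_{\hat\gamma}(G)}$, where $G:\mathbb R^d\to\mathbb R$ is measurable with $\mathrm{Var}_{\hat\gamma}(G)>0$ and satisfies, for some $a_G\ge0$, $|G(b)-\int G\,d\hat\gamma|\le a_G\exp(\sqrt d\,\|b-\hat b\|_{H_V}/2)$ for all $b\in\mathbb R^d$; then $a_g=a_G/\sqrt{\mathrm{Var}_{\hat\gamma}(G)}$. (This is the paper's growth condition with the constant $c_0=1$, the value valid in this model.) $g$ is even (odd) about $\hat b$ if $g(\hat b+y)=g(\hat b-y)$ (resp. $=-g(\hat b-y)$) for all $y$. *)

theory Defs
  imports "HOL-Probability.Probability" "Jordan_Normal_Form.Gauss_Jordan_Elimination"
    "Jordan_Normal_Form.Determinant"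
begin

text \<open>
  The absolute constants must not depend on the dimension, so the dimension is a natural number
  and points of Euclidean d-space are the elements of \<^term>\<open>carrier_vec d\<close>.
\<close>

no_notation Finite_Cartesian_Product.vec_nth (infixl "$" 90)
no_notation inner (infix "\<bullet>" 70)

type_synonym rvec = "real Matrix.vec"
type_synonym rmat = "real Matrix.mat"

section \<open>Matrices and norms\<close>

definition pos_def :: "nat \<Rightarrow> rmat \<Rightarrow> bool" where
  "pos_def d A \<longleftrightarrow> A \<in> carrier_mat d d \<and> transpose_mat A = A \<and>
     (\<forall>u\<in>carrier_vec d. u \<noteq> 0\<^sub>v d \<longrightarrow> 0 < u \<bullet> (A *\<^sub>v u))"

definition pos_semidef :: "nat \<Rightarrow> rmat \<Rightarrow> bool" where
  "pos_semidef d A \<longleftrightarrow> A \<in> carrier_mat d d \<and> transpose_mat A = A \<and>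
     (\<forall>u\<in>carrier_vec d. 0 \<le> u \<bullet> (A *\<^sub>v u))"

definition mat_inv :: "rmat \<Rightarrow> rmat" where
  "mat_inv A = the (mat_inverse A)"

definition mat_sqrt :: "nat \<Rightarrow> rmat \<Rightarrow> rmat" where
  "mat_sqrt d A = (THE R. pos_semidef d R \<and> R * R = A)"

definition wnorm :: "rmat \<Rightarrow> rvec \<Rightarrow> real" where
  "wnorm H x = sqrt (x \<bullet> (H *\<^sub>v x))"

definition mat_wnorm :: "nat \<Rightarrow> rmat \<Rightarrow> rmat \<Rightarrow> real" where
  "mat_wnorm d H A = (SUP u\<in>{u \<in> carrier_vec d. wnorm H u = 1}. \<bar>u \<bullet> (A *\<^sub>v u)\<bar>)"

definition enorm :: "rvec \<Rightarrow> real" where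
  "enorm x = sqrt (x \<bullet> x)"

definition op_norm :: "nat \<Rightarrow> rmat \<Rightarrow> real" where
  "op_norm d A = (SUP u\<in>{u \<in> carrier_vec d. enorm u = 1}. enorm (A *\<^sub>v u))"

section \<open>Derivatives\<close>

definition partial_deriv :: "nat \<Rightarrow> nat \<Rightarrow> (rvec \<Rightarrow> real) \<Rightarrow> rvec \<Rightarrow> real" where
  "partial_deriv d i f b = deriv (\<lambda>t. f (b + t \<cdot>\<^sub>v unit_vec d i)) 0"

definition hessian :: "nat \<Rightarrow> (rvec \<Rightarrow> real) \<Rightarrow> rvec \<Rightarrow> rmat" where
  "hessian d f b = Matrix.mat d d (\<lambda>(i, j). partial_deriv d i (partial_deriv d j f) b)"

definition third_deriv :: "nat \<Rightarrow> (rvec \<Rightarrow> real) \<Rightarrow> rvec \<Rightarrow> nat \<Rightarrow> nat \<Rightarrow> nat \<Rightarrow> real" where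
  "third_deriv d f b i j k = partial_deriv d i (partial_deriv d j (partial_deriv d k f)) b"

definition cubic_form :: "nat \<Rightarrow> (nat \<Rightarrow> nat \<Rightarrow> nat \<Rightarrow> real) \<Rightarrow> rvec \<Rightarrow> real" where
  "cubic_form d T y = (\<Sum>i<d. \<Sum>j<d. \<Sum>k<d. T i j k * y $ i * y $ j * y $ k)"

definition tensor_mat :: "nat \<Rightarrow> (nat \<Rightarrow> nat \<Rightarrow> nat \<Rightarrow> real) \<Rightarrow> rmat \<Rightarrow> rvec" where
  "tensor_mat d T A = Matrix.vec d (\<lambda>i. \<Sum>j<d. \<Sum>k<d. T i j k * A $$ (j, k))"

section \<open>Measures on d-space\<close>

text \<open>
  Lebesgue measure on the Borel sets of d-space, transported from the product measure along the
  bijection \<^term>\<open>Matrix.vec d\<close> between extensional functions on \<^term>\<open>{..<d}\<close> and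
  \<^term>\<open>carrier_vec d\<close>.
\<close>

definition lborel_vec :: "nat \<Rightarrow> rvec measure" where
  "lborel_vec d = embed_measure (\<Pi>\<^sub>M i\<in>{..<d}. lborel) (Matrix.vec d)"

text \<open>The second parameter is the mean, the third the covariance matrix.\<close>

definition gaussian :: "nat \<Rightarrow> rvec \<Rightarrow> rmat \<Rightarrow> rvec measure" where
  "gaussian d m C = density (lborel_vec d) (\<lambda>x. ennreal
     (exp (- ((x - m) \<bullet> (mat_inv C *\<^sub>v (x - m))) / 2) / sqrt ((2 * pi) ^ d * Determinant.det C)))"

text \<open>
  The probability measure proportional to \<open>exp (- V)\<close>. If \<open>exp (- V)\<close> is not integrable, this is the
  null measure, so \<^term>\<open>prob_space (gibbs d V)\<close> expresses that the normalization is possible.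
\<close>

definition gibbs :: "nat \<Rightarrow> (rvec \<Rightarrow> real) \<Rightarrow> rvec measure" where
  "gibbs d V = density (lborel_vec d)
     (\<lambda>b. ennreal (exp (- V b) / (\<integral>x. exp (- V x) \<partial>lborel_vec d)))"

definition mean_vec :: "nat \<Rightarrow> rvec measure \<Rightarrow> rvec" where
  "mean_vec d \<mu> = Matrix.vec d (\<lambda>i. \<integral>b. b $ i \<partial>\<mu>)"

definition cov_mat :: "nat \<Rightarrow> rvec measure \<Rightarrow> rmat" where
  "cov_mat d \<mu> = Matrix.mat d d (\<lambda>(i, j).
     \<integral>b. (b $ i - mean_vec d \<mu> $ i) * (b $ j - mean_vec d \<mu> $ j) \<partial>\<mu>)"

definition var :: "rvec measure \<Rightarrow> (rvec \<Rightarrow> real) \<Rightarrow> real" where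
  "var \<mu> G = (\<integral>b. (G b - (\<integral>x. G x \<partial>\<mu>))\<^sup>2 \<partial>\<mu>)"

text \<open>
  Total variation distance of real-valued set functions on the Borel sets; set functions, because
  one of the arguments may be a signed measure.
\<close>

definition tv :: "nat \<Rightarrow> (rvec set \<Rightarrow> real) \<Rightarrow> (rvec set \<Rightarrow> real) \<Rightarrow> real" where
  "tv d \<mu> \<nu> = (SUP A\<in>sets (lborel_vec d). \<bar>\<mu> A - \<nu> A\<bar>)"

section \<open>Logistic regression\<close>

definition sigmoid :: "real \<Rightarrow> real" where
  "sigmoid t = 1 / (1 + exp (- t))"

definition softplus :: "real \<Rightarrow> real" where
  "softplus t = ln (1 + exp t)"

text \<open>
  Law of one observation \<open>(X, Y)\<close>: the density with respect to (law of X) \<open>\<otimes>\<close> (counting measure) is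
  the conditional probability mass function of Y given X.
\<close>

definition obs_law :: "nat \<Rightarrow> rmat \<Rightarrow> rvec \<Rightarrow> (rvec \<times> bool) measure" where
  "obs_law d M \<beta> = density (gaussian d (0\<^sub>v d) M \<Otimes>\<^sub>M count_space UNIV)
     (\<lambda>(x, y). ennreal (pmf (bernoulli_pmf (sigmoid (\<beta> \<bullet> x))) y))"

definition data_law :: "nat \<Rightarrow> nat \<Rightarrow> rmat \<Rightarrow> rvec \<Rightarrow> (nat \<Rightarrow> rvec \<times> bool) measure" where
  "data_law n d M \<beta> = (\<Pi>\<^sub>M i\<in>{..<n}. obs_law d M \<beta>)"

text \<open>Prior precision matrices: zero for the flat prior, otherwise the inverse covariance.\<close>

definition prior_precision :: "nat \<Rightarrow> rmat \<Rightarrow> bool" where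
  "prior_precision d P \<longleftrightarrow> P = 0\<^sub>m d d \<or> (\<exists>\<Sigma>\<^sub>0. pos_def d \<Sigma>\<^sub>0 \<and> P = mat_inv \<Sigma>\<^sub>0)"

definition potential :: "nat \<Rightarrow> rmat \<Rightarrow> (nat \<Rightarrow> rvec \<times> bool) \<Rightarrow> rvec \<Rightarrow> real" where
  "potential n P D b = - (\<Sum>i<n. of_bool (snd (D i)) * (fst (D i) \<bullet> b))
     + (\<Sum>i<n. softplus (fst (D i) \<bullet> b)) + (b \<bullet> (P *\<^sub>v b)) / 2"

section \<open>Laplace approximation\<close>

definition laplace :: "nat \<Rightarrow> (rvec \<Rightarrow> real) \<Rightarrow> rvec \<Rightarrow> rvec measure" where
  "laplace d V m = gaussian d m (mat_inv (hessian d V m))"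

definition skew :: "nat \<Rightarrow> (rvec \<Rightarrow> real) \<Rightarrow> rvec \<Rightarrow> rvec \<Rightarrow> real" where
  "skew d V m b = - (1 / 6) * cubic_form d (third_deriv d V m) (b - m)"

text \<open>
  The signed measure with density \<open>1 + S\<close> with respect to the Laplace approximation, given by its
  values on Borel sets and by its integral.
\<close>

definition skew_laplace :: "nat \<Rightarrow> (rvec \<Rightarrow> real) \<Rightarrow> rvec \<Rightarrow> rvec set \<Rightarrow> real" where
  "skew_laplace d V m A = (\<integral>b\<in>A. (1 + skew d V m b) \<partial>laplace d V m)"

definition skew_laplace_integral :: "nat \<Rightarrow> (rvec \<Rightarrow> real) \<Rightarrow> rvec \<Rightarrow> (rvec \<Rightarrow> real) \<Rightarrow> real" where
  "skew_laplace_integral d V m g = (\<integral>b. g b * (1 + skew d V m b) \<partial>laplace d V m)"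

definition tv_leading :: "nat \<Rightarrow> (rvec \<Rightarrow> real) \<Rightarrow> rvec \<Rightarrow> real" where
  "tv_leading d V m = (1 / 2) * (\<integral>b. \<bar>skew d V m b\<bar> \<partial>laplace d V m)"

definition mean_shift :: "nat \<Rightarrow> (rvec \<Rightarrow> real) \<Rightarrow> rvec \<Rightarrow> rvec" where
  "mean_shift d V m = (let H = hessian d V m in
     (- (1 / 2)) \<cdot>\<^sub>v (mat_inv H *\<^sub>v tensor_mat d (third_deriv d V m) (mat_inv H)))"

definition standardized ::
    "nat \<Rightarrow> (rvec \<Rightarrow> real) \<Rightarrow> rvec \<Rightarrow> (rvec \<Rightarrow> real) \<Rightarrow> real \<Rightarrow> bool" where
  "standardized d V m g a \<longleftrightarrow>
     (\<exists>G aG. G \<in> borel_measurable (lborel_vec d) \<and> 0 < var (laplace d V m) G \<and> 0 \<le> aG \<and>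
        (\<forall>b\<in>carrier_vec d. \<bar>G b - (\<integral>x. G x \<partial>laplace d V m)\<bar>
            \<le> aG * exp (sqrt (real d) * wnorm (hessian d V m) (b - m) / 2)) \<and>
        g = (\<lambda>b. (G b - (\<integral>x. G x \<partial>laplace d V m)) / sqrt (var (laplace d V m) G)) \<and>
        a = aG / sqrt (var (laplace d V m) G))"

definition even_about :: "nat \<Rightarrow> rvec \<Rightarrow> (rvec \<Rightarrow> real) \<Rightarrow> bool" where
  "even_about d m g \<longleftrightarrow> (\<forall>y\<in>carrier_vec d. g (m + y) = g (m - y))"

definition odd_about :: "nat \<Rightarrow> rvec \<Rightarrow> (rvec \<Rightarrow> real) \<Rightarrow> bool" where
  "odd_about d m g \<longleftrightarrow> (\<forall>y\<in>carrier_vec d. g (m + y) = - g (m - y))"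

end

theory Submission
  imports Defs "HOL-Real_Asymp.Real_Asymp"
begin

text \<open>
  On an event of large probability the design satisfies moment bounds uniformly over all directions: upper
  bounds for the fourth and sixth powers of the linear predictors and a lower bound for the total margin of
  misclassification. They follow from Chernoff bounds on finite nets. On this event the problem is deterministic: the
  minimizer exists, the Hessian there dominates a multiple of \<open>n M\<close>, and in the coordinates that whiten
  the Hessian the posterior has density proportional to \<open>exp r\<close> with respect to the standard Gaussian, where
  \<open>r\<close> is the Taylor remainder of order three and \<open>S\<close> is its cubic part. The Maurey--Pisier
  inequality gives dimension-free control \<open>S = O(\<epsilon>)\<close> in all moments although \<open>S\<close> is not
  uniformly small, hence \<open>exp r = 1 + S + O(\<epsilon>\<^sup>2)\<close> in mean square on a ball that carries almost all the
  mass, with an odd part of the error of order \<open>\<epsilon>\<^sup>3\<close>. Total variation, mean and covariance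
  are expectations of bounded, linear and quadratic test functions.
\<close>

section \<open>Lebesgue and Gaussian measure in coordinates\<close>

text \<open>The obstacle is that only \<open>eps\<close>, not \<open>d ^ 3 / n\<close>, is small: at
  points of typical squared norm \<open>d\<close> the pointwise bound for \<open>S\<close> is of
  order \<open>d ^ (3 / 2) / sqrt n\<close>, so \<open>exp r\<close> has no useful pointwise
  expansion. But the gradient of \<open>S\<close> at \<open>x\<close> has norm at most of order
  \<open>sqn d x / sqrt n\<close>, which is \<open>eps\<close> at typical points, and Gaussian
  concentration turns this into moments of \<open>S\<close>. The squared radius \<open>rho2\<close>
  of the ball is the geometric mean of \<open>d\<close> and \<open>sqrt n\<close>, the squared norm
  at which the quartic remainder may reach order one. It is small enough for this remainder to stay
  below \<open>B * eps\<close> and for \<open>exp (4 * S)\<close> to have a bounded mean on the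
  ball, and large enough for the mass outside to be below \<open>exp (- rho2 / 16)\<close>, the
  origin of \<tau>. Outside the ball only convexity of the potential is available. The data enter
  through three inequalities that hold in all directions, with constants depending on
  \<open>K\<close> alone and for every prior precision at once. The lower bound on the misclassified
  margin serves twice: it makes the potential coercive, which locates the minimizer, and it bounds
  the Gram matrix of the design from below.\<close>

abbreviation leb :: "nat \<Rightarrow> (nat \<Rightarrow> real) measure" where
  "leb d \<equiv> \<Pi>\<^sub>M i\<in>{..<d}. lborel"

definition std_gauss :: "real measure" where
  "std_gauss = density lborel std_normal_density"

definition gauss :: "nat \<Rightarrow> (nat \<Rightarrow> real) measure" where
  "gauss d = (\<Pi>\<^sub>M i\<in>{..<d}. std_gauss)"

text \<open>Points are plain functions of which only the values below \<open>d\<close> matter, so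
  that product measures over \<open>{..<d}\<close> apply directly; gradients and coefficient
  families need not be extensional.\<close>

definition dot :: "nat \<Rightarrow> (nat \<Rightarrow> real) \<Rightarrow> (nat \<Rightarrow> real) \<Rightarrow> real" where
  "dot d u x = (\<Sum>j<d. u j * x j)"

definition sqn :: "nat \<Rightarrow> (nat \<Rightarrow> real) \<Rightarrow> real" where
  "sqn d x = (\<Sum>j<d. (x j)\<^sup>2)"

abbreviation gdens :: "nat \<Rightarrow> (nat \<Rightarrow> real) \<Rightarrow> real" where
  "gdens d x \<equiv> exp (- sqn d x / 2) / sqrt (2 * pi) ^ d"

lemma sets_std_gauss [measurable_cong, simp]: "sets std_gauss = sets borel"
  by (simp add: std_gauss_def)

lemma space_std_gauss [simp]: "space std_gauss = UNIV"
  by (simp add: std_gauss_def)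

lemma sets_gauss [measurable_cong]: "sets (gauss d) = sets (leb d)"
  unfolding gauss_def by (intro sets_PiM_cong) auto

lemma space_gauss: "space (gauss d) = ({..<d} \<rightarrow>\<^sub>E UNIV)"
  by (simp add: gauss_def space_PiM)

lemma prob_space_std_gauss: "prob_space std_gauss"
  unfolding std_gauss_def by (rule prob_space_normal_density) simp

interpretation std_gauss: prob_space std_gauss
  by (rule prob_space_std_gauss)

interpretation gauss_prod: product_sigma_finite "\<lambda>_::nat. std_gauss"
  by unfold_locales

interpretation leb_prod: product_sigma_finite "\<lambda>_::nat. lborel :: real measure"
  by unfold_locales

lemma prob_space_gauss: "prob_space (gauss d)"
  unfolding gauss_def by (intro prob_space_PiM prob_space_std_gauss)

interpretation gauss: prob_space "gauss d"
  by (rule prob_space_gauss)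

lemma sigma_finite_leb: "sigma_finite_measure (leb d)"
  by (rule leb_prod.sigma_finite) simp

interpretation leb: sigma_finite_measure "leb d"
  by (rule sigma_finite_leb)

lemma measurable_dot [measurable]: "dot d u \<in> borel_measurable (leb d)"
  unfolding dot_def by measurable

lemma measurable_dot_gauss [measurable]: "dot d u \<in> borel_measurable (gauss d)"
  by (simp cong: measurable_cong_sets add: sets_gauss)

lemma measurable_sqn [measurable]: "sqn d \<in> borel_measurable (leb d)"
  unfolding sqn_def by measurable

lemma sqn_nonneg [simp]: "0 \<le> sqn d x"
  by (simp add: sqn_def sum_nonneg)

lemma dot_self: "dot d x x = sqn d x"
  by (simp add: dot_def sqn_def power2_eq_square)

lemma dot_commute: "dot d x y = dot d y x"
  by (simp add: dot_def mult.commute)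

lemma dot_Cauchy_Schwarz: "(dot d u x)\<^sup>2 \<le> sqn d u * sqn d x"
  unfolding dot_def sqn_def by (rule Cauchy_Schwarz_ineq_sum)

lemma dot_restrict [simp]: "dot d u (restrict f {..<d}) = dot d u f"
  by (simp add: dot_def)

lemma sqn_restrict [simp]: "sqn d (restrict f {..<d}) = sqn d f"
  by (simp add: sqn_def)

lemma dot_add: "dot d u (\<lambda>i. a * x i + b * y i) = a * dot d u x + b * dot d u y"
  by (simp add: dot_def sum_distrib_left sum.distrib algebra_simps)

lemma dot_scale: "dot d u (\<lambda>i. a * x i) = a * dot d u x"
  by (simp add: dot_def sum_distrib_left algebra_simps)

lemma dot_minus: "dot d u (\<lambda>i. - x i) = - dot d u x"
  by (simp add: dot_def sum_negf)

lemma sqn_scale: "sqn d (\<lambda>i. a * x i) = a\<^sup>2 * sqn d x"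
  by (simp add: sqn_def sum_distrib_left power_mult_distrib)

lemma sqn_minus [simp]: "sqn d (\<lambda>i. - x i) = sqn d x"
  by (simp add: sqn_def)

section \<open>Changes of variables for Lebesgue and Gaussian integrals\<close>

lemma nn_integral_gauss:
  assumes [measurable]: "f \<in> borel_measurable (leb d)"
  shows "(\<integral>\<^sup>+x. f x \<partial>gauss d)
    = (\<integral>\<^sup>+x. ennreal (gdens d x) * f x \<partial>leb d)"
proof -
  have "gauss d = density (leb d) (\<lambda>x. ennreal (gdens d x))"
    unfolding gauss_def
  proof (rule gauss_prod.PiM_eqI[symmetric])
    show "sets (density (leb d) (\<lambda>x. ennreal (gdens d x)))
        = sets (\<Pi>\<^sub>M i\<in>{..<d}. std_gauss)"
      using sets_gauss[of d] by (simp add: gauss_def)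
  next
    fix A assume A: "\<And>i. i \<in> {..<d} \<Longrightarrow> A i \<in> sets std_gauss"
    have A': "Pi\<^sub>E {..<d} A \<in> sets (leb d)"
      using A by (intro sets_PiM_I_finite) auto
    have "emeasure (density (leb d) (\<lambda>x. ennreal (gdens d x)))
        (Pi\<^sub>E {..<d} A)
      = (\<integral>\<^sup>+x. ennreal (gdens d x) * indicator (Pi\<^sub>E {..<d} A) x \<partial>leb d)"
      using A' by (subst emeasure_density) auto
    also have "\<dots> = (\<integral>\<^sup>+x. (\<Prod>i<d. ennreal (std_normal_density (x i)) * indicator (A i) (x i)) \<partial>leb d)"
    proof (rule nn_integral_cong)
      fix x assume x: "x \<in> space (leb d)"
      have "(\<Prod>i<d. indicator (A i) (x i)) = (indicator (Pi\<^sub>E {..<d} A) x :: ennreal)"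
      proof (cases "x \<in> Pi\<^sub>E {..<d} A")
        case True
        then show ?thesis by (auto simp: PiE_def Pi_def)
      next
        case False
        then obtain i where "i < d" "x i \<notin> A i"
          using x by (auto simp: space_PiM PiE_def Pi_def)
        then show ?thesis using False by (auto intro!: bexI[of _ i])
      qed
      moreover have "(\<Prod>i<d. std_normal_density (x i)) = gdens d x"
        by (simp add: std_normal_density_def prod_dividef exp_sum[symmetric] sqn_def sum_negf sum_divide_distrib)
      ultimately show "ennreal (gdens d x) * indicator (Pi\<^sub>E {..<d} A) x
          = (\<Prod>i<d. ennreal (std_normal_density (x i)) * indicator (A i) (x i))"
        by (simp add: prod.distrib prod_ennreal)
    qed
    also have "\<dots> = (\<Prod>i<d. \<integral>\<^sup>+x. ennreal (std_normal_density x) * indicator (A i) x \<partial>lborel)"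
      using A by (intro leb_prod.product_nn_integral_prod) auto
    also have "\<dots> = (\<Prod>i<d. emeasure std_gauss (A i))"
      using A unfolding std_gauss_def by (intro prod.cong) (auto simp: emeasure_density)
    finally show "emeasure (density (leb d) (\<lambda>x. ennreal (gdens d x)))
        (Pi\<^sub>E {..<d} A) = (\<Prod>i<d. emeasure std_gauss (A i))" .
  qed simp
  then show ?thesis
    by (simp add: nn_integral_density)
qed

text \<open>Induction on the dimension: for a fixed last coordinate \<open>y\<close> the remaining
  ones undergo a triangular map whose offset is shifted by \<open>A i d * y\<close>, which is why
  \<open>c\<close> is arbitrary in the induction; the last coordinate is then a one-dimensional
  affine substitution. Triangular maps suffice, because the whitening matrix will come from
  Gram-Schmidt orthogonalization.\<close>

lemma nn_integral_leb_upper_triangular: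
  fixes A :: "nat \<Rightarrow> nat \<Rightarrow> real"
  assumes "\<And>i. i < d \<Longrightarrow> A i i \<noteq> 0" "f \<in> borel_measurable (leb d)"
  shows "(\<integral>\<^sup>+x. f x \<partial>leb d)
    = ennreal (\<Prod>i<d. \<bar>A i i\<bar>) * (\<integral>\<^sup>+x. f (\<lambda>i\<in>{..<d}. c i + (\<Sum>j\<in>{i..<d}. A i j * x j)) \<partial>leb d)"
  using assms
proof (induction d arbitrary: f c)
  case 0
  then show ?case by (simp add: PiM_empty nn_integral_count_space_finite)
next
  case (Suc d)
  have ins: "{..<Suc d} = insert d {..<d}" by auto
  have f[measurable]: "f \<in> borel_measurable (Pi\<^sub>M (insert d {..<d}) (\<lambda>_. lborel))"
    using Suc.prems(2) by (simp add: ins)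
  have up[measurable]: "(\<lambda>(y, x). f (x(d := y))) \<in> borel_measurable (lborel \<Otimes>\<^sub>M leb d)"
    by measurable
  have fy: "(\<lambda>x. f (x(d := y))) \<in> borel_measurable (leb d)" for y
    by measurable
  define g where "g y = (\<integral>\<^sup>+x. f (x(d := y)) \<partial>leb d)" for y
  have g[measurable]: "g \<in> borel_measurable borel"
    unfolding g_def by (rule leb.borel_measurable_nn_integral[of _ lborel, simplified]) measurable
  define F where "F = (\<lambda>x. f (\<lambda>i\<in>{..<Suc d}. c i + (\<Sum>j\<in>{i..<Suc d}. A i j * x j)))"
  have F[measurable]: "F \<in> borel_measurable (Pi\<^sub>M (insert d {..<d}) (\<lambda>_. lborel))"
    unfolding F_def ins[symmetric]
  proof (rule measurable_compose[OF _ Suc.prems(2)])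
    have [measurable]: "(\<lambda>x. x j) \<in> borel_measurable (leb (Suc d))" if "j < Suc d" for j
      using that measurable_component_singleton[of j "{..<Suc d}" "\<lambda>_. lborel"] by simp
    show "(\<lambda>x. \<lambda>i\<in>{..<Suc d}. c i + (\<Sum>j\<in>{i..<Suc d}. A i j * x j)) \<in> leb (Suc d) \<rightarrow>\<^sub>M leb (Suc d)"
      by (rule measurable_restrict) auto
  qed
  have Feq: "F (x(d := y)) = f ((\<lambda>i\<in>{..<d}. (c i + A i d * y) + (\<Sum>j\<in>{i..<d}. A i j * x j))(d := c d + A d d * y))"
    if "x \<in> space (leb d)" for x y
    unfolding F_def
    by (rule arg_cong[of _ _ f], rule ext) (auto simp: restrict_def le_less_Suc_eq sum.atLeastLessThan_Suc)
  have IH: "ennreal (\<Prod>i<d. \<bar>A i i\<bar>) * (\<integral>\<^sup>+x. F (x(d := y)) \<partial>leb d) = g (c d + A d d * y)" for y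
  proof -
    have "(\<integral>\<^sup>+x. F (x(d := y)) \<partial>leb d) = (\<integral>\<^sup>+x. f ((\<lambda>i\<in>{..<d}. (c i + A i d * y) + (\<Sum>j\<in>{i..<d}. A i j * x j))(d := c d + A d d * y)) \<partial>leb d)"
      by (intro nn_integral_cong) (rule Feq)
    moreover have "g (c d + A d d * y) = ennreal (\<Prod>i<d. \<bar>A i i\<bar>)
        * (\<integral>\<^sup>+x. f ((\<lambda>i\<in>{..<d}. (c i + A i d * y) + (\<Sum>j\<in>{i..<d}. A i j * x j))(d := c d + A d d * y)) \<partial>leb d)"
      unfolding g_def by (rule Suc.IH[OF _ fy]) (simp add: Suc.prems(1))
    ultimately show ?thesis
      by (simp only:)
  qed
  have "(\<integral>\<^sup>+x. f x \<partial>leb (Suc d)) = (\<integral>\<^sup>+y. g y \<partial>lborel)"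
    unfolding g_def ins by (rule leb_prod.product_nn_integral_insert_rev) auto
  also have "\<dots> = ennreal \<bar>A d d\<bar> * (\<integral>\<^sup>+y. g (c d + A d d * y) \<partial>lborel)"
    using Suc.prems(1) by (intro nn_integral_real_affine) auto
  also have "(\<integral>\<^sup>+y. g (c d + A d d * y) \<partial>lborel)
      = ennreal (\<Prod>i<d. \<bar>A i i\<bar>) * (\<integral>\<^sup>+y. (\<integral>\<^sup>+x. F (x(d := y)) \<partial>leb d) \<partial>lborel)"
    unfolding IH[symmetric]
    by (intro nn_integral_cmult leb.borel_measurable_nn_integral[of _ lborel, simplified]) measurable
  also have "(\<integral>\<^sup>+y. (\<integral>\<^sup>+x. F (x(d := y)) \<partial>leb d) \<partial>lborel) = (\<integral>\<^sup>+x. F x \<partial>leb (Suc d))"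
    unfolding ins by (rule leb_prod.product_nn_integral_insert_rev[symmetric]) auto
  moreover have "ennreal (\<Prod>i<Suc d. \<bar>A i i\<bar>) = ennreal \<bar>A d d\<bar> * ennreal (\<Prod>i<d. \<bar>A i i\<bar>)"
    by (simp add: ennreal_mult prod_nonneg mult.commute)
  ultimately show ?case
    unfolding F_def by (simp only: mult.assoc)
qed

lemma nn_integral_leb_shift:
  assumes "f \<in> borel_measurable (leb d)"
  shows "(\<integral>\<^sup>+x. f (\<lambda>i\<in>{..<d}. c i + x i) \<partial>leb d) = (\<integral>\<^sup>+x. f x \<partial>leb d)"
proof -
  have *: "(\<Sum>j\<in>{i..<d}. (if i = j then 1 else 0) * x j) = x i" if "i < d" for i and x :: "nat \<Rightarrow> real"
    using that by (subst sum.mono_neutral_right[of _ "{i}"]) auto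
  show ?thesis
    using nn_integral_leb_upper_triangular[OF _ assms, of "\<lambda>i j. if i = j then 1 else 0" c]
    by (simp add: * cong: restrict_cong)
qed


section \<open>Rotation invariance of a pair of Gaussian points\<close>

definition lincomb :: "nat \<Rightarrow> real \<Rightarrow> (nat \<Rightarrow> real) \<Rightarrow> real \<Rightarrow> (nat \<Rightarrow> real) \<Rightarrow> nat \<Rightarrow> real" where
  "lincomb d a x b y = (\<lambda>i\<in>{..<d}. a * x i + b * y i)"

lemma dot_lincomb [simp]: "dot d u (lincomb d a x b y) = a * dot d u x + b * dot d u y"
  by (simp add: lincomb_def dot_add)

lemma sqn_lincomb: "sqn d (lincomb d a x b y) = a\<^sup>2 * sqn d x + 2 * a * b * dot d x y + b\<^sup>2 * sqn d y"
  by (simp add: lincomb_def sqn_def dot_def power2_sum power_mult_distrib sum.distrib sum_distrib_left algebra_simps)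

lemma measurable_lincomb [measurable (raw)]:
  assumes [measurable]: "f \<in> N \<rightarrow>\<^sub>M leb d" "g \<in> N \<rightarrow>\<^sub>M leb d" "a \<in> borel_measurable N" "b \<in> borel_measurable N"
  shows "(\<lambda>w. lincomb d (a w) (f w) (b w) (g w)) \<in> N \<rightarrow>\<^sub>M leb d"
proof -
  have [measurable]: "(\<lambda>w. f w i) \<in> borel_measurable N" "(\<lambda>w. g w i) \<in> borel_measurable N" if "i < d" for i
    using that measurable_compose[OF assms(1), of "\<lambda>x. x i" borel] measurable_compose[OF assms(2), of "\<lambda>x. x i" borel]
    by auto
  show ?thesis
    unfolding lincomb_def by (rule measurable_restrict) auto
qed

text \<open>For one point held fixed a shear is a translation of the other, so Fubini and
  translation invariance suffice.\<close>

lemma nn_integral_leb_shear: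
  assumes F[measurable]: "case_prod F \<in> borel_measurable (leb d \<Otimes>\<^sub>M leb d)"
  shows "(\<integral>\<^sup>+x. \<integral>\<^sup>+y. F (lincomb d 1 x a y) y \<partial>leb d \<partial>leb d) = (\<integral>\<^sup>+x. \<integral>\<^sup>+y. F x y \<partial>leb d \<partial>leb d)"
    and "(\<integral>\<^sup>+x. \<integral>\<^sup>+y. F x (lincomb d a x 1 y) \<partial>leb d \<partial>leb d) = (\<integral>\<^sup>+x. \<integral>\<^sup>+y. F x y \<partial>leb d \<partial>leb d)"
proof -
  let ?I = "\<integral>\<^sup>+x. \<integral>\<^sup>+y. F x y \<partial>leb d \<partial>leb d" and ?J = "\<integral>\<^sup>+x. \<integral>\<^sup>+y. F (lincomb d 1 x a y) y \<partial>leb d \<partial>leb d"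
  interpret P: pair_sigma_finite "leb d" "leb d" ..
  have "?J = (\<integral>\<^sup>+y. \<integral>\<^sup>+x. F (lincomb d 1 x a y) y \<partial>leb d \<partial>leb d)"
    by (rule P.Fubini'[symmetric]) measurable
  also have "\<dots> = (\<integral>\<^sup>+y. \<integral>\<^sup>+x. F x y \<partial>leb d \<partial>leb d)"
  proof (rule nn_integral_cong)
    fix y assume [measurable]: "y \<in> space (leb d)"
    show "(\<integral>\<^sup>+x. F (lincomb d 1 x a y) y \<partial>leb d) = (\<integral>\<^sup>+x. F x y \<partial>leb d)"
      using nn_integral_leb_shift[of "\<lambda>x. F x y" d "\<lambda>i. a * y i"]
      by (simp add: lincomb_def add.commute)
  qed
  also have "\<dots> = ?I"
    by (rule P.Fubini') measurable
  finally show "?J = ?I" .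
  show "(\<integral>\<^sup>+x. \<integral>\<^sup>+y. F x (lincomb d a x 1 y) \<partial>leb d \<partial>leb d) = ?I"
  proof (rule nn_integral_cong)
    fix x assume [measurable]: "x \<in> space (leb d)"
    show "(\<integral>\<^sup>+y. F x (lincomb d a x 1 y) \<partial>leb d) = (\<integral>\<^sup>+y. F x y \<partial>leb d)"
      using nn_integral_leb_shift[of "\<lambda>y. F x y" d "\<lambda>i. a * x i"]
      by (simp add: lincomb_def)
  qed
qed

text \<open>A rotation by an angle other than \<open>\<pi>\<close> is a product of three shears.\<close>

lemma nn_integral_leb_rotate:
  assumes F[measurable]: "case_prod F \<in> borel_measurable (leb d \<Otimes>\<^sub>M leb d)"
    and cs: "c\<^sup>2 + s\<^sup>2 = 1" "c > -1"
  shows "(\<integral>\<^sup>+x. \<integral>\<^sup>+y. F (lincomb d c x s y) (lincomb d (- s) x c y) \<partial>leb d \<partial>leb d)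
    = (\<integral>\<^sup>+x. \<integral>\<^sup>+y. F x y \<partial>leb d \<partial>leb d)"
proof -
  \<comment> \<open>The tangent of half the angle: the rotation is the shear by \<open>t\<close>,
    then by \<open>- s\<close> in the other variable, then by \<open>t\<close> again. The condition
    \<open>c > -1\<close> keeps the quotient meaningful.\<close>
  define t where "t = s / (1 + c)"
  have st: "s * t = 1 - c" "t * (1 + c) = s"
    using cs by (auto simp: t_def field_simps power2_eq_square)
  define F1 where "F1 x y = F (lincomb d 1 x t y) y" for x y
  define F2 where "F2 x y = F1 x (lincomb d (- s) x 1 y)" for x y
  have F1[measurable]: "case_prod F1 \<in> borel_measurable (leb d \<Otimes>\<^sub>M leb d)"
    unfolding F1_def by measurable
  have F2[measurable]: "case_prod F2 \<in> borel_measurable (leb d \<Otimes>\<^sub>M leb d)"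
    unfolding F2_def by measurable
  have 1: "x i + t * y i + t * (y i - s * (x i + t * y i)) = c * x i + s * y i"
    and 2: "y i - s * (x i + t * y i) = c * y i - s * x i" for x y :: "nat \<Rightarrow> real" and i
  proof -
    have "x i + t * y i + t * (y i - s * (x i + t * y i)) = (1 - s * t) * x i + t * (1 + (1 - s * t)) * y i"
      by (simp add: algebra_simps)
    then show "x i + t * y i + t * (y i - s * (x i + t * y i)) = c * x i + s * y i"
      using st by simp
    have "y i - s * (x i + t * y i) = (1 - s * t) * y i - s * x i"
      by (simp add: algebra_simps)
    then show "y i - s * (x i + t * y i) = c * y i - s * x i"
      using st by simp
  qed
  have l: "lincomb d 1 (lincomb d 1 x t y) t (lincomb d (- s) (lincomb d 1 x t y) 1 y) = lincomb d c x s y"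
    "lincomb d (- s) (lincomb d 1 x t y) 1 y = lincomb d (- s) x c y" for x y
    using 1[of x _ y] 2[of y _ x] unfolding lincomb_def by (auto simp: fun_eq_iff)
  have eq: "F (lincomb d c x s y) (lincomb d (- s) x c y) = F2 (lincomb d 1 x t y) y" for x y
    unfolding F1_def F2_def l(2) l(1)[unfolded l(2)] by (rule refl)
  show ?thesis
    unfolding eq nn_integral_leb_shear(1)[OF F2]
    unfolding F2_def nn_integral_leb_shear(2)[OF F1]
    unfolding F1_def by (rule nn_integral_leb_shear(1)[OF F])
qed

lemma nn_integral_gauss_pair:
  assumes F[measurable]: "case_prod F \<in> borel_measurable (leb d \<Otimes>\<^sub>M leb d)"
  shows "(\<integral>\<^sup>+x. \<integral>\<^sup>+y. F x y \<partial>gauss d \<partial>gauss d)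
    = (\<integral>\<^sup>+x. \<integral>\<^sup>+y. ennreal (exp (- (sqn d x + sqn d y) / 2) / sqrt (2 * pi) ^ (2 * d)) * F x y \<partial>leb d \<partial>leb d)"
proof -
  let ?h = "\<lambda>x. gdens d x"
  have "(\<integral>\<^sup>+x. \<integral>\<^sup>+y. F x y \<partial>gauss d \<partial>gauss d)
      = (\<integral>\<^sup>+x. ennreal (?h x) * (\<integral>\<^sup>+y. F x y \<partial>gauss d) \<partial>leb d)"
    by (rule nn_integral_gauss)
      (rule sigma_finite_measure.borel_measurable_nn_integral; (unfold_locales)?; measurable)
  also have "\<dots> = (\<integral>\<^sup>+x. \<integral>\<^sup>+y. ennreal (exp (- (sqn d x + sqn d y) / 2) / sqrt (2 * pi) ^ (2 * d)) * F x y \<partial>leb d \<partial>leb d)"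
  proof (rule nn_integral_cong)
    fix x assume x[measurable]: "x \<in> space (leb d)"
    have "ennreal (?h x) * (\<integral>\<^sup>+y. F x y \<partial>gauss d) = (\<integral>\<^sup>+y. ennreal (?h x) * (ennreal (?h y) * F x y) \<partial>leb d)"
      by (subst nn_integral_gauss) (measurable, subst nn_integral_cmult, measurable)
    also have "\<dots> = (\<integral>\<^sup>+y. ennreal (exp (- (sqn d x + sqn d y) / 2) / sqrt (2 * pi) ^ (2 * d)) * F x y \<partial>leb d)"
    proof -
      have "?h x * ?h y = exp (- (sqn d x + sqn d y) / 2) / sqrt (2 * pi) ^ (2 * d)" for y
        by (simp add: mult_exp_exp diff_divide_distrib mult_2[of d] power_add)
      then show ?thesis
        by (simp add: mult.assoc[symmetric] ennreal_mult[symmetric])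
    qed
    finally show "ennreal (?h x) * (\<integral>\<^sup>+y. F x y \<partial>gauss d)
      = (\<integral>\<^sup>+y. ennreal (exp (- (sqn d x + sqn d y) / 2) / sqrt (2 * pi) ^ (2 * d)) * F x y \<partial>leb d)" .
  qed
  finally show ?thesis .
qed

text \<open>The joint density depends only on the sum of the two squared norms, which the rotation
  preserves, so the invariance of Lebesgue measure carries over.\<close>

lemma nn_integral_gauss_rotate:
  assumes F[measurable]: "case_prod F \<in> borel_measurable (leb d \<Otimes>\<^sub>M leb d)"
    and cs: "c\<^sup>2 + s\<^sup>2 = 1" "c > -1"
  shows "(\<integral>\<^sup>+x. \<integral>\<^sup>+y. F (lincomb d c x s y) (lincomb d (- s) x c y) \<partial>gauss d \<partial>gauss d)
    = (\<integral>\<^sup>+x. \<integral>\<^sup>+y. F x y \<partial>gauss d \<partial>gauss d)"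
proof -
  have eq: "sqn d (lincomb d c x s y) + sqn d (lincomb d (- s) x c y) = sqn d x + sqn d y" for x y
  proof -
    have "sqn d (lincomb d c x s y) + sqn d (lincomb d (- s) x c y) = (c\<^sup>2 + s\<^sup>2) * (sqn d x + sqn d y)"
      unfolding sqn_lincomb by (simp add: algebra_simps)
    then show ?thesis using cs by simp
  qed
  have "(\<integral>\<^sup>+x. \<integral>\<^sup>+y. F (lincomb d c x s y) (lincomb d (- s) x c y) \<partial>gauss d \<partial>gauss d)
    = (\<integral>\<^sup>+x. \<integral>\<^sup>+y. ennreal (exp (- (sqn d (lincomb d c x s y) + sqn d (lincomb d (- s) x c y)) / 2)
         / sqrt (2 * pi) ^ (2 * d)) * F (lincomb d c x s y) (lincomb d (- s) x c y) \<partial>leb d \<partial>leb d)"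
    by (subst nn_integral_gauss_pair) (measurable, simp add: eq)
  also have "\<dots> = (\<integral>\<^sup>+x. \<integral>\<^sup>+y. ennreal (exp (- (sqn d x + sqn d y) / 2)
         / sqrt (2 * pi) ^ (2 * d)) * F x y \<partial>leb d \<partial>leb d)"
    by (rule nn_integral_leb_rotate[OF _ cs]) measurable
  also have "\<dots> = (\<integral>\<^sup>+x. \<integral>\<^sup>+y. F x y \<partial>gauss d \<partial>gauss d)"
    by (rule nn_integral_gauss_pair[symmetric]) measurable
  finally show ?thesis .
qed

lemma nn_integral_gauss_reflect:
  assumes [measurable]: "f \<in> borel_measurable (leb d)"
  shows "(\<integral>\<^sup>+x. f (\<lambda>i\<in>{..<d}. - x i) \<partial>gauss d) = (\<integral>\<^sup>+x. f x \<partial>gauss d)"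
proof -
  have *: "(\<Sum>j\<in>{i..<d}. (if i = j then - 1 else 0) * x j) = - x i" if "i < d" for i and x :: "nat \<Rightarrow> real"
    using that by (subst sum.mono_neutral_right[of _ "{i}"]) auto
  have [measurable]: "(\<lambda>x. f (\<lambda>i\<in>{..<d}. - x i)) \<in> borel_measurable (leb d)"
    by (rule measurable_compose[of _ _ "leb d"]) measurable
  show ?thesis
    unfolding nn_integral_gauss[OF assms]
    by (subst nn_integral_leb_upper_triangular[where A = "\<lambda>i j. if i = j then - 1 else 0" and c = "\<lambda>_. 0"])
      (simp_all add: * nn_integral_gauss cong: restrict_cong)
qed

section \<open>Linear forms and norms under the standard Gaussian\<close>

lemma indep_vars_gauss:
  assumes "d > 0"
  shows "gauss.indep_vars d (\<lambda>_. borel) (\<lambda>i x. x i) {..<d}"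
proof -
  have "gauss.indep_vars d (\<lambda>_. std_gauss) (\<lambda>i x. x i) {..<d}"
  proof (subst gauss.indep_vars_iff_distr_eq_PiM')
    have "distr (gauss d) (gauss d) (\<lambda>x. \<lambda>i\<in>{..<d}. x i) = distr (gauss d) (gauss d) (\<lambda>x. x)"
      by (rule distr_cong) (auto simp: space_gauss PiE_def extensional_restrict)
    then have "distr (gauss d) (Pi\<^sub>M {..<d} (\<lambda>_. std_gauss)) (\<lambda>x. \<lambda>i\<in>{..<d}. x i) = gauss d"
      by (simp add: gauss_def)
    also have "\<dots> = (\<Pi>\<^sub>M i\<in>{..<d}. distr (gauss d) std_gauss (\<lambda>x. x i))"
      unfolding gauss_def
      by (intro PiM_cong refl distr_PiM_component[symmetric] prob_space_std_gauss) auto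
    finally show "distr (gauss d) (Pi\<^sub>M {..<d} (\<lambda>_. std_gauss)) (\<lambda>x. \<lambda>i\<in>{..<d}. x i)
        = (\<Pi>\<^sub>M i\<in>{..<d}. distr (gauss d) std_gauss (\<lambda>x. x i))" .
  qed (use assms in \<open>auto simp: gauss_def\<close>)
  then show ?thesis
    by (subst gauss.indep_vars_cong[OF refl refl]) (auto simp: gauss.indep_vars_def cong: measurable_cong_sets)
qed

lemma distr_gauss_dot:
  "distr (gauss d) borel (dot d w) = distr std_gauss borel (\<lambda>t. sqrt (sqn d w) * t)"
proof (cases "sqn d w = 0")
  case True
  then have "w i = 0" if "i < d" for i
    using that by (simp add: sqn_def sum_nonneg_eq_0_iff)
  then have "dot d w x = 0" for x
    by (simp add: dot_def)
  then have "distr (gauss d) borel (dot d w) = distr (gauss d) borel (\<lambda>_. 0)"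
    by (intro distr_cong) auto
  also have "\<dots> = distr std_gauss borel (\<lambda>_. 0)"
    by (simp add: gauss.distr_const std_gauss.distr_const)
  finally show ?thesis using True by simp
next
  case False
  then have d: "d > 0" by (auto simp: sqn_def intro: gr0I)
  \<comment> \<open>Zero coefficients are dropped because a degenerate normal law has no density and
    would not fit the rule for sums of independent normal variables.\<close>
  define J where "J = {i\<in>{..<d}. w i \<noteq> 0}"
  have "J \<noteq> {}"
    using False by (auto simp: sqn_def J_def intro: ccontr)
  have X: "distributed (gauss d) lborel (\<lambda>x. w i * x i) (normal_density 0 \<bar>w i\<bar>)" if i: "i \<in> J" for i
  proof -
    have "distr (gauss d) lborel (\<lambda>x. x i) = distr (gauss d) std_gauss (\<lambda>x. x i)"
      by (rule distr_cong) auto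
    also have "\<dots> = std_gauss"
      unfolding gauss_def using i by (intro distr_PiM_component prob_space_std_gauss) (auto simp: J_def)
    finally have "distributed (gauss d) lborel (\<lambda>x. x i) (normal_density 0 1)"
      using i by (auto simp: distributed_def std_gauss_def J_def gauss_def)
    from gauss.normal_density_affine[OF this, of "w i" 0] show ?thesis
      using i by (auto simp: J_def)
  qed
  have "gauss.indep_vars d (\<lambda>_. borel) (\<lambda>i x. w i * x i) {..<d}"
    using gauss.indep_vars_compose2[OF indep_vars_gauss[OF d], of "\<lambda>i t. w i * t" "\<lambda>_. borel"] by simp
  then have "gauss.indep_vars d (\<lambda>_. borel) (\<lambda>i x. w i * x i) J"
    by (rule gauss.indep_vars_subset) (auto simp: J_def)
  then have "distributed (gauss d) lborel (\<lambda>x. \<Sum>i\<in>J. w i * x i)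
      (normal_density (\<Sum>i\<in>J. 0) (sqrt (\<Sum>i\<in>J. \<bar>w i\<bar>\<^sup>2)))"
    using X \<open>J \<noteq> {}\<close> by (intro gauss.sum_indep_normal) (auto simp: J_def)
  moreover have "(\<Sum>i\<in>J. w i * x i) = dot d w x" for x
    unfolding dot_def J_def by (rule sum.mono_neutral_left) auto
  moreover have "(\<Sum>i\<in>J. \<bar>w i\<bar>\<^sup>2) = sqn d w"
    unfolding sqn_def J_def by (simp, rule sum.mono_neutral_left) auto
  ultimately have 1: "distr (gauss d) lborel (dot d w) = density lborel (normal_density 0 (sqrt (sqn d w)))"
    by (simp add: distributed_def)
  have "0 < sqn d w"
    using False sqn_nonneg[of d w] by linarith
  then have pos: "sqrt (sqn d w) > 0"
    by simp
  have "distributed std_gauss lborel (\<lambda>t. t) (normal_density 0 1)"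
    by (auto simp: distributed_def std_gauss_def distr_id2)
  from std_gauss.normal_density_affine[OF this, of "sqrt (sqn d w)" 0]
  have 2: "distr std_gauss lborel (\<lambda>t. sqrt (sqn d w) * t) = density lborel (normal_density 0 (sqrt (sqn d w)))"
    using pos by (simp add: distributed_def)
  have "distr (gauss d) borel (dot d w) = distr (gauss d) lborel (dot d w)"
    by (rule distr_cong) auto
  also have "\<dots> = distr std_gauss lborel (\<lambda>t. sqrt (sqn d w) * t)"
    unfolding 1 2 ..
  also have "\<dots> = distr std_gauss borel (\<lambda>t. sqrt (sqn d w) * t)"
    by (rule distr_cong) auto
  finally show ?thesis .
qed

lemma nn_integral_gauss_dot:
  assumes [measurable]: "f \<in> borel_measurable borel"
  shows "(\<integral>\<^sup>+x. f (dot d w x) \<partial>gauss d) = (\<integral>\<^sup>+t. f (sqrt (sqn d w) * t) \<partial>std_gauss)"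
proof -
  have "(\<integral>\<^sup>+x. f (dot d w x) \<partial>gauss d) = (\<integral>\<^sup>+t. f t \<partial>distr (gauss d) borel (dot d w))"
    by (rule nn_integral_distr[symmetric]) auto
  then show ?thesis
    unfolding distr_gauss_dot by (subst (asm) nn_integral_distr) auto
qed

lemma integral_gauss_dot:
  fixes f :: "real \<Rightarrow> real"
  assumes [measurable]: "f \<in> borel_measurable borel"
  shows "(\<integral>x. f (dot d w x) \<partial>gauss d) = (\<integral>t. f (sqrt (sqn d w) * t) \<partial>std_gauss)"
    and "integrable (gauss d) (\<lambda>x. f (dot d w x)) \<longleftrightarrow> integrable std_gauss (\<lambda>t. f (sqrt (sqn d w) * t))"
proof -
  have "(\<integral>x. f (dot d w x) \<partial>gauss d) = (\<integral>t. f t \<partial>distr (gauss d) borel (dot d w))"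
    by (rule integral_distr[symmetric]) auto
  then show "(\<integral>x. f (dot d w x) \<partial>gauss d) = (\<integral>t. f (sqrt (sqn d w) * t) \<partial>std_gauss)"
    unfolding distr_gauss_dot by (subst (asm) integral_distr) auto
  have "integrable (gauss d) (\<lambda>x. f (dot d w x)) \<longleftrightarrow> integrable (distr (gauss d) borel (dot d w)) f"
    by (rule integrable_distr_eq[symmetric]) auto
  then show "integrable (gauss d) (\<lambda>x. f (dot d w x)) \<longleftrightarrow> integrable std_gauss (\<lambda>t. f (sqrt (sqn d w) * t))"
    unfolding distr_gauss_dot by (subst (asm) integrable_distr_eq) auto
qed

lemma nn_integral_std_gauss_exp: "(\<integral>\<^sup>+t. ennreal (exp (a * t)) \<partial>std_gauss) = ennreal (exp (a\<^sup>2 / 2))"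
proof -
  have eq: "std_normal_density t * exp (a * t) = exp (a\<^sup>2 / 2) * normal_density a 1 t" for t
    by (simp add: normal_density_def mult_exp_exp field_simps power2_eq_square)
  have "(\<integral>\<^sup>+t. ennreal (exp (a * t)) \<partial>std_gauss) = (\<integral>\<^sup>+t. ennreal (exp (a\<^sup>2 / 2)) * ennreal (normal_density a 1 t) \<partial>lborel)"
    unfolding std_gauss_def by (subst nn_integral_density) (auto simp: ennreal_mult[symmetric] eq)
  also have "\<dots> = ennreal (exp (a\<^sup>2 / 2)) * (\<integral>\<^sup>+t. ennreal (normal_density a 1 t) \<partial>lborel)"
    by (rule nn_integral_cmult) auto
  also have "(\<integral>\<^sup>+t. ennreal (normal_density a 1 t) \<partial>lborel) = 1"
    by (subst nn_integral_eq_integral) auto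
  finally show ?thesis by simp
qed

lemma nn_integral_std_gauss_exp_sq:
  assumes "a < 1 / 2"
  shows "(\<integral>\<^sup>+t. ennreal (exp (a * t\<^sup>2)) \<partial>std_gauss) = ennreal (1 / sqrt (1 - 2 * a))"
proof -
  define s where "s = 1 / sqrt (1 - 2 * a)"
  have s: "s > 0" "s\<^sup>2 = 1 / (1 - 2 * a)" using assms by (auto simp: s_def power_divide)
  have "exp (- t\<^sup>2 / 2) * exp (a * t\<^sup>2) = exp (- t\<^sup>2 / (2 * s\<^sup>2))" for t
    using assms by (simp add: s(2) mult_exp_exp field_simps)
  then have eq: "std_normal_density t * exp (a * t\<^sup>2) = s * normal_density 0 s t" for t
    using s(1) by (simp add: normal_density_def real_sqrt_mult)
  have "(\<integral>\<^sup>+t. ennreal (exp (a * t\<^sup>2)) \<partial>std_gauss) = (\<integral>\<^sup>+t. ennreal s * ennreal (normal_density 0 s t) \<partial>lborel)"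
    unfolding std_gauss_def using s(1) by (subst nn_integral_density) (auto simp: ennreal_mult[symmetric] eq)
  also have "\<dots> = ennreal s * (\<integral>\<^sup>+t. ennreal (normal_density 0 s t) \<partial>lborel)"
    by (rule nn_integral_cmult) auto
  also have "(\<integral>\<^sup>+t. ennreal (normal_density 0 s t) \<partial>lborel) = 1"
    using s by (subst nn_integral_eq_integral) auto
  finally show ?thesis by (simp add: s_def)
qed

lemma nn_integral_gauss_exp_sqn:
  assumes "a < 1 / 2"
  shows "(\<integral>\<^sup>+x. ennreal (exp (a * sqn d x)) \<partial>gauss d) = ennreal ((1 / sqrt (1 - 2 * a)) ^ d)"
proof -
  have "(\<integral>\<^sup>+x. ennreal (exp (a * sqn d x)) \<partial>gauss d) = (\<integral>\<^sup>+x. (\<Prod>i<d. ennreal (exp (a * (x i)\<^sup>2))) \<partial>gauss d)"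
    by (intro nn_integral_cong) (simp add: prod_ennreal exp_sum[symmetric] sqn_def sum_distrib_left)
  also have "\<dots> = (\<Prod>i<d. \<integral>\<^sup>+t. ennreal (exp (a * t\<^sup>2)) \<partial>std_gauss)"
    unfolding gauss_def by (rule gauss_prod.product_nn_integral_prod) auto
  also have "\<dots> = ennreal ((1 / sqrt (1 - 2 * a)) ^ d)"
    using assms by (simp add: nn_integral_std_gauss_exp_sq ennreal_power)
  finally show ?thesis .
qed

lemma power_div_fact_le_exp:
  fixes x :: real
  assumes "0 \<le> x"
  shows "x ^ k / fact k \<le> exp x"
proof -
  have "(\<Sum>n\<in>{k}. x ^ n /\<^sub>R fact n) \<le> (\<Sum>n. x ^ n /\<^sub>R fact n)"
    using assms by (intro sum_le_suminf summable_exp_generic) auto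
  then show ?thesis
    by (simp add: exp_def divide_inverse mult.commute)
qed

text \<open>From \<open>y ^ k / fact k \<le> exp y\<close> at \<open>y = sqn d x / (4 * d)\<close>:
  with this exponent the exponential moment stays below two in every dimension, so the bound has the
  right order \<open>d ^ k\<close>.\<close>

lemma nn_integral_gauss_sqn_power:
  assumes "d > 0"
  shows "(\<integral>\<^sup>+x. ennreal (sqn d x ^ k) \<partial>gauss d) \<le> ennreal (2 * fact k * 4 ^ k * real d ^ k)"
proof -
  define a where "a = 1 / (4 * real d)"
  have a: "a < 1 / 2" "a > 0" using assms by (auto simp: a_def field_simps)
  have "sqn d x ^ k \<le> fact k * 4 ^ k * real d ^ k * exp (a * sqn d x)" for x
  proof -
    have "(a * sqn d x) ^ k / fact k \<le> exp (a * sqn d x)"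
      by (rule power_div_fact_le_exp) (use a in auto)
    then show ?thesis
      using assms by (simp add: a_def power_mult_distrib power_divide field_simps)
  qed
  then have "(\<integral>\<^sup>+x. ennreal (sqn d x ^ k) \<partial>gauss d)
      \<le> (\<integral>\<^sup>+x. ennreal (fact k * 4 ^ k * real d ^ k) * ennreal (exp (a * sqn d x)) \<partial>gauss d)"
    by (intro nn_integral_mono) (auto simp: ennreal_mult[symmetric])
  also have "\<dots> = ennreal (fact k * 4 ^ k * real d ^ k) * ennreal ((1 / sqrt (1 - 2 * a)) ^ d)"
    using a by (subst nn_integral_cmult) (auto simp: nn_integral_gauss_exp_sqn)
  also have "\<dots> = ennreal (fact k * 4 ^ k * real d ^ k * (1 / sqrt (1 - 2 * a)) ^ d)"
    using a by (subst ennreal_mult) auto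
  finally have 1: "(\<integral>\<^sup>+x. ennreal (sqn d x ^ k) \<partial>gauss d)
      \<le> ennreal (fact k * 4 ^ k * real d ^ k * (1 / sqrt (1 - 2 * a)) ^ d)" .
  have "(1 / sqrt (1 - 2 * a)) ^ d \<le> 2"
  proof -
    \<comment> \<open>Bernoulli's inequality bounds \<open>(1 - 2 * a) ^ d\<close> below by
      \<open>1 / 2\<close>; passing to the square root only increases the base.\<close>
    have "1 / 2 = 1 + real d * (- (2 * a))"
      using assms by (simp add: a_def field_simps)
    also have "\<dots> \<le> (1 + - (2 * a)) ^ d"
      by (rule Bernoulli_inequality) (use a in auto)
    also have "\<dots> \<le> sqrt (1 - 2 * a) ^ d"
    proof (rule power_mono)
      have "(1 - 2 * a) * (1 - 2 * a) \<le> 1 - 2 * a"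
        using a by (intro mult_left_le) auto
      then show "1 + - (2 * a) \<le> sqrt (1 - 2 * a)"
        by (intro real_le_rsqrt) (simp add: power2_eq_square)
    qed (use a in linarith)
    finally show ?thesis by (simp add: power_divide divide_simps)
  qed
  then have "fact k * 4 ^ k * real d ^ k * (1 / sqrt (1 - 2 * a)) ^ d \<le> fact k * 4 ^ k * real d ^ k * 2"
    by (intro mult_left_mono) auto
  also have "\<dots> = 2 * fact k * 4 ^ k * real d ^ k"
    by simp
  finally show ?thesis
    using 1 ennreal_leI order_trans by blast
qed

text \<open>The double factorial of \<open>2 k - 1\<close>, which is the moment of order
  \<open>2 k\<close> of the standard Gaussian.\<close>

definition gmom :: "nat \<Rightarrow> real" where
  "gmom k = fact (2 * k) / (2 ^ k * fact k)"

lemma gmom_pos: "gmom k > 0"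
  by (simp add: gmom_def)

lemma has_bochner_integral_std_gauss_even: "has_bochner_integral std_gauss (\<lambda>t. t ^ (2 * k)) (gmom k)"
  unfolding std_gauss_def gmom_def
  by (rule has_bochner_integral_density) (use std_normal_moment_even in auto)

lemma nn_integral_std_gauss_even: "(\<integral>\<^sup>+t. ennreal (t ^ (2 * k)) \<partial>std_gauss) = ennreal (gmom k)"
  using has_bochner_integral_std_gauss_even[of k]
  by (subst nn_integral_eq_integral) (auto simp: has_bochner_integral_iff)

lemma nn_integral_gauss_dot_even:
  "(\<integral>\<^sup>+x. ennreal (dot d w x ^ (2 * k)) \<partial>gauss d) = ennreal (gmom k * sqn d w ^ k)"
proof -
  have "(\<integral>\<^sup>+x. ennreal (dot d w x ^ (2 * k)) \<partial>gauss d)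
      = (\<integral>\<^sup>+t. ennreal (sqn d w ^ k) * ennreal (t ^ (2 * k)) \<partial>std_gauss)"
    by (subst nn_integral_gauss_dot[where f = "\<lambda>t. ennreal (t ^ (2 * k))"])
      (auto simp: power_mult_distrib power_mult ennreal_mult[symmetric])
  also have "\<dots> = ennreal (sqn d w ^ k) * ennreal (gmom k)"
    by (subst nn_integral_cmult) (auto simp: nn_integral_std_gauss_even)
  finally show ?thesis by (simp add: ennreal_mult[symmetric] less_imp_le[OF gmom_pos] mult.commute)
qed

section \<open>The Maurey--Pisier inequality\<close>

text \<open>Jensen's inequality for the uniform law on the interval: the increment of
  \<open>F\<close> is the mean of \<open>(b - a) * f\<close>.\<close>

lemma convex_mean_Icc:
  fixes \<phi> F f :: "real \<Rightarrow> real"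
  assumes \<phi>: "convex_on UNIV \<phi>" "continuous_on UNIV \<phi>" "\<And>t. 0 \<le> \<phi> t"
    and ab: "a < b"
    and F: "\<And>x. (F has_real_derivative f x) (at x)" and f: "\<And>x. isCont f x"
  shows "ennreal (\<phi> (F b - F a))
    \<le> (\<integral>\<^sup>+x. ennreal (1 / (b - a)) * ennreal (\<phi> ((b - a) * f x)) * indicator {a..b} x \<partial>lborel)"
proof -
  define w where "w x = indicator {a..b} x / (b - a)" for x
  define \<mu> where "\<mu> = density lborel (\<lambda>x. ennreal (w x))"
  have w[measurable]: "w \<in> borel_measurable borel" and w0: "\<And>x. 0 \<le> w x"
    using ab by (auto simp: w_def[abs_def])
  have [measurable]: "f \<in> borel_measurable borel" "\<phi> \<in> borel_measurable borel"
    using f \<phi>(2) by (auto intro!: borel_measurable_continuous_onI simp: continuous_on_eq_continuous_at)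
  have c\<phi>: "isCont \<phi> t" for t
    using \<phi>(2) by (simp add: continuous_on_eq_continuous_at)
  have int: "has_bochner_integral \<mu> h I"
    if "has_bochner_integral lborel (\<lambda>x. (h x / (b - a)) * indicator {a..b} x) I" "h \<in> borel_measurable borel" for h I
    unfolding \<mu>_def using that w0
    by (intro has_bochner_integral_density) (auto simp: w_def[abs_def] mult.commute)
  have one: "has_bochner_integral lborel (\<lambda>x. (1 / (b - a)) * indicator {a..b} x) 1"
  proof -
    have "has_bochner_integral lborel (\<lambda>x. (1 / (b - a)) * indicator {a..b} x) (b / (b - a) - a / (b - a))"
      using ab by (intro has_bochner_integral_FTC_Icc_real) (auto intro!: derivative_eq_intros)
    then show ?thesis
      using ab by (simp add: diff_divide_distrib[symmetric])
  qed
  have "(\<integral>\<^sup>+x. ennreal ((1 / (b - a)) * indicator {a..b} x) \<partial>lborel) = 1"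
    using one ab by (subst nn_integral_eq_integral) (auto simp: has_bochner_integral_iff)
  then interpret \<mu>: prob_space \<mu>
    by (intro prob_spaceI) (simp add: \<mu>_def emeasure_density w_def)
  have 1: "has_bochner_integral \<mu> (\<lambda>x. (b - a) * f x) (F b - F a)"
    using has_bochner_integral_FTC_Icc_real[of a b F f] ab F f by (intro int) auto
  have "integrable lborel (\<lambda>x. (\<phi> ((b - a) * f x) / (b - a)) * indicator {a..b} x)"
    using ab f by (intro borel_integrable_atLeastAtMost continuous_intros isCont_o2[OF _ c\<phi>]) auto
  then have 2: "integrable \<mu> (\<lambda>x. \<phi> ((b - a) * f x))"
    using int has_bochner_integral_integrable by (auto simp: has_bochner_integral_iff)
  have "\<phi> (\<mu>.expectation (\<lambda>x. (b - a) * f x)) \<le> \<mu>.expectation (\<lambda>x. \<phi> ((b - a) * f x))"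
    using 1 2 \<phi>(1) by (intro \<mu>.jensens_inequality[where I = UNIV]) (auto simp: has_bochner_integral_iff)
  then have "ennreal (\<phi> (F b - F a)) \<le> ennreal (\<mu>.expectation (\<lambda>x. \<phi> ((b - a) * f x)))"
    using 1 by (intro ennreal_leI) (simp add: has_bochner_integral_iff)
  also have "\<dots> = (\<integral>\<^sup>+x. ennreal (\<phi> ((b - a) * f x)) \<partial>\<mu>)"
    using 2 \<phi>(3) by (intro nn_integral_eq_integral[symmetric]) auto
  also have "\<dots> = (\<integral>\<^sup>+x. ennreal (1 / (b - a)) * ennreal (\<phi> ((b - a) * f x)) * indicator {a..b} x \<partial>lborel)"
    unfolding \<mu>_def by (subst nn_integral_density) (auto simp: w_def intro!: nn_integral_cong split: split_indicator)
  finally show ?thesis .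
qed

text \<open>
  Along the rotation \<open>X\<^sub>\<theta> = cos \<theta> X + sin \<theta> Y\<close> the increment \<open>f Y - f X\<close> is the integral of
  \<open>\<nabla>f(X\<^sub>\<theta>) \<bullet> X'\<^sub>\<theta>\<close>, and \<open>(X\<^sub>\<theta>, X'\<^sub>\<theta>)\<close> is again a pair of independent standard Gaussians. A constraint
  \<open>X, Y \<in> U\<close> survives as the constraint \<open>X\<^sub>\<theta> \<in> U'\<close>, which does not affect \<open>X'\<^sub>\<theta>\<close>.
\<close>

theorem Maurey_Pisier:
  fixes f :: "(nat \<Rightarrow> real) \<Rightarrow> real" and grad :: "(nat \<Rightarrow> real) \<Rightarrow> nat \<Rightarrow> real"
  assumes \<phi>: "convex_on UNIV \<phi>" "continuous_on UNIV \<phi>" "\<And>t. 0 \<le> \<phi> t"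
    and f[measurable]: "f \<in> borel_measurable (leb d)"
    and grad[measurable]: "\<And>j. j < d \<Longrightarrow> (\<lambda>x. grad x j) \<in> borel_measurable (leb d)"
    and U[measurable]: "U \<in> sets (leb d)" "U' \<in> sets (leb d)"
    and rot: "\<And>x y \<theta>. x \<in> U \<Longrightarrow> y \<in> U \<Longrightarrow> lincomb d (cos \<theta>) x (sin \<theta>) y \<in> U'"
    and deriv: "\<And>x y \<theta>. ((\<lambda>\<theta>. f (lincomb d (cos \<theta>) x (sin \<theta>) y)) has_real_derivative
        dot d (grad (lincomb d (cos \<theta>) x (sin \<theta>) y)) (lincomb d (- sin \<theta>) x (cos \<theta>) y)) (at \<theta>)"
    and cont: "\<And>x y \<theta>. isCont (\<lambda>\<theta>. dot d (grad (lincomb d (cos \<theta>) x (sin \<theta>) y)) (lincomb d (- sin \<theta>) x (cos \<theta>) y)) \<theta>"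
  shows "(\<integral>\<^sup>+x. \<integral>\<^sup>+y. ennreal (\<phi> (f y - f x)) * indicator U x * indicator U y \<partial>gauss d \<partial>gauss d)
    \<le> (\<integral>\<^sup>+x. (\<integral>\<^sup>+t. ennreal (\<phi> (pi / 2 * sqrt (sqn d (grad x)) * t)) \<partial>std_gauss) * indicator U' x \<partial>gauss d)"
proof -
  let ?X = "\<lambda>\<theta> x y. lincomb d (cos \<theta>) x (sin \<theta>) y" and ?Y = "\<lambda>\<theta> x y. lincomb d (- sin \<theta>) x (cos \<theta>) y"
  let ?c = "\<lambda>\<theta>. ennreal (2 / pi) * indicator {0..pi / 2} \<theta>"
  have [measurable]: "\<phi> \<in> borel_measurable borel"
    using \<phi>(2) by (intro borel_measurable_continuous_onI)
  define \<Psi> where "\<Psi> u v = ennreal (\<phi> (pi / 2 * dot d (grad u) v)) * indicator U' u" for u v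
  let ?I = "\<integral>\<^sup>+x. \<integral>\<^sup>+y. \<Psi> x y \<partial>gauss d \<partial>gauss d"
  have m\<Psi>[measurable]: "case_prod \<Psi> \<in> borel_measurable (leb d \<Otimes>\<^sub>M leb d)"
  proof -
    have "(\<lambda>p. dot d (grad (fst p)) (snd p)) \<in> borel_measurable (leb d \<Otimes>\<^sub>M leb d)"
      unfolding dot_def by (intro borel_measurable_sum borel_measurable_times) measurable
    then show ?thesis
      unfolding \<Psi>_def split_beta by measurable
  qed
  have pt: "ennreal (\<phi> (f y - f x)) * indicator U x * indicator U y
      \<le> (\<integral>\<^sup>+\<theta>. ?c \<theta> * \<Psi> (?X \<theta> x y) (?Y \<theta> x y) \<partial>lborel)"
    if x: "x \<in> space (gauss d)" and y: "y \<in> space (gauss d)" for x y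
  proof (cases "x \<in> U \<and> y \<in> U")
    case True
    have 0: "lincomb d 1 x 0 y = x" "lincomb d 0 x 1 y = y"
      using x y by (auto simp: lincomb_def space_gauss PiE_def extensional_def restrict_def)
    have "ennreal (\<phi> (f y - f x)) * indicator U x * indicator U y = ennreal (\<phi> (f y - f x))"
      using True by simp
    also have "\<dots> \<le> (\<integral>\<^sup>+\<theta>. ennreal (1 / (pi / 2 - 0)) * ennreal (\<phi> ((pi / 2 - 0) * dot d (grad (?X \<theta> x y)) (?Y \<theta> x y))) * indicator {0..pi / 2} \<theta> \<partial>lborel)"
      using convex_mean_Icc[OF \<phi> _ deriv[where x = x and y = y] cont[where x = x and y = y], of 0 "pi / 2"] by (simp add: 0)
    also have "\<dots> = (\<integral>\<^sup>+\<theta>. ?c \<theta> * \<Psi> (?X \<theta> x y) (?Y \<theta> x y) \<partial>lborel)"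
      using rot True by (intro nn_integral_cong) (simp add: \<Psi>_def ac_simps)
    finally show ?thesis .
  qed auto
  interpret P: pair_sigma_finite "gauss d" "lborel :: real measure"
    by unfold_locales
  have m3[measurable]: "(\<lambda>(x, y, \<theta>). ?c \<theta> * \<Psi> (?X \<theta> x y) (?Y \<theta> x y))
      \<in> borel_measurable (leb d \<Otimes>\<^sub>M leb d \<Otimes>\<^sub>M lborel)"
    by measurable
  have "(\<integral>\<^sup>+x. \<integral>\<^sup>+y. ennreal (\<phi> (f y - f x)) * indicator U x * indicator U y \<partial>gauss d \<partial>gauss d)
      \<le> (\<integral>\<^sup>+x. \<integral>\<^sup>+y. \<integral>\<^sup>+\<theta>. ?c \<theta> * \<Psi> (?X \<theta> x y) (?Y \<theta> x y) \<partial>lborel \<partial>gauss d \<partial>gauss d)"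
    by (intro nn_integral_mono pt)
  also have "\<dots> = (\<integral>\<^sup>+x. \<integral>\<^sup>+\<theta>. \<integral>\<^sup>+y. ?c \<theta> * \<Psi> (?X \<theta> x y) (?Y \<theta> x y) \<partial>gauss d \<partial>lborel \<partial>gauss d)"
  proof (intro nn_integral_cong P.Fubini'[symmetric])
    fix x assume "x \<in> space (gauss d)"
    then have [measurable]: "x \<in> space (leb d)"
      by (simp add: space_gauss space_PiM)
    have "sets (gauss d \<Otimes>\<^sub>M lborel) = sets (leb d \<Otimes>\<^sub>M (lborel :: real measure))"
      by (intro sets_pair_measure_cong sets_gauss refl)
    then show "(\<lambda>(y, \<theta>). ?c \<theta> * \<Psi> (?X \<theta> x y) (?Y \<theta> x y))
        \<in> borel_measurable (gauss d \<Otimes>\<^sub>M lborel)"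
      by (subst measurable_cong_sets[OF _ refl]) (assumption, measurable)
  qed
  also have "\<dots> = (\<integral>\<^sup>+\<theta>. \<integral>\<^sup>+x. \<integral>\<^sup>+y. ?c \<theta> * \<Psi> (?X \<theta> x y) (?Y \<theta> x y) \<partial>gauss d \<partial>gauss d \<partial>lborel)"
    by (intro P.Fubini'[symmetric]) measurable
  also have "\<dots> = (\<integral>\<^sup>+\<theta>. ?c \<theta> * ?I \<partial>lborel)"
  proof (rule nn_integral_cong)
    fix \<theta> :: real
    show "(\<integral>\<^sup>+x. \<integral>\<^sup>+y. ?c \<theta> * \<Psi> (?X \<theta> x y) (?Y \<theta> x y) \<partial>gauss d \<partial>gauss d)
      = ?c \<theta> * ?I"
    \<comment> \<open>On the quarter circle the cosine is nonnegative, so the rotation invariance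
      applies; for other angles both sides vanish through the indicator.\<close>
    proof (cases "\<theta> \<in> {0..pi / 2}")
      case True
      then have c: "cos \<theta> > - 1"
        using cos_ge_zero[of \<theta>] by auto
      have "(\<integral>\<^sup>+x. \<integral>\<^sup>+y. ?c \<theta> * \<Psi> (?X \<theta> x y) (?Y \<theta> x y) \<partial>gauss d \<partial>gauss d)
          = (\<integral>\<^sup>+x. \<integral>\<^sup>+y. ?c \<theta> * \<Psi> x y \<partial>gauss d \<partial>gauss d)"
        by (rule nn_integral_gauss_rotate[where F = "\<lambda>x y. ?c \<theta> * \<Psi> x y"])
          (measurable, auto simp: c)
      also have "\<dots> = (\<integral>\<^sup>+x. ?c \<theta> * (\<integral>\<^sup>+y. \<Psi> x y \<partial>gauss d) \<partial>gauss d)"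
      proof (intro nn_integral_cong nn_integral_cmult)
        fix x assume "x \<in> space (gauss d)"
        then have [measurable]: "x \<in> space (leb d)"
          by (simp add: space_gauss space_PiM)
        have "\<Psi> x \<in> borel_measurable (leb d)"
          by measurable
        then show "\<Psi> x \<in> borel_measurable (gauss d)"
          by (simp cong: measurable_cong_sets add: sets_gauss)
      qed
      also have "\<dots> = ?c \<theta> * ?I"
        by (intro nn_integral_cmult) measurable
      finally show ?thesis .
    qed simp
  qed
  also have "\<dots> = (\<integral>\<^sup>+\<theta>. ?c \<theta> \<partial>lborel) * ?I"
    by (intro nn_integral_multc) measurable
  also have "(\<integral>\<^sup>+\<theta>. ?c \<theta> \<partial>lborel) = 1"
    by (subst nn_integral_cmult) (auto simp: ennreal_mult[symmetric])
  \<comment> \<open>For fixed \<open>x\<close> the form \<open>dot d (grad x) y\<close> is a centred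
    Gaussian with variance \<open>sqn d (grad x)\<close>, and the constraint on \<open>x\<close> is
    a constant factor.\<close>
  also have "1 * ?I
      = (\<integral>\<^sup>+x. (\<integral>\<^sup>+t. ennreal (\<phi> (pi / 2 * sqrt (sqn d (grad x)) * t)) \<partial>std_gauss) * indicator U' x \<partial>gauss d)"
    unfolding mult_1
  proof (rule nn_integral_cong)
    fix x assume "x \<in> space (gauss d)"
    have "(\<integral>\<^sup>+y. \<Psi> x y \<partial>gauss d) = (\<integral>\<^sup>+y. ennreal (\<phi> (pi / 2 * dot d (grad x) y)) \<partial>gauss d) * indicator U' x"
      unfolding \<Psi>_def by (rule nn_integral_multc) measurable
    also have "(\<integral>\<^sup>+y. ennreal (\<phi> (pi / 2 * dot d (grad x) y)) \<partial>gauss d)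
        = (\<integral>\<^sup>+t. ennreal (\<phi> (pi / 2 * sqrt (sqn d (grad x)) * t)) \<partial>std_gauss)"
      by (subst nn_integral_gauss_dot[where f = "\<lambda>t. ennreal (\<phi> (pi / 2 * t))"]) (measurable, simp add: mult.assoc)
    finally show "(\<integral>\<^sup>+y. \<Psi> x y \<partial>gauss d)
        = (\<integral>\<^sup>+t. ennreal (\<phi> (pi / 2 * sqrt (sqn d (grad x)) * t)) \<partial>std_gauss) * indicator U' x" .
  qed
  finally show ?thesis .
qed

section \<open>The logistic link and elementary inequalities\<close>

text \<open>The derivative of order \<open>k\<close> of \<open>softplus\<close>, for
  \<open>k\<close> up to five, as a polynomial in the sigmoid. Larger \<open>k\<close> repeat the
  formula of order five; derivative relations are claimed only up to that order.\<close>

definition dsig :: "nat \<Rightarrow> real \<Rightarrow> real" where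
  "dsig k t = (let s = sigmoid t in
     if k = 0 then softplus t else if k = 1 then s else if k = 2 then s * (1 - s)
     else if k = 3 then s * (1 - s) * (1 - 2 * s)
     else if k = 4 then s * (1 - s) * (1 - 6 * s + 6 * s\<^sup>2)
     else s * (1 - s) * (1 - 2 * s) * (1 - 12 * s + 12 * s\<^sup>2))"

lemma one_plus_exp_neq_0 [simp]: "1 + exp t \<noteq> 0" "exp t + 1 \<noteq> 0" for t :: real
proof -
  have "0 < 1 + exp t" by (simp add: add_pos_pos)
  then show "1 + exp t \<noteq> 0" "exp t + 1 \<noteq> 0" by linarith+
qed

lemma sigmoid_bounds: "0 < sigmoid t" "sigmoid t < 1"
  by (auto simp: sigmoid_def divide_simps add_pos_pos)

lemma sigmoid_minus: "sigmoid (- t) = 1 - sigmoid t"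
  by (simp add: sigmoid_def divide_simps add_pos_pos exp_minus)

lemma DERIV_softplus: "(softplus has_real_derivative sigmoid t) (at t)"
  unfolding softplus_def[abs_def] sigmoid_def
  by (auto intro!: derivative_eq_intros simp: add_pos_pos exp_minus divide_simps)

lemma DERIV_sigmoid: "(sigmoid has_real_derivative sigmoid t * (1 - sigmoid t)) (at t)"
  unfolding sigmoid_def[abs_def]
  by (auto intro!: derivative_eq_intros simp: divide_simps power2_eq_square)

lemma DERIV_dsig: "k \<le> 4 \<Longrightarrow> (dsig k has_real_derivative dsig (Suc k) t) (at t)"
proof -
  note [derivative_intros] = DERIV_chain2[OF DERIV_sigmoid]
  have e: "dsig 0 = softplus" "dsig (Suc 0) = sigmoid" "dsig 2 = (\<lambda>t. sigmoid t * (1 - sigmoid t))"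
    "dsig 3 = (\<lambda>t. sigmoid t * (1 - sigmoid t) * (1 - 2 * sigmoid t))"
    "dsig 4 = (\<lambda>t. sigmoid t * (1 - sigmoid t) * (1 - 6 * sigmoid t + 6 * (sigmoid t)\<^sup>2))"
    "dsig 5 = (\<lambda>t. sigmoid t * (1 - sigmoid t) * (1 - 2 * sigmoid t) * (1 - 12 * sigmoid t + 12 * (sigmoid t)\<^sup>2))"
    by (auto simp: dsig_def Let_def fun_eq_iff)
  have 2: "(dsig 2 has_real_derivative dsig 3 t) (at t)"
    unfolding e by (auto intro!: derivative_eq_intros simp: algebra_simps power2_eq_square)
  have 3: "(dsig 3 has_real_derivative dsig 4 t) (at t)"
    unfolding e by (auto intro!: derivative_eq_intros simp: algebra_simps power2_eq_square)
  have 4: "(dsig 4 has_real_derivative dsig 5 t) (at t)"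
    unfolding e by (auto intro!: derivative_eq_intros simp: algebra_simps power2_eq_square)
  assume "k \<le> 4"
  then consider "k = 0" | "k = 1" | "k = 2" | "k = 3" | "k = 4" by linarith
  then show ?thesis
  proof cases
    case 1
    then show ?thesis using DERIV_softplus by (simp add: e)
  next
    case 2
    then show ?thesis using DERIV_sigmoid e(3) by (simp add: e numeral_2_eq_2)
  qed (use 2 3 4 in \<open>simp_all add: eval_nat_numeral\<close>)
qed

lemma dsig_1 [simp]: "dsig (Suc 0) = sigmoid" and dsig_0 [simp]: "dsig 0 = softplus"
  by (auto simp: dsig_def fun_eq_iff)

lemma dsig_2_pos: "0 < dsig 2 t"
  using sigmoid_bounds[of t] by (simp add: dsig_def Let_def)

text \<open>All factors are polynomials in \<open>p = s * (1 - s)\<close>, apart from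
  \<open>1 - 2 * s\<close>, and \<open>p\<close> lies between \<open>0\<close> and
  \<open>1 / 4\<close>.\<close>

lemma abs_dsig_le: "2 \<le> k \<Longrightarrow> \<bar>dsig k t\<bar> \<le> 1"
proof -
  define s where "s = sigmoid t"
  have s: "0 < s" "s < 1" using sigmoid_bounds[of t] by (auto simp: s_def)
  define p where "p = s * (1 - s)"
  have "0 \<le> (1 - 2 * s)\<^sup>2" by simp
  then have p: "0 < p" "p \<le> 1 / 4"
    using s by (auto simp: p_def power2_eq_square algebra_simps)
  have a: "\<bar>1 - 2 * s\<bar> \<le> 1" "\<bar>1 - 6 * s + 6 * s\<^sup>2\<bar> \<le> 1" "\<bar>1 - 12 * s + 12 * s\<^sup>2\<bar> \<le> 2"
  proof -
    have "1 - 6 * s + 6 * s\<^sup>2 = 1 - 6 * p" "1 - 12 * s + 12 * s\<^sup>2 = 1 - 12 * p"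
      by (simp_all add: p_def power2_eq_square algebra_simps)
    then show "\<bar>1 - 2 * s\<bar> \<le> 1" "\<bar>1 - 6 * s + 6 * s\<^sup>2\<bar> \<le> 1" "\<bar>1 - 12 * s + 12 * s\<^sup>2\<bar> \<le> 2"
      using s p by (auto simp: abs_le_iff)
  qed
  have b: "\<bar>p * x\<bar> \<le> 1" if "\<bar>x\<bar> \<le> 2" for x
  proof -
    have "p * \<bar>x\<bar> \<le> 1 / 4 * 2" using p that by (intro mult_mono) auto
    then show ?thesis using p by (simp add: abs_mult)
  qed
  have c: "\<bar>(1 - 2 * s) * (1 - 12 * s + 12 * s\<^sup>2)\<bar> \<le> 1 * 2"
    unfolding abs_mult using a by (intro mult_mono) auto
  assume "2 \<le> k"
  then consider "k = 2" | "k = 3" | "k = 4" | "k \<ge> 5" by linarith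
  then show ?thesis
  proof cases
    case 1
    then show ?thesis using p by (simp add: dsig_def s_def[symmetric] p_def[symmetric])
  next
    case 2
    then show ?thesis using b[of "1 - 2 * s"] a by (simp add: dsig_def s_def[symmetric] p_def[symmetric])
  next
    case 3
    then show ?thesis using b[of "1 - 6 * s + 6 * s\<^sup>2"] a by (simp add: dsig_def s_def[symmetric] p_def[symmetric])
  next
    case 4
    then have "dsig k t = p * ((1 - 2 * s) * (1 - 12 * s + 12 * s\<^sup>2))"
      by (simp add: dsig_def Let_def s_def p_def mult.assoc)
    then show ?thesis using b[OF c[simplified]] by simp
  qed
qed

lemma dsig_2_ge:
  assumes "\<bar>t\<bar> \<le> A"
  shows "1 / (1 + exp A)\<^sup>2 \<le> dsig 2 t"
proof -
  have "dsig 2 t = 1 / ((1 + exp (- t)) * (1 + exp t))"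
    by (simp add: dsig_def Let_def sigmoid_minus[symmetric], simp add: sigmoid_def)
  moreover have "(1 + exp (- t)) * (1 + exp t) \<le> (1 + exp A) * (1 + exp A)"
    using assms by (intro mult_mono add_mono) auto
  moreover have "0 < (1 + exp (- t)) * (1 + exp t)"
    by (intro mult_pos_pos add_pos_pos) auto
  ultimately show ?thesis
    by (simp add: power2_eq_square frac_le)
qed

lemma softplus_Taylor:
  assumes "m \<le> 5" "0 < m"
  shows "\<exists>\<xi>. softplus (\<theta> + t) = (\<Sum>j<m. dsig j \<theta> / fact j * t ^ j) + dsig m \<xi> / fact m * t ^ m"
proof -
  have "\<exists>\<xi>. \<bar>\<xi>\<bar> \<le> \<bar>t\<bar> \<and> (\<lambda>s. softplus (\<theta> + s)) t
      = (\<Sum>j<m. (\<lambda>j s. dsig j (\<theta> + s)) j 0 / fact j * t ^ j) + (\<lambda>j s. dsig j (\<theta> + s)) m \<xi> / fact m * t ^ m"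
  proof (rule Maclaurin_bi_le)
    show "\<forall>j s. j < m \<and> \<bar>s\<bar> \<le> \<bar>t\<bar> \<longrightarrow> ((\<lambda>s. dsig j (\<theta> + s)) has_real_derivative dsig (Suc j) (\<theta> + s)) (at s)"
    proof (intro allI impI)
      fix j s assume "j < m \<and> \<bar>s\<bar> \<le> \<bar>t\<bar>"
      then have "(dsig j has_real_derivative dsig (Suc j) (s + \<theta>)) (at (s + \<theta>))"
        using assms by (intro DERIV_dsig) auto
      then have "((\<lambda>s. dsig j (s + \<theta>)) has_real_derivative dsig (Suc j) (s + \<theta>)) (at s)"
        by (rule DERIV_shift[THEN iffD1])
      then show "((\<lambda>s. dsig j (\<theta> + s)) has_real_derivative dsig (Suc j) (\<theta> + s)) (at s)"
        unfolding add.commute[of \<theta>] .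
    qed
  qed simp
  then show ?thesis by auto
qed

definition srem :: "real \<Rightarrow> real \<Rightarrow> real" where
  "srem \<theta> t = softplus (\<theta> + t) - softplus \<theta> - sigmoid \<theta> * t - dsig 2 \<theta> * t\<^sup>2 / 2"

text \<open>Three accuracies for three purposes: the cubic bound controls the remainder at every
  distance, the quartic one compares it with its leading term, and the quintic one will be used for
  its odd part.\<close>

lemma abs_srem_le: "\<bar>srem \<theta> t\<bar> \<le> \<bar>t\<bar> ^ 3 / 6"
  and abs_srem_cubic_le: "\<bar>srem \<theta> t - dsig 3 \<theta> * t ^ 3 / 6\<bar> \<le> t ^ 4 / 24"
  and abs_srem_quartic_le: "\<bar>srem \<theta> t - dsig 3 \<theta> * t ^ 3 / 6 - dsig 4 \<theta> * t ^ 4 / 24\<bar> \<le> \<bar>t\<bar> ^ 5 / 120"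
proof -
  have b: "\<bar>dsig m \<xi> * t ^ m / c\<bar> \<le> \<bar>t\<bar> ^ m / c" if "2 \<le> m" "c > 0" for m \<xi> c
  proof -
    have "\<bar>dsig m \<xi>\<bar> * \<bar>t\<bar> ^ m \<le> 1 * \<bar>t\<bar> ^ m"
      using abs_dsig_le[of m \<xi>] that by (intro mult_right_mono) auto
    then show ?thesis using that by (simp add: abs_mult power_abs divide_right_mono)
  qed
  obtain \<xi> where "softplus (\<theta> + t) = (\<Sum>j<3. dsig j \<theta> / fact j * t ^ j) + dsig 3 \<xi> / fact 3 * t ^ 3"
    using softplus_Taylor[of 3] by auto
  then have eq: "srem \<theta> t = dsig 3 \<xi> * t ^ 3 / 6"
    by (simp add: srem_def eval_nat_numeral)
  then show "\<bar>srem \<theta> t\<bar> \<le> \<bar>t\<bar> ^ 3 / 6"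
    unfolding eq using b[of 3 6 \<xi>] by simp
  obtain \<xi> where "softplus (\<theta> + t) = (\<Sum>j<4. dsig j \<theta> / fact j * t ^ j) + dsig 4 \<xi> / fact 4 * t ^ 4"
    using softplus_Taylor[of 4] by auto
  then have eq: "srem \<theta> t - dsig 3 \<theta> * t ^ 3 / 6 = dsig 4 \<xi> * t ^ 4 / 24"
    by (simp add: srem_def eval_nat_numeral)
  then show "\<bar>srem \<theta> t - dsig 3 \<theta> * t ^ 3 / 6\<bar> \<le> t ^ 4 / 24"
    unfolding eq using b[of 4 24 \<xi>] by simp
  obtain \<xi> where "softplus (\<theta> + t) = (\<Sum>j<5. dsig j \<theta> / fact j * t ^ j) + dsig 5 \<xi> / fact 5 * t ^ 5"
    using softplus_Taylor[of 5] by auto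
  then have eq: "srem \<theta> t - dsig 3 \<theta> * t ^ 3 / 6 - dsig 4 \<theta> * t ^ 4 / 24 = dsig 5 \<xi> * t ^ 5 / 120"
    by (simp add: srem_def eval_nat_numeral)
  then show "\<bar>srem \<theta> t - dsig 3 \<theta> * t ^ 3 / 6 - dsig 4 \<theta> * t ^ 4 / 24\<bar> \<le> \<bar>t\<bar> ^ 5 / 120"
    unfolding eq using b[of 5 120 \<xi>] by simp
qed

text \<open>The quartic Taylor term is even and cancels, so the odd part deviates from the cubic
  term only at order five.\<close>

lemma abs_srem_odd_le: "\<bar>(srem \<theta> t - srem \<theta> (- t)) / 2 - dsig 3 \<theta> * t ^ 3 / 6\<bar> \<le> \<bar>t\<bar> ^ 5 / 120"
proof -
  have "\<bar>srem \<theta> (- t) + dsig 3 \<theta> * t ^ 3 / 6 - dsig 4 \<theta> * t ^ 4 / 24\<bar> \<le> \<bar>t\<bar> ^ 5 / 120"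
    using abs_srem_quartic_le[of \<theta> "- t"] by simp
  note this[THEN abs_le_D1] this[THEN abs_le_D2]
    abs_srem_quartic_le[of \<theta> t, THEN abs_le_D1] abs_srem_quartic_le[of \<theta> t, THEN abs_le_D2]
  then show ?thesis by (intro abs_leI) (simp_all add: field_simps)
qed

lemma convex_softplus: "convex_on UNIV softplus"
proof (rule convex_on_realI[where f' = sigmoid])
  fix x y :: real assume "x \<le> y"
  then show "sigmoid x \<le> sigmoid y"
    by (auto simp: sigmoid_def intro!: divide_left_mono mult_pos_pos add_pos_pos)
qed (auto intro: DERIV_softplus)

text \<open>Convexity on the segment from \<open>\<theta>\<close> to \<open>\<theta> + t\<close>.
  This is what later transfers growth on a sphere to all points beyond it.\<close>

lemma softplus_Bregman_scale:
  assumes "0 \<le> s" "s \<le> 1"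
  shows "softplus (\<theta> + s * t) - softplus \<theta> - sigmoid \<theta> * (s * t)
    \<le> s * (softplus (\<theta> + t) - softplus \<theta> - sigmoid \<theta> * t)"
proof -
  have "softplus ((1 - s) *\<^sub>R \<theta> + s *\<^sub>R (\<theta> + t)) \<le> (1 - s) * softplus \<theta> + s * softplus (\<theta> + t)"
    using convex_onD[OF convex_softplus, of s \<theta> "\<theta> + t"] assms by simp
  then show ?thesis by (simp add: algebra_simps)
qed

lemma abs_exp_2_le: "\<bar>exp y - 1 - y\<bar> \<le> y\<^sup>2 * (exp y + exp (- y)) / 2" for y :: real
proof -
  obtain t where t: "\<bar>t\<bar> \<le> \<bar>y\<bar>" "exp y = (\<Sum>m<2. y ^ m / fact m) + exp t / fact 2 * y ^ 2"
    using Maclaurin_exp_le[of y 2] by auto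
  have "exp t \<le> exp \<bar>y\<bar>" using t by simp
  also have "\<dots> \<le> exp y + exp (- y)" by (cases "y \<ge> 0") auto
  finally have "exp t * y\<^sup>2 / 2 \<le> (exp y + exp (- y)) * y\<^sup>2 / 2"
    by (intro divide_right_mono mult_right_mono) auto
  moreover have eq: "exp y - 1 - y = exp t * y\<^sup>2 / 2"
    using t(2) by (simp add: eval_nat_numeral)
  ultimately show ?thesis unfolding eq by (simp add: mult.commute)
qed

text \<open>In the odd part of the exponential the quadratic term cancels, which gains one order
  over the bound for \<open>exp y - 1 - y\<close>.\<close>

lemma abs_sinh_3_le: "\<bar>(exp y - exp (- y)) / 2 - y\<bar> \<le> \<bar>y\<bar> ^ 3 * (exp y + exp (- y)) / 6" for y :: real
proof -
  have *: "\<bar>exp y - 1 - y - y\<^sup>2 / 2\<bar> \<le> \<bar>y\<bar> ^ 3 * (exp y + exp (- y)) / 6" for y :: real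
  proof -
    obtain t where t: "\<bar>t\<bar> \<le> \<bar>y\<bar>" "exp y = (\<Sum>m<3. y ^ m / fact m) + exp t / fact 3 * y ^ 3"
      using Maclaurin_exp_le[of y 3] by auto
    have "exp t \<le> exp \<bar>y\<bar>" using t by simp
    also have "\<dots> \<le> exp y + exp (- y)" by (cases "y \<ge> 0") auto
    finally have "\<bar>y\<bar> ^ 3 * exp t / 6 \<le> \<bar>y\<bar> ^ 3 * (exp y + exp (- y)) / 6"
      by (intro divide_right_mono mult_left_mono) auto
    moreover have eq: "exp y - 1 - y - y\<^sup>2 / 2 = y ^ 3 * exp t / 6"
      using t(2) by (simp add: eval_nat_numeral)
    ultimately show ?thesis unfolding eq by (simp add: abs_mult power_abs)
  qed
  have "\<bar>exp (- y) - 1 + y - y\<^sup>2 / 2\<bar> \<le> \<bar>y\<bar> ^ 3 * (exp y + exp (- y)) / 6"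
    using *[of "- y"] by (simp add: add.commute)
  note this[THEN abs_le_D1] this[THEN abs_le_D2] *[of y, THEN abs_le_D1] *[of y, THEN abs_le_D2]
  then show ?thesis by (intro abs_leI) (simp_all add: field_simps)
qed

section \<open>The posterior in standardized coordinates\<close>

text \<open>Valued in \<open>ennreal\<close>, so that a finite bound for a nonnegative function also
  proves its integrability; negative values of \<open>F\<close> would count as zero.\<close>

definition EG :: "nat \<Rightarrow> ((nat \<Rightarrow> real) \<Rightarrow> real) \<Rightarrow> ennreal" where
  "EG d F = (\<integral>\<^sup>+x. ennreal (F x) \<partial>gauss d)"

lemma EG_mono: "(\<And>x. x \<in> space (leb d) \<Longrightarrow> F x \<le> G x) \<Longrightarrow> EG d F \<le> EG d G"
  unfolding EG_def by (intro nn_integral_mono ennreal_leI) (simp add: space_gauss space_PiM)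

lemma EG_le_trans:
  "(\<And>x. x \<in> space (leb d) \<Longrightarrow> F x \<le> G x) \<Longrightarrow> EG d G \<le> c \<Longrightarrow> EG d F \<le> c"
  using EG_mono order_trans by blast

lemma measurable_gauss_leb: "f \<in> borel_measurable (leb d) \<Longrightarrow> f \<in> borel_measurable (gauss d)"
  by (simp cong: measurable_cong_sets add: sets_gauss)

lemma EG_add_le:
  assumes [measurable]: "F \<in> borel_measurable (leb d)" "G \<in> borel_measurable (leb d)"
    and "\<And>x. 0 \<le> F x" "\<And>x. 0 \<le> G x" "EG d F \<le> ennreal a" "EG d G \<le> ennreal b" "0 \<le> a" "0 \<le> b"
  shows "EG d (\<lambda>x. F x + G x) \<le> ennreal (a + b)"
proof -
  have "EG d (\<lambda>x. F x + G x) = EG d F + EG d G"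
    unfolding EG_def using assms(3,4) measurable_gauss_leb[OF assms(1)] measurable_gauss_leb[OF assms(2)]
    by (subst nn_integral_add[symmetric]) auto
  then show ?thesis
    using assms by (simp add: add_mono)
qed

lemma EG_cmult_le:
  assumes [measurable]: "F \<in> borel_measurable (leb d)" and "0 \<le> c" "EG d F \<le> ennreal a"
  shows "EG d (\<lambda>x. c * F x) \<le> ennreal (c * a)"
proof -
  have "EG d (\<lambda>x. c * F x) = ennreal c * EG d F"
    unfolding EG_def using \<open>0 \<le> c\<close> measurable_gauss_leb[OF assms(1)]
    by (subst nn_integral_cmult[symmetric]) (auto simp: ennreal_mult')
  also have "\<dots> \<le> ennreal c * ennreal a"
    using assms by (intro mult_left_mono) auto
  finally show ?thesis
    using \<open>0 \<le> c\<close> by (simp add: ennreal_mult')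
qed

definition cball :: "nat \<Rightarrow> real \<Rightarrow> (nat \<Rightarrow> real) set" where
  "cball d c = {x \<in> space (leb d). sqn d x \<le> c}"

lemma cball_sets [measurable]: "cball d c \<in> sets (leb d)"
  unfolding cball_def by measurable

lemma reflect_in_space: "(\<lambda>i\<in>{..<d}. - x i) \<in> space (leb d)"
  by (simp add: space_PiM)

lemma reflect_in_cball: "x \<in> space (leb d) \<Longrightarrow> (\<lambda>i\<in>{..<d}. - x i) \<in> cball d c \<longleftrightarrow> x \<in> cball d c"
  by (simp add: cball_def reflect_in_space)

lemma lincomb_in_cball:
  assumes "x \<in> cball d c" "y \<in> cball d c"
  shows "lincomb d (cos \<theta>) x (sin \<theta>) y \<in> cball d (2 * c)"
proof -
  have "sqn d (lincomb d (cos \<theta>) x (sin \<theta>) y) + sqn d (lincomb d (- sin \<theta>) x (cos \<theta>) y)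
      = ((cos \<theta>)\<^sup>2 + (sin \<theta>)\<^sup>2) * (sqn d x + sqn d y)"
    unfolding sqn_lincomb by (simp add: algebra_simps del: sin_cos_squared_add sin_cos_squared_add2)
  then have "sqn d (lincomb d (cos \<theta>) x (sin \<theta>) y) + sqn d (lincomb d (- sin \<theta>) x (cos \<theta>) y) = sqn d x + sqn d y"
    by simp
  then have "sqn d (lincomb d (cos \<theta>) x (sin \<theta>) y) \<le> sqn d x + sqn d y"
    using sqn_nonneg[of d "lincomb d (- sin \<theta>) x (cos \<theta>) y"] by linarith
  then show ?thesis
    using assms by (simp add: cball_def lincomb_def space_PiM)
qed

text \<open>The deterministic problem after whitening: \<open>z i\<close> is the \<open>i\<close>-th
  observation in coordinates in which the Hessian at the minimizer is the identity, and
  \<open>th i\<close> is its linear predictor there. Hence \<open>second\<close>: the likelihood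
  part of the Hessian is at most the identity, the gap being the prior precision. The scaling of
  \<open>fourth\<close> and \<open>sixth\<close> is that of vectors with squared norm about
  \<open>d / n\<close>. The power of two in \<open>small\<close> is generous, not optimal.\<close>

locale logistic_coords =
  fixes d n :: nat and z :: "nat \<Rightarrow> nat \<Rightarrow> real" and th :: "nat \<Rightarrow> real" and B :: real
  assumes d1: "1 \<le> d" and n1: "1 \<le> n" and B1: "1 \<le> B"
    and small: "2 ^ 20 * B\<^sup>2 * (real d / sqrt (real n)) \<le> 1"
    and fourth: "\<And>x. (\<Sum>i<n. dot d (z i) x ^ 4) \<le> B / real n * (sqn d x)\<^sup>2"
    and second: "\<And>x. (\<Sum>i<n. dsig 2 (th i) * (dot d (z i) x)\<^sup>2) \<le> sqn d x"
    and sixth: "(\<Sum>i<n. sqn d (z i) ^ 3) \<le> B * real d ^ 3 / (real n)\<^sup>2"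
begin

definition eps :: real where "eps = real d / sqrt (real n)"

definition rho2 :: real where "rho2 = real n powr (1 / 4) * sqrt (real d)"

abbreviation growth :: "(nat \<Rightarrow> real) \<Rightarrow> real" where
  "growth x \<equiv> exp (sqrt (real d) * sqrt (sqn d x) / 2)"

definition lin :: "nat \<Rightarrow> (nat \<Rightarrow> real) \<Rightarrow> real" where "lin i x = dot d (z i) x"

definition S :: "(nat \<Rightarrow> real) \<Rightarrow> real" where
  "S x = - (\<Sum>i<n. dsig 3 (th i) * lin i x ^ 3) / 6"

definition r :: "(nat \<Rightarrow> real) \<Rightarrow> real" where
  "r x = - (\<Sum>i<n. srem (th i) (lin i x))"

definition q :: "(nat \<Rightarrow> real) \<Rightarrow> real" where
  "q x = (\<Sum>i<n. lin i x ^ 4)"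

definition grad :: "(nat \<Rightarrow> real) \<Rightarrow> nat \<Rightarrow> real" where
  "grad x j = - (\<Sum>i<n. dsig 3 (th i) * (lin i x)\<^sup>2 * z i j) / 2"

abbreviation refl :: "(nat \<Rightarrow> real) \<Rightarrow> nat \<Rightarrow> real" where
  "refl x \<equiv> (\<lambda>i\<in>{..<d}. - x i)"

abbreviation U :: "(nat \<Rightarrow> real) set" where "U \<equiv> cball d rho2"

lemma dn_pos: "0 < real d" "0 < real n"
  using d1 n1 by auto

lemma eps_pos: "0 < eps"
  using dn_pos by (simp add: eps_def)

lemma eps_small: "2 ^ 20 * B\<^sup>2 * eps \<le> 1" "2 ^ 20 * eps \<le> 1" "eps \<le> 1" "2 ^ 20 * (B * eps) \<le> 1" "B * eps \<le> 1"
proof -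
  show 1: "2 ^ 20 * B\<^sup>2 * eps \<le> 1" using small by (simp add: eps_def)
  have b: "1 \<le> B\<^sup>2" "B \<le> B\<^sup>2" using B1 by (auto simp: self_le_power one_le_power)
  have "1 * eps \<le> B\<^sup>2 * eps" and e2: "B * eps \<le> B\<^sup>2 * eps"
    using eps_pos b by (intro mult_right_mono; simp)+
  then have e1: "eps \<le> B\<^sup>2 * eps" by simp
  have h: "1048576 * (B\<^sup>2 * eps) \<le> 1" using 1 by simp
  show "2 ^ 20 * eps \<le> 1" "eps \<le> 1" "2 ^ 20 * (B * eps) \<le> 1" "B * eps \<le> 1"
  proof -
    have "1048576 * eps \<le> 1" "eps \<le> 1" "1048576 * (B * eps) \<le> 1" "B * eps \<le> 1"
      using h e1 e2 eps_pos by linarith+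
    then show "2 ^ 20 * eps \<le> 1" "eps \<le> 1" "2 ^ 20 * (B * eps) \<le> 1" "B * eps \<le> 1"
      by simp_all
  qed
qed

lemma rho2_sq: "rho2\<^sup>2 = real n * eps"
proof -
  have "(real n powr (1 / 4))\<^sup>2 = sqrt (real n)"
    using dn_pos by (simp add: powr_half_sqrt[symmetric] power2_eq_square powr_add[symmetric])
  then have "rho2\<^sup>2 = sqrt (real n) * real d"
    using dn_pos by (simp add: rho2_def power_mult_distrib)
  also have "\<dots> = real n * eps"
    using dn_pos by (simp add: eps_def field_simps)
  finally show ?thesis .
qed

lemma rho2_pos: "0 < rho2"
  using dn_pos by (simp add: rho2_def)

lemma eps_sq: "eps\<^sup>2 = (real d)\<^sup>2 / real n"
  using dn_pos by (simp add: eps_def power_divide)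

text \<open>Since \<open>rho2 ^ 2 = n * eps\<close> and \<open>d ^ 2 = n * eps ^ 2\<close>, the
  bound \<open>2 ^ 20 * eps \<le> 1\<close> becomes the factor \<open>2 ^ 10\<close> by which the
  ball exceeds the typical squared norm.\<close>

lemma rho2_ge: "1024 * real d \<le> rho2"
proof (rule power2_le_imp_le)
  have "(1024 * real d)\<^sup>2 = 2 ^ 20 * eps * (real n * eps)"
    using eps_sq dn_pos by (simp add: power2_eq_square field_simps)
  also have "\<dots> \<le> 1 * (real n * eps)"
    using eps_small eps_pos dn_pos by (intro mult_right_mono) auto
  finally show "(1024 * real d)\<^sup>2 \<le> rho2\<^sup>2"
    by (simp add: rho2_sq)
qed (use rho2_pos in simp)

lemma lin_lincomb: "lin i (lincomb d a x b y) = a * lin i x + b * lin i y"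
  by (simp add: lin_def)

lemma lin_refl [simp]: "lin i (refl x) = - lin i x"
  by (simp add: lin_def dot_minus)

lemma lin_scale: "lin i (\<lambda>j. a * x j) = a * lin i x"
  by (simp add: lin_def dot_scale)

lemma measurable_lin [measurable]: "lin i \<in> borel_measurable (leb d)"
  unfolding lin_def[abs_def] by measurable

lemma measurable_S [measurable]: "S \<in> borel_measurable (leb d)"
  unfolding S_def[abs_def] by measurable

lemma measurable_srem [measurable]: "srem \<theta> \<in> borel_measurable borel"
  unfolding srem_def[abs_def] softplus_def by measurable

lemma measurable_r [measurable]: "r \<in> borel_measurable (leb d)"
  unfolding r_def[abs_def] by measurable

lemma measurable_q [measurable]: "q \<in> borel_measurable (leb d)"
  unfolding q_def[abs_def] by measurable

lemma S_refl [simp]: "S (refl x) = - S x"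
  by (simp add: S_def sum_negf)

lemma q_nonneg: "0 \<le> q x"
  unfolding q_def by (intro sum_nonneg) simp

lemma q_refl [simp]: "q (refl x) = q x"
  by (simp add: q_def)

lemma q_le: "q x \<le> B / real n * (sqn d x)\<^sup>2"
  using fourth[of x] by (simp add: q_def lin_def)

lemma q_le_U: "x \<in> U \<Longrightarrow> q x \<le> B * eps"
proof -
  assume "x \<in> U"
  then have "(sqn d x)\<^sup>2 \<le> rho2\<^sup>2"
    by (intro power_mono) (auto simp: cball_def)
  then have "B / real n * (sqn d x)\<^sup>2 \<le> B / real n * (real n * eps)"
    unfolding rho2_sq using B1 by (intro mult_left_mono) auto
  also have "\<dots> = B * eps" using dn_pos by simp
  finally show ?thesis using q_le[of x] by simp
qed

text \<open>Second and, below, third powers are interpolated from the fourth-moment bound by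
  Cauchy-Schwarz, at the cost of powers of \<open>B\<close>.\<close>

lemma sum_lin_sq_le: "(\<Sum>i<n. (lin i x)\<^sup>2) \<le> B * sqn d x"
proof (rule power2_le_imp_le)
  have "(\<Sum>i<n. (lin i x)\<^sup>2 * 1)\<^sup>2 \<le> (\<Sum>i<n. ((lin i x)\<^sup>2)\<^sup>2) * (\<Sum>i<n. 1\<^sup>2)"
    by (rule Cauchy_Schwarz_ineq_sum)
  also have "\<dots> = q x * real n"
    by (simp add: q_def)
  also have "\<dots> \<le> (B / real n * (sqn d x)\<^sup>2) * real n"
    using q_le by (intro mult_right_mono) auto
  also have "\<dots> = B * (sqn d x)\<^sup>2"
    using dn_pos by simp
  also have "\<dots> \<le> B\<^sup>2 * (sqn d x)\<^sup>2"
    using B1 by (intro mult_right_mono) (auto simp: self_le_power)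
  finally show "(\<Sum>i<n. (lin i x)\<^sup>2)\<^sup>2 \<le> (B * sqn d x)\<^sup>2"
    by (simp add: power_mult_distrib)
qed (use B1 in simp)

lemma sum_lin_cube_le: "(\<Sum>i<n. \<bar>lin i x\<bar> ^ 3) \<le> B * sqn d x * sqrt (sqn d x) / sqrt (real n)"
proof (rule power2_le_imp_le)
  have "(\<Sum>i<n. \<bar>lin i x\<bar> * (lin i x)\<^sup>2)\<^sup>2 \<le> (\<Sum>i<n. \<bar>lin i x\<bar>\<^sup>2) * (\<Sum>i<n. ((lin i x)\<^sup>2)\<^sup>2)"
    by (rule Cauchy_Schwarz_ineq_sum)
  also have "\<dots> \<le> (B * sqn d x) * (B / real n * (sqn d x)\<^sup>2)"
    using sum_lin_sq_le[of x] q_le[of x] q_nonneg[of x] B1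
    by (intro mult_mono) (auto simp: q_def)
  also have "\<dots> = (B * sqn d x * sqrt (sqn d x) / sqrt (real n))\<^sup>2"
    by (simp add: power_divide power_mult_distrib power2_eq_square)
  finally show "(\<Sum>i<n. \<bar>lin i x\<bar> ^ 3)\<^sup>2 \<le> (B * sqn d x * sqrt (sqn d x) / sqrt (real n))\<^sup>2"
    by (simp add: numeral_3_eq_3 numeral_2_eq_2 mult.assoc)
qed (use B1 in simp)

lemma abs_r_S_le: "\<bar>r x - S x\<bar> \<le> q x / 24"
proof -
  have "\<bar>r x - S x\<bar> = \<bar>\<Sum>i<n. srem (th i) (lin i x) - dsig 3 (th i) * lin i x ^ 3 / 6\<bar>"
    by (simp add: r_def S_def sum_subtractf sum_divide_distrib abs_minus_commute)
  also have "\<dots> \<le> (\<Sum>i<n. lin i x ^ 4 / 24)"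
    by (rule order_trans[OF sum_abs]) (intro sum_mono abs_srem_cubic_le)
  finally show ?thesis by (simp add: q_def sum_divide_distrib)
qed

lemma abs_r_le: "\<bar>r x\<bar> \<le> B * sqn d x * sqrt (sqn d x) / sqrt (real n) / 6"
proof -
  have "\<bar>r x\<bar> \<le> (\<Sum>i<n. \<bar>srem (th i) (lin i x)\<bar>)"
    by (simp add: r_def sum_abs)
  also have "\<dots> \<le> (\<Sum>i<n. \<bar>lin i x\<bar> ^ 3 / 6)"
    by (intro sum_mono abs_srem_le)
  finally show ?thesis using sum_lin_cube_le[of x] by (simp add: sum_divide_distrib[symmetric])
qed

lemma abs_S_le: "\<bar>S x\<bar> \<le> B * sqn d x * sqrt (sqn d x) / sqrt (real n) / 6"
proof -
  have "\<bar>S x\<bar> \<le> (\<Sum>i<n. \<bar>dsig 3 (th i) * lin i x ^ 3\<bar>) / 6"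
    by (simp add: S_def sum_abs)
  also have "(\<Sum>i<n. \<bar>dsig 3 (th i) * lin i x ^ 3\<bar>) \<le> (\<Sum>i<n. 1 * \<bar>lin i x\<bar> ^ 3)"
    unfolding abs_mult power_abs by (intro sum_mono mult_right_mono abs_dsig_le) auto
  finally show ?thesis using sum_lin_cube_le[of x] by simp
qed

section \<open>The gradient of the cubic form and concentration\<close>

lemma dot_grad: "dot d (grad x) y = - (\<Sum>i<n. dsig 3 (th i) * (lin i x)\<^sup>2 * lin i y) / 2"
proof -
  have "dot d (grad x) y = - (\<Sum>j<d. \<Sum>i<n. dsig 3 (th i) * (lin i x)\<^sup>2 * (z i j * y j)) / 2"
    by (simp add: dot_def grad_def sum_distrib_right sum_negf sum_divide_distrib mult.assoc)
  also have "(\<Sum>j<d. \<Sum>i<n. dsig 3 (th i) * (lin i x)\<^sup>2 * (z i j * y j))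
      = (\<Sum>i<n. dsig 3 (th i) * (lin i x)\<^sup>2 * lin i y)"
    by (subst sum.swap) (simp add: lin_def dot_def sum_distrib_left)
  finally show ?thesis .
qed

text \<open>Duality: the gradient is paired with itself, and Cauchy-Schwarz separates fourth powers
  in direction \<open>x\<close> from squares in the direction of the gradient. No power of
  \<open>d\<close> is lost.\<close>

lemma sqn_grad_le: "sqn d (grad x) \<le> B\<^sup>2 * (sqn d x)\<^sup>2 / (4 * real n)"
proof (cases "sqn d (grad x) = 0")
  case True
  then show ?thesis using B1 by simp
next
  case False
  let ?y = "grad x"
  have pos: "0 < sqn d ?y" using False sqn_nonneg[of d ?y] by linarith
  have "sqn d ?y = dot d ?y ?y" by (simp add: dot_self)
  also have "\<dots> = - (\<Sum>i<n. (lin i x)\<^sup>2 * (dsig 3 (th i) * lin i ?y)) / 2"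
    unfolding dot_grad by (simp add: ac_simps)
  finally have "(sqn d ?y)\<^sup>2 = (\<Sum>i<n. (lin i x)\<^sup>2 * (dsig 3 (th i) * lin i ?y))\<^sup>2 / 4"
    by (simp add: power_divide)
  also have "\<dots> \<le> (\<Sum>i<n. ((lin i x)\<^sup>2)\<^sup>2) * (\<Sum>i<n. (dsig 3 (th i) * lin i ?y)\<^sup>2) / 4"
    by (intro divide_right_mono Cauchy_Schwarz_ineq_sum) simp
  also have "\<dots> \<le> (B / real n * (sqn d x)\<^sup>2) * (B * sqn d ?y) / 4"
  proof -
    have "(dsig 3 (th i))\<^sup>2 \<le> 1" for i
      using abs_dsig_le[of 3 "th i"] by (simp add: abs_square_le_1)
    then have "(\<Sum>i<n. (dsig 3 (th i) * lin i ?y)\<^sup>2) \<le> (\<Sum>i<n. 1 * (lin i ?y)\<^sup>2)"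
      unfolding power_mult_distrib by (intro sum_mono mult_right_mono) auto
    also have "\<dots> \<le> B * sqn d ?y" using sum_lin_sq_le by simp
    finally show ?thesis
      using q_le[of x] B1 by (intro divide_right_mono mult_mono) (auto simp: q_def intro!: sum_nonneg)
  qed
  finally have "sqn d ?y * sqn d ?y \<le> (B\<^sup>2 * (sqn d x)\<^sup>2 / (4 * real n)) * sqn d ?y"
    by (simp add: power2_eq_square ac_simps)
  then show ?thesis using pos by (rule mult_right_le_imp_le)
qed

lemma measurable_grad [measurable]: "(\<lambda>x. grad x j) \<in> borel_measurable (leb d)"
  unfolding grad_def by measurable

text \<open>The Maurey-Pisier inequality controls increments of \<open>S\<close>; oddness removes
  the second point. On the symmetric set \<open>A\<close> the points \<open>y\<close> and
  \<open>- y\<close> contribute equally, and \<open>- S x\<close> is the midpoint of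
  \<open>S y - S x\<close> and \<open>- S y - S x\<close>, so convexity bounds
  \<open>\<phi> (- S x)\<close> at the price of the mass of \<open>A\<close> on the left.\<close>

lemma concentration:
  assumes \<phi>: "convex_on UNIV \<phi>" "continuous_on UNIV \<phi>" "\<And>t. 0 \<le> \<phi> t"
    and U[measurable]: "A \<in> sets (leb d)" "A' \<in> sets (leb d)"
    and rot: "\<And>x y \<theta>. x \<in> A \<Longrightarrow> y \<in> A \<Longrightarrow> lincomb d (cos \<theta>) x (sin \<theta>) y \<in> A'"
    and sym: "\<And>x. x \<in> space (leb d) \<Longrightarrow> refl x \<in> A \<longleftrightarrow> x \<in> A"
  shows "(\<integral>\<^sup>+x. ennreal (\<phi> (- S x)) * indicator A x \<partial>gauss d) * emeasure (gauss d) A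
    \<le> (\<integral>\<^sup>+x. (\<integral>\<^sup>+t. ennreal (\<phi> (pi / 2 * sqrt (sqn d (grad x)) * t)) \<partial>std_gauss) * indicator A' x \<partial>gauss d)"
proof -
  have [measurable]: "\<phi> \<in> borel_measurable borel"
    using \<phi>(2) by (intro borel_measurable_continuous_onI)
  have AG[measurable]: "A \<in> sets (gauss d)" using U by (simp add: sets_gauss)
  have inner: "ennreal (\<phi> (- S x)) * emeasure (gauss d) A
      \<le> (\<integral>\<^sup>+y. ennreal (\<phi> (S y - S x)) * indicator A y \<partial>gauss d)" (is "_ \<le> ?I") for x
  proof -
    have m[measurable]: "(\<lambda>y. ennreal (\<phi> (S y - S x)) * indicator A y) \<in> borel_measurable (leb d)"
      "(\<lambda>y. ennreal (\<phi> (- S y - S x)) * indicator A y) \<in> borel_measurable (leb d)"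
      by measurable
    have "?I = (\<integral>\<^sup>+y. ennreal (\<phi> (S (refl y) - S x)) * indicator A (refl y) \<partial>gauss d)"
      by (rule nn_integral_gauss_reflect[symmetric]) measurable
    also have "\<dots> = (\<integral>\<^sup>+y. ennreal (\<phi> (- S y - S x)) * indicator A y \<partial>gauss d)"
      by (intro nn_integral_cong) (simp add: space_gauss sym space_PiM indicator_def)
    finally have I: "?I = (\<integral>\<^sup>+y. ennreal (\<phi> (- S y - S x)) * indicator A y \<partial>gauss d)" .
    have "2 * (ennreal (\<phi> (- S x)) * emeasure (gauss d) A)
        = (\<integral>\<^sup>+y. ennreal (2 * \<phi> (- S x)) * indicator A y \<partial>gauss d)"
      using \<phi>(3) by (subst nn_integral_cmult_indicator) (auto simp: ennreal_mult mult.assoc)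
    also have "\<dots> \<le> (\<integral>\<^sup>+y. ennreal (\<phi> (S y - S x)) * indicator A y + ennreal (\<phi> (- S y - S x)) * indicator A y \<partial>gauss d)"
    proof (rule nn_integral_mono)
      fix y
      have "\<phi> ((1 - 1/2) *\<^sub>R (S y - S x) + (1/2) *\<^sub>R (- S y - S x)) \<le> (1 - 1/2) * \<phi> (S y - S x) + (1/2) * \<phi> (- S y - S x)"
        by (rule convex_onD[OF \<phi>(1)]) auto
      moreover have "(1 - 1/2) *\<^sub>R (S y - S x) + (1/2) *\<^sub>R (- S y - S x) = - S x"
        by (simp add: field_simps)
      ultimately have "2 * \<phi> (- S x) \<le> \<phi> (S y - S x) + \<phi> (- S y - S x)"
        by simp
      then show "ennreal (2 * \<phi> (- S x)) * indicator A y
          \<le> ennreal (\<phi> (S y - S x)) * indicator A y + ennreal (\<phi> (- S y - S x)) * indicator A y"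
        using \<phi>(3) by (auto split: split_indicator simp: ennreal_plus[symmetric] simp del: ennreal_plus intro!: ennreal_leI)
    qed
    also have "\<dots> = 2 * ?I"
      unfolding mult_2 by (subst nn_integral_add) (auto simp: I intro!: measurable_gauss_leb)
    finally show ?thesis
      by (subst (asm) ennreal_mult_le_mult_iff) auto
  qed
  have "(\<integral>\<^sup>+x. ennreal (\<phi> (- S x)) * indicator A x \<partial>gauss d) * emeasure (gauss d) A
      = (\<integral>\<^sup>+x. ennreal (\<phi> (- S x)) * indicator A x * emeasure (gauss d) A \<partial>gauss d)"
    by (intro nn_integral_multc[symmetric] measurable_gauss_leb) measurable
  also have "\<dots> \<le> (\<integral>\<^sup>+x. \<integral>\<^sup>+y. ennreal (\<phi> (S y - S x)) * indicator A x * indicator A y \<partial>gauss d \<partial>gauss d)"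
  proof (rule nn_integral_mono)
    fix x
    show "ennreal (\<phi> (- S x)) * indicator A x * emeasure (gauss d) A
        \<le> (\<integral>\<^sup>+y. ennreal (\<phi> (S y - S x)) * indicator A x * indicator A y \<partial>gauss d)"
      using inner[of x] by (simp split: split_indicator)
  qed
  also have "\<dots> \<le> (\<integral>\<^sup>+x. (\<integral>\<^sup>+t. ennreal (\<phi> (pi / 2 * sqrt (sqn d (grad x)) * t)) \<partial>std_gauss) * indicator A' x \<partial>gauss d)"
  proof (rule Maurey_Pisier[OF \<phi> measurable_S measurable_grad U rot])
    fix x y \<theta>
    show "((\<lambda>\<theta>. S (lincomb d (cos \<theta>) x (sin \<theta>) y)) has_real_derivative
        dot d (grad (lincomb d (cos \<theta>) x (sin \<theta>) y)) (lincomb d (- sin \<theta>) x (cos \<theta>) y)) (at \<theta>)"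
      unfolding dot_grad S_def lin_lincomb
      by (auto intro!: derivative_eq_intros simp: sum_distrib_left sum_negf[symmetric] sum_divide_distrib algebra_simps intro!: sum.cong)
        (simp_all add: field_simps)
    show "isCont (\<lambda>\<theta>. dot d (grad (lincomb d (cos \<theta>) x (sin \<theta>) y)) (lincomb d (- sin \<theta>) x (cos \<theta>) y)) \<theta>"
      unfolding dot_grad lin_lincomb by (auto intro!: continuous_intros)
  qed
  finally show ?thesis .
qed

definition cmom :: "nat \<Rightarrow> real" where
  "cmom k = gmom k * (2 * fact (2 * k) * 4 ^ (2 * k))"

lemma cmom_pos: "0 < cmom k"
  by (simp add: cmom_def gmom_pos)

lemma pi_sq_le: "pi\<^sup>2 \<le> 16"
  using pi_less_4 by (intro order_trans[OF power_mono[of pi 4 2]]) auto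

text \<open>Concentration on the whole space with an even power as \<phi>. The inner Gaussian
  average produces the power \<open>2 k\<close> of the gradient norm, hence
  \<open>(sqn d x) ^ (2 * k) / n ^ k\<close>, and the moments of the squared norm give
  \<open>(d ^ 2 / n) ^ k = eps ^ (2 * k)\<close>.\<close>

lemma EG_S_power: "EG d (\<lambda>x. S x ^ (2 * k)) \<le> ennreal (cmom k * (B * eps) ^ (2 * k))"
proof -
  let ?T = "\<lambda>x. \<integral>\<^sup>+t. ennreal ((pi / 2 * sqrt (sqn d (grad x)) * t) ^ (2 * k)) \<partial>std_gauss"
  let ?sp = "space (leb d)"
  have 1: "(\<integral>\<^sup>+x. ennreal ((- S x) ^ (2 * k)) * indicator ?sp x \<partial>gauss d) * emeasure (gauss d) ?sp
    \<le> (\<integral>\<^sup>+x. ?T x * indicator ?sp x \<partial>gauss d)"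
    by (rule concentration) (auto intro!: convex_power_even continuous_intros reflect_in_space simp: lincomb_def space_PiM)
  have 2: "emeasure (gauss d) ?sp = 1"
    using gauss.emeasure_space_1[of d] by (simp add: space_gauss space_PiM)
  have 3: "(\<integral>\<^sup>+x. ennreal ((- S x) ^ (2 * k)) * indicator ?sp x \<partial>gauss d) = EG d (\<lambda>x. S x ^ (2 * k))"
    unfolding EG_def by (intro nn_integral_cong) (auto simp: space_gauss space_PiM)
  have "EG d (\<lambda>x. S x ^ (2 * k)) \<le> (\<integral>\<^sup>+x. ?T x * indicator ?sp x \<partial>gauss d)"
    using 1 unfolding 2 3 by simp
  also have "(\<integral>\<^sup>+x. ?T x * indicator ?sp x \<partial>gauss d)
      \<le> EG d (\<lambda>x. gmom k * (B\<^sup>2 / real n) ^ k * sqn d x ^ (2 * k))"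
    unfolding EG_def
  proof (rule nn_integral_mono)
    fix x
    let ?c = "pi\<^sup>2 / 4 * sqn d (grad x)"
    have c: "0 \<le> ?c" by simp
    have "(pi / 2 * sqrt (sqn d (grad x)) * t) ^ (2 * k) = ?c ^ k * t ^ (2 * k)" for t
      by (simp add: power_mult power_mult_distrib power_divide)
    then have "?T x
        = (\<integral>\<^sup>+t. ennreal (?c ^ k) * ennreal (t ^ (2 * k)) \<partial>std_gauss)"
      using c by (simp add: ennreal_mult)
    also have "\<dots> = ennreal (?c ^ k) * ennreal (gmom k)"
      by (subst nn_integral_cmult) (auto simp: nn_integral_std_gauss_even)
    also have "\<dots> = ennreal (gmom k * ?c ^ k)"
      using c gmom_pos[of k] by (simp add: ennreal_mult mult.commute)
    also have "\<dots> \<le> ennreal (gmom k * (B\<^sup>2 / real n * (sqn d x)\<^sup>2) ^ k)"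
    proof -
      have "?c \<le> 16 / 4 * (B\<^sup>2 * (sqn d x)\<^sup>2 / (4 * real n))"
        using sqn_grad_le[of x] pi_sq_le by (intro mult_mono) auto
      also have "\<dots> = B\<^sup>2 / real n * (sqn d x)\<^sup>2" by simp
      finally show ?thesis
        using gmom_pos[of k] c by (intro ennreal_leI mult_left_mono power_mono) auto
    qed
    also have "gmom k * (B\<^sup>2 / real n * (sqn d x)\<^sup>2) ^ k = gmom k * (B\<^sup>2 / real n) ^ k * sqn d x ^ (2 * k)"
      by (simp only: power_mult power_mult_distrib mult.assoc)
    finally show "?T x * indicator ?sp x
        \<le> ennreal (gmom k * (B\<^sup>2 / real n) ^ k * sqn d x ^ (2 * k))"
      by (cases "x \<in> ?sp") simp_all
  qed
  also have "EG d (\<lambda>x. gmom k * (B\<^sup>2 / real n) ^ k * sqn d x ^ (2 * k))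
      \<le> ennreal (gmom k * (B\<^sup>2 / real n) ^ k * (2 * fact (2 * k) * 4 ^ (2 * k) * real d ^ (2 * k)))"
  proof (rule EG_cmult_le)
    show "EG d (\<lambda>x. sqn d x ^ (2 * k)) \<le> ennreal (2 * fact (2 * k) * 4 ^ (2 * k) * real d ^ (2 * k))"
      unfolding EG_def using d1 by (intro nn_integral_gauss_sqn_power) auto
  qed (use gmom_pos[of k] in auto)
  also have "gmom k * (B\<^sup>2 / real n) ^ k * (2 * fact (2 * k) * 4 ^ (2 * k) * real d ^ (2 * k)) = cmom k * (B * eps) ^ (2 * k)"
    using eps_sq by (simp add: cmom_def power_mult power_mult_distrib power_divide)
  finally show ?thesis .
qed

text \<open>The weight leaves room for two growth factors, one for the test function and one for
  \<open>S\<close>. It is absorbed by the inequality \<open>8 a b \<le> 16 a ^ 2 + b ^ 2\<close>,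
  after which an exponential moment of the squared norm is integrated and \<open>rho2\<close>
  dominates all multiples of \<open>d\<close>.\<close>

lemma Gaussian_tail: "EG d (\<lambda>x. exp (sqrt (real d) * sqrt (sqn d x)) * indicator (- U) x) \<le> ennreal (exp (- rho2 / 16))"
proof -
  have "EG d (\<lambda>x. exp (sqrt (real d) * sqrt (sqn d x)) * indicator (- U) x)
      \<le> EG d (\<lambda>x. exp (2 * real d - rho2 / 8) * exp (1 / 4 * sqn d x))"
  proof (rule EG_mono)
    fix x assume x: "x \<in> space (leb d)"
    show "exp (sqrt (real d) * sqrt (sqn d x)) * indicator (- U) x \<le> exp (2 * real d - rho2 / 8) * exp (1 / 4 * sqn d x)"
    proof (cases "x \<in> U")
      case False
      then have "rho2 < sqn d x" using x by (simp add: cball_def)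
      moreover have "0 \<le> (4 * sqrt (real d) - sqrt (sqn d x))\<^sup>2" by simp
      then have "8 * (sqrt (real d) * sqrt (sqn d x)) \<le> 16 * real d + sqn d x"
        by (simp add: power2_diff power_mult_distrib)
      ultimately have "sqrt (real d) * sqrt (sqn d x) \<le> 2 * real d - rho2 / 8 + 1 / 4 * sqn d x"
        by simp
      then show ?thesis using False by (simp add: exp_add[symmetric])
    qed simp
  qed
  also have "\<dots> \<le> ennreal (exp (2 * real d - rho2 / 8) * (1 / sqrt (1 - 2 * (1 / 4))) ^ d)"
  proof (rule EG_cmult_le)
    show "EG d (\<lambda>x. exp (1 / 4 * sqn d x)) \<le> ennreal ((1 / sqrt (1 - 2 * (1 / 4))) ^ d)"
      unfolding EG_def by (rule order.refl[THEN order_trans, OF nn_integral_gauss_exp_sqn[THEN eq_refl]]) simp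
  qed auto
  also have "\<dots> \<le> ennreal (exp (- rho2 / 16))"
  proof (rule ennreal_leI)
    have "1 / sqrt (1 - 2 * (1 / 4)) = sqrt 2" by (simp add: real_sqrt_divide)
    also have "\<dots> \<le> exp 1"
      using exp_ge_add_one_self[of 1] sqrt2_less_2 by linarith
    finally have "(1 / sqrt (1 - 2 * (1 / 4))) ^ d \<le> exp 1 ^ d"
      by (intro power_mono) auto
    then have "exp (2 * real d - rho2 / 8) * (1 / sqrt (1 - 2 * (1 / 4))) ^ d \<le> exp (2 * real d - rho2 / 8) * exp (real d)"
      by (intro mult_left_mono) (auto simp: exp_of_nat_mult[symmetric])
    also have "\<dots> \<le> exp (- rho2 / 16)"
      using rho2_ge d1 by (simp add: exp_add[symmetric])
    finally show "exp (2 * real d - rho2 / 8) * (1 / sqrt (1 - 2 * (1 / 4))) ^ d \<le> exp (- rho2 / 16)" .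
  qed
  finally show ?thesis .
qed

lemma prob_U: "1 / 2 \<le> measure (gauss d) U"
proof -
  have [measurable]: "U \<in> sets (gauss d)" by (simp add: sets_gauss)
  have "emeasure (gauss d) (space (gauss d) - U) = (\<integral>\<^sup>+x. indicator (space (gauss d) - U) x \<partial>gauss d)"
    by (rule nn_integral_indicator[symmetric]) measurable
  also have "\<dots> = EG d (indicator (- U))"
    unfolding EG_def by (intro nn_integral_cong) (auto split: split_indicator)
  also have "\<dots> \<le> EG d (\<lambda>x. exp (sqrt (real d) * sqrt (sqn d x)) * indicator (- U) x)"
    by (rule EG_mono) (auto split: split_indicator)
  also have "\<dots> \<le> ennreal (exp (- rho2 / 16))"
    by (rule Gaussian_tail)
  also have "\<dots> \<le> ennreal (1 / 2)"
  proof (rule ennreal_leI)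
    have "exp (- rho2 / 16) \<le> exp (- 1)"
      using rho2_ge d1 by simp
    also have "\<dots> \<le> 1 / 2"
      using exp_ge_add_one_self[of 1] by (simp add: exp_minus field_simps)
    finally show "exp (- rho2 / 16) \<le> 1 / 2" .
  qed
  finally have "measure (gauss d) (space (gauss d) - U) \<le> 1 / 2"
    unfolding gauss.emeasure_eq_measure by (subst (asm) ennreal_le_iff) auto
  then show ?thesis by (subst (asm) gauss.prob_compl) auto
qed

text \<open>A cubic form has in general no exponential moment under the Gaussian, hence the
  restriction to \<open>U\<close>. Rotations of two points of \<open>U\<close> have squared norm at
  most \<open>2 * rho2\<close>, where the squared gradient is of order \<open>B ^ 2 * eps\<close>;
  so \<open>S\<close> behaves there like a Gaussian of small variance. The assumption on
  \<open>l\<close> covers both signs of \<open>4\<close>.\<close>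

lemma exp_S_moment:
  assumes "l\<^sup>2 = 16"
  shows "EG d (\<lambda>x. exp (l * S x) * indicator U x) \<le> ennreal 6"
proof -
  have "(\<integral>\<^sup>+x. ennreal (exp (- l * - S x)) * indicator U x \<partial>gauss d) * emeasure (gauss d) U
    \<le> (\<integral>\<^sup>+x. (\<integral>\<^sup>+t. ennreal (exp (- l * (pi / 2 * sqrt (sqn d (grad x)) * t))) \<partial>std_gauss) * indicator (cball d (2 * rho2)) x \<partial>gauss d)"
  proof (rule concentration)
    have "convex_on UNIV (\<lambda>t. exp (- l * t))"
      by (rule f''_ge0_imp_convex[where f' = "\<lambda>t. - l * exp (- l * t)" and f'' = "\<lambda>t. l\<^sup>2 * exp (- l * t)"])
        (auto intro!: derivative_eq_intros simp: power2_eq_square)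
    then show "convex_on UNIV (\<lambda>t. exp (- l * t))" .
  qed (auto intro!: continuous_intros lincomb_in_cball simp: reflect_in_cball)
  also have "\<dots> \<le> (\<integral>\<^sup>+x. ennreal (exp 1) \<partial>gauss d)"
  proof (rule nn_integral_mono)
    fix x
    show "(\<integral>\<^sup>+t. ennreal (exp (- l * (pi / 2 * sqrt (sqn d (grad x)) * t))) \<partial>std_gauss) * indicator (cball d (2 * rho2)) x \<le> ennreal (exp 1)"
    proof (cases "x \<in> cball d (2 * rho2)")
      case True
      have "(- l * (pi / 2 * sqrt (sqn d (grad x))))\<^sup>2 / 2 = 2 * (pi\<^sup>2 * sqn d (grad x))"
        using assms by (simp add: power_mult_distrib power_divide)
      also have "\<dots> \<le> 2 * (16 * (B\<^sup>2 * (2 * rho2)\<^sup>2 / (4 * real n)))"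
      proof -
        have "sqn d (grad x) \<le> B\<^sup>2 * (sqn d x)\<^sup>2 / (4 * real n)" by (rule sqn_grad_le)
        also have "\<dots> \<le> B\<^sup>2 * (2 * rho2)\<^sup>2 / (4 * real n)"
          using True by (intro divide_right_mono mult_left_mono power_mono) (auto simp: cball_def)
        finally show ?thesis using pi_sq_le by (intro mult_left_mono mult_mono) auto
      qed
      also have "\<dots> = 32 * B\<^sup>2 * eps"
        using dn_pos by (simp add: power_mult_distrib rho2_sq)
      also have "\<dots> \<le> 1" using eps_small(1) eps_pos by (simp add: mult.assoc)
      finally have "exp ((- l * (pi / 2 * sqrt (sqn d (grad x))))\<^sup>2 / 2) \<le> exp 1" by simp
      then show ?thesis
        using True nn_integral_std_gauss_exp[of "- l * (pi / 2 * sqrt (sqn d (grad x)))"]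
        by (simp add: mult.assoc ennreal_leI)
    qed simp
  qed
  also have "\<dots> = ennreal (exp 1)"
    using gauss.emeasure_space_1[of d] by simp
  finally have 1: "EG d (\<lambda>x. exp (l * S x) * indicator U x) * emeasure (gauss d) U \<le> ennreal (exp 1)"
    by (simp add: EG_def ennreal_mult' ennreal_indicator)
  have "EG d (\<lambda>x. exp (l * S x) * indicator U x) * ennreal (1 / 2)
      \<le> EG d (\<lambda>x. exp (l * S x) * indicator U x) * emeasure (gauss d) U"
    unfolding gauss.emeasure_eq_measure by (intro mult_left_mono ennreal_leI prob_U) simp
  also note 1
  \<comment> \<open>The factor \<open>1 / 2\<close> is the lower bound for the mass of
    \<open>U\<close>, and \<open>exp 1 \<le> 3\<close> yields the constant \<open>6\<close>.\<close>
  also have "ennreal (exp 1) \<le> ennreal (6 * (1 / 2))"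
    using exp_le by (intro ennreal_leI) simp
  also have "ennreal (6 * (1 / 2)) = ennreal 6 * ennreal (1 / 2)"
    by (rule ennreal_mult) auto
  finally show ?thesis
    by (subst (asm) mult.commute, subst (asm) (2) mult.commute, subst (asm) ennreal_mult_le_mult_iff) auto
qed

end

lemma abs_add_power_le: "\<bar>a + b\<bar> ^ k \<le> 2 ^ k * (\<bar>a\<bar> ^ k + \<bar>b\<bar> ^ k)" for a b :: real
proof -
  have "\<bar>a + b\<bar> \<le> 2 * max \<bar>a\<bar> \<bar>b\<bar>" by linarith
  then have "\<bar>a + b\<bar> ^ k \<le> (2 * max \<bar>a\<bar> \<bar>b\<bar>) ^ k"
    by (intro power_mono) auto
  also have "\<dots> = 2 ^ k * max \<bar>a\<bar> \<bar>b\<bar> ^ k"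
    by (simp add: power_mult_distrib)
  also have "max \<bar>a\<bar> \<bar>b\<bar> ^ k \<le> \<bar>a\<bar> ^ k + \<bar>b\<bar> ^ k"
    by (simp add: max_def)
  finally show ?thesis by simp
qed

text \<open>With \<open>c\<close> a suitable power of \<open>eps\<close> this weighted inequality
  takes the place of Cauchy-Schwarz for the expectations \<open>EG\<close>.\<close>

lemma two_mult_le_scaled:
  fixes a b c :: real
  assumes "c > 0"
  shows "2 * (a * b) \<le> a\<^sup>2 / c + c * b\<^sup>2"
proof -
  have "0 \<le> (a - c * b)\<^sup>2 / c" using assms by simp
  also have "\<dots> = a\<^sup>2 / c + c * b\<^sup>2 - 2 * (a * b)"
    using assms by (simp add: power2_eq_square field_simps)
  finally show ?thesis by simp
qed

lemma abs_exp_minus_one_le: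
  fixes y :: real
  assumes "\<bar>y\<bar> \<le> 1 / 2"
  shows "\<bar>exp y - 1\<bar> \<le> 2 * \<bar>y\<bar>"
proof (cases "0 \<le> y")
  case True
  have "exp y \<le> 1 / (1 - y)"
    using exp_ge_add_one_self[of "- y"] assms by (simp add: exp_minus field_simps)
  also have "\<dots> \<le> 1 + 2 * y"
  proof -
    have "y * y \<le> y * (1 / 2)"
      using True assms by (intro mult_left_mono) auto
    then show ?thesis
      using assms by (simp add: divide_le_eq algebra_simps)
  qed
  finally show ?thesis using True exp_ge_add_one_self[of y] by linarith
next
  case False
  then show ?thesis using exp_ge_add_one_self[of y] one_le_exp_iff[of y] by linarith
qed

lemma EG_sum_le:
  assumes "finite I" "\<And>i. i \<in> I \<Longrightarrow> F i \<in> borel_measurable (leb d)"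
    and "\<And>i x. i \<in> I \<Longrightarrow> 0 \<le> F i x" "\<And>i. i \<in> I \<Longrightarrow> EG d (F i) \<le> ennreal (a i)" "\<And>i. i \<in> I \<Longrightarrow> 0 \<le> a i"
  shows "EG d (\<lambda>x. \<Sum>i\<in>I. F i x) \<le> ennreal (\<Sum>i\<in>I. a i)"
  using assms
proof (induction I)
  case (insert i I)
  have "EG d (\<lambda>x. F i x + (\<Sum>i\<in>I. F i x)) \<le> ennreal (a i + (\<Sum>i\<in>I. a i))"
    using insert by (intro EG_add_le) (auto intro!: sum_nonneg)
  then show ?case using insert by simp
qed (simp add: EG_def)

section \<open>Mean-square size of the error and of its odd part\<close>

context logistic_coords
begin

definition smom :: "nat \<Rightarrow> real" where
  "smom k = 2 * fact k * 4 ^ k"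

lemma smom_pos: "0 < smom k"
  by (simp add: smom_def)

lemma EG_sqn_power: "EG d (\<lambda>x. sqn d x ^ k) \<le> ennreal (smom k * real d ^ k)"
  unfolding EG_def smom_def using d1 by (intro nn_integral_gauss_sqn_power) auto

lemma EG_q_power: "EG d (\<lambda>x. q x ^ k) \<le> ennreal (B ^ k * smom (2 * k) * eps ^ (2 * k))"
proof (rule EG_le_trans)
  fix x
  show "q x ^ k \<le> (B / real n) ^ k * sqn d x ^ (2 * k)"
    using power_mono[OF q_le q_nonneg] by (simp only: power_mult_distrib power_mult)
next
  have "EG d (\<lambda>x. (B / real n) ^ k * sqn d x ^ (2 * k)) \<le> ennreal ((B / real n) ^ k * (smom (2 * k) * real d ^ (2 * k)))"
    using B1 by (intro EG_cmult_le EG_sqn_power) auto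
  also have "(B / real n) ^ k * (smom (2 * k) * real d ^ (2 * k)) = B ^ k * smom (2 * k) * eps ^ (2 * k)"
    unfolding power_mult eps_sq by (simp add: power_divide power_mult[symmetric])
  finally show "EG d (\<lambda>x. (B / real n) ^ k * sqn d x ^ (2 * k)) \<le> ennreal (B ^ k * smom (2 * k) * eps ^ (2 * k))" .
qed

definition w :: "(nat \<Rightarrow> real) \<Rightarrow> real" where
  "w x = exp (r x) - 1 - S x"

lemma measurable_w [measurable]: "w \<in> borel_measurable (leb d)"
  unfolding w_def[abs_def] by measurable

lemma q_le_1_U: "x \<in> U \<Longrightarrow> q x \<le> 1"
  using q_le_U[of x] eps_small by simp

lemma exp_r_fourth_le:
  assumes "x \<in> U"
  shows "exp (4 * r x) \<le> 2 * exp (4 * S x)" "exp (- 4 * r x) \<le> 2 * exp (- 4 * S x)"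
proof -
  have "\<bar>r x - S x\<bar> \<le> 1 / 24"
    using abs_r_S_le[of x] q_le_1_U[OF assms] by simp
  then have 1: "4 * r x \<le> 1 / 2 + 4 * S x" "- 4 * r x \<le> 1 / 2 + - 4 * S x" by linarith+
  have "exp (1 / 2) \<le> (2 :: real)"
    using abs_exp_minus_one_le[of "1 / 2"] by simp
  then have 2: "exp (1 / 2 + t) \<le> 2 * exp t" for t :: real
    by (simp add: exp_add)
  show "exp (4 * r x) \<le> 2 * exp (4 * S x)"
    using 1(1) 2[of "4 * S x"] order_trans exp_le_cancel_iff by blast
  show "exp (- 4 * r x) \<le> 2 * exp (- 4 * S x)"
    using 1(2) 2[of "- 4 * S x"] order_trans exp_le_cancel_iff by blast
qed

text \<open>Serves both \<open>r\<close> and its odd part: each differs from \<open>S\<close> by at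
  most \<open>q\<close>, which is below \<open>B * eps\<close> on \<open>U\<close>.\<close>

lemma S_power_bound:
  assumes "x \<in> U" "\<bar>y\<bar> \<le> \<bar>S x\<bar> + q x"
  shows "\<bar>y\<bar> ^ (2 * k) \<le> 2 ^ (2 * k) * (S x ^ (2 * k) + (B * eps) ^ (2 * k))"
proof -
  have "\<bar>y\<bar> ^ (2 * k) \<le> \<bar>\<bar>S x\<bar> + q x\<bar> ^ (2 * k)"
    using assms(2) by (intro power_mono) auto
  also have "\<dots> \<le> 2 ^ (2 * k) * (\<bar>\<bar>S x\<bar>\<bar> ^ (2 * k) + \<bar>q x\<bar> ^ (2 * k))"
    by (rule abs_add_power_le)
  also have "\<dots> \<le> 2 ^ (2 * k) * (S x ^ (2 * k) + (B * eps) ^ (2 * k))"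
  proof -
    have "\<bar>q x\<bar> ^ (2 * k) \<le> (B * eps) ^ (2 * k)"
      using q_le_U[OF assms(1)] q_nonneg[of x] by (intro power_mono) auto
    then show ?thesis by (simp add: power_even_abs)
  qed
  finally show ?thesis .
qed

definition cw :: real where
  "cw = 64 * (cmom 4 + 1) * B ^ 8 + 96 + 2 * B\<^sup>2 * smom 4"

lemma EG_exp_S: "EG d (\<lambda>x. exp (4 * S x) * indicator U x + exp (- 4 * S x) * indicator U x) \<le> ennreal (6 + 6)"
  by (intro EG_add_le exp_S_moment) (auto intro!: borel_measurable_times)

lemma EG_const: "0 \<le> c \<Longrightarrow> EG d (\<lambda>x. c) \<le> ennreal c"
  using gauss.emeasure_space_1[of d] by (simp add: EG_def)

lemma EG_S_power_add: "EG d (\<lambda>x. S x ^ (2 * k) + (B * eps) ^ (2 * k)) \<le> ennreal ((cmom k + 1) * (B * eps) ^ (2 * k))"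
proof -
  have "EG d (\<lambda>x. S x ^ (2 * k) + (B * eps) ^ (2 * k)) \<le> ennreal (cmom k * (B * eps) ^ (2 * k) + (B * eps) ^ (2 * k))"
    using cmom_pos[of k] by (intro EG_add_le EG_S_power EG_const) (auto simp: zero_le_even_power less_imp_le)
  then show ?thesis by (simp add: algebra_simps)
qed

lemma exp_pm_r_le:
  assumes "x \<in> U"
  shows "(exp (r x) + exp (- r x)) ^ 4 \<le> 32 * (exp (4 * S x) + exp (- 4 * S x))"
proof -
  have p: "exp t ^ 4 = exp (4 * t)" for t :: real
    using exp_of_nat_mult[of 4 t] by simp
  have "(exp (r x) + exp (- r x)) ^ 4 \<le> 2 ^ 4 * (\<bar>exp (r x)\<bar> ^ 4 + \<bar>exp (- r x)\<bar> ^ 4)"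
    using abs_add_power_le[of "exp (r x)" "exp (- r x)" 4] by simp
  also have "\<dots> = 16 * (exp (4 * r x) + exp (- 4 * r x))"
    by (simp add: p)
  also have "\<dots> \<le> 16 * (2 * exp (4 * S x) + 2 * exp (- 4 * S x))"
    using exp_r_fourth_le[OF assms] by simp
  finally show ?thesis by simp
qed

text \<open>The error is \<open>exp r - 1 - r\<close>, at most \<open>r ^ 2 * e / 2\<close> with
  \<open>e = exp r + exp (- r)\<close>, plus \<open>r - S\<close>, at most \<open>q\<close>. In the
  square, \<open>r ^ 4 * e ^ 2\<close> is split with weight \<open>eps ^ 4\<close> into
  \<open>r ^ 8 / eps ^ 4\<close> and \<open>eps ^ 4 * e ^ 4\<close>: the first factor has an eighth
  moment of order \<open>eps ^ 8\<close>, the second a bounded fourth moment on \<open>U\<close>.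
  The functions \<open>?F1\<close>, \<open>?F2\<close>, \<open>?F3\<close> are the three
  contributions.\<close>

lemma EG_w_sq: "EG d (\<lambda>x. (w x)\<^sup>2 * indicator U x) \<le> ennreal (cw * eps ^ 4)"
proof -
  let ?F1 = "\<lambda>x. 64 / eps ^ 4 * (S x ^ (2 * 4) + (B * eps) ^ (2 * 4))"
  let ?F2 = "\<lambda>x. 8 * eps ^ 4 * (exp (4 * S x) * indicator U x + exp (- 4 * S x) * indicator U x)"
  let ?F3 = "\<lambda>x. 2 * q x ^ 2"
  have "EG d (\<lambda>x. (w x)\<^sup>2 * indicator U x) \<le> EG d (\<lambda>x. ?F1 x + (?F2 x + ?F3 x))"
  proof (rule EG_mono)
    fix x
    show "(w x)\<^sup>2 * indicator U x \<le> ?F1 x + (?F2 x + ?F3 x)"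
    proof (cases "x \<in> U")
      case False
      then show ?thesis using eps_pos B1 by simp
    next
      case True
      define e where "e = exp (r x) + exp (- r x)"
      have rS: "\<bar>r x - S x\<bar> \<le> q x"
        using abs_r_S_le[of x] q_nonneg[of x] by simp
      then have "\<bar>r x\<bar> ^ (2 * 4) \<le> 2 ^ (2 * 4) * (S x ^ (2 * 4) + (B * eps) ^ (2 * 4))"
        by (intro S_power_bound[OF True]) linarith
      then have r8: "r x ^ 8 \<le> 256 * (S x ^ 8 + (B * eps) ^ 8)"
        by (simp add: power_even_abs)
      have "\<bar>w x\<bar> \<le> \<bar>exp (r x) - 1 - r x\<bar> + \<bar>r x - S x\<bar>"
        unfolding w_def by linarith
      also have "\<dots> \<le> (r x)\<^sup>2 * e / 2 + q x"
        using abs_exp_2_le[of "r x"] rS by (simp add: e_def)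
      finally have "\<bar>w x\<bar>\<^sup>2 \<le> ((r x)\<^sup>2 * e / 2 + q x)\<^sup>2"
        by (intro power_mono) auto
      also have "\<dots> \<le> 2 * ((r x)\<^sup>2 * e / 2)\<^sup>2 + 2 * (q x)\<^sup>2"
        using zero_le_power2[of "(r x)\<^sup>2 * e / 2 - q x"] by (simp add: power2_sum power2_diff)
      also have "2 * ((r x)\<^sup>2 * e / 2)\<^sup>2 = (1 / 4) * (2 * ((r x) ^ 4 * e\<^sup>2))"
        by (simp add: power_mult_distrib power_divide)
      also have "2 * ((r x) ^ 4 * e\<^sup>2) \<le> ((r x) ^ 4)\<^sup>2 / eps ^ 4 + eps ^ 4 * (e\<^sup>2)\<^sup>2"
        using eps_pos by (intro two_mult_le_scaled) auto
      also have "\<dots> = (r x) ^ 8 / eps ^ 4 + eps ^ 4 * e ^ 4"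
        by (simp add: power_mult[symmetric])
      finally have "(w x)\<^sup>2 \<le> (1 / 4) * ((r x) ^ 8 / eps ^ 4 + eps ^ 4 * e ^ 4) + 2 * (q x)\<^sup>2"
        by simp
      also have "\<dots> \<le> (1 / 4) * (256 * (S x ^ 8 + (B * eps) ^ 8) / eps ^ 4
          + eps ^ 4 * (32 * (exp (4 * S x) + exp (- 4 * S x)))) + 2 * (q x)\<^sup>2"
        using r8 exp_pm_r_le[OF True] eps_pos by (intro add_mono mult_left_mono divide_right_mono) (auto simp: e_def)
      also have "\<dots> = ?F1 x + (?F2 x + ?F3 x)"
        using True by (simp add: algebra_simps add_divide_distrib)
      finally show ?thesis using True by simp
    qed
  qed
  also have "\<dots> \<le> ennreal (64 / eps ^ 4 * ((cmom 4 + 1) * (B * eps) ^ (2 * 4))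
      + (8 * eps ^ 4 * (6 + 6) + 2 * (B ^ 2 * smom (2 * 2) * eps ^ (2 * 2))))"
    using eps_pos cmom_pos[of 4] smom_pos[of "2 * 2"] B1
    by (intro EG_add_le EG_cmult_le EG_S_power_add EG_exp_S EG_q_power)
      (auto intro!: borel_measurable_times borel_measurable_add add_nonneg_nonneg mult_nonneg_nonneg)
  also have "64 / eps ^ 4 * ((cmom 4 + 1) * (B * eps) ^ (2 * 4))
      + (8 * eps ^ 4 * (6 + 6) + 2 * (B ^ 2 * smom (2 * 2) * eps ^ (2 * 2))) = cw * eps ^ 4"
    using eps_pos by (simp add: cw_def power_mult_distrib field_simps eval_nat_numeral)
  finally show ?thesis .
qed

text \<open>The square of the fifth-power sum that bounds the odd part of \<open>r - S\<close>; its
  mean is of order \<open>eps ^ 6\<close>.\<close>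

definition p6 :: "(nat \<Rightarrow> real) \<Rightarrow> real" where
  "p6 x = (\<Sum>i<n. \<bar>lin i x\<bar> ^ 5)\<^sup>2"

definition cp :: real where
  "cp = B\<^sup>2 * (smom 4 + gmom 6)"

text \<open>Splitting the fifth power as \<open>2 + 3\<close> leaves a factor \<open>q\<close>,
  bounded for every \<open>x\<close>, and a sum of sixth powers that can be integrated term by
  term.\<close>

lemma p6_le: "p6 x \<le> (B / real n) * (\<Sum>i<n. (sqn d x)\<^sup>2 * lin i x ^ 6)"
proof -
  have "\<bar>t\<bar> ^ 5 = t\<^sup>2 * \<bar>t\<bar> ^ 3" for t :: real
    using power_add[of "\<bar>t\<bar>" 2 3] by simp
  then have "p6 x = (\<Sum>i<n. (lin i x)\<^sup>2 * \<bar>lin i x\<bar> ^ 3)\<^sup>2"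
    by (simp only: p6_def)
  also have "\<dots> \<le> (\<Sum>i<n. ((lin i x)\<^sup>2)\<^sup>2) * (\<Sum>i<n. (\<bar>lin i x\<bar> ^ 3)\<^sup>2)"
    by (rule Cauchy_Schwarz_ineq_sum)
  also have "\<dots> = q x * (\<Sum>i<n. lin i x ^ 6)"
    by (simp add: q_def power_mult[symmetric] power_even_abs)
  also have "\<dots> \<le> (B / real n * (sqn d x)\<^sup>2) * (\<Sum>i<n. lin i x ^ 6)"
    by (intro mult_right_mono q_le sum_nonneg) auto
  finally show ?thesis by (simp add: sum_distrib_left mult.assoc)
qed

lemma EG_sqn_lin: "EG d (\<lambda>x. (sqn d x)\<^sup>2 * lin i x ^ 6) \<le> ennreal ((smom 4 + gmom 6) * (real d)\<^sup>2 * sqn d (z i) ^ 3)"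
proof (cases "sqn d (z i) = 0")
  case True
  then have "lin i x = 0" for x
    using dot_Cauchy_Schwarz[of d "z i" x] by (simp add: lin_def)
  then show ?thesis by (simp add: EG_def)
next
  case False
  then have z: "0 < sqn d (z i)" using sqn_nonneg[of d "z i"] by linarith
  \<comment> \<open>Chosen so that both terms of the weighted inequality have the same order
    \<open>d ^ 2 * sqn d (z i) ^ 3\<close>.\<close>
  define c where "c = sqn d (z i) ^ 3 / (real d)\<^sup>2"
  have c: "0 < c" using z dn_pos by (simp add: c_def)
  have "EG d (\<lambda>x. (sqn d x)\<^sup>2 * lin i x ^ 6) \<le> EG d (\<lambda>x. c * sqn d x ^ 4 + (1 / c) * lin i x ^ (2 * 6))"
  proof (rule EG_mono)
    fix x
    have "2 * (lin i x ^ 6 * (sqn d x)\<^sup>2) \<le> (lin i x ^ 6)\<^sup>2 / c + c * ((sqn d x)\<^sup>2)\<^sup>2"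
      by (rule two_mult_le_scaled[OF c])
    moreover have "0 \<le> lin i x ^ 6 * (sqn d x)\<^sup>2"
      by (simp add: zero_le_even_power)
    ultimately have "lin i x ^ 6 * (sqn d x)\<^sup>2 \<le> (lin i x ^ 6)\<^sup>2 / c + c * ((sqn d x)\<^sup>2)\<^sup>2"
      by linarith
    then show "(sqn d x)\<^sup>2 * lin i x ^ 6 \<le> c * sqn d x ^ 4 + (1 / c) * lin i x ^ (2 * 6)"
      by (simp add: power_mult[symmetric] mult.commute add.commute)
  qed
  also have "\<dots> \<le> ennreal (c * (smom 4 * real d ^ 4) + (1 / c) * (gmom 6 * sqn d (z i) ^ 6))"
  proof (intro EG_add_le EG_cmult_le EG_sqn_power)
    show "EG d (\<lambda>x. lin i x ^ (2 * 6)) \<le> ennreal (gmom 6 * sqn d (z i) ^ 6)"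
      unfolding EG_def lin_def by (subst nn_integral_gauss_dot_even) simp
  qed (use c smom_pos[of 4] gmom_pos[of 6] in \<open>auto intro!: mult_nonneg_nonneg\<close>)
  also have "c * (smom 4 * real d ^ 4) + (1 / c) * (gmom 6 * sqn d (z i) ^ 6) = (smom 4 + gmom 6) * (real d)\<^sup>2 * sqn d (z i) ^ 3"
    using z dn_pos by (simp add: c_def field_simps eval_nat_numeral)
  finally show ?thesis .
qed

text \<open>This is where \<open>sixth\<close> enters. The result is \<open>d ^ 5 / n ^ 3\<close>,
  which \<open>d \<ge> 1\<close> turns into \<open>eps ^ 6\<close>.\<close>

lemma EG_p6: "EG d p6 \<le> ennreal (cp * eps ^ 6)"
proof (rule EG_le_trans[OF p6_le])
  have c: "0 \<le> smom 4 + gmom 6" using smom_pos[of 4] gmom_pos[of 6] by simp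
  have "EG d (\<lambda>x. (B / real n) * (\<Sum>i<n. (sqn d x)\<^sup>2 * lin i x ^ 6))
      \<le> ennreal ((B / real n) * (\<Sum>i<n. (smom 4 + gmom 6) * (real d)\<^sup>2 * sqn d (z i) ^ 3))"
    using B1 c by (intro EG_cmult_le EG_sum_le EG_sqn_lin) (auto simp: zero_le_even_power)
  also have "\<dots> \<le> ennreal (cp * eps ^ 6)"
  proof (rule ennreal_leI)
    have "(B / real n) * (\<Sum>i<n. (smom 4 + gmom 6) * (real d)\<^sup>2 * sqn d (z i) ^ 3)
        = (B / real n) * ((smom 4 + gmom 6) * (real d)\<^sup>2) * (\<Sum>i<n. sqn d (z i) ^ 3)"
      by (simp only: sum_distrib_left mult.assoc)
    also have "\<dots> \<le> (B / real n) * ((smom 4 + gmom 6) * (real d)\<^sup>2) * (B * real d ^ 3 / (real n)\<^sup>2)"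
      using B1 c by (intro mult_left_mono sixth) auto
    also have "\<dots> = cp * (real d ^ 5 / real n ^ 3)"
      by (simp add: cp_def eval_nat_numeral)
    also have "\<dots> \<le> cp * (real d ^ 6 / real n ^ 3)"
      using c d1 by (intro mult_left_mono divide_right_mono power_increasing) (auto simp: cp_def)
    also have "real d ^ 6 / real n ^ 3 = eps ^ 6"
      using arg_cong[OF eps_sq, of "\<lambda>t. t ^ 3"] by (simp add: power_divide power_mult[symmetric])
    finally show "(B / real n) * (\<Sum>i<n. (smom 4 + gmom 6) * (real d)\<^sup>2 * sqn d (z i) ^ 3) \<le> cp * eps ^ 6" .
  qed
  finally show "EG d (\<lambda>x. (B / real n) * (\<Sum>i<n. (sqn d x)\<^sup>2 * lin i x ^ 6)) \<le> ennreal (cp * eps ^ 6)" .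
qed

definition wo :: "(nat \<Rightarrow> real) \<Rightarrow> real" where
  "wo x = (w x - w (refl x)) / 2"

lemma abs_r_odd_le: "\<bar>(r x - r (refl x)) / 2 - S x\<bar> \<le> (\<Sum>i<n. \<bar>lin i x\<bar> ^ 5) / 120"
proof -
  have "\<bar>(r x - r (refl x)) / 2 - S x\<bar>
      = \<bar>\<Sum>i<n. (srem (th i) (lin i x) - srem (th i) (- lin i x)) / 2 - dsig 3 (th i) * lin i x ^ 3 / 6\<bar>"
    unfolding r_def S_def lin_refl
    by (subst abs_minus_commute) (simp add: sum_subtractf sum_divide_distrib diff_divide_distrib)
  also have "\<dots> \<le> (\<Sum>i<n. \<bar>lin i x\<bar> ^ 5 / 120)"
    by (rule order_trans[OF sum_abs]) (intro sum_mono abs_srem_odd_le)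
  finally show ?thesis by (simp add: sum_divide_distrib)
qed

text \<open>With \<open>a\<close> and \<open>b\<close> the odd and even parts of \<open>r\<close>,
  the odd part of \<open>exp r\<close> is \<open>exp b * sinh a\<close>. Subtracting
  \<open>S\<close> leaves \<open>exp b * (sinh a - a)\<close>, \<open>a * (exp b - 1)\<close> and
  \<open>a - S x\<close>, each of third order because \<open>b\<close> is of the order of
  \<open>q\<close> and the quartic terms have left \<open>a\<close>.\<close>

lemma abs_wo_le:
  assumes "x \<in> U"
  shows "\<bar>wo x\<bar> \<le> \<bar>(r x - r (refl x)) / 2\<bar> ^ 3 * (exp (r x) + exp (r (refl x))) / 6
    + \<bar>(r x - r (refl x)) / 2\<bar> * q x + (\<Sum>i<n. \<bar>lin i x\<bar> ^ 5) / 120"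
proof -
  define a where "a = (r x - r (refl x)) / 2"
  define b where "b = (r x + r (refl x)) / 2"
  have rab: "r x = b + a" "r (refl x) = b - a"
    by (simp_all add: a_def b_def field_simps)
  have qr: "q (refl x) = q x" by simp
  have "\<bar>r x - S x\<bar> \<le> q x / 24" "\<bar>r (refl x) + S x\<bar> \<le> q x / 24"
    using abs_r_S_le[of x] abs_r_S_le[of "refl x"] by simp_all
  then have "\<bar>r x + r (refl x)\<bar> \<le> q x / 12" by linarith
  then have bq: "\<bar>b\<bar> \<le> q x / 24"
    by (simp add: b_def)
  have b2: "\<bar>exp b - 1\<bar> \<le> q x"
    using abs_exp_minus_one_le[of b] bq q_le_1_U[OF assms] q_nonneg[of x] by linarith
  have "wo x = exp b * ((exp a - exp (- a)) / 2 - a) + a * (exp b - 1) + (a - S x)"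
    unfolding wo_def w_def rab by (simp add: exp_add exp_diff exp_minus field_simps)
  then have "\<bar>wo x\<bar> \<le> \<bar>exp b * ((exp a - exp (- a)) / 2 - a)\<bar> + \<bar>a * (exp b - 1)\<bar> + \<bar>a - S x\<bar>"
    by linarith
  also have "\<dots> \<le> exp b * (\<bar>a\<bar> ^ 3 * (exp a + exp (- a)) / 6) + \<bar>a\<bar> * q x + (\<Sum>i<n. \<bar>lin i x\<bar> ^ 5) / 120"
    using abs_sinh_3_le[of a] b2 abs_r_odd_le[of x]
    by (intro add_mono) (auto simp: abs_mult a_def[symmetric] intro!: mult_left_mono)
  also have "exp b * (\<bar>a\<bar> ^ 3 * (exp a + exp (- a)) / 6) = \<bar>a\<bar> ^ 3 * (exp (r x) + exp (r (refl x))) / 6"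
    unfolding rab by (simp add: exp_add exp_diff exp_minus field_simps)
  finally show ?thesis unfolding a_def .
qed

definition cwo :: real where
  "cwo = 512 / 3 * (cmom 6 + 1) * B ^ 12 + 16 + 3 / 2 * B ^ 4 * smom 8 + 24 * (cmom 2 + 1) * B ^ 4 + cp"

lemma measurable_wo [measurable]: "wo \<in> borel_measurable (leb d)"
proof -
  have [measurable]: "(\<lambda>x. w (refl x)) \<in> borel_measurable (leb d)"
    by (rule measurable_compose[OF _ measurable_w]) measurable
  show ?thesis unfolding wo_def[abs_def] by measurable
qed

lemma measurable_p6 [measurable]: "p6 \<in> borel_measurable (leb d)"
  unfolding p6_def[abs_def] by measurable

text \<open>The square of each of the three terms has to be of order \<open>eps ^ 6\<close>. The
  weights \<open>eps ^ 6\<close> and \<open>eps ^ 2\<close> separate \<open>a ^ 3\<close> from the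
  exponentials and \<open>q\<close> from \<open>a\<close>; the fifth-power term is
  \<open>p6\<close>.\<close>

lemma EG_wo_sq: "EG d (\<lambda>x. (wo x)\<^sup>2 * indicator U x) \<le> ennreal (cwo * eps ^ 6)"
proof -
  let ?F1 = "\<lambda>x. 512 / 3 / eps ^ 6 * (S x ^ (2 * 6) + (B * eps) ^ (2 * 6))"
  let ?F2 = "\<lambda>x. 4 / 3 * eps ^ 6 * (exp (4 * S x) * indicator U x + exp (- 4 * S x) * indicator U x)"
  let ?F3 = "\<lambda>x. 3 / (2 * eps\<^sup>2) * q x ^ 4"
  let ?F4 = "\<lambda>x. 24 * eps\<^sup>2 * (S x ^ (2 * 2) + (B * eps) ^ (2 * 2))"
  have "EG d (\<lambda>x. (wo x)\<^sup>2 * indicator U x) \<le> EG d (\<lambda>x. ?F1 x + (?F2 x + (?F3 x + (?F4 x + p6 x))))"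
  proof (rule EG_mono)
    fix x assume x: "x \<in> space (leb d)"
    show "(wo x)\<^sup>2 * indicator U x \<le> ?F1 x + (?F2 x + (?F3 x + (?F4 x + p6 x)))"
    proof (cases "x \<in> U")
      case False
      have "0 \<le> p6 x" by (simp add: p6_def)
      then show ?thesis using False eps_pos B1 by (auto intro!: add_nonneg_nonneg mult_nonneg_nonneg)
    next
      case True
      have RU: "refl x \<in> U" using reflect_in_cball[OF x] True by simp
      define a where "a = (r x - r (refl x)) / 2"
      define e where "e = exp (r x) + exp (r (refl x))"
      define p where "p = (\<Sum>i<n. \<bar>lin i x\<bar> ^ 5) / 120"
      have "\<bar>r x - S x\<bar> \<le> q x / 24" "\<bar>r (refl x) + S x\<bar> \<le> q x / 24"
        using abs_r_S_le[of x] abs_r_S_le[of "refl x"] by simp_all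
      then have "\<bar>r x - r (refl x)\<bar> \<le> 2 * (\<bar>S x\<bar> + q x)"
        using q_nonneg[of x] by argo
      then have aS: "\<bar>a\<bar> \<le> \<bar>S x\<bar> + q x"
        by (simp add: a_def)
      have a12: "a ^ 12 \<le> 4096 * (S x ^ 12 + (B * eps) ^ 12)"
        using S_power_bound[OF True aS, of 6] by (simp add: power_even_abs)
      have a4: "a ^ 4 \<le> 16 * (S x ^ 4 + (B * eps) ^ 4)"
        using S_power_bound[OF True aS, of 2] by (simp add: power_even_abs)
      have p: "exp t ^ 4 = exp (4 * t)" for t :: real
        using exp_of_nat_mult[of 4 t] by simp
      have "e ^ 4 \<le> 2 ^ 4 * (\<bar>exp (r x)\<bar> ^ 4 + \<bar>exp (r (refl x))\<bar> ^ 4)"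
        using abs_add_power_le[of "exp (r x)" "exp (r (refl x))" 4] by (simp add: e_def)
      also have "\<dots> = 16 * (exp (4 * r x) + exp (4 * r (refl x)))"
        by (simp add: p)
      also have "\<dots> \<le> 16 * (2 * exp (4 * S x) + 2 * exp (- 4 * S x))"
        using exp_r_fourth_le(1)[OF True] exp_r_fourth_le(1)[OF RU] by simp
      finally have e4: "e ^ 4 \<le> 32 * (exp (4 * S x) + exp (- 4 * S x))" by simp
      have "(wo x)\<^sup>2 \<le> (\<bar>a\<bar> ^ 3 * e / 6 + \<bar>a\<bar> * q x + p)\<^sup>2"
        using power_mono[OF abs_wo_le[OF True], of 2] by (simp add: a_def e_def p_def)
      also have "\<dots> \<le> 3 * ((\<bar>a\<bar> ^ 3 * e / 6)\<^sup>2 + (\<bar>a\<bar> * q x)\<^sup>2 + p\<^sup>2)"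
        using zero_le_power2[of "\<bar>a\<bar> ^ 3 * e / 6 - \<bar>a\<bar> * q x"] zero_le_power2[of "\<bar>a\<bar> ^ 3 * e / 6 - p"]
          zero_le_power2[of "\<bar>a\<bar> * q x - p"]
        by (simp add: power2_eq_square algebra_simps)
      also have "\<dots> = 1 / 24 * (2 * (a ^ 6 * e\<^sup>2)) + 3 / 2 * (2 * ((q x)\<^sup>2 * a\<^sup>2)) + 3 * p\<^sup>2"
        by (simp add: power_mult_distrib power_divide power_mult[symmetric] power_even_abs)
      also have "\<dots> \<le> 1 / 24 * ((a ^ 6)\<^sup>2 / eps ^ 6 + eps ^ 6 * (e\<^sup>2)\<^sup>2)
          + 3 / 2 * (((q x)\<^sup>2)\<^sup>2 / eps\<^sup>2 + eps\<^sup>2 * (a\<^sup>2)\<^sup>2) + 3 * p\<^sup>2"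
        using eps_pos by (intro add_mono mult_left_mono two_mult_le_scaled) auto
      also have "\<dots> = 1 / 24 * (a ^ 12 / eps ^ 6 + eps ^ 6 * e ^ 4)
          + 3 / 2 * (q x ^ 4 / eps\<^sup>2 + eps\<^sup>2 * a ^ 4) + 3 * p\<^sup>2"
        by (simp add: power_mult[symmetric])
      also have "\<dots> \<le> 1 / 24 * (4096 * (S x ^ 12 + (B * eps) ^ 12) / eps ^ 6 + eps ^ 6 * (32 * (exp (4 * S x) + exp (- 4 * S x))))
          + 3 / 2 * (q x ^ 4 / eps\<^sup>2 + eps\<^sup>2 * (16 * (S x ^ 4 + (B * eps) ^ 4))) + p6 x"
      proof -
        have "3 * p\<^sup>2 \<le> p6 x"
          by (simp add: p_def p6_def power_divide)
        then show ?thesis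
          using a12 a4 e4 eps_pos by (intro add_mono mult_left_mono divide_right_mono) auto
      qed
      also have "\<dots> = ?F1 x + (?F2 x + (?F3 x + (?F4 x + p6 x)))"
        using True eps_pos by (simp add: field_simps)
      finally show ?thesis using True by simp
    qed
  qed
  also have "\<dots> \<le> ennreal (512 / 3 / eps ^ 6 * ((cmom 6 + 1) * (B * eps) ^ (2 * 6))
      + (4 / 3 * eps ^ 6 * (6 + 6) + (3 / (2 * eps\<^sup>2) * (B ^ 4 * smom (2 * 4) * eps ^ (2 * 4))
      + (24 * eps\<^sup>2 * ((cmom 2 + 1) * (B * eps) ^ (2 * 2)) + cp * eps ^ 6))))"
    using eps_pos cmom_pos[of 6] cmom_pos[of 2] smom_pos[of "2 * 4"] smom_pos[of 4] gmom_pos[of 6] B1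
    by (intro EG_add_le EG_cmult_le EG_S_power_add EG_exp_S EG_q_power EG_p6)
      (auto intro!: borel_measurable_times borel_measurable_add add_nonneg_nonneg mult_nonneg_nonneg simp: cp_def p6_def)
  also have "512 / 3 / eps ^ 6 * ((cmom 6 + 1) * (B * eps) ^ (2 * 6))
      + (4 / 3 * eps ^ 6 * (6 + 6) + (3 / (2 * eps\<^sup>2) * (B ^ 4 * smom (2 * 4) * eps ^ (2 * 4))
      + (24 * eps\<^sup>2 * ((cmom 2 + 1) * (B * eps) ^ (2 * 2)) + cp * eps ^ 6))) = cwo * eps ^ 6"
    using eps_pos by (simp add: cwo_def power_mult_distrib field_simps eval_nat_numeral)
  finally show ?thesis .
qed

end

text \<open>At rate four the integral is \<open>1 / 2\<close>, in particular at most one, so the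
  product over the coordinates stays bounded by one in every dimension.\<close>

lemma nn_integral_exp_abs: "(\<integral>\<^sup>+t. ennreal (exp (- 4 * \<bar>t\<bar>)) \<partial>lborel) \<le> 1"
proof -
  have 1: "(\<integral>\<^sup>+t. ennreal (exp (- 4 * t)) * indicator {0..} t \<partial>lborel) = ennreal (0 - (- exp (- 4 * 0) / 4))"
    by (rule nn_integral_FTC_atLeast) (auto intro!: derivative_eq_intros, real_asymp)
  have "(\<integral>\<^sup>+t. ennreal (exp (- 4 * t)) * indicator {0..} t \<partial>lborel)
      = ennreal \<bar>- 1\<bar> * (\<integral>\<^sup>+t. ennreal (exp (- 4 * (0 + - 1 * t))) * indicator {0..} (0 + - 1 * t) \<partial>lborel)"
    by (rule nn_integral_real_affine) auto
  then have 2: "(\<integral>\<^sup>+t. ennreal (exp (4 * t)) * indicator {0..} (- t) \<partial>lborel) = ennreal (0 - (- exp (- 4 * 0) / 4))"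
    using 1 by simp
  have "(\<integral>\<^sup>+t. ennreal (exp (- 4 * \<bar>t\<bar>)) \<partial>lborel)
      \<le> (\<integral>\<^sup>+t. ennreal (exp (- 4 * t)) * indicator {0..} t + ennreal (exp (4 * t)) * indicator {0..} (- t) \<partial>lborel)"
    by (rule nn_integral_mono) (auto split: split_indicator)
  also have "\<dots> = ennreal (0 - (- exp (- 4 * 0) / 4)) + ennreal (0 - (- exp (- 4 * 0) / 4))"
    by (subst nn_integral_add) (auto simp only: 1 2, measurable)
  also have "\<dots> = ennreal (1 / 2)"
    by (subst ennreal_plus[symmetric]) auto
  also have "\<dots> \<le> 1"
    unfolding ennreal_1[symmetric] by (rule ennreal_leI) simp
  finally show ?thesis .
qed

lemma sum_abs_le_sqrt_sqn: "(\<Sum>j<d. \<bar>x j\<bar>) \<le> sqrt (real d) * sqrt (sqn d x)"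
proof (rule power2_le_imp_le)
  have "(\<Sum>j<d. 1 * \<bar>x j\<bar>)\<^sup>2 \<le> (\<Sum>j<d. 1\<^sup>2) * (\<Sum>j<d. \<bar>x j\<bar>\<^sup>2)"
    by (rule Cauchy_Schwarz_ineq_sum)
  then show "(\<Sum>j<d. \<bar>x j\<bar>)\<^sup>2 \<le> (sqrt (real d) * sqrt (sqn d x))\<^sup>2"
    by (simp add: power_mult_distrib sqn_def[symmetric])
qed simp

lemma EG_integrable:
  assumes f: "f \<in> borel_measurable (leb d)" and "EG d (\<lambda>x. \<bar>f x\<bar>) \<le> ennreal c" "0 \<le> c"
  shows "integrable (gauss d) f" "\<bar>\<integral>x. f x \<partial>gauss d\<bar> \<le> c"
proof -
  have [measurable]: "f \<in> borel_measurable (gauss d)" by (rule measurable_gauss_leb[OF f])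
  show int: "integrable (gauss d) f"
    using assms by (intro integrableI_bounded) (auto simp: EG_def intro: le_less_trans)
  have "ennreal \<bar>\<integral>x. f x \<partial>gauss d\<bar> \<le> ennreal (\<integral>x. \<bar>f x\<bar> \<partial>gauss d)"
    by (intro ennreal_leI integral_abs_bound)
  also have "\<dots> = EG d (\<lambda>x. \<bar>f x\<bar>)"
    unfolding EG_def using int by (intro nn_integral_eq_integral[symmetric]) auto
  finally show "\<bar>\<integral>x. f x \<partial>gauss d\<bar> \<le> c"
    using assms(2,3) by (meson ennreal_le_iff order_trans)
qed

lemma distr_gauss_reflect: "distr (gauss d) (gauss d) (\<lambda>x. \<lambda>i\<in>{..<d}. - x i) = gauss d"
proof (rule measure_eqI)
  have m: "(\<lambda>x. \<lambda>i\<in>{..<d}. - x i) \<in> gauss d \<rightarrow>\<^sub>M gauss d"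
    unfolding gauss_def by measurable
  fix A assume "A \<in> sets (distr (gauss d) (gauss d) (\<lambda>x. \<lambda>i\<in>{..<d}. - x i))"
  then have A: "A \<in> sets (gauss d)" "A \<in> sets (leb d)" by (auto simp: sets_gauss)
  have "emeasure (distr (gauss d) (gauss d) (\<lambda>x. \<lambda>i\<in>{..<d}. - x i)) A
      = (\<integral>\<^sup>+x. indicator A x \<partial>distr (gauss d) (gauss d) (\<lambda>x. \<lambda>i\<in>{..<d}. - x i))"
    using A by simp
  also have "\<dots> = (\<integral>\<^sup>+x. indicator A (\<lambda>i\<in>{..<d}. - x i) \<partial>gauss d)"
    using m A by (intro nn_integral_distr) auto
  also have "\<dots> = (\<integral>\<^sup>+x. indicator A x \<partial>gauss d)"
    using A by (intro nn_integral_gauss_reflect) auto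
  finally show "emeasure (distr (gauss d) (gauss d) (\<lambda>x. \<lambda>i\<in>{..<d}. - x i)) A = emeasure (gauss d) A"
    using A by simp
qed simp

lemma integral_gauss_reflect:
  fixes f :: "(nat \<Rightarrow> real) \<Rightarrow> real"
  assumes "f \<in> borel_measurable (leb d)"
  shows "(\<integral>x. f (\<lambda>i\<in>{..<d}. - x i) \<partial>gauss d) = (\<integral>x. f x \<partial>gauss d)"
proof -
  have m: "(\<lambda>x. \<lambda>i\<in>{..<d}. - x i) \<in> gauss d \<rightarrow>\<^sub>M gauss d"
    unfolding gauss_def by measurable
  have "(\<integral>x. f x \<partial>distr (gauss d) (gauss d) (\<lambda>x. \<lambda>i\<in>{..<d}. - x i)) = (\<integral>x. f (\<lambda>i\<in>{..<d}. - x i) \<partial>gauss d)"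
    using m measurable_gauss_leb[OF assms] by (intro integral_distr)
  then show ?thesis by (simp add: distr_gauss_reflect)
qed

lemma integral_gauss_odd:
  fixes f :: "(nat \<Rightarrow> real) \<Rightarrow> real"
  assumes "f \<in> borel_measurable (leb d)" "\<And>x. x \<in> space (leb d) \<Longrightarrow> f (\<lambda>i\<in>{..<d}. - x i) = - f x"
  shows "(\<integral>x. f x \<partial>gauss d) = 0"
proof -
  have "(\<integral>x. f (\<lambda>i\<in>{..<d}. - x i) \<partial>gauss d) = (\<integral>x. - f x \<partial>gauss d)"
    using assms(2) by (intro Bochner_Integration.integral_cong) (auto simp: space_gauss space_PiM)
  then show ?thesis using integral_gauss_reflect[OF assms(1)] by simp
qed

section \<open>Growth of the potential and tails outside the ball\<close>

context logistic_coords
begin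

definition tau :: real where "tau = exp (- rho2 / 16)"

lemma tau_pos: "0 < tau" by (simp add: tau_def)

lemma tau_le_1: "tau \<le> 1" using rho2_pos by (simp add: tau_def)

text \<open>The quantity \<open>sqn d x / 2 - r x\<close> is the excess of the potential over its
  minimum. It is a sum of Bregman divergences of \<open>softplus\<close> plus a quadratic form, that
  of the prior, which is nonnegative by \<open>second\<close>; both lie below their chords on rays
  from the origin.\<close>

lemma potential_scale:
  assumes "0 \<le> s" "s \<le> 1"
  shows "s\<^sup>2 * sqn d x / 2 - r (\<lambda>j. s * x j) \<le> s * (sqn d x / 2 - r x)"
proof -
  define b where "b t i = softplus (th i + t) - softplus (th i) - sigmoid (th i) * t" for t i
  have e: "sqn d y / 2 - r y = (\<Sum>i<n. b (lin i y) i) + (sqn d y - (\<Sum>i<n. dsig 2 (th i) * (lin i y)\<^sup>2)) / 2" for y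
    by (simp add: r_def srem_def b_def sum_subtractf sum.distrib sum_divide_distrib diff_divide_distrib)
  have Q: "0 \<le> sqn d x - (\<Sum>i<n. dsig 2 (th i) * (lin i x)\<^sup>2)"
    using second[of x] by (simp add: lin_def)
  have "s\<^sup>2 * sqn d x / 2 - r (\<lambda>j. s * x j)
      = (\<Sum>i<n. b (s * lin i x) i) + s\<^sup>2 * (sqn d x - (\<Sum>i<n. dsig 2 (th i) * (lin i x)\<^sup>2)) / 2"
    using e[of "\<lambda>j. s * x j"] by (simp add: sqn_scale lin_scale power_mult_distrib sum_distrib_left algebra_simps)
  also have "\<dots> \<le> (\<Sum>i<n. s * b (lin i x) i) + s * (sqn d x - (\<Sum>i<n. dsig 2 (th i) * (lin i x)\<^sup>2)) / 2"
  proof (intro add_mono sum_mono divide_right_mono)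
    show "b (s * lin i x) i \<le> s * b (lin i x) i" for i
      unfolding b_def by (rule softplus_Bregman_scale[OF assms])
    have "s\<^sup>2 \<le> s" using assms by (simp add: power2_eq_square mult_left_le)
    then show "s\<^sup>2 * (sqn d x - (\<Sum>i<n. dsig 2 (th i) * (lin i x)\<^sup>2)) \<le> s * (sqn d x - (\<Sum>i<n. dsig 2 (th i) * (lin i x)\<^sup>2))"
      using Q by (intro mult_right_mono)
  qed simp
  also have "\<dots> = s * (sqn d x / 2 - r x)"
    unfolding e by (simp add: sum_distrib_left algebra_simps)
  finally show ?thesis .
qed

text \<open>Uniqueness of the minimizer rests on this. Close to the origin the cubic remainder is at
  most half of the quadratic term, \<open>s\<close> being chosen accordingly, and convexity along
  the ray carries positivity back to \<open>x\<close>.\<close>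

lemma potential_pos:
  assumes q: "0 < sqn d x"
  shows "0 < sqn d x / 2 - r x"
proof -
  define K where "K = B * sqn d x * sqrt (sqn d x) / sqrt (real n) / 6"
  define s where "s = min 1 (sqn d x / (4 * (K + 1)))"
  have K: "0 \<le> K" using B1 by (simp add: K_def)
  have s: "0 < s" "s \<le> 1" using q K by (auto simp: s_def)
  have "s * (K + 1) \<le> sqn d x / (4 * (K + 1)) * (K + 1)" using K by (intro mult_right_mono) (auto simp: s_def)
  also have "\<dots> = sqn d x / 4"
  proof -
    have h: "a / (4 * c) * c = a / 4" if "0 < c" for a c :: real using that by simp
    show ?thesis by (rule h) (use K in simp)
  qed
  finally have "s * K \<le> sqn d x / 4" using s unfolding distrib_left by linarith
  then have "s\<^sup>2 * (s * K) \<le> s\<^sup>2 * (sqn d x / 4)" by (intro mult_left_mono) auto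
  moreover have "\<bar>r (\<lambda>j. s * x j)\<bar> \<le> s\<^sup>2 * (s * K)"
    using abs_r_le[of "\<lambda>j. s * x j"] s by (simp add: sqn_scale real_sqrt_mult K_def mult_ac)
  moreover have "0 < s\<^sup>2 * (sqn d x / 4)" using s q by simp
  ultimately have "0 < s\<^sup>2 * sqn d x / 2 - r (\<lambda>j. s * x j)" by argo
  also have "\<dots> \<le> s * (sqn d x / 2 - r x)" using s by (intro potential_scale) auto
  finally show ?thesis using s by (simp add: zero_less_mult_iff)
qed

text \<open>Outside \<open>U\<close>, convexity along rays turns the quadratic growth on the boundary of \<open>U\<close> into linear growth.\<close>

lemma potential_ge:
  assumes "rho2 < sqn d x"
  shows "sqrt rho2 * sqrt (sqn d x) / 4 \<le> sqn d x / 2 - r x"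
proof -
  define s where "s = sqrt rho2 / sqrt (sqn d x)"
  have sq: "0 < sqn d x" using assms rho2_pos by linarith
  have s: "0 < s" "s \<le> 1" using assms rho2_pos sq by (auto simp: s_def)
  have s2: "s\<^sup>2 * sqn d x = rho2" using sq rho2_pos by (simp add: s_def power_divide)
  \<comment> \<open>The square of \<open>B ^ 2 * rho2 / n\<close> is \<open>B ^ 4 * eps / n\<close>,
    and \<open>1 / n \<le> eps ^ 2\<close>. So on the sphere of squared radius \<open>rho2\<close>
    the cubic remainder is at most \<open>rho2 / 6\<close>.\<close>
  have small: "B * sqrt rho2 / sqrt (real n) \<le> 1"
  proof (rule power2_le_imp_le)
    have "(B\<^sup>2 * rho2 / real n)\<^sup>2 \<le> 1\<^sup>2"
    proof -
      have "1 / real n \<le> eps\<^sup>2"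
        unfolding eps_sq using d1 by (intro divide_right_mono) auto
      then have "(B\<^sup>2)\<^sup>2 * eps * (1 / real n) \<le> (B\<^sup>2)\<^sup>2 * eps * eps\<^sup>2"
        using eps_pos by (intro mult_left_mono) auto
      also have "\<dots> = (B\<^sup>2 * eps) * (B\<^sup>2 * eps) * eps"
        by (simp add: power2_eq_square)
      also have "\<dots> \<le> 1 * 1 * 1"
        using eps_small eps_pos B1 by (intro mult_mono) auto
      finally show ?thesis
        using dn_pos by (simp add: power_mult_distrib power_divide rho2_sq power2_eq_square[of "real n"])
    qed
    then have "B\<^sup>2 * rho2 / real n \<le> 1"
      by (rule power2_le_imp_le) simp
    then show "(B * sqrt rho2 / sqrt (real n))\<^sup>2 \<le> 1\<^sup>2"
      using rho2_pos dn_pos by (simp add: power_mult_distrib power_divide)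
  qed simp
  have "\<bar>r (\<lambda>j. s * x j)\<bar> \<le> B * rho2 * sqrt rho2 / sqrt (real n) / 6"
    using abs_r_le[of "\<lambda>j. s * x j"] by (simp add: sqn_scale s2)
  also have "\<dots> = rho2 * (B * sqrt rho2 / sqrt (real n)) / 6" by simp
  also have "\<dots> \<le> rho2 * 1 / 6"
    using rho2_pos small by (intro divide_right_mono mult_left_mono) auto
  finally have "rho2 / 4 \<le> rho2 / 2 - r (\<lambda>j. s * x j)"
    using rho2_pos by (simp add: abs_le_iff)
  also have "\<dots> \<le> s * (sqn d x / 2 - r x)"
    using potential_scale[of s x] s by (simp add: s2)
  finally have "rho2 / 4 / s \<le> sqn d x / 2 - r x"
    using s by (simp add: field_simps)
  moreover have "rho2 / 4 / s = sqrt rho2 * sqrt (sqn d x) / 4"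
    using rho2_pos sq by (simp add: s_def field_simps)
  ultimately show ?thesis by simp
qed

text \<open>The Gaussian factor and \<open>exp r\<close> have to be estimated together, so the
  integral is taken back to Lebesgue measure. There the linear growth of the potential outside
  \<open>U\<close> pays for the weight, for an integrable product of exponentials in the
  coordinates, and for \<open>tau\<close>.\<close>

lemma posterior_tail: "EG d (\<lambda>x. exp (sqrt (real d) * sqrt (sqn d x)) * exp (r x) * indicator (- U) x) \<le> ennreal tau"
proof -
  let ?f = "\<lambda>x. exp (sqrt (real d) * sqrt (sqn d x)) * exp (r x) * indicator (- U) x"
  let ?P = "\<lambda>x. \<Prod>j<d. exp (- 4 * \<bar>x j\<bar>)" and ?Q = "\<lambda>x. \<Prod>j<d. ennreal (exp (- 4 * \<bar>x j\<bar>))"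
  have "EG d (\<lambda>x. ?f x)
      = (\<integral>\<^sup>+x. ennreal (gdens d x)
          * ennreal (?f x) \<partial>leb d)"
    unfolding EG_def by (rule nn_integral_gauss) measurable
  also have "\<dots> \<le> (\<integral>\<^sup>+x. ennreal tau * ?Q x \<partial>leb d)"
  proof (rule nn_integral_mono)
    fix x assume x: "x \<in> space (leb d)"
    have "gdens d x * (?f x)
        \<le> tau * ?P x"
    proof (cases "x \<in> U")
      case True
      then show ?thesis using tau_pos by (auto intro!: mult_nonneg_nonneg prod_nonneg)
    next
      case False
      then have ge: "rho2 < sqn d x" using x by (simp add: cball_def)
      let ?\<rho> = "sqrt rho2" and ?x = "sqrt (sqn d x)"
      have "1 \<le> sqrt (2 * pi)" using pi_ge_two by simp
      then have "1 \<le> sqrt (2 * pi) ^ d" by (rule one_le_power)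
      then have "gdens d x \<le> exp (- sqn d x / 2)"
        by (simp add: divide_le_eq mult_left_le_one_le mult_le_cancel_left1)
      then have "gdens d x * (exp (sqrt (real d) * ?x) * exp (r x) * indicator (- U) x)
          \<le> exp (- sqn d x / 2) * (exp (sqrt (real d) * ?x) * exp (r x))"
      proof -
        assume h: "gdens d x \<le> exp (- sqn d x / 2)"
        have ind: "indicator (- U) x = (1 :: real)" using False by simp
        show ?thesis unfolding ind mult_1_right by (rule mult_right_mono[OF h]) simp
      qed
      also have "\<dots> = exp (sqrt (real d) * ?x - (sqn d x / 2 - r x))"
        by (simp add: mult_exp_exp algebra_simps)
      also have "\<dots> \<le> exp (- rho2 / 16 + - 4 * (\<Sum>j<d. \<bar>x j\<bar>))"
      proof -
        have "sqrt (1024 * real d) \<le> ?\<rho>" using rho2_ge by simp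
        moreover have "sqrt (1024 * real d) = 32 * sqrt (real d)"
          by (simp add: real_sqrt_mult real_sqrt_unique)
        ultimately have "32 * sqrt (real d) * ?x \<le> ?\<rho> * ?x"
          by (intro mult_right_mono) auto
        moreover have "rho2 \<le> ?\<rho> * ?x"
        proof -
          have "?\<rho> * ?\<rho> \<le> ?\<rho> * ?x" using ge rho2_pos by (intro mult_left_mono) auto
          then show ?thesis using rho2_pos by simp
        qed
        \<comment> \<open>The budget is \<open>v / 4\<close>. The growth weight takes at most
          \<open>v / 32\<close>, the product of exponentials at most \<open>4 * v / 32\<close>, and
          \<open>rho2 / 16\<close> at most \<open>2 * v / 32\<close>.\<close>
        moreover have "u - W \<le> - rho2 / 16 + - 4 * s"
          if "32 * sqrt (real d) * ?x \<le> v" "rho2 \<le> v" "v / 4 \<le> W" "s \<le> u" "u = sqrt (real d) * ?x" "0 < rho2"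
          for u v W s :: real
          using that by linarith
        ultimately have "sqrt (real d) * ?x - (sqn d x / 2 - r x) \<le> - rho2 / 16 + - 4 * (\<Sum>j<d. \<bar>x j\<bar>)"
          using rho2_pos potential_ge[OF ge] sum_abs_le_sqrt_sqn[where d = d and x = x] by blast
        then show ?thesis by (rule exp_le_cancel_iff[THEN iffD2])
      qed
      also have "\<dots> = tau * ?P x"
        unfolding tau_def exp_add sum_distrib_left by (simp only: exp_sum finite_lessThan)
      finally show ?thesis .
    qed
    then have "ennreal (gdens d x * (?f x))
        \<le> ennreal (tau * ?P x)" by (rule ennreal_leI)
    then show "ennreal (gdens d x) * ennreal (?f x)
        \<le> ennreal tau * ?Q x"
      using tau_pos by (subst (asm) ennreal_mult, simp, simp, subst (asm) ennreal_mult) (auto simp: prod_ennreal prod_nonneg)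
  qed
  also have "\<dots> = ennreal tau * (\<integral>\<^sup>+x. ?Q x \<partial>leb d)"
    by (rule nn_integral_cmult) measurable
  also have "(\<integral>\<^sup>+x. ?Q x \<partial>leb d) = (\<Prod>j<d. \<integral>\<^sup>+t. ennreal (exp (- 4 * \<bar>t\<bar>)) \<partial>lborel)"
    by (rule leb_prod.product_nn_integral_prod) auto
  also have "\<dots> = (\<integral>\<^sup>+t. ennreal (exp (- 4 * \<bar>t\<bar>)) \<partial>lborel) ^ d"
    by simp
  also have "ennreal tau * \<dots> \<le> ennreal tau * 1"
    using nn_integral_exp_abs by (intro mult_left_mono power_le_one) auto
  finally show ?thesis by simp
qed

lemma abs_S_le_exp: "1 + \<bar>S x\<bar> \<le> 9 * growth x"
proof -
  let ?x = "sqrt (sqn d x)"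
  have "1 \<le> sqrt (real d)" using d1 by simp
  then have "1 * ?x \<le> sqrt (real d) * ?x"
    by (intro mult_right_mono) auto
  then have e: "exp (?x / 2) \<le> exp (sqrt (real d) * ?x / 2)" by simp
  have "\<bar>S x\<bar> \<le> (B / sqrt (real n)) * ?x ^ 3 / 6"
    using abs_S_le[of x] by (simp add: power3_eq_cube field_simps)
  also have "\<dots> \<le> 1 * ?x ^ 3 / 6"
  proof (intro divide_right_mono mult_right_mono)
    have "B / sqrt (real n) * 1 \<le> B / sqrt (real n) * real d"
      using d1 B1 by (intro mult_left_mono) auto
    also have "\<dots> = B * eps" by (simp add: eps_def)
    finally show "B / sqrt (real n) \<le> 1" using eps_small(5) by simp
  qed auto
  also have "\<dots> = 8 * ((?x / 2) ^ 3 / fact 3)"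
    by (simp add: power_divide eval_nat_numeral)
  also have "\<dots> \<le> 8 * exp (?x / 2)"
    by (intro mult_left_mono power_div_fact_le_exp) auto
  finally have "\<bar>S x\<bar> \<le> 8 * exp (?x / 2)" .
  moreover have "1 \<le> exp (?x / 2)" by simp
  ultimately show ?thesis using e by linarith
qed

text \<open>No expansion holds outside \<open>U\<close>; there \<open>w\<close> is at most
  \<open>exp r + 1 + |S|\<close>, and the growth factors of \<open>g\<close> and of
  \<open>1 + |S|\<close> multiply to the weight of the two tail bounds.\<close>

lemma EG_tail:
  assumes g[measurable]: "g \<in> borel_measurable (leb d)"
    and bd: "\<And>x. x \<in> space (leb d) \<Longrightarrow> \<bar>g x\<bar> \<le> a * growth x"
    and a: "0 \<le> a"
  shows "EG d (\<lambda>x. \<bar>g x * w x\<bar> * indicator (- U) x) \<le> ennreal (10 * a * tau)"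
    and "EG d (\<lambda>x. \<bar>g x * S x\<bar> * indicator (- U) x) \<le> ennreal (9 * a * tau)"
    and "EG d (\<lambda>x. \<bar>g x\<bar> * indicator (- U) x) \<le> ennreal (a * tau)"
    and "EG d (\<lambda>x. \<bar>g x * exp (r x)\<bar> * indicator (- U) x) \<le> ennreal (a * tau)"
proof -
  let ?e = "\<lambda>x. exp (sqrt (real d) * sqrt (sqn d x))"
  have ee: "?e x = growth x * growth x" for x
    by (simp add: mult_exp_exp)
  have 1: "\<bar>g x\<bar> * (1 + \<bar>S x\<bar>) \<le> 9 * a * ?e x" if "x \<in> space (leb d)" for x
  proof -
    have "\<bar>g x\<bar> * (1 + \<bar>S x\<bar>) \<le> (a * growth x) * (9 * growth x)"
      using a by (intro mult_mono bd that abs_S_le_exp) auto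
    then show ?thesis unfolding ee by (simp add: mult_ac)
  qed
  have 2: "\<bar>g x\<bar> \<le> a * ?e x" if "x \<in> space (leb d)" for x
  proof -
    have "growth x \<le> ?e x" by simp
    then have "a * growth x \<le> a * ?e x" using a by (rule mult_left_mono)
    then show ?thesis using bd[OF that] by linarith
  qed
  have G: "EG d (\<lambda>x. ?e x * indicator (- U) x) \<le> ennreal tau"
    using Gaussian_tail by (simp add: tau_def)
  have A: "EG d (\<lambda>x. a * (?e x * exp (r x) * indicator (- U) x)) \<le> ennreal (a * tau)"
    by (rule EG_cmult_le[OF _ a posterior_tail]) measurable
  have C: "EG d (\<lambda>x. c * (?e x * indicator (- U) x)) \<le> ennreal (c * tau)" if "0 \<le> c" for c
    by (rule EG_cmult_le[OF _ that G]) measurable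
  show "EG d (\<lambda>x. \<bar>g x * w x\<bar> * indicator (- U) x) \<le> ennreal (10 * a * tau)"
  proof (rule EG_le_trans)
    fix x assume x: "x \<in> space (leb d)"
    have "\<bar>g x * w x\<bar> \<le> \<bar>g x\<bar> * exp (r x) + \<bar>g x\<bar> * (1 + \<bar>S x\<bar>)"
    proof -
      have "\<bar>w x\<bar> \<le> exp (r x) + (1 + \<bar>S x\<bar>)"
        unfolding w_def using exp_gt_zero[of "r x"] by linarith
      then show ?thesis
        unfolding abs_mult distrib_left[symmetric] by (intro mult_left_mono) auto
    qed
    also have "\<dots> \<le> a * ?e x * exp (r x) + 9 * a * ?e x"
      using 1[OF x] 2[OF x] by (intro add_mono mult_right_mono) auto
    finally show "\<bar>g x * w x\<bar> * indicator (- U) x \<le> a * (?e x * exp (r x) * indicator (- U) x) + 9 * a * (?e x * indicator (- U) x)"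
      by (auto split: split_indicator simp: algebra_simps)
  next
    have "EG d (\<lambda>x. a * (?e x * exp (r x) * indicator (- U) x) + 9 * a * (?e x * indicator (- U) x)) \<le> ennreal (a * tau + 9 * a * tau)"
      using a tau_pos by (intro EG_add_le A C) (auto intro!: mult_nonneg_nonneg)
    then show "EG d (\<lambda>x. a * (?e x * exp (r x) * indicator (- U) x) + 9 * a * (?e x * indicator (- U) x)) \<le> ennreal (10 * a * tau)"
      by (simp add: algebra_simps)
  qed
  show "EG d (\<lambda>x. \<bar>g x * S x\<bar> * indicator (- U) x) \<le> ennreal (9 * a * tau)"
  proof (rule EG_le_trans[OF _ C])
    fix x assume x: "x \<in> space (leb d)"
    have "\<bar>g x * S x\<bar> \<le> 9 * a * ?e x"
      using 1[OF x] by (simp add: abs_mult distrib_left) 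
    then show "\<bar>g x * S x\<bar> * indicator (- U) x \<le> 9 * a * (?e x * indicator (- U) x)"
      by (auto split: split_indicator)
  qed (use a in simp)
  show "EG d (\<lambda>x. \<bar>g x\<bar> * indicator (- U) x) \<le> ennreal (a * tau)"
    by (rule EG_le_trans[OF _ C[OF a]]) (use 2 in \<open>auto split: split_indicator\<close>)
  show "EG d (\<lambda>x. \<bar>g x * exp (r x)\<bar> * indicator (- U) x) \<le> ennreal (a * tau)"
  proof (rule EG_le_trans[OF _ A])
    fix x assume x: "x \<in> space (leb d)"
    have "\<bar>g x * exp (r x)\<bar> \<le> a * ?e x * exp (r x)"
      unfolding abs_mult using 2[OF x] by (intro mult_mono) auto
    then show "\<bar>g x * exp (r x)\<bar> * indicator (- U) x \<le> a * (?e x * exp (r x) * indicator (- U) x)"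
      by (auto split: split_indicator simp: mult_ac)
  qed
qed

end

section \<open>Expectations of test functions under the posterior\<close>

context logistic_coords
begin

text \<open>The weight \<kappa> is the root mean square of \<open>f\<close> up to the constant, as
  in Cauchy-Schwarz.\<close>

lemma EG_mult_U:
  assumes [measurable]: "g \<in> borel_measurable (leb d)" "f \<in> borel_measurable (leb d)"
    and "EG d (\<lambda>x. (g x)\<^sup>2) \<le> ennreal 1" "EG d (\<lambda>x. (f x)\<^sup>2 * indicator U x) \<le> ennreal (c * \<kappa>\<^sup>2)"
    and "0 < \<kappa>" "0 \<le> c"
  shows "EG d (\<lambda>x. \<bar>g x * f x\<bar> * indicator U x) \<le> ennreal ((1 + c) * \<kappa>)"
proof (rule EG_le_trans)
  fix x
  have "2 * (\<bar>f x\<bar> * \<bar>g x\<bar>) \<le> \<bar>f x\<bar>\<^sup>2 / \<kappa> + \<kappa> * \<bar>g x\<bar>\<^sup>2"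
    by (rule two_mult_le_scaled[OF \<open>0 < \<kappa>\<close>])
  moreover have "0 \<le> \<bar>f x\<bar> * \<bar>g x\<bar>" by simp
  ultimately have "\<bar>f x\<bar> * \<bar>g x\<bar> \<le> \<bar>f x\<bar>\<^sup>2 / \<kappa> + \<kappa> * \<bar>g x\<bar>\<^sup>2" by linarith
  then show "\<bar>g x * f x\<bar> * indicator U x \<le> \<kappa> * (g x)\<^sup>2 + (1 / \<kappa>) * ((f x)\<^sup>2 * indicator U x)"
    using \<open>0 < \<kappa>\<close> by (auto split: split_indicator simp: abs_mult mult.commute add.commute)
next
  have "EG d (\<lambda>x. \<kappa> * (g x)\<^sup>2 + (1 / \<kappa>) * ((f x)\<^sup>2 * indicator U x)) \<le> ennreal (\<kappa> * 1 + (1 / \<kappa>) * (c * \<kappa>\<^sup>2))"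
    using assms by (intro EG_add_le EG_cmult_le) auto
  also have "\<kappa> * 1 + (1 / \<kappa>) * (c * \<kappa>\<^sup>2) = (1 + c) * \<kappa>"
    using \<open>0 < \<kappa>\<close> by (simp add: power2_eq_square algebra_simps)
  finally show "EG d (\<lambda>x. \<kappa> * (g x)\<^sup>2 + (1 / \<kappa>) * ((f x)\<^sup>2 * indicator U x)) \<le> ennreal ((1 + c) * \<kappa>)" .
qed

lemma cw_nonneg: "0 \<le> cw" and cwo_nonneg: "0 \<le> cwo"
  using cmom_pos[of 4] cmom_pos[of 6] cmom_pos[of 2] smom_pos[of 4] smom_pos[of 8] gmom_pos[of 6] B1
  by (auto simp: cw_def cwo_def cp_def intro!: add_nonneg_nonneg mult_nonneg_nonneg)

definition LS :: real where "LS = 1 + B\<^sup>2 * cmom 1"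

definition Lm :: real where "Lm = 4 * (1 + LS) * (11 + cw + cwo)"

lemma LS_nonneg: "0 \<le> LS"
  using cmom_pos[of 1] by (simp add: LS_def)

lemma EG_one: "EG d (\<lambda>x. 1\<^sup>2) \<le> ennreal 1"
  using EG_const[of 1] by simp

lemma integrable_of_square:
  assumes [measurable]: "f \<in> borel_measurable (leb d)" and "EG d (\<lambda>x. (f x)\<^sup>2) \<le> ennreal c" "0 \<le> c"
  shows "integrable (gauss d) f"
proof (rule EG_integrable(1))
  have "EG d (\<lambda>x. 1 + (f x)\<^sup>2) \<le> ennreal (1 + c)"
    using assms by (intro EG_add_le EG_const) auto
  then show "EG d (\<lambda>x. \<bar>f x\<bar>) \<le> ennreal (1 + c)"
  proof (rule EG_le_trans[rotated])
    fix x
    have "0 \<le> (\<bar>f x\<bar> - 1)\<^sup>2" by simp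
    then have "2 * \<bar>f x\<bar> \<le> 1 + (f x)\<^sup>2" by (simp add: power2_diff)
    then show "\<bar>f x\<bar> \<le> 1 + (f x)\<^sup>2" using abs_ge_zero[of "f x"] by linarith
  qed
qed (use assms in auto)

lemma S_square: "EG d (\<lambda>x. (S x)\<^sup>2) \<le> ennreal (B\<^sup>2 * cmom 1 * eps\<^sup>2)"
  using EG_S_power[of 1] by (simp add: power_mult_distrib mult_ac)

lemma integrable_S: "integrable (gauss d) S"
  using cmom_pos[of 1] by (intro integrable_of_square[OF measurable_S S_square]) auto

lemma integral_S: "(\<integral>x. S x \<partial>gauss d) = 0"
  by (rule integral_gauss_odd) auto

lemma gS_bound:
  assumes g[measurable]: "g \<in> borel_measurable (leb d)" and "EG d (\<lambda>x. (g x)\<^sup>2) \<le> ennreal 1"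
  shows "integrable (gauss d) (\<lambda>x. g x * S x)" "\<bar>\<integral>x. g x * S x \<partial>gauss d\<bar> \<le> LS * eps"
proof -
  have "EG d (\<lambda>x. \<bar>g x * S x\<bar>) \<le> ennreal (LS * eps)"
  proof (rule EG_le_trans)
    fix x
    have "2 * (\<bar>S x\<bar> * \<bar>g x\<bar>) \<le> \<bar>S x\<bar>\<^sup>2 / eps + eps * \<bar>g x\<bar>\<^sup>2"
      by (rule two_mult_le_scaled[OF eps_pos])
    moreover have "0 \<le> \<bar>S x\<bar> * \<bar>g x\<bar>" by simp
    ultimately have "\<bar>S x\<bar> * \<bar>g x\<bar> \<le> \<bar>S x\<bar>\<^sup>2 / eps + eps * \<bar>g x\<bar>\<^sup>2" by linarith
    then show "\<bar>g x * S x\<bar> \<le> eps * (g x)\<^sup>2 + (1 / eps) * (S x)\<^sup>2"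
      by (simp add: abs_mult mult.commute add.commute)
  next
    have "EG d (\<lambda>x. eps * (g x)\<^sup>2 + (1 / eps) * (S x)\<^sup>2) \<le> ennreal (eps * 1 + (1 / eps) * (B\<^sup>2 * cmom 1 * eps\<^sup>2))"
      using assms eps_pos cmom_pos[of 1] by (intro EG_add_le EG_cmult_le S_square) auto
    also have "eps * 1 + (1 / eps) * (B\<^sup>2 * cmom 1 * eps\<^sup>2) = LS * eps"
      using eps_pos by (simp add: LS_def power2_eq_square algebra_simps)
    finally show "EG d (\<lambda>x. eps * (g x)\<^sup>2 + (1 / eps) * (S x)\<^sup>2) \<le> ennreal (LS * eps)" .
  qed
  then show "integrable (gauss d) (\<lambda>x. g x * S x)" "\<bar>\<integral>x. g x * S x \<partial>gauss d\<bar> \<le> LS * eps"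
    using LS_nonneg eps_pos by (auto intro: EG_integrable)
qed

context
  fixes g :: "(nat \<Rightarrow> real) \<Rightarrow> real" and a :: real
  assumes g[measurable]: "g \<in> borel_measurable (leb d)"
    and bd: "\<And>x. x \<in> space (leb d) \<Longrightarrow> \<bar>g x\<bar> \<le> a * growth x"
    and a: "0 \<le> a" and g2: "EG d (\<lambda>x. (g x)\<^sup>2) \<le> ennreal 1"
begin

lemma gw_tail:
  "integrable (gauss d) (\<lambda>x. g x * w x * indicator (- U) x)"
  "\<bar>\<integral>x. g x * w x * indicator (- U) x \<partial>gauss d\<bar> \<le> 10 * a * tau"
proof -
  have "EG d (\<lambda>x. \<bar>g x * w x * indicator (- U) x\<bar>) \<le> ennreal (10 * a * tau)"
    using EG_tail(1)[OF g bd a] by (simp add: abs_mult)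
  then show "integrable (gauss d) (\<lambda>x. g x * w x * indicator (- U) x)"
    "\<bar>\<integral>x. g x * w x * indicator (- U) x \<partial>gauss d\<bar> \<le> 10 * a * tau"
    using a tau_pos by (auto intro!: EG_integrable borel_measurable_times)
qed

lemma gw_U:
  "integrable (gauss d) (\<lambda>x. g x * w x * indicator U x)"
  "\<bar>\<integral>x. g x * w x * indicator U x \<partial>gauss d\<bar> \<le> (1 + cw) * eps\<^sup>2"
proof -
  have "EG d (\<lambda>x. \<bar>g x * w x\<bar> * indicator U x) \<le> ennreal ((1 + cw) * eps\<^sup>2)"
    using EG_w_sq g2 eps_pos cw_nonneg by (intro EG_mult_U) (auto simp: power_mult[symmetric])
  then have "EG d (\<lambda>x. \<bar>g x * w x * indicator U x\<bar>) \<le> ennreal ((1 + cw) * eps\<^sup>2)"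
    by (simp add: abs_mult)
  then show "integrable (gauss d) (\<lambda>x. g x * w x * indicator U x)"
    "\<bar>\<integral>x. g x * w x * indicator U x \<partial>gauss d\<bar> \<le> (1 + cw) * eps\<^sup>2"
    using cw_nonneg by (auto intro!: EG_integrable borel_measurable_times)
qed

lemma gw_split: "g x * w x = g x * w x * indicator U x + g x * w x * indicator (- U) x"
  by (auto split: split_indicator)

lemma gw_bound:
  "integrable (gauss d) (\<lambda>x. g x * w x)"
  "\<bar>\<integral>x. g x * w x \<partial>gauss d\<bar> \<le> (1 + cw) * eps\<^sup>2 + 10 * a * tau"
proof -
  show "integrable (gauss d) (\<lambda>x. g x * w x)"
    by (subst gw_split) (intro Bochner_Integration.integrable_add gw_U gw_tail)
  have "(\<integral>x. g x * w x \<partial>gauss d) = (\<integral>x. g x * w x * indicator U x \<partial>gauss d) + (\<integral>x. g x * w x * indicator (- U) x \<partial>gauss d)"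
    by (subst gw_split) (intro Bochner_Integration.integral_add gw_U gw_tail)
  then show "\<bar>\<integral>x. g x * w x \<partial>gauss d\<bar> \<le> (1 + cw) * eps\<^sup>2 + 10 * a * tau"
    using gw_U(2) gw_tail(2) by linarith
qed

text \<open>On the symmetric set \<open>U\<close> the even part of \<open>w\<close> integrates to
  zero against an odd \<open>g\<close>, so \<open>w\<close> may be replaced by \<open>wo\<close>,
  which gains one power of \<open>eps\<close>. The tail needs no such gain.\<close>

lemma gw_bound_odd:
  assumes odd: "\<And>x. x \<in> space (leb d) \<Longrightarrow> g (refl x) = - g x"
  shows "\<bar>\<integral>x. g x * w x \<partial>gauss d\<bar> \<le> (1 + cwo) * eps ^ 3 + 10 * a * tau"
proof -
  have "EG d (\<lambda>x. \<bar>g x * wo x\<bar> * indicator U x) \<le> ennreal ((1 + cwo) * eps ^ 3)"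
    using EG_wo_sq g2 eps_pos cwo_nonneg by (intro EG_mult_U) (auto simp: power_mult[symmetric])
  then have "EG d (\<lambda>x. \<bar>g x * wo x * indicator U x\<bar>) \<le> ennreal ((1 + cwo) * eps ^ 3)"
    by (simp add: abs_mult)
  then have o: "integrable (gauss d) (\<lambda>x. g x * wo x * indicator U x)"
    "\<bar>\<integral>x. g x * wo x * indicator U x \<partial>gauss d\<bar> \<le> (1 + cwo) * eps ^ 3"
    using cwo_nonneg eps_pos by (auto intro!: EG_integrable borel_measurable_times)
  have w2: "w (refl (refl x)) = w x" for x
    by (simp only: w_def r_def S_refl lin_refl minus_minus)
  have "(\<integral>x. g x * w x * indicator U x - g x * wo x * indicator U x \<partial>gauss d) = 0"
  proof (rule integral_gauss_odd)
    fix x assume x: "x \<in> space (leb d)"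
    have "indicator U (refl x) = (indicator U x :: real)"
      using reflect_in_cball[OF x] by (simp add: indicator_def)
    then show "g (refl x) * w (refl x) * indicator U (refl x) - g (refl x) * wo (refl x) * indicator U (refl x)
        = - (g x * w x * indicator U x - g x * wo x * indicator U x)"
    proof -
      assume ind: "indicator U (refl x) = (indicator U x :: real)"
      have wr: "wo (refl x) = (w (refl x) - w x) / 2"
        by (simp only: wo_def w2)
      show ?thesis
        unfolding odd[OF x] wr ind by (simp add: wo_def field_simps)
    qed
  qed measurable
  then have "(\<integral>x. g x * w x * indicator U x \<partial>gauss d) = (\<integral>x. g x * wo x * indicator U x \<partial>gauss d)"
    by (subst (asm) Bochner_Integration.integral_diff) (use gw_U o in auto)
  moreover have "(\<integral>x. g x * w x \<partial>gauss d) = (\<integral>x. g x * w x * indicator U x \<partial>gauss d) + (\<integral>x. g x * w x * indicator (- U) x \<partial>gauss d)"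
    by (subst gw_split) (intro Bochner_Integration.integral_add gw_U gw_tail)
  ultimately show ?thesis
    using o(2) gw_tail(2) by linarith
qed

end

lemma one_le_exp_growth: "\<bar>1\<bar> \<le> 1 * growth x"
  by simp

lemma w_bound: "integrable (gauss d) w" "\<bar>\<integral>x. w x \<partial>gauss d\<bar> \<le> (1 + cw) * eps\<^sup>2 + 10 * tau"
  using gw_bound[OF _ one_le_exp_growth _ EG_one] by auto

definition Zr :: real where "Zr = (\<integral>x. exp (r x) \<partial>gauss d)"

lemma exp_r_eq: "exp (r x) = 1 + S x + w x"
  by (simp add: w_def)

lemma integrable_exp_r: "integrable (gauss d) (\<lambda>x. exp (r x))"
  unfolding exp_r_eq using integrable_S w_bound(1) by auto

lemma Zr_eq: "Zr = 1 + (\<integral>x. w x \<partial>gauss d)"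
  unfolding Zr_def exp_r_eq using integrable_S w_bound(1) by (simp add: integral_S gauss.prob_space)

text \<open>The error bound for the integral of \<open>w\<close> is no help, since its constant is
  not controlled by \<open>small\<close>. Instead \<open>exp r \<ge> 1 + r \<ge> 23 / 24 + S\<close>
  on \<open>U\<close>, where the odd function \<open>S\<close> integrates to zero and the mass is at
  least one half.\<close>

lemma Zr_ge: "1 / 4 \<le> Zr"
proof -
  have [measurable]: "U \<in> sets (gauss d)" by (simp add: sets_gauss)
  have iS: "integrable (gauss d) (\<lambda>x. S x * indicator U x)"
    using integrable_S by (intro integrable_real_mult_indicator) auto
  have "(\<integral>x. S x * indicator U x \<partial>gauss d) = 0"
  proof (rule integral_gauss_odd)
    fix x assume x: "x \<in> space (leb d)"
    have "indicator U (refl x) = (indicator U x :: real)"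
      using reflect_in_cball[OF x] by (simp add: indicator_def)
    then show "S (refl x) * indicator U (refl x) = - (S x * indicator U x)" by simp
  qed measurable
  then have "(\<integral>x. 23 / 24 * indicator U x + S x * indicator U x \<partial>gauss d) = 23 / 24 * measure (gauss d) U"
    using iS by (subst Bochner_Integration.integral_add) (auto simp: gauss.emeasure_eq_measure)
  moreover have "(\<integral>x. 23 / 24 * indicator U x + S x * indicator U x \<partial>gauss d) \<le> Zr"
    unfolding Zr_def
  proof (rule integral_mono)
    fix x
    show "23 / 24 * indicator U x + S x * indicator U x \<le> exp (r x)"
    proof (cases "x \<in> U")
      case True
      then have "\<bar>r x - S x\<bar> \<le> 1 / 24"
        using abs_r_S_le[of x] q_le_1_U by force
      then have "23 / 24 + S x \<le> 1 + r x" by linarith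
      moreover have "23 / 24 * indicator U x + S x * indicator U x = 23 / 24 + S x"
        using True by simp
      ultimately show ?thesis using exp_ge_add_one_self[of "r x"] by linarith
    qed simp
  qed (use iS integrable_exp_r in \<open>auto simp: gauss.emeasure_eq_measure\<close>)
  ultimately show ?thesis using prob_U by simp
qed

definition post :: "((nat \<Rightarrow> real) \<Rightarrow> real) \<Rightarrow> real" where
  "post g = (\<integral>x. g x * exp (r x) \<partial>gauss d) / Zr"

text \<open>Let \<open>s\<close>, \<open>t\<close>, \<open>u\<close> be the Gaussian means of
  \<open>g * S\<close>, \<open>g * w\<close> and \<open>w\<close>. As \<open>g\<close> and
  \<open>S\<close> have mean zero, the normalizing constant is \<open>1 + u\<close> and the error is
  \<open>(t - s * u) / Zr\<close>. The product \<open>s * u\<close> is already of third order, so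
  normalization does not spoil the gain for odd \<open>g\<close>.\<close>

theorem post_expansion:
  fixes g :: "(nat \<Rightarrow> real) \<Rightarrow> real" and a :: real
  assumes g[measurable]: "g \<in> borel_measurable (leb d)"
    and bd: "\<And>x. x \<in> space (leb d) \<Longrightarrow> \<bar>g x\<bar> \<le> a * growth x"
    and a: "1 \<le> a" and g2: "EG d (\<lambda>x. (g x)\<^sup>2) \<le> ennreal 1" and g0: "(\<integral>x. g x \<partial>gauss d) = 0"
  shows "integrable (gauss d) (\<lambda>x. g x * exp (r x))"
    and "\<bar>post g - (\<integral>x. g x * S x \<partial>gauss d)\<bar> \<le> Lm * (a * tau + eps\<^sup>2)"
    and "(\<And>x. x \<in> space (leb d) \<Longrightarrow> g (refl x) = - g x) \<Longrightarrow>
      \<bar>post g - (\<integral>x. g x * S x \<partial>gauss d)\<bar> \<le> Lm * (a * tau + eps ^ 3)"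
proof -
  have a0: "0 \<le> a" using a by simp
  have ig: "integrable (gauss d) g"
    by (rule integrable_of_square[OF g g2]) simp
  note gS = gS_bound[OF g g2] and gw = gw_bound[OF g bd a0 g2]
  have e: "g x * exp (r x) = g x + g x * S x + g x * w x" for x
    by (simp add: exp_r_eq algebra_simps)
  show "integrable (gauss d) (\<lambda>x. g x * exp (r x))"
    unfolding e using ig gS(1) gw(1) by auto
  have "(\<integral>x. g x * exp (r x) \<partial>gauss d) = (\<integral>x. g x * S x \<partial>gauss d) + (\<integral>x. g x * w x \<partial>gauss d)"
    unfolding e using ig gS(1) gw(1) by (simp add: g0)
  moreover define s where "s = (\<integral>x. g x * S x \<partial>gauss d)"
  moreover define t where "t = (\<integral>x. g x * w x \<partial>gauss d)"
  moreover define u where "u = (\<integral>x. w x \<partial>gauss d)"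
  ultimately have "post g - s = (t - s * u) / Zr"
    using Zr_ge by (simp add: post_def Zr_eq field_simps)
  then have "\<bar>post g - s\<bar> = \<bar>t - s * u\<bar> / Zr"
    using Zr_ge by (simp add: abs_divide)
  also have "\<dots> \<le> \<bar>t - s * u\<bar> / (1 / 4)"
    using Zr_ge by (intro divide_left_mono) auto
  also have "\<dots> \<le> 4 * (\<bar>t\<bar> + \<bar>s\<bar> * \<bar>u\<bar>)"
    using abs_triangle_ineq4[of t "s * u"] by (simp add: abs_mult)
  also have "\<dots> \<le> 4 * (\<bar>t\<bar> + LS * eps * ((1 + cw) * eps\<^sup>2 + 10 * tau))"
    using gS(2) w_bound(2) LS_nonneg eps_pos by (intro mult_left_mono add_left_mono mult_mono) (auto simp: s_def u_def)
  finally have main: "\<bar>post g - s\<bar> \<le> 4 * (\<bar>t\<bar> + LS * eps * ((1 + cw) * eps\<^sup>2 + 10 * tau))" .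
  \<comment> \<open>Treats both claims: \<open>h\<close> is \<open>eps ^ 2\<close> with the constant
    of \<open>w\<close>, or \<open>eps ^ 3\<close> with that of its odd part.\<close>
  have fin: "\<bar>post g - s\<bar> \<le> Lm * (a * tau + h)"
    if t: "\<bar>t\<bar> \<le> (1 + c) * h + 10 * a * tau" and c: "c = cw \<or> c = cwo" and h: "eps ^ 3 \<le> h" for c h
  proof -
    have h0: "0 \<le> h" using h eps_pos by (meson less_imp_le order_trans zero_less_power)
    have at: "tau \<le> a * tau" "0 \<le> a * tau" using a tau_pos by auto
    have "eps * tau \<le> 1 * tau" using eps_small(3) tau_pos by (intro mult_right_mono) auto
    then have et: "eps * tau \<le> a * tau" using at by simp
    have "\<bar>t\<bar> \<le> (11 + cw + cwo) * (a * tau + h)"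
    proof -
      have "\<bar>t\<bar> \<le> (1 + c) * h + 10 * (a * tau)" using t by simp
      also have "\<dots> \<le> (11 + cw + cwo) * h + (11 + cw + cwo) * (a * tau)"
      proof (rule add_mono)
        show "(1 + c) * h \<le> (11 + cw + cwo) * h"
          using c cw_nonneg cwo_nonneg h0 by (intro mult_right_mono) auto
        show "10 * (a * tau) \<le> (11 + cw + cwo) * (a * tau)"
          using cw_nonneg cwo_nonneg at by (intro mult_right_mono) auto
      qed
      finally show ?thesis by (simp add: algebra_simps)
    qed
    moreover have "eps * ((1 + cw) * eps\<^sup>2 + 10 * tau) \<le> (11 + cw + cwo) * (a * tau + h)"
    proof -
      have "eps * ((1 + cw) * eps\<^sup>2 + 10 * tau) = (1 + cw) * eps ^ 3 + 10 * (eps * tau)"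
        by (simp add: power3_eq_cube power2_eq_square algebra_simps)
      also have "\<dots> \<le> (11 + cw + cwo) * h + (11 + cw + cwo) * (a * tau)"
      proof (rule add_mono)
        show "(1 + cw) * eps ^ 3 \<le> (11 + cw + cwo) * h"
          using cw_nonneg cwo_nonneg h eps_pos by (intro mult_mono) auto
        show "10 * (eps * tau) \<le> (11 + cw + cwo) * (a * tau)"
          using cw_nonneg cwo_nonneg et eps_pos tau_pos by (intro mult_mono) auto
      qed
      finally show ?thesis by (simp add: algebra_simps)
    qed
    then have "LS * (eps * ((1 + cw) * eps\<^sup>2 + 10 * tau)) \<le> LS * ((11 + cw + cwo) * (a * tau + h))"
      using LS_nonneg by (rule mult_left_mono)
    ultimately have "4 * (\<bar>t\<bar> + LS * eps * ((1 + cw) * eps\<^sup>2 + 10 * tau))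
        \<le> 4 * ((11 + cw + cwo) * (a * tau + h) + LS * ((11 + cw + cwo) * (a * tau + h)))"
      by (simp add: mult.assoc)
    also have "\<dots> = Lm * (a * tau + h)"
      by (simp add: Lm_def algebra_simps)
    finally show ?thesis using main by simp
  qed
  have "eps ^ 3 \<le> eps\<^sup>2"
    using eps_pos eps_small(3) by (intro power_decreasing) auto
  then show "\<bar>post g - (\<integral>x. g x * S x \<partial>gauss d)\<bar> \<le> Lm * (a * tau + eps\<^sup>2)"
    using fin[of cw "eps\<^sup>2"] gw(2) by (simp add: s_def t_def)
  show "\<bar>post g - (\<integral>x. g x * S x \<partial>gauss d)\<bar> \<le> Lm * (a * tau + eps ^ 3)"
    if odd: "\<And>x. x \<in> space (leb d) \<Longrightarrow> g (refl x) = - g x"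
    using fin[of cwo "eps ^ 3"] gw_bound_odd[OF g bd a0 g2 odd] by (simp add: s_def t_def)
qed

end

section \<open>Linear algebra\<close>

definition bf :: "nat \<Rightarrow> (nat \<Rightarrow> nat \<Rightarrow> real) \<Rightarrow> (nat \<Rightarrow> real) \<Rightarrow> (nat \<Rightarrow> real) \<Rightarrow> real" where
  "bf d h u v = (\<Sum>i<d. \<Sum>j<d. u i * h i j * v j)"

lemma bf_add_right: "bf d h u (\<lambda>i. v i + w i) = bf d h u v + bf d h u w"
  by (simp add: bf_def distrib_left sum.distrib)

lemma bf_scale_right: "bf d h u (\<lambda>i. c * v i) = c * bf d h u v"
  by (simp add: bf_def sum_distrib_left algebra_simps)

lemma bf_diff_right: "bf d h u (\<lambda>i. v i - w i) = bf d h u v - bf d h u w"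
  by (simp add: bf_def right_diff_distrib sum_subtractf)

lemma bf_sum_right: "finite I \<Longrightarrow> bf d h u (\<lambda>i. \<Sum>l\<in>I. f l i) = (\<Sum>l\<in>I. bf d h u (f l))"
proof (induction I rule: finite_induct)
  case (insert l I)
  then show ?case using bf_add_right[of d h u "f l" "\<lambda>i. \<Sum>l\<in>I. f l i"] by simp
qed (simp add: bf_def)

lemma bf_commute:
  assumes "\<And>i j. i < d \<Longrightarrow> j < d \<Longrightarrow> h i j = h j i"
  shows "bf d h u v = bf d h v u"
  unfolding bf_def by (subst sum.swap) (auto intro!: sum.cong simp: assms mult_ac)

text \<open>Gram-Schmidt for the inner product \<open>h\<close>, run through the standard basis in
  its order: the vector with index \<open>k\<close> combines basis vectors up to \<open>k\<close>
  with a positive last coefficient, so the vectors form the columns of an upper triangular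
  matrix.\<close>

lemma Gram_Schmidt_upper:
  assumes sym: "\<And>i j. i < d \<Longrightarrow> j < d \<Longrightarrow> h i j = h j i"
    and pos: "\<And>u. \<exists>i<d. u i \<noteq> 0 \<Longrightarrow> 0 < bf d h u u"
    and "k \<le> d"
  shows "\<exists>a. (\<forall>j<k. \<forall>i>j. a j i = 0) \<and> (\<forall>j<k. 0 < a j j) \<and>
    (\<forall>i<k. \<forall>j<k. bf d h (a i) (a j) = (if i = j then 1 else 0))"
  using \<open>k \<le> d\<close>
proof (induction k)
  case 0
  then show ?case by simp
next
  case (Suc k)
  then obtain a where a: "\<And>j i. j < k \<Longrightarrow> j < i \<Longrightarrow> a j i = 0" "\<And>j. j < k \<Longrightarrow> 0 < a j j"
    "\<And>i j. i < k \<Longrightarrow> j < k \<Longrightarrow> bf d h (a i) (a j) = (if i = j then 1 else 0)"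
    by (metis Suc_leD)
  define e where "e i = (if i = k then 1 else 0 :: real)" for i
  define v where "v i = e i - (\<Sum>l<k. bf d h (a l) e * a l i)" for i
  have vk: "v k = 1" by (simp add: v_def e_def a(1))
  have vz: "v i = 0" if "k < i" for i
    using that by (simp add: v_def e_def a(1))
  have av: "bf d h (a i) v = 0" if "i < k" for i
  proof -
    have "bf d h (a i) v = bf d h (a i) e - (\<Sum>l<k. bf d h (a l) e * bf d h (a i) (a l))"
      unfolding v_def by (simp add: bf_diff_right bf_sum_right bf_scale_right)
    also have "(\<Sum>l<k. bf d h (a l) e * bf d h (a i) (a l)) = (\<Sum>l<k. if l = i then bf d h (a i) e else 0)"
      using that by (intro sum.cong) (auto simp: a(3))
    also have "\<dots> = bf d h (a i) e" using that by simp
    finally show ?thesis by simp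
  qed
  \<comment> \<open>The entry \<open>v k = 1\<close> prevents \<open>v\<close> from vanishing,
    whence it can be normalized.\<close>
  have q: "0 < bf d h v v"
    using Suc.prems vk by (intro pos) (auto intro!: exI[of _ k])
  define c where "c = 1 / sqrt (bf d h v v)"
  have c: "0 < c" "c * (c * bf d h v v) = 1"
    using q by (auto simp: c_def field_simps)
  define a' where "a' = a(k := (\<lambda>i. c * v i))"
  have sc: "bf d h (\<lambda>i. c * v i) u = c * bf d h v u" for u
    by (subst bf_commute[OF sym], simp, simp, subst bf_scale_right, subst bf_commute[OF sym]) auto
  have "bf d h (a' i) (a' j) = (if i = j then 1 else 0)" if ij: "i < Suc k" "j < Suc k" for i j
  proof -
    consider "i < k" "j < k" | "i = k" "j < k" | "i < k" "j = k" | "i = k" "j = k"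
      using ij by (auto simp: less_Suc_eq)
    then show ?thesis
    proof cases
      case 2
      then have "bf d h v (a j) = 0" by (subst bf_commute[OF sym]) (auto simp: av)
      then show ?thesis using 2 by (simp add: a'_def sc)
    qed (auto simp: a'_def a sc bf_scale_right av c)
  qed
  moreover have "a' j i = 0" if "j < Suc k" "j < i" for i j
    using that by (cases "j = k") (auto simp: a'_def vz a)
  moreover have "0 < a' j j" if "j < Suc k" for j
    using that c by (cases "j = k") (auto simp: a'_def vk a)
  ultimately show ?case by blast
qed

lemma scalar_prod_vec: "vec d u \<bullet> vec d v = dot d u v"
  by (simp add: scalar_prod_def dot_def lessThan_atLeast0)

lemma scalar_prod_eq_dot: "u \<in> carrier_vec d \<Longrightarrow> v \<in> carrier_vec d \<Longrightarrow> u \<bullet> v = dot d (\<lambda>i. u $ i) (\<lambda>i. v $ i)"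
  by (simp add: scalar_prod_def dot_def lessThan_atLeast0)

lemma mult_mat_vec_index:
  "A \<in> carrier_mat d d \<Longrightarrow> v \<in> carrier_vec d \<Longrightarrow> i < d \<Longrightarrow> (A *\<^sub>v v) $ i = (\<Sum>j<d. A $$ (i, j) * v $ j)"
  by (simp add: scalar_prod_def lessThan_atLeast0)

lemma quadratic_form_bf:
  assumes "H \<in> carrier_mat d d" "u \<in> carrier_vec d" "v \<in> carrier_vec d"
  shows "u \<bullet> (H *\<^sub>v v) = bf d (\<lambda>i j. H $$ (i, j)) (\<lambda>i. u $ i) (\<lambda>i. v $ i)"
  using assms by (subst scalar_prod_eq_dot[of _ d])
    (auto simp: dot_def bf_def mult_mat_vec_index[of _ d] sum_distrib_left mult.assoc simp del: index_mult_mat_vec intro!: sum.cong)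

lemma mult_mat_index:
  "A \<in> carrier_mat d d \<Longrightarrow> B \<in> carrier_mat d d \<Longrightarrow> i < d \<Longrightarrow> j < d \<Longrightarrow> (A * B) $$ (i, j) = (\<Sum>k<d. A $$ (i, k) * B $$ (k, j))"
  by (simp add: scalar_prod_def lessThan_atLeast0)

lemma sym_matD: "transpose_mat H = H \<Longrightarrow> H \<in> carrier_mat d d \<Longrightarrow> i < d \<Longrightarrow> j < d \<Longrightarrow> H $$ (i, j) = H $$ (j, i)"
  by (metis carrier_matD index_transpose_mat(1))

lemma pos_def_whitening:
  assumes "pos_def d H"
  obtains A where "A \<in> carrier_mat d d" "\<And>i j. i < d \<Longrightarrow> j < i \<Longrightarrow> A $$ (i, j) = 0" "\<And>i. i < d \<Longrightarrow> 0 < A $$ (i, i)"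
    "transpose_mat A * (H * A) = 1\<^sub>m d"
proof -
  let ?h = "\<lambda>i j. H $$ (i, j)"
  have H: "H \<in> carrier_mat d d" "transpose_mat H = H" using assms by (auto simp: pos_def_def)
  have pos: "0 < bf d ?h u u" if "\<exists>i<d. u i \<noteq> 0" for u
  proof -
    have "vec d u \<noteq> 0\<^sub>v d" using that by (metis index_vec index_zero_vec(1))
    then have "0 < vec d u \<bullet> (H *\<^sub>v vec d u)"
      using assms by (auto simp: pos_def_def)
    also have "\<dots> = bf d ?h u u"
      using H by (subst quadratic_form_bf[of _ d]) (auto simp: bf_def)
    finally show ?thesis .
  qed
  have "\<exists>a. (\<forall>j<d. \<forall>i>j. a j i = 0) \<and> (\<forall>j<d. 0 < a j j) \<and>
      (\<forall>i<d. \<forall>j<d. bf d ?h (a i) (a j) = (if i = j then 1 else 0))"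
    by (rule Gram_Schmidt_upper[OF sym_matD[OF H(2,1)] pos order_refl])
  then obtain a where a0: "(\<forall>j<d. \<forall>i>j. a j i = 0) \<and> (\<forall>j<d. 0 < a j j) \<and>
      (\<forall>i<d. \<forall>j<d. bf d ?h (a i) (a j) = (if i = j then 1 else 0))"
    by (elim exE)
  then have a: "\<And>j i. j < d \<Longrightarrow> j < i \<Longrightarrow> a j i = 0" "\<And>j. j < d \<Longrightarrow> 0 < a j j"
    "\<And>i j. i < d \<Longrightarrow> j < d \<Longrightarrow> bf d ?h (a i) (a j) = (if i = j then 1 else 0)"
    by auto
  define A where "A = mat d d (\<lambda>(i, j). a j i)"
  have A: "A \<in> carrier_mat d d" by (simp add: A_def)
  have "transpose_mat A * (H * A) = 1\<^sub>m d"
  proof (rule eq_matI)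
    fix i j assume ij: "i < dim_row (1\<^sub>m d)" "j < dim_col (1\<^sub>m d)"
    have "(transpose_mat A * (H * A)) $$ (i, j) = (\<Sum>k<d. a i k * (\<Sum>l<d. H $$ (k, l) * a j l))"
      using ij A H by (subst mult_mat_index[of _ d]) (auto simp: mult_mat_index[of _ d] A_def simp del: index_mult_mat intro!: sum.cong)
    also have "\<dots> = bf d ?h (a i) (a j)" by (simp add: bf_def sum_distrib_left mult.assoc)
    finally show "(transpose_mat A * (H * A)) $$ (i, j) = 1\<^sub>m d $$ (i, j)"
      using ij a(3) by simp
  qed (use A H in auto)
  then show ?thesis
    using that[OF A] a by (auto simp: A_def)
qed

lemma mat_inv_eqI:
  assumes "A \<in> carrier_mat d d" "B \<in> carrier_mat d d" "A * B = 1\<^sub>m d"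
  shows "mat_inv A = B"
proof -
  have BA: "B * A = 1\<^sub>m d" by (rule mat_mult_left_right_inverse[OF assms])
  have "A \<in> Units (ring_mat TYPE(real) d ())"
    unfolding Units_def using assms BA by (auto simp: ring_mat_def)
  then obtain C where C: "mat_inverse A = Some C"
    using mat_inverse(1)[OF assms(1), where b = "()"] by (cases "mat_inverse A") auto
  then have CA: "C * A = 1\<^sub>m d" and Cc: "C \<in> carrier_mat d d"
    using mat_inverse(2)[OF assms(1)] by auto
  have "C = C * (A * B)" using Cc assms(3) by simp
  also have "\<dots> = (C * A) * B" by (rule assoc_mult_mat[OF Cc assms(1,2), symmetric])
  also have "\<dots> = B" using CA assms(2) by simp
  finally have "C = B" .
  then show ?thesis using C by (simp add: mat_inv_def)
qed

text \<open>\<open>A\<close> whitens \<open>H\<close>: the substitution \<open>b = m + A x\<close> turns the quadratic form of \<open>H\<close> into the Euclidean one.\<close>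

locale whitening =
  fixes d :: nat and H A :: rmat
  assumes H: "H \<in> carrier_mat d d" "transpose_mat H = H"
    and A: "A \<in> carrier_mat d d"
    and upper: "\<And>i j. i < d \<Longrightarrow> j < i \<Longrightarrow> A $$ (i, j) = 0"
    and diag: "\<And>i. i < d \<Longrightarrow> 0 < A $$ (i, i)"
    and white: "transpose_mat A * (H * A) = 1\<^sub>m d"
begin

lemma At: "transpose_mat A \<in> carrier_mat d d" using A by simp

text \<open>A one-sided inverse of a square matrix is two-sided, so the inverse of \<open>H\<close>
  is \<open>A\<close> times its transpose, which is the covariance of \<open>A x\<close> for a
  standard Gaussian \<open>x\<close>.\<close>

lemma HAAt: "H * (A * transpose_mat A) = 1\<^sub>m d"
proof -
  have "(H * A) * transpose_mat A = 1\<^sub>m d"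
    by (rule mat_mult_left_right_inverse[OF At _ white]) (use H A in simp)
  then show ?thesis using H A At by simp
qed

lemma mat_inv_H: "mat_inv H = A * transpose_mat A"
  using HAAt H A by (intro mat_inv_eqI[of _ d]) auto

lemma mat_inv_H_carrier: "mat_inv H \<in> carrier_mat d d"
  using A by (simp add: mat_inv_H)

lemma H_mat_inv: "H * mat_inv H = 1\<^sub>m d" "mat_inv H * H = 1\<^sub>m d"
proof -
  show 1: "H * mat_inv H = 1\<^sub>m d" using HAAt by (simp add: mat_inv_H)
  show "mat_inv H * H = 1\<^sub>m d"
    by (rule mat_mult_left_right_inverse[OF H(1) mat_inv_H_carrier 1])
qed

lemma mat_inv_mat_inv_H: "mat_inv (mat_inv H) = H"
  using H_mat_inv H mat_inv_H_carrier by (intro mat_inv_eqI[of _ d]) auto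

lemma transpose_mat_inv_H: "transpose_mat (mat_inv H) = mat_inv H"
  using A by (simp add: mat_inv_H transpose_mult[of _ d d _ d])

lemma det_mat_inv_H: "Determinant.det (mat_inv H) = (\<Prod>i<d. A $$ (i, i))\<^sup>2"
proof -
  have "Determinant.det A = prod_list (diag_mat A)"
    using A upper by (intro det_upper_triangular[of _ d]) auto
  also have "\<dots> = (\<Prod>i<d. A $$ (i, i))"
    using A by (simp add: diag_mat_def prod.list_conv_set_nth lessThan_atLeast0)
  finally show ?thesis
    using A by (simp add: mat_inv_H det_mult[of _ d] det_transpose[of _ d] power2_eq_square)
qed

definition ax :: "(nat \<Rightarrow> real) \<Rightarrow> rvec" where
  "ax x = A *\<^sub>v vec d x"

definition emb :: "rvec \<Rightarrow> (nat \<Rightarrow> real) \<Rightarrow> rvec" where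
  "emb m x = m + ax x"

lemma ax_carrier [simp]: "ax x \<in> carrier_vec d"
  using A by (simp add: ax_def)

lemma emb_carrier [simp]: "m \<in> carrier_vec d \<Longrightarrow> emb m x \<in> carrier_vec d"
  by (simp add: emb_def)

lemma emb_minus: "m \<in> carrier_vec d \<Longrightarrow> emb m x - m = ax x"
  unfolding emb_def by (intro eq_vecI) (use ax_carrier[of x] in \<open>auto simp del: ax_carrier\<close>)

lemma ax_index: "i < d \<Longrightarrow> ax x $ i = (\<Sum>j<d. A $$ (i, j) * x j)"
  unfolding ax_def using A by (subst mult_mat_vec_index[of _ d]) auto

lemma ax_index_upper: "i < d \<Longrightarrow> ax x $ i = (\<Sum>j\<in>{i..<d}. A $$ (i, j) * x j)"
  unfolding ax_index by (rule sum.mono_neutral_right) (auto simp: upper)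

lemma quadratic_ax: "ax x \<bullet> (H *\<^sub>v ax y) = dot d x y"
proof -
  have "ax x \<bullet> (H *\<^sub>v ax y) = (A *\<^sub>v vec d x) \<bullet> ((H * A) *\<^sub>v vec d y)"
    using H A by (simp add: ax_def)
  also have "\<dots> = ((H * A) *\<^sub>v vec d y) \<bullet> (A *\<^sub>v vec d x)"
    using H A by (intro comm_scalar_prod[of _ d]) auto
  also have "\<dots> = (transpose_mat A *\<^sub>v ((H * A) *\<^sub>v vec d y)) \<bullet> vec d x"
    using H A by (intro transpose_vec_mult_scalar[symmetric, of _ d d]) auto
  also have "\<dots> = vec d y \<bullet> vec d x"
    using white H A At by (subst assoc_mult_mat_vec[symmetric, of _ d d _ d]) auto
  finally show ?thesis by (simp add: scalar_prod_vec dot_commute)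
qed

lemma wnorm_ax: "wnorm H (ax x) = sqrt (sqn d x)"
  by (simp add: wnorm_def quadratic_ax dot_self)

text \<open>Coordinates of \<open>u\<close> as a linear functional: pairing \<open>u\<close> with
  \<open>ax x\<close> is pairing \<open>co u\<close> with \<open>x\<close>, and the squared norm of
  \<open>co u\<close> is the dual form \<open>u \<bullet> (mat_inv H *\<^sub>v u)\<close>.\<close>

definition co :: "rvec \<Rightarrow> nat \<Rightarrow> real" where
  "co u = (\<lambda>i. (transpose_mat A *\<^sub>v u) $ i)"

lemma scalar_prod_ax: "u \<in> carrier_vec d \<Longrightarrow> u \<bullet> ax x = dot d (co u) x"
proof -
  assume u: "u \<in> carrier_vec d"
  have "u \<bullet> ax x = (transpose_mat A *\<^sub>v u) \<bullet> vec d x"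
    unfolding ax_def using A u by (intro transpose_vec_mult_scalar[symmetric, of _ d d]) auto
  also have "\<dots> = dot d (co u) x"
    using mult_mat_vec_carrier[OF At u] by (subst scalar_prod_eq_dot[of _ d]) (auto simp: co_def dot_def)
  finally show ?thesis .
qed

lemma sqn_co: "u \<in> carrier_vec d \<Longrightarrow> sqn d (co u) = u \<bullet> (mat_inv H *\<^sub>v u)"
proof -
  assume u: "u \<in> carrier_vec d"
  have "sqn d (co u) = (transpose_mat A *\<^sub>v u) \<bullet> (transpose_mat A *\<^sub>v u)"
    using mult_mat_vec_carrier[OF At u] by (subst scalar_prod_eq_dot[of _ d]) (auto simp: co_def dot_self)
  also have "\<dots> = u \<bullet> (A *\<^sub>v (transpose_mat A *\<^sub>v u))"
    using A u by (intro transpose_vec_mult_scalar[of _ d d]) auto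
  also have "\<dots> = u \<bullet> (mat_inv H *\<^sub>v u)"
    using A At u by (simp add: mat_inv_H)
  finally show ?thesis .
qed

lemma ax_surj: "u \<in> carrier_vec d \<Longrightarrow> \<exists>x. ax x = u"
proof -
  assume u: "u \<in> carrier_vec d"
  have "A * (transpose_mat A * H) = 1\<^sub>m d"
    using H_mat_inv(2) A At H by (simp add: mat_inv_H)
  then have "A *\<^sub>v (transpose_mat A *\<^sub>v (H *\<^sub>v u)) = u"
  proof -
    have "A *\<^sub>v (transpose_mat A *\<^sub>v (H *\<^sub>v u)) = (A * (transpose_mat A * H)) *\<^sub>v u"
      using A At H u by (simp add: assoc_mult_mat_vec[of _ d d _ d])
    then show ?thesis
      using \<open>A * (transpose_mat A * H) = 1\<^sub>m d\<close> u by simp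
  qed
  moreover have "vec d (\<lambda>i. (transpose_mat A *\<^sub>v (H *\<^sub>v u)) $ i) = transpose_mat A *\<^sub>v (H *\<^sub>v u)"
    using A by (intro eq_vecI) auto
  ultimately show ?thesis
    unfolding ax_def by metis
qed

lemma ax_zero: "ax (\<lambda>_. 0) = 0\<^sub>v d"
  using carrier_vecD[OF ax_carrier] by (intro eq_vecI) (simp_all add: ax_index)

lemma emb_surj:
  assumes m: "m \<in> carrier_vec d" and b: "b \<in> carrier_vec d"
  shows "\<exists>x. emb m x = b"
proof -
  obtain x where "ax x = b - m" using ax_surj[of "b - m"] m b by auto
  then have "emb m x = b" using m b by (auto simp: emb_def intro!: eq_vecI)
  then show ?thesis by blast
qed

end

lemma pos_def_imp_whitening: "pos_def d H \<Longrightarrow> \<exists>A. whitening d H A"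
  by (rule pos_def_whitening) (auto simp: pos_def_def whitening_def)

section \<open>Transport of measures by the whitening map\<close>

lemma inj_on_vec: "inj_on (vec d) (space (leb d))"
proof (rule inj_onI, rule ext)
  fix x y :: "nat \<Rightarrow> real" and k
  assume xy: "x \<in> space (leb d)" "y \<in> space (leb d)" "vec d x = vec d y"
  show "x k = y k"
  proof (cases "k < d")
    case True
    then show ?thesis using arg_cong[OF xy(3), of "\<lambda>v. v $ k"] by simp
  qed (use xy in \<open>auto simp: space_PiM PiE_def extensional_def\<close>)
qed

lemma space_lborel_vec: "space (lborel_vec d) = carrier_vec d"
proof -
  have "u \<in> vec d ` (\<Pi>\<^sub>E i\<in>{..<d}. UNIV)" if "u \<in> carrier_vec d" for u :: rvec
    using that by (intro image_eqI[of _ _ "\<lambda>i\<in>{..<d}. u $ i"]) (auto intro!: eq_vecI)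
  then show ?thesis
    by (auto simp: lborel_vec_def space_embed_measure space_PiM)
qed

lemma measurable_lborel_vecI: "(\<lambda>x. f (vec d x)) \<in> leb d \<rightarrow>\<^sub>M N \<Longrightarrow> f \<in> lborel_vec d \<rightarrow>\<^sub>M N"
  unfolding lborel_vec_def by (rule measurable_embed_measure1)

lemma measurable_vec: "vec d \<in> leb d \<rightarrow>\<^sub>M lborel_vec d"
  unfolding lborel_vec_def by (rule measurable_embed_measure2'[OF inj_on_vec])

lemma nn_integral_lborel_vec:
  "f \<in> borel_measurable (lborel_vec d) \<Longrightarrow> (\<integral>\<^sup>+b. f b \<partial>lborel_vec d) = (\<integral>\<^sup>+x. f (vec d x) \<partial>leb d)"
  unfolding lborel_vec_def by (rule nn_integral_embed_measure'[OF inj_on_vec])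

lemma measurable_lborel_vec_index [measurable]: "i < d \<Longrightarrow> (\<lambda>b. b $ i) \<in> borel_measurable (lborel_vec d)"
proof (rule measurable_lborel_vecI)
  assume "i < d"
  then show "(\<lambda>x. vec d x $ i) \<in> borel_measurable (leb d)"
    using measurable_component_singleton[of i "{..<d}" "\<lambda>_. lborel"] by simp
qed

context whitening
begin

lemma emb_vec: "m \<in> carrier_vec d \<Longrightarrow> emb m x = vec d (\<lambda>i\<in>{..<d}. m $ i + (\<Sum>j\<in>{i..<d}. A $$ (i, j) * x j))"
  by (rule eq_vecI) (use ax_carrier[of x] in \<open>auto simp: emb_def ax_index_upper simp del: ax_carrier\<close>)

lemma measurable_emb [measurable]: "m \<in> carrier_vec d \<Longrightarrow> emb m \<in> leb d \<rightarrow>\<^sub>M lborel_vec d"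
proof -
  assume m: "m \<in> carrier_vec d"
  have [measurable]: "(\<lambda>x. x j) \<in> borel_measurable (leb d)" if "j < d" for j
    using that measurable_component_singleton[of j "{..<d}" "\<lambda>_. lborel"] by simp
  have "(\<lambda>x. \<lambda>i\<in>{..<d}. m $ i + (\<Sum>j\<in>{i..<d}. A $$ (i, j) * x j)) \<in> leb d \<rightarrow>\<^sub>M leb d"
    by (rule measurable_restrict) auto
  from measurable_compose[OF this measurable_vec] show ?thesis
    by (simp add: emb_vec[OF m, symmetric])
qed

lemma measurable_emb_gauss: "m \<in> carrier_vec d \<Longrightarrow> emb m \<in> gauss d \<rightarrow>\<^sub>M lborel_vec d"
  using measurable_emb by (simp cong: measurable_cong_sets add: sets_gauss)

lemma prod_diag_pos: "0 < (\<Prod>i<d. A $$ (i, i))"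
  using diag by (intro prod_pos) auto

lemma nn_integral_emb:
  assumes m: "m \<in> carrier_vec d" and f[measurable]: "f \<in> borel_measurable (lborel_vec d)"
  shows "(\<integral>\<^sup>+b. f b \<partial>lborel_vec d) = ennreal (\<Prod>i<d. A $$ (i, i)) * (\<integral>\<^sup>+x. f (emb m x) \<partial>leb d)"
proof -
  have "(\<integral>\<^sup>+b. f b \<partial>lborel_vec d) = (\<integral>\<^sup>+x. f (vec d x) \<partial>leb d)"
    by (rule nn_integral_lborel_vec[OF f])
  also have "\<dots> = ennreal (\<Prod>i<d. \<bar>A $$ (i, i)\<bar>) * (\<integral>\<^sup>+x. f (vec d (\<lambda>i\<in>{..<d}. m $ i + (\<Sum>j\<in>{i..<d}. A $$ (i, j) * x j))) \<partial>leb d)"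
    using diag measurable_compose[OF measurable_vec f]
    by (intro nn_integral_leb_upper_triangular[where A = "\<lambda>i j. A $$ (i, j)"]) (auto simp: less_imp_neq[symmetric])
  also have "(\<Prod>i<d. \<bar>A $$ (i, i)\<bar>) = (\<Prod>i<d. A $$ (i, i))"
    using diag by (intro prod.cong) (auto simp: less_imp_le)
  finally show ?thesis unfolding emb_vec[OF m] .
qed

text \<open>One substitution for two measures: \<open>\<rho> = 1\<close> gives the Laplace
  approximation, and \<open>\<rho>\<close> proportional to \<open>exp r\<close> gives the
  posterior.\<close>

lemma density_emb_gauss:
  assumes m: "m \<in> carrier_vec d"
    and F[measurable]: "F \<in> borel_measurable (lborel_vec d)"
    and \<rho>[measurable]: "\<rho> \<in> borel_measurable (leb d)" and \<rho>0: "\<And>x. 0 \<le> \<rho> x"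
    and eq: "\<And>x. F (emb m x) * (\<Prod>i<d. A $$ (i, i)) = gdens d x * \<rho> x"
  shows "density (lborel_vec d) (\<lambda>b. ennreal (F b)) = distr (density (gauss d) (\<lambda>x. ennreal (\<rho> x))) (lborel_vec d) (emb m)"
proof (rule measure_eqI)
  fix X assume "X \<in> sets (density (lborel_vec d) (\<lambda>b. ennreal (F b)))"
  then have X[measurable]: "X \<in> sets (lborel_vec d)" by simp
  have e: "emb m \<in> density (gauss d) (\<lambda>x. ennreal (\<rho> x)) \<rightarrow>\<^sub>M lborel_vec d"
    using measurable_emb_gauss[OF m] by simp
  have [measurable]: "emb m \<in> leb d \<rightarrow>\<^sub>M lborel_vec d" by (rule measurable_emb[OF m])
  have [measurable]: "\<rho> \<in> borel_measurable (gauss d)" by (rule measurable_gauss_leb[OF \<rho>])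
  have [measurable]: "emb m \<in> gauss d \<rightarrow>\<^sub>M lborel_vec d" by (rule measurable_emb_gauss[OF m])
  have "emeasure (density (lborel_vec d) (\<lambda>b. ennreal (F b))) X = (\<integral>\<^sup>+b. ennreal (F b) * indicator X b \<partial>lborel_vec d)"
    by (rule emeasure_density) auto
  also have "\<dots> = ennreal (\<Prod>i<d. A $$ (i, i)) * (\<integral>\<^sup>+x. ennreal (F (emb m x)) * indicator X (emb m x) \<partial>leb d)"
    by (rule nn_integral_emb[OF m]) auto
  also have "\<dots> = (\<integral>\<^sup>+x. ennreal (\<Prod>i<d. A $$ (i, i)) * (ennreal (F (emb m x)) * indicator X (emb m x)) \<partial>leb d)"
    by (rule nn_integral_cmult[symmetric]) measurable
  also have "\<dots> = (\<integral>\<^sup>+x. ennreal (gdens d x) * (ennreal (\<rho> x) * indicator X (emb m x)) \<partial>leb d)"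
  proof (rule nn_integral_cong)
    fix x
    have "ennreal (\<Prod>i<d. A $$ (i, i)) * ennreal (F (emb m x)) = ennreal (F (emb m x) * (\<Prod>i<d. A $$ (i, i)))"
      using prod_diag_pos by (simp add: ennreal_mult'' mult.commute)
    also have "\<dots> = ennreal (gdens d x) * ennreal (\<rho> x)"
      unfolding eq using \<rho>0 by (intro ennreal_mult) auto
    finally show "ennreal (\<Prod>i<d. A $$ (i, i)) * (ennreal (F (emb m x)) * indicator X (emb m x))
        = ennreal (gdens d x) * (ennreal (\<rho> x) * indicator X (emb m x))"
      by (simp add: mult.assoc[symmetric])
  qed
  also have "\<dots> = (\<integral>\<^sup>+x. ennreal (\<rho> x) * indicator X (emb m x) \<partial>gauss d)"
    by (rule nn_integral_gauss[symmetric]) measurable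
  also have "\<dots> = (\<integral>\<^sup>+x. indicator X (emb m x) \<partial>density (gauss d) (\<lambda>x. ennreal (\<rho> x)))"
    by (rule nn_integral_density[symmetric]) measurable
  also have "\<dots> = (\<integral>\<^sup>+b. indicator X b \<partial>distr (density (gauss d) (\<lambda>x. ennreal (\<rho> x))) (lborel_vec d) (emb m))"
    using e by (intro nn_integral_distr[symmetric]) auto
  also have "\<dots> = emeasure (distr (density (gauss d) (\<lambda>x. ennreal (\<rho> x))) (lborel_vec d) (emb m)) X"
    by simp
  finally show "emeasure (density (lborel_vec d) (\<lambda>b. ennreal (F b))) X
      = emeasure (distr (density (gauss d) (\<lambda>x. ennreal (\<rho> x))) (lborel_vec d) (emb m)) X" .
qed simp

lemma measurable_quadratic [measurable]: "m \<in> carrier_vec d \<Longrightarrow> (\<lambda>b. (b - m) \<bullet> (H *\<^sub>v (b - m))) \<in> borel_measurable (lborel_vec d)"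
proof -
  assume m: "m \<in> carrier_vec d"
  have "(b - m) \<bullet> (H *\<^sub>v (b - m)) = bf d (\<lambda>i j. H $$ (i, j)) (\<lambda>i. b $ i - m $ i) (\<lambda>i. b $ i - m $ i)"
    if "b \<in> space (lborel_vec d)" for b
    using that m H by (subst quadratic_form_bf[of _ d]) (auto simp: space_lborel_vec bf_def)
  moreover have "(\<lambda>b. bf d (\<lambda>i j. H $$ (i, j)) (\<lambda>i. b $ i - m $ i) (\<lambda>i. b $ i - m $ i)) \<in> borel_measurable (lborel_vec d)"
    unfolding bf_def by measurable
  ultimately show ?thesis by (simp cong: measurable_cong)
qed

lemma gaussian_eq_distr:
  assumes m: "m \<in> carrier_vec d"
  shows "gaussian d m (mat_inv H) = distr (gauss d) (lborel_vec d) (emb m)"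
proof -
  have "gaussian d m (mat_inv H) = distr (density (gauss d) (\<lambda>x. ennreal 1)) (lborel_vec d) (emb m)"
    unfolding gaussian_def
  proof (rule density_emb_gauss[OF m])
    fix x
    have "(emb m x - m) \<bullet> (H *\<^sub>v (emb m x - m)) = sqn d x"
      by (simp add: emb_minus[OF m] quadratic_ax dot_self)
    moreover have "e / (s * Q) * Q = e / s * 1" if "0 < Q" for e s Q :: real
      using that by simp
    note this[OF prod_diag_pos]
    moreover have "sqrt ((2 * pi) ^ d * Determinant.det (mat_inv H)) = sqrt (2 * pi) ^ d * (\<Prod>i<d. A $$ (i, i))"
      unfolding det_mat_inv_H real_sqrt_mult[of "(2 * pi) ^ d"] real_sqrt_power[of "2 * pi"]
      using prod_diag_pos by simp
    ultimately show "exp (- ((emb m x - m) \<bullet> (mat_inv (mat_inv H) *\<^sub>v (emb m x - m))) / 2) / sqrt ((2 * pi) ^ d * Determinant.det (mat_inv H))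
        * (\<Prod>i<d. A $$ (i, i)) = gdens d x * 1"
      by (simp only: mat_inv_mat_inv_H)
  qed (use measurable_quadratic[OF m] in \<open>auto simp: mat_inv_mat_inv_H\<close>)
  then show ?thesis by (simp add: density_1)
qed

end

section \<open>Derivatives of the potential\<close>

lemma scalar_prod_add_smult:
  fixes x b h :: rvec
  assumes "x \<in> carrier_vec d" "b \<in> carrier_vec d" "h \<in> carrier_vec d"
  shows "x \<bullet> (b + t \<cdot>\<^sub>v h) = x \<bullet> b + t * (x \<bullet> h)"
  using assms by (subst scalar_prod_add_distrib[of _ d]) auto

lemma sum_cube:
  fixes f :: "nat \<Rightarrow> real"
  shows "(\<Sum>i\<in>I. f i) ^ 3 = (\<Sum>i\<in>I. \<Sum>j\<in>I. \<Sum>k\<in>I. f i * (f j * f k))"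
proof -
  have "(\<Sum>i\<in>I. f i) ^ 3 = (\<Sum>i\<in>I. f i) * ((\<Sum>i\<in>I. f i) * (\<Sum>i\<in>I. f i))"
    by (simp add: power3_eq_cube mult.assoc)
  also have "\<dots> = (\<Sum>i\<in>I. f i * ((\<Sum>i\<in>I. f i) * (\<Sum>i\<in>I. f i)))"
    by (rule sum_distrib_right)
  also have "\<dots> = (\<Sum>i\<in>I. f i * (\<Sum>j\<in>I. \<Sum>k\<in>I. f j * f k))"
    by (simp only: sum_product)
  finally show ?thesis by (simp only: sum_distrib_left)
qed

lemma sum_mult_double_sum:
  fixes a :: "nat \<Rightarrow> real"
  shows "(\<Sum>i\<in>I. a i) * (\<Sum>j\<in>J. \<Sum>k\<in>K. b j k) = (\<Sum>i\<in>I. \<Sum>j\<in>J. \<Sum>k\<in>K. a i * b j k)"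
  by (subst sum_distrib_right) (simp only: sum_distrib_left)

text \<open>The formula \<open>F\<close> for \<open>f\<close> need only hold on the carrier, which
  every coordinate line through \<open>b\<close> stays in. This permits iterating partial
  derivatives with closed formulas.\<close>

lemma partial_derivI:
  assumes "\<And>b. b \<in> carrier_vec d \<Longrightarrow> f b = F b" "b \<in> carrier_vec d"
    and "((\<lambda>t. F (b + t \<cdot>\<^sub>v unit_vec d i)) has_real_derivative D) (at 0)"
  shows "partial_deriv d i f b = D"
proof -
  have "(\<lambda>t. f (b + t \<cdot>\<^sub>v unit_vec d i)) = (\<lambda>t. F (b + t \<cdot>\<^sub>v unit_vec d i))"
    using assms by (intro ext assms(1)) auto
  then show ?thesis
    using assms(3) by (simp add: partial_deriv_def DERIV_imp_deriv)
qed

text \<open>A positive semidefinite precision \<open>P\<close> covers the flat and the Gaussian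
  prior at once.\<close>

locale logistic_data =
  fixes d n :: nat and P :: rmat and D :: "nat \<Rightarrow> rvec \<times> bool"
  assumes n1: "1 \<le> n"
    and X: "\<And>i. i < n \<Longrightarrow> fst (D i) \<in> carrier_vec d"
    and P: "pos_semidef d P"
begin

abbreviation "Xv i \<equiv> fst (D i)"

abbreviation Yv :: "nat \<Rightarrow> real" where "Yv i \<equiv> of_bool (snd (D i))"

abbreviation "V \<equiv> potential n P D"

lemma P_carrier: "P \<in> carrier_mat d d" and P_sym: "transpose_mat P = P"
  and P_psd: "u \<in> carrier_vec d \<Longrightarrow> 0 \<le> u \<bullet> (P *\<^sub>v u)"
  using P by (auto simp: pos_semidef_def)

lemma P_symD: "i < d \<Longrightarrow> j < d \<Longrightarrow> P $$ (i, j) = P $$ (j, i)"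
  by (rule sym_matD[OF P_sym P_carrier])

lemma P_comm: "u \<in> carrier_vec d \<Longrightarrow> v \<in> carrier_vec d \<Longrightarrow> u \<bullet> (P *\<^sub>v v) = v \<bullet> (P *\<^sub>v u)"
  using P_carrier by (simp add: quadratic_form_bf[of _ d]) (rule bf_commute[OF P_symD])

lemma P_line:
  assumes b: "b \<in> carrier_vec d" and h: "h \<in> carrier_vec d"
  shows "(b + t \<cdot>\<^sub>v h) \<bullet> (P *\<^sub>v (b + t \<cdot>\<^sub>v h)) = b \<bullet> (P *\<^sub>v b) + 2 * t * (b \<bullet> (P *\<^sub>v h)) + t\<^sup>2 * (h \<bullet> (P *\<^sub>v h))"
proof -
  have "P *\<^sub>v (b + t \<cdot>\<^sub>v h) = P *\<^sub>v b + t \<cdot>\<^sub>v (P *\<^sub>v h)"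
    using P_carrier b h by (simp add: mult_add_distrib_mat_vec[of _ d d] mult_mat_vec[of _ d d])
  moreover have "(b + t \<cdot>\<^sub>v h) \<bullet> (P *\<^sub>v b + t \<cdot>\<^sub>v (P *\<^sub>v h))
      = (b + t \<cdot>\<^sub>v h) \<bullet> (P *\<^sub>v b) + t * ((b + t \<cdot>\<^sub>v h) \<bullet> (P *\<^sub>v h))"
    using P_carrier b h by (intro scalar_prod_add_smult[of _ d]) auto
  moreover have "(b + t \<cdot>\<^sub>v h) \<bullet> (P *\<^sub>v u) = b \<bullet> (P *\<^sub>v u) + t * (h \<bullet> (P *\<^sub>v u))" if "u \<in> carrier_vec d" for u
    using P_carrier b h that by (subst add_scalar_prod_distrib[of _ d]) auto
  ultimately show ?thesis
    using b h P_comm[OF b h] by (simp add: power2_eq_square algebra_simps)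
qed

lemma V_line:
  assumes b: "b \<in> carrier_vec d" and h: "h \<in> carrier_vec d"
  shows "V (b + t \<cdot>\<^sub>v h) = - (\<Sum>i<n. Yv i * (Xv i \<bullet> b + t * (Xv i \<bullet> h)))
    + (\<Sum>i<n. softplus (Xv i \<bullet> b + t * (Xv i \<bullet> h)))
    + (b \<bullet> (P *\<^sub>v b) + 2 * t * (b \<bullet> (P *\<^sub>v h)) + t\<^sup>2 * (h \<bullet> (P *\<^sub>v h))) / 2"
  unfolding potential_def P_line[OF assms]
  by (intro arg_cong2[where f = "(+)"] arg_cong[of _ _ uminus] sum.cong refl) (simp_all add: scalar_prod_add_smult[OF X b h])

lemma V_line_deriv:
  assumes b: "b \<in> carrier_vec d" and h: "h \<in> carrier_vec d"
  shows "((\<lambda>t. V (b + t \<cdot>\<^sub>v h)) has_real_derivative (\<Sum>i<n. (sigmoid (Xv i \<bullet> b) - Yv i) * (Xv i \<bullet> h)) + b \<bullet> (P *\<^sub>v h)) (at 0)"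
  unfolding V_line[OF assms]
  by (auto intro!: derivative_eq_intros DERIV_chain2[OF DERIV_softplus] simp: sum_subtractf left_diff_distrib right_diff_distrib sum_negf mult.commute simp del: sum_mult_of_bool_eq sum_of_bool_mult_eq)

lemma partial_V: "b \<in> carrier_vec d \<Longrightarrow> i < d \<Longrightarrow> partial_deriv d i V b
    = (\<Sum>l<n. (sigmoid (Xv l \<bullet> b) - Yv l) * Xv l $ i) + b \<bullet> (P *\<^sub>v unit_vec d i)"
  by (rule partial_derivI[where F = V], simp, simp)
    (use V_line_deriv[of b "unit_vec d i"] X in \<open>simp add: scalar_prod_right_unit[of _ d] cong: sum.cong\<close>)

lemma P_unit: "i < d \<Longrightarrow> j < d \<Longrightarrow> unit_vec d i \<bullet> (P *\<^sub>v unit_vec d j) = P $$ (i, j)"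
  using P_carrier by (subst scalar_prod_left_unit[of _ d]) (auto simp: scalar_prod_right_unit[of _ d])

lemma partial2_V: "b \<in> carrier_vec d \<Longrightarrow> i < d \<Longrightarrow> j < d \<Longrightarrow> partial_deriv d i (partial_deriv d j V) b
    = (\<Sum>l<n. dsig 2 (Xv l \<bullet> b) * Xv l $ i * Xv l $ j) + P $$ (i, j)"
proof (rule partial_derivI[OF partial_V])
  assume b: "b \<in> carrier_vec d" and i: "i < d" and j: "j < d"
  have X': "Xv l \<bullet> (b + t \<cdot>\<^sub>v unit_vec d i) = Xv l \<bullet> b + t * Xv l $ i" if "l < n" for l t
    using b i X[OF that] by (subst scalar_prod_add_smult[of _ d]) (auto simp: scalar_prod_right_unit[of _ d])
  have P': "(b + t \<cdot>\<^sub>v unit_vec d i) \<bullet> (P *\<^sub>v unit_vec d j) = b \<bullet> (P *\<^sub>v unit_vec d j) + t * P $$ (i, j)" for t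
    using b i j P_carrier P_unit[OF i j] by (subst add_scalar_prod_distrib[of _ d]) auto
  have "((\<lambda>t. (\<Sum>l<n. (sigmoid (Xv l \<bullet> b + t * Xv l $ i) - Yv l) * Xv l $ j) + (b \<bullet> (P *\<^sub>v unit_vec d j) + t * P $$ (i, j)))
      has_real_derivative (\<Sum>l<n. dsig 2 (Xv l \<bullet> b) * Xv l $ i * Xv l $ j) + P $$ (i, j)) (at 0)"
    by (auto intro!: derivative_eq_intros DERIV_chain2[OF DERIV_sigmoid] simp: dsig_def Let_def)
  then show "((\<lambda>t. (\<Sum>l<n. (sigmoid (Xv l \<bullet> (b + t \<cdot>\<^sub>v unit_vec d i)) - Yv l) * Xv l $ j) + (b + t \<cdot>\<^sub>v unit_vec d i) \<bullet> (P *\<^sub>v unit_vec d j))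
      has_real_derivative (\<Sum>l<n. dsig 2 (Xv l \<bullet> b) * Xv l $ i * Xv l $ j) + P $$ (i, j)) (at 0)"
    by (simp add: P' X' cong: sum.cong_simp)
qed

lemma third_deriv_V: "b \<in> carrier_vec d \<Longrightarrow> i < d \<Longrightarrow> j < d \<Longrightarrow> k < d \<Longrightarrow>
    third_deriv d V b i j k = (\<Sum>l<n. dsig 3 (Xv l \<bullet> b) * Xv l $ i * Xv l $ j * Xv l $ k)"
  unfolding third_deriv_def
proof (rule partial_derivI[OF partial2_V])
  assume b: "b \<in> carrier_vec d" and i: "i < d" and j: "j < d" and k: "k < d"
  have X': "Xv l \<bullet> (b + t \<cdot>\<^sub>v unit_vec d i) = Xv l \<bullet> b + t * Xv l $ i" if "l < n" for l t
    using b i X[OF that] by (subst scalar_prod_add_smult[of _ d]) (auto simp: scalar_prod_right_unit[of _ d])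
  have d2: "(dsig 2 has_real_derivative dsig 3 t) (at t)" for t
    using DERIV_dsig[of 2 t] by (simp add: eval_nat_numeral)
  have "((\<lambda>t. (\<Sum>l<n. dsig 2 (Xv l \<bullet> b + t * Xv l $ i) * Xv l $ j * Xv l $ k) + P $$ (j, k))
      has_real_derivative (\<Sum>l<n. dsig 3 (Xv l \<bullet> b) * Xv l $ i * Xv l $ j * Xv l $ k)) (at 0)"
    by (auto intro!: derivative_eq_intros DERIV_chain2[OF d2])
  then show "((\<lambda>t. (\<Sum>l<n. dsig 2 (Xv l \<bullet> (b + t \<cdot>\<^sub>v unit_vec d i)) * Xv l $ j * Xv l $ k) + P $$ (j, k))
      has_real_derivative (\<Sum>l<n. dsig 3 (Xv l \<bullet> b) * Xv l $ i * Xv l $ j * Xv l $ k)) (at 0)"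
    by (simp add: X' cong: sum.cong_simp)
qed

lemma hessian_carrier: "hessian d V b \<in> carrier_mat d d"
  by (simp add: hessian_def)

lemma hessian_index: "b \<in> carrier_vec d \<Longrightarrow> i < d \<Longrightarrow> j < d \<Longrightarrow>
    hessian d V b $$ (i, j) = (\<Sum>l<n. dsig 2 (Xv l \<bullet> b) * Xv l $ i * Xv l $ j) + P $$ (i, j)"
  by (simp add: hessian_def partial2_V)

lemma hessian_sym: "b \<in> carrier_vec d \<Longrightarrow> transpose_mat (hessian d V b) = hessian d V b"
  by (rule eq_matI) (auto simp: hessian_index hessian_carrier[THEN carrier_matD(1)] hessian_carrier[THEN carrier_matD(2)]
    P_symD intro!: sum.cong)

lemma hessian_quadratic:
  assumes "b \<in> carrier_vec d" "u \<in> carrier_vec d"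
  shows "u \<bullet> (hessian d V b *\<^sub>v u) = (\<Sum>l<n. dsig 2 (Xv l \<bullet> b) * (Xv l \<bullet> u)\<^sup>2) + u \<bullet> (P *\<^sub>v u)"
proof -
  have "u \<bullet> (hessian d V b *\<^sub>v u) = (\<Sum>i<d. \<Sum>j<d. u $ i * ((\<Sum>l<n. dsig 2 (Xv l \<bullet> b) * Xv l $ i * Xv l $ j) + P $$ (i, j)) * u $ j)"
    using assms hessian_carrier by (subst quadratic_form_bf[of _ d]) (auto simp: bf_def hessian_index intro!: sum.cong)
  also have "\<dots> = (\<Sum>i<d. \<Sum>j<d. \<Sum>l<n. dsig 2 (Xv l \<bullet> b) * ((Xv l $ i * u $ i) * (Xv l $ j * u $ j))) + u \<bullet> (P *\<^sub>v u)"
    using assms P_carrier by (subst quadratic_form_bf[of _ d])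
      (auto simp: bf_def distrib_left distrib_right sum.distrib sum_distrib_left sum_distrib_right mult_ac intro!: sum.cong)
  also have "(\<Sum>i<d. \<Sum>j<d. \<Sum>l<n. dsig 2 (Xv l \<bullet> b) * ((Xv l $ i * u $ i) * (Xv l $ j * u $ j)))
      = (\<Sum>l<n. \<Sum>i<d. \<Sum>j<d. dsig 2 (Xv l \<bullet> b) * ((Xv l $ i * u $ i) * (Xv l $ j * u $ j)))"
    by (subst (2) sum.swap, subst sum.swap) (rule refl)
  also have "\<dots> = (\<Sum>l<n. dsig 2 (Xv l \<bullet> b) * (Xv l \<bullet> u)\<^sup>2)"
  proof (rule sum.cong)
    fix l assume "l \<in> {..<n}"
    then have "Xv l \<bullet> u = (\<Sum>i<d. Xv l $ i * u $ i)"
      using assms X by (simp add: scalar_prod_def lessThan_atLeast0)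
    then have "(Xv l \<bullet> u)\<^sup>2 = (\<Sum>i<d. \<Sum>j<d. (Xv l $ i * u $ i) * (Xv l $ j * u $ j))"
      by (simp add: power2_eq_square sum_product)
    then show "(\<Sum>i<d. \<Sum>j<d. dsig 2 (Xv l \<bullet> b) * ((Xv l $ i * u $ i) * (Xv l $ j * u $ j))) = dsig 2 (Xv l \<bullet> b) * (Xv l \<bullet> u)\<^sup>2"
      by (simp add: sum_distrib_left)
  qed simp
  finally show ?thesis .
qed

text \<open>Each observation contributes a multiple of the third tensor power of its covariate to
  the third derivative, so the cubic form collapses to a sum of cubes.\<close>

lemma skew_eq:
  assumes b: "m \<in> carrier_vec d" "b \<in> carrier_vec d"
  shows "skew d V m b = - (\<Sum>l<n. dsig 3 (Xv l \<bullet> m) * (Xv l \<bullet> (b - m)) ^ 3) / 6"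
proof -
  define y where "y = b - m"
  have y: "y \<in> carrier_vec d" using b by (simp add: y_def)
  have "cubic_form d (third_deriv d V m) y
      = (\<Sum>i<d. \<Sum>j<d. \<Sum>k<d. \<Sum>l<n. dsig 3 (Xv l \<bullet> m) * ((Xv l $ i * y $ i) * ((Xv l $ j * y $ j) * (Xv l $ k * y $ k))))"
    unfolding cubic_form_def using b
    by (intro sum.cong refl) (simp add: third_deriv_V sum_distrib_left sum_distrib_right mult_ac)
  also have "\<dots> = (\<Sum>l<n. \<Sum>i<d. \<Sum>j<d. \<Sum>k<d. dsig 3 (Xv l \<bullet> m) * ((Xv l $ i * y $ i) * ((Xv l $ j * y $ j) * (Xv l $ k * y $ k))))"
    by (subst (3) sum.swap, subst (2) sum.swap, subst sum.swap) (rule refl)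
  also have "\<dots> = (\<Sum>l<n. dsig 3 (Xv l \<bullet> m) * (Xv l \<bullet> y) ^ 3)"
  proof (rule sum.cong)
    fix l assume "l \<in> {..<n}"
    then have "Xv l \<bullet> y = (\<Sum>i<d. Xv l $ i * y $ i)"
      using y X by (simp add: scalar_prod_def lessThan_atLeast0)
    then have "(Xv l \<bullet> y) ^ 3 = (\<Sum>i<d. \<Sum>j<d. \<Sum>k<d. (Xv l $ i * y $ i) * ((Xv l $ j * y $ j) * (Xv l $ k * y $ k)))"
      by (simp only: sum_cube)
    then show "(\<Sum>i<d. \<Sum>j<d. \<Sum>k<d. dsig 3 (Xv l \<bullet> m) * ((Xv l $ i * y $ i) * ((Xv l $ j * y $ j) * (Xv l $ k * y $ k))))
        = dsig 3 (Xv l \<bullet> m) * (Xv l \<bullet> y) ^ 3"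
      by (simp add: sum_distrib_left)
  qed simp
  finally show ?thesis by (simp add: skew_def y_def)
qed

lemma tensor_mat_dot:
  assumes m: "m \<in> carrier_vec d" and v: "v \<in> carrier_vec d" and K: "K \<in> carrier_mat d d"
  shows "v \<bullet> tensor_mat d (third_deriv d V m) K = (\<Sum>l<n. dsig 3 (Xv l \<bullet> m) * (Xv l \<bullet> v) * (Xv l \<bullet> (K *\<^sub>v Xv l)))"
proof -
  have "v \<bullet> tensor_mat d (third_deriv d V m) K = (\<Sum>i<d. \<Sum>j<d. \<Sum>k<d. \<Sum>l<n. dsig 3 (Xv l \<bullet> m) * ((Xv l $ i * v $ i) * (Xv l $ j * K $$ (j, k) * Xv l $ k)))"
  proof -
    have "v \<bullet> tensor_mat d (third_deriv d V m) K = (\<Sum>i<d. v $ i * (\<Sum>j<d. \<Sum>k<d. third_deriv d V m i j k * K $$ (j, k)))"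
      using v by (subst scalar_prod_eq_dot[of _ d]) (auto simp: dot_def tensor_mat_def)
    also have "\<dots> = (\<Sum>i<d. \<Sum>j<d. \<Sum>k<d. v $ i * (third_deriv d V m i j k * K $$ (j, k)))"
      by (simp only: sum_distrib_left)
    also have "\<dots> = (\<Sum>i<d. \<Sum>j<d. \<Sum>k<d. \<Sum>l<n. dsig 3 (Xv l \<bullet> m) * ((Xv l $ i * v $ i) * (Xv l $ j * K $$ (j, k) * Xv l $ k)))"
      using m by (intro sum.cong refl) (simp add: third_deriv_V sum_distrib_left sum_distrib_right mult_ac)
    finally show ?thesis .
  qed
  also have "\<dots> = (\<Sum>l<n. \<Sum>i<d. \<Sum>j<d. \<Sum>k<d. dsig 3 (Xv l \<bullet> m) * ((Xv l $ i * v $ i) * (Xv l $ j * K $$ (j, k) * Xv l $ k)))"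
    by (subst (3) sum.swap, subst (2) sum.swap, subst sum.swap) (rule refl)
  also have "\<dots> = (\<Sum>l<n. dsig 3 (Xv l \<bullet> m) * (Xv l \<bullet> v) * (Xv l \<bullet> (K *\<^sub>v Xv l)))"
  proof (rule sum.cong)
    fix l assume l: "l \<in> {..<n}"
    then have 1: "Xv l \<bullet> v = (\<Sum>i<d. Xv l $ i * v $ i)"
      using v X by (simp add: scalar_prod_def lessThan_atLeast0)
    have 2: "Xv l \<bullet> (K *\<^sub>v Xv l) = (\<Sum>j<d. \<Sum>k<d. Xv l $ j * K $$ (j, k) * Xv l $ k)"
      using l X K by (subst quadratic_form_bf[of _ d]) (auto simp: bf_def)
    show "(\<Sum>i<d. \<Sum>j<d. \<Sum>k<d. dsig 3 (Xv l \<bullet> m) * ((Xv l $ i * v $ i) * (Xv l $ j * K $$ (j, k) * Xv l $ k)))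
        = dsig 3 (Xv l \<bullet> m) * (Xv l \<bullet> v) * (Xv l \<bullet> (K *\<^sub>v Xv l))"
      unfolding 1 2 mult.assoc[of "dsig 3 (Xv l \<bullet> m)"] sum_mult_double_sum by (simp only: sum_distrib_left)
  qed simp
  finally show ?thesis .
qed

section \<open>Location of the minimizer and the Hessian there\<close>

lemma first_order:
  assumes m: "is_arg_min V (\<lambda>b. b \<in> carrier_vec d) m" and h: "h \<in> carrier_vec d"
  shows "(\<Sum>i<n. (sigmoid (Xv i \<bullet> m) - Yv i) * (Xv i \<bullet> h)) + m \<bullet> (P *\<^sub>v h) = 0"
proof (rule DERIV_local_min)
  have mc: "m \<in> carrier_vec d" using m by (simp add: is_arg_min_def)
  show "((\<lambda>t. V (m + t \<cdot>\<^sub>v h)) has_real_derivative (\<Sum>i<n. (sigmoid (Xv i \<bullet> m) - Yv i) * (Xv i \<bullet> h)) + m \<bullet> (P *\<^sub>v h)) (at 0)"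
    by (rule V_line_deriv[OF mc h])
  have "m + 0 \<cdot>\<^sub>v h = m" using mc h by (intro eq_vecI) auto
  then have "V (m + 0 \<cdot>\<^sub>v h) \<le> V (m + t \<cdot>\<^sub>v h)" for t
    using m mc h by (auto simp: is_arg_min_linorder)
  then show "\<forall>t. \<bar>0 - t\<bar> < 1 \<longrightarrow> V (m + 0 \<cdot>\<^sub>v h) \<le> V (m + t \<cdot>\<^sub>v h)" by blast
qed simp

text \<open>The logistic loss dominates the misclassified margin, since \<open>softplus t\<close>
  exceeds both \<open>0\<close> and \<open>t\<close>. This makes the potential coercive once the
  margins are bounded below.\<close>

lemma loss_ge: "max 0 (- (if y then 1 else - 1) * t) \<le> softplus t - of_bool y * t"
proof -
  have "t \<le> softplus t" "0 \<le> softplus t" for t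
    unfolding softplus_def by (auto simp: ln_ge_iff add_pos_pos)
  then show ?thesis by (cases y) (auto simp: max_def)
qed

lemma V_ge:
  assumes "b \<in> carrier_vec d"
  shows "(\<Sum>i<n. max 0 (- (if snd (D i) then 1 else - 1) * (Xv i \<bullet> b))) \<le> V b"
proof -
  have "(\<Sum>i<n. max 0 (- (if snd (D i) then 1 else - 1) * (Xv i \<bullet> b))) \<le> (\<Sum>i<n. softplus (Xv i \<bullet> b) - Yv i * (Xv i \<bullet> b))"
    by (intro sum_mono loss_ge)
  then show ?thesis using P_psd[OF assms] by (simp add: potential_def sum_subtractf)
qed

lemma V_zero: "V (0\<^sub>v d) = real n * ln 2"
proof -
  have "Xv i \<bullet> 0\<^sub>v d = 0" if "i < n" for i using X[OF that] by simp
  moreover have "P *\<^sub>v 0\<^sub>v d \<in> carrier_vec d" using P_carrier by simp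
  ultimately show ?thesis by (simp add: potential_def softplus_def)
qed

end

text \<open>What is needed of the sample. \<open>G1\<close> bounds fourth powers in all directions;
  \<open>G2\<close> says that every direction misclassifies a total margin proportional to its
  length, so the data are far from separable; in \<open>G3\<close> the number
  \<open>\<rho> i\<close> stands for a bound on the squared norm of the covariate after whitening
  \<open>M\<close>, and the sixth powers of these norms are bounded on average.\<close>

locale good_data = logistic_data d n P D for d n :: nat and P :: rmat and D :: "nat \<Rightarrow> rvec \<times> bool" +
  fixes M :: rmat and C4 c1 C6 :: real
  assumes d1: "1 \<le> d" and M: "pos_def d M" and C4: "0 < C4" and c1: "0 < c1" and C6: "0 \<le> C6"
    and G1: "\<And>u. u \<in> carrier_vec d \<Longrightarrow> (\<Sum>i<n. (fst (D i) \<bullet> u) ^ 4) \<le> C4 * real n * (u \<bullet> (M *\<^sub>v u))\<^sup>2"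
    and G2: "\<And>u. u \<in> carrier_vec d \<Longrightarrow>
      c1 * real n * wnorm M u \<le> (\<Sum>i<n. max 0 (- (if snd (D i) then 1 else - 1) * (fst (D i) \<bullet> u)))"
    and G3: "\<exists>\<rho>. (\<forall>i<n. 0 \<le> \<rho> i \<and> (\<forall>u\<in>carrier_vec d. (fst (D i) \<bullet> u)\<^sup>2 \<le> \<rho> i * (u \<bullet> (M *\<^sub>v u))))
      \<and> (\<Sum>i<n. \<rho> i ^ 3) \<le> C6 * real n * real d ^ 3"
begin

lemma n_pos: "0 < real n" using n1 by simp

lemma M_carrier: "M \<in> carrier_mat d d" using M by (simp add: pos_def_def)

lemma M_nonneg: "u \<in> carrier_vec d \<Longrightarrow> 0 \<le> u \<bullet> (M *\<^sub>v u)"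
  using M by (cases "u = 0\<^sub>v d") (auto simp: pos_def_def less_imp_le)

lemma wnorm_sq: "u \<in> carrier_vec d \<Longrightarrow> (wnorm M u)\<^sup>2 = u \<bullet> (M *\<^sub>v u)"
  using M_nonneg by (simp add: wnorm_def)

lemma wnorm_nonneg: "u \<in> carrier_vec d \<Longrightarrow> 0 \<le> wnorm M u"
  using M_nonneg by (simp add: wnorm_def)

lemma V_ge_wnorm: "b \<in> carrier_vec d \<Longrightarrow> c1 * real n * wnorm M b \<le> V b"
  using G2[of b] V_ge[of b] by simp

lemma sum_sq_ge:
  assumes u: "u \<in> carrier_vec d"
  shows "c1\<^sup>2 * real n * (u \<bullet> (M *\<^sub>v u)) \<le> (\<Sum>i<n. (Xv i \<bullet> u)\<^sup>2)"
proof -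
  have "c1 * real n * wnorm M u \<le> (\<Sum>i<n. 1 * \<bar>Xv i \<bullet> u\<bar>)"
    by (rule order_trans[OF G2[OF u]]) (auto intro!: sum_mono)
  then have "(c1 * real n * wnorm M u)\<^sup>2 \<le> (\<Sum>i<n. 1 * \<bar>Xv i \<bullet> u\<bar>)\<^sup>2"
    using c1 wnorm_nonneg[OF u] by (intro power_mono) auto
  also have "\<dots> \<le> (\<Sum>i<n. 1\<^sup>2) * (\<Sum>i<n. \<bar>Xv i \<bullet> u\<bar>\<^sup>2)"
    by (rule Cauchy_Schwarz_ineq_sum)
  finally have "real n * (c1\<^sup>2 * real n * (u \<bullet> (M *\<^sub>v u))) \<le> real n * (\<Sum>i<n. (Xv i \<bullet> u)\<^sup>2)"
    unfolding power_mult_distrib wnorm_sq[OF u] by (simp add: power2_eq_square mult_ac)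
  then show ?thesis using n_pos by simp
qed

text \<open>By \<open>G2\<close> the potential exceeds its value \<open>n * ln 2\<close> at the
  origin outside the \<open>M\<close>-ball of radius \<open>ln 2 / c1\<close>; inside, compactness
  yields a minimum.\<close>

lemma argmin_exists: "\<exists>m. is_arg_min V (\<lambda>b. b \<in> carrier_vec d) m"
proof -
  obtain A where "whitening d M A" using pos_def_imp_whitening[OF M] by blast
  then interpret W: whitening d M A .
  define R where "R = ln 2 / c1"
  have R: "0 \<le> R" using c1 by (simp add: R_def)
  \<comment> \<open>A box in whitened coordinates that contains the ball, with the coordinates from
    \<open>d\<close> on frozen at zero: a compact product in the function space.\<close>
  define K where "K = Pi\<^sub>E (UNIV :: nat set) (\<lambda>i. if i < d then {- R..R} else {0 :: real})"
  have "compactin (product_topology (\<lambda>i. euclidean) UNIV) K"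
    unfolding K_def by (subst compactin_PiE) auto
  then have K: "compact K"
    by (simp add: euclidean_product_topology)
  have "(\<lambda>_. 0) \<in> K" using R by (auto simp: K_def)
  then have Kne: "K \<noteq> {}" by auto
  have sp: "continuous_on UNIV softplus"
    using DERIV_softplus by (meson DERIV_isCont continuous_at_imp_continuous_on)
  have co[continuous_intros]: "continuous_on K (\<lambda>x. x i)" for i :: nat
    by (rule continuous_on_subset[OF continuous_on_product_coordinates]) simp
  have "V (W.ax x) = - (\<Sum>i<n. Yv i * dot d (W.co (Xv i)) x) + (\<Sum>i<n. softplus (dot d (W.co (Xv i)) x))
      + bf d (\<lambda>i j. P $$ (i, j)) (\<lambda>i. W.ax x $ i) (\<lambda>i. W.ax x $ i) / 2" for x
    unfolding potential_def using P_carrier X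
    by (simp add: W.scalar_prod_ax quadratic_form_bf[of _ d])
  moreover have "continuous_on K (\<lambda>x. - (\<Sum>i<n. Yv i * dot d (W.co (Xv i)) x) + (\<Sum>i<n. softplus (dot d (W.co (Xv i)) x))
      + bf d (\<lambda>i j. P $$ (i, j)) (\<lambda>i. W.ax x $ i) (\<lambda>i. W.ax x $ i) / 2)"
    unfolding bf_def dot_def
    by (intro continuous_intros continuous_on_compose2[OF sp]) (auto simp: W.ax_index intro!: continuous_intros)
  ultimately have "continuous_on K (\<lambda>x. V (W.ax x))" by simp
  then obtain x0 where x0: "x0 \<in> K" "\<And>x. x \<in> K \<Longrightarrow> V (W.ax x0) \<le> V (W.ax x)"
    using continuous_attains_inf[OF K Kne] by blast
  have "V (W.ax x0) \<le> V b" if b: "b \<in> carrier_vec d" for b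
  proof -
    obtain x where x: "W.ax x = b" using W.ax_surj[OF b] by blast
    show ?thesis
    proof (cases "sqrt (sqn d x) \<le> R")
      case True
      define x' where "x' i = (if i < d then x i else 0)" for i
      have "\<bar>x i\<bar> \<le> R" if "i < d" for i
      proof -
        have "(x i)\<^sup>2 \<le> sqn d x" unfolding sqn_def using that by (intro member_le_sum) auto
        then have "\<bar>x i\<bar> \<le> sqrt (sqn d x)" by (intro real_le_rsqrt) simp
        then show ?thesis using True by linarith
      qed
      then have "x' \<in> K" by (auto simp: K_def x'_def abs_le_iff minus_le_iff)
      moreover have "W.ax x' = W.ax x"
        unfolding W.ax_def by (rule arg_cong[of _ _ "mult_mat_vec A"], rule eq_vecI) (auto simp: x'_def)
      ultimately show ?thesis using x0(2) x by metis
    next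
      case False
      have "V (W.ax x0) \<le> V (W.ax (\<lambda>_. 0))" by (rule x0(2)) fact
      also have "\<dots> = c1 * real n * R" using c1 by (simp add: W.ax_zero V_zero R_def)
      also have "\<dots> \<le> c1 * real n * wnorm M b"
        using False c1 n_pos by (intro mult_left_mono) (auto simp: x[symmetric] W.wnorm_ax)
      also have "\<dots> \<le> V b" by (rule V_ge_wnorm[OF b])
      finally show ?thesis .
    qed
  qed
  then show ?thesis by (intro exI[of _ "W.ax x0"]) (auto simp: is_arg_min_linorder)
qed

definition Rmin :: real where "Rmin = ln 2 / c1"

text \<open>The cut-off for linear predictors at the minimizer at which
  \<open>C4 * Rmin ^ 2 / Acut ^ 2 = c1 ^ 2 / 2\<close>: observations beyond it account for at most
  half of the lower bound for the Gram form. The factor \<open>1 / 2\<close> in \<open>cH\<close> is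
  what remains.\<close>

definition Acut :: real where "Acut = sqrt (2 * C4) * Rmin / c1"

definition cH :: real where "cH = c1\<^sup>2 / (2 * (1 + exp Acut)\<^sup>2)"

lemma cH_pos: "0 < cH"
proof -
  have "0 < 1 + exp Acut" by (simp add: add_pos_pos)
  then show ?thesis using c1 by (simp add: cH_def)
qed

text \<open>Whitening by the Hessian, which is at least \<open>cH * n * M\<close>, divides fourth
  powers by \<open>cH ^ 2\<close> and sixth powers by \<open>cH ^ 3\<close>.\<close>

definition BB :: real where "BB = max 1 (max (C4 / cH\<^sup>2) (C6 / cH ^ 3))"

end

locale minimized_data = good_data +
  fixes m :: rvec
  assumes m: "is_arg_min (potential n P D) (\<lambda>b. b \<in> carrier_vec d) m"
begin

lemma m_carrier: "m \<in> carrier_vec d" using m by (simp add: is_arg_min_def)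

abbreviation "Hm \<equiv> hessian d V m"

lemma wnorm_m_le: "wnorm M m \<le> Rmin"
proof -
  have "c1 * real n * wnorm M m \<le> V m" by (rule V_ge_wnorm[OF m_carrier])
  also have "\<dots> \<le> V (0\<^sub>v d)" using m by (auto simp: is_arg_min_linorder)
  also have "\<dots> = c1 * real n * Rmin" using c1 by (simp add: V_zero Rmin_def)
  finally show ?thesis using c1 n_pos by simp
qed

text \<open>The fourth-moment bound limits the weight of the observations with a large linear predictor.\<close>

lemma hessian_ge:
  assumes u: "u \<in> carrier_vec d"
  shows "cH * real n * (u \<bullet> (M *\<^sub>v u)) \<le> u \<bullet> (Hm *\<^sub>v u)"
proof -
  \<comment> \<open>A minorant that replaces the indicator of a moderate linear predictor: at most
    the square of \<open>Xv i \<bullet> u\<close> below the cut-off, at most zero beyond it, and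
    with a sum that fourth moments control.\<close>
  let ?g = "\<lambda>i. (Xv i \<bullet> u)\<^sup>2 - (Xv i \<bullet> u)\<^sup>2 * (Xv i \<bullet> m)\<^sup>2 / Acut\<^sup>2"
  define \<kappa> where "\<kappa> = 1 / (1 + exp Acut)\<^sup>2"
  have \<kappa>: "0 < \<kappa>"
  proof -
    have "0 < 1 + exp Acut" by (simp add: add_pos_pos)
    then show ?thesis by (simp add: \<kappa>_def)
  qed
  have Rpos: "0 < Rmin" using c1 by (simp add: Rmin_def)
  have Apos: "0 < Acut" using Rpos C4 c1 by (simp add: Acut_def)
  have A2: "Acut\<^sup>2 = 2 * C4 * Rmin\<^sup>2 / c1\<^sup>2"
    using C4 by (simp add: Acut_def power_mult_distrib power_divide)
  have pt: "\<kappa> * ?g i \<le> dsig 2 (Xv i \<bullet> m) * (Xv i \<bullet> u)\<^sup>2" for i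
  proof (cases "\<bar>Xv i \<bullet> m\<bar> \<le> Acut")
    case True
    have "\<kappa> * ?g i \<le> \<kappa> * (Xv i \<bullet> u)\<^sup>2"
      using \<kappa> by (intro mult_left_mono) auto
    also have "\<dots> \<le> dsig 2 (Xv i \<bullet> m) * (Xv i \<bullet> u)\<^sup>2"
      using dsig_2_ge[OF True] by (intro mult_right_mono) (auto simp: \<kappa>_def)
    finally show ?thesis .
  next
    case False
    then have "Acut\<^sup>2 \<le> (Xv i \<bullet> m)\<^sup>2" using Apos by (intro abs_le_square_iff[THEN iffD1]) auto
    then have "(Xv i \<bullet> u)\<^sup>2 * Acut\<^sup>2 \<le> (Xv i \<bullet> u)\<^sup>2 * (Xv i \<bullet> m)\<^sup>2" by (intro mult_left_mono) auto
    then have "(Xv i \<bullet> u)\<^sup>2 - (Xv i \<bullet> u)\<^sup>2 * (Xv i \<bullet> m)\<^sup>2 / Acut\<^sup>2 \<le> 0"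
      using Apos by (simp add: field_simps)
    then have "\<kappa> * ?g i \<le> 0"
      using \<kappa> by (simp add: mult_le_0_iff)
    also have "0 \<le> dsig 2 (Xv i \<bullet> m) * (Xv i \<bullet> u)\<^sup>2" using dsig_2_pos[of "Xv i \<bullet> m"] by simp
    finally show ?thesis .
  qed
  let ?q = "u \<bullet> (M *\<^sub>v u)"
  have q0: "0 \<le> ?q" by (rule M_nonneg[OF u])
  \<comment> \<open>Cauchy-Schwarz and \<open>G1\<close> in the two directions \<open>u\<close> and
    \<open>m\<close>; the length of \<open>m\<close> is bounded by comparing \<open>V m\<close> with
    \<open>V\<close> at the origin.\<close>
  have cross: "(\<Sum>i<n. (Xv i \<bullet> u)\<^sup>2 * (Xv i \<bullet> m)\<^sup>2) \<le> C4 * real n * ?q * Rmin\<^sup>2"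
  proof (rule power2_le_imp_le)
    have "(\<Sum>i<n. (Xv i \<bullet> u)\<^sup>2 * (Xv i \<bullet> m)\<^sup>2)\<^sup>2 \<le> (\<Sum>i<n. ((Xv i \<bullet> u)\<^sup>2)\<^sup>2) * (\<Sum>i<n. ((Xv i \<bullet> m)\<^sup>2)\<^sup>2)"
      by (rule Cauchy_Schwarz_ineq_sum)
    also have "\<dots> \<le> (C4 * real n * ?q\<^sup>2) * (C4 * real n * (m \<bullet> (M *\<^sub>v m))\<^sup>2)"
      using G1[OF u] G1[OF m_carrier] C4 by (intro mult_mono) (auto intro!: sum_nonneg)
    also have "\<dots> \<le> (C4 * real n * ?q\<^sup>2) * (C4 * real n * (Rmin\<^sup>2)\<^sup>2)"
    proof -
      have "m \<bullet> (M *\<^sub>v m) \<le> Rmin\<^sup>2"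
        unfolding wnorm_sq[OF m_carrier, symmetric] using wnorm_m_le wnorm_nonneg[OF m_carrier] by (rule power_mono)
      then have "(m \<bullet> (M *\<^sub>v m))\<^sup>2 \<le> (Rmin\<^sup>2)\<^sup>2" using M_nonneg[OF m_carrier] by (rule power_mono)
      then show ?thesis using C4 by (intro mult_left_mono) auto
    qed
    also have "\<dots> = (C4 * real n * ?q * Rmin\<^sup>2)\<^sup>2" by (simp add: power2_eq_square mult_ac)
    finally show "(\<Sum>i<n. (Xv i \<bullet> u)\<^sup>2 * (Xv i \<bullet> m)\<^sup>2)\<^sup>2 \<le> (C4 * real n * ?q * Rmin\<^sup>2)\<^sup>2" .
  qed (use C4 q0 in simp)
  have "cH * real n * ?q = \<kappa> * (c1\<^sup>2 * real n * ?q - C4 * real n * ?q * Rmin\<^sup>2 / Acut\<^sup>2)"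
    using Rpos C4 c1 by (simp add: A2 cH_def \<kappa>_def field_simps)
  also have "\<dots> \<le> \<kappa> * ((\<Sum>i<n. (Xv i \<bullet> u)\<^sup>2) - (\<Sum>i<n. (Xv i \<bullet> u)\<^sup>2 * (Xv i \<bullet> m)\<^sup>2) / Acut\<^sup>2)"
    using \<kappa> sum_sq_ge[OF u] cross by (intro mult_left_mono diff_mono divide_right_mono) auto
  also have "\<dots> = (\<Sum>i<n. \<kappa> * ?g i)"
    by (simp add: sum_distrib_left[symmetric] sum_subtractf sum_divide_distrib)
  also have "\<dots> \<le> (\<Sum>i<n. dsig 2 (Xv i \<bullet> m) * (Xv i \<bullet> u)\<^sup>2)" by (intro sum_mono pt)
  also have "\<dots> \<le> u \<bullet> (Hm *\<^sub>v u)"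
    unfolding hessian_quadratic[OF m_carrier u] using P_psd[OF u] by simp
  finally show ?thesis .
qed

lemma pos_def_H: "pos_def d Hm"
  unfolding pos_def_def
proof (intro conjI ballI impI)
  fix u :: rvec assume u: "u \<in> carrier_vec d" "u \<noteq> 0\<^sub>v d"
  then have "0 < cH * real n * (u \<bullet> (M *\<^sub>v u))"
    using M cH_pos n_pos by (auto simp: pos_def_def)
  then show "0 < u \<bullet> (Hm *\<^sub>v u)" using hessian_ge[OF u(1)] by linarith
qed (simp_all add: hessian_carrier hessian_sym m_carrier)

end

locale coord_data = minimized_data + whitening d "hessian d (potential n P D) m" A for A +
  assumes small: "2 ^ 20 * BB\<^sup>2 * (real d / sqrt (real n)) \<le> 1"
begin

lemma M_ax_le: "ax x \<bullet> (M *\<^sub>v ax x) \<le> sqn d x / (cH * real n)"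
  using hessian_ge[of "ax x"] cH_pos n_pos by (simp add: quadratic_ax dot_self field_simps)

text \<open>The abstract coordinates are realized: the Hessian bound says that \<open>ax x\<close>
  has squared \<open>M\<close>-norm at most \<open>sqn d x / (cH * n)\<close>, which rescales
  \<open>G1\<close> and \<open>G3\<close>, and \<open>second\<close> is the quadratic form of the
  Hessian without its prior part.\<close>

sublocale L: logistic_coords d n "\<lambda>i. co (Xv i)" "\<lambda>i. Xv i \<bullet> m" BB
proof
  have b: "1 \<le> BB" "C4 / cH\<^sup>2 \<le> BB" "C6 / cH ^ 3 \<le> BB" by (auto simp: BB_def)
  show "1 \<le> d" "1 \<le> n" "1 \<le> BB" "2 ^ 20 * BB\<^sup>2 * (real d / sqrt (real n)) \<le> 1"
    using d1 n1 b small by auto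
  show "(\<Sum>i<n. dot d (co (Xv i)) x ^ 4) \<le> BB / real n * (sqn d x)\<^sup>2" for x
  proof -
    have "(\<Sum>i<n. dot d (co (Xv i)) x ^ 4) = (\<Sum>i<n. (Xv i \<bullet> ax x) ^ 4)"
      using X by (simp add: scalar_prod_ax)
    also have "\<dots> \<le> C4 * real n * (ax x \<bullet> (M *\<^sub>v ax x))\<^sup>2" by (rule G1) simp
    also have "\<dots> \<le> C4 * real n * (sqn d x / (cH * real n))\<^sup>2"
      using C4 M_ax_le M_nonneg by (intro mult_left_mono power_mono) auto
    also have "\<dots> = C4 / cH\<^sup>2 / real n * (sqn d x)\<^sup>2"
      using n_pos by (simp add: power2_eq_square field_simps)
    also have "\<dots> \<le> BB / real n * (sqn d x)\<^sup>2"
      using b by (intro mult_right_mono divide_right_mono) auto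
    finally show ?thesis .
  qed
  show "(\<Sum>i<n. dsig 2 (Xv i \<bullet> m) * (dot d (co (Xv i)) x)\<^sup>2) \<le> sqn d x" for x
  proof -
    have "sqn d x = (\<Sum>i<n. dsig 2 (Xv i \<bullet> m) * (Xv i \<bullet> ax x)\<^sup>2) + ax x \<bullet> (P *\<^sub>v ax x)"
      using quadratic_ax[of x x] hessian_quadratic[OF m_carrier, of "ax x"] by (simp add: dot_self)
    then show ?thesis using P_psd[of "ax x"] X by (simp add: scalar_prod_ax)
  qed
  show "(\<Sum>i<n. sqn d (co (Xv i)) ^ 3) \<le> BB * real d ^ 3 / (real n)\<^sup>2"
  proof -
    obtain \<rho> where \<rho>: "\<And>i. i < n \<Longrightarrow> 0 \<le> \<rho> i" "\<And>i u. i < n \<Longrightarrow> u \<in> carrier_vec d \<Longrightarrow> (Xv i \<bullet> u)\<^sup>2 \<le> \<rho> i * (u \<bullet> (M *\<^sub>v u))"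
      "(\<Sum>i<n. \<rho> i ^ 3) \<le> C6 * real n * real d ^ 3"
      using G3 by blast
    have "sqn d (co (Xv i)) \<le> \<rho> i / (cH * real n)" if i: "i < n" for i
    proof (cases "sqn d (co (Xv i)) = 0")
      case True
      then show ?thesis using \<rho>(1)[OF i] cH_pos by simp
    next
      case False
      then have pos: "0 < sqn d (co (Xv i))" using sqn_nonneg[of d "co (Xv i)"] by linarith
      \<comment> \<open>The direction \<open>ax (co (Xv i))\<close> is the extremal one: the
        covariate pairs with it to the squared norm itself.\<close>
      have "(sqn d (co (Xv i)))\<^sup>2 = (Xv i \<bullet> ax (co (Xv i)))\<^sup>2"
        using X[OF i] by (simp add: scalar_prod_ax dot_self)
      also have "\<dots> \<le> \<rho> i * (ax (co (Xv i)) \<bullet> (M *\<^sub>v ax (co (Xv i))))"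
        by (rule \<rho>(2)[OF i]) simp
      also have "\<dots> \<le> \<rho> i * (sqn d (co (Xv i)) / (cH * real n))"
        using \<rho>(1)[OF i] by (intro mult_left_mono M_ax_le)
      finally have "sqn d (co (Xv i)) * sqn d (co (Xv i)) \<le> (\<rho> i / (cH * real n)) * sqn d (co (Xv i))"
        by (simp add: power2_eq_square)
      then show ?thesis using pos by (rule mult_right_le_imp_le)
    qed
    then have "(\<Sum>i<n. sqn d (co (Xv i)) ^ 3) \<le> (\<Sum>i<n. (\<rho> i / (cH * real n)) ^ 3)"
      by (intro sum_mono power_mono) auto
    also have "\<dots> = (\<Sum>i<n. \<rho> i ^ 3) / (cH * real n) ^ 3"
      by (simp add: power_divide sum_divide_distrib)
    also have "\<dots> \<le> C6 * real n * real d ^ 3 / (cH * real n) ^ 3"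
      using \<rho>(3) cH_pos by (intro divide_right_mono) auto
    also have "\<dots> = C6 / cH ^ 3 * (real d ^ 3 / (real n)\<^sup>2)"
      using n_pos by (simp add: power_mult_distrib eval_nat_numeral)
    also have "\<dots> \<le> BB * (real d ^ 3 / (real n)\<^sup>2)"
      using b by (intro mult_right_mono) auto
    finally show ?thesis by simp
  qed
qed

lemma lin_eq: "i < n \<Longrightarrow> L.lin i x = Xv i \<bullet> ax x"
  using X by (simp add: L.lin_def scalar_prod_ax)

lemma skew_emb: "skew d V m (emb m x) = L.S x"
  using m_carrier by (simp add: skew_eq emb_minus L.S_def lin_eq)

text \<open>Taylor expansion at the minimizer: the linear term vanishes by stationarity, the
  quadratic term is Euclidean by whitening, the prior contributes no higher terms, and the rest is
  \<open>- L.r x\<close>.\<close>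

lemma V_emb: "V (emb m x) = V m + sqn d x / 2 - L.r x"
proof -
  let ?h = "ax x"
  have h: "?h \<in> carrier_vec d" by simp
  have e: "emb m x = m + 1 \<cdot>\<^sub>v ?h" and m0: "m + 0 \<cdot>\<^sub>v ?h = m"
    using m_carrier h by (auto simp: emb_def intro!: eq_vecI simp del: ax_carrier)
  have fo: "m \<bullet> (P *\<^sub>v ?h) = - (\<Sum>i<n. (sigmoid (Xv i \<bullet> m) - Yv i) * (Xv i \<bullet> ?h))"
    using first_order[OF m h] by simp
  have sq: "sqn d x = (\<Sum>i<n. dsig 2 (Xv i \<bullet> m) * (Xv i \<bullet> ?h)\<^sup>2) + ?h \<bullet> (P *\<^sub>v ?h)"
    using quadratic_ax[of x x] hessian_quadratic[OF m_carrier h] by (simp add: dot_self)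
  have "V (emb m x) - V m = (\<Sum>i<n. softplus (Xv i \<bullet> m + Xv i \<bullet> ?h) - softplus (Xv i \<bullet> m) - sigmoid (Xv i \<bullet> m) * (Xv i \<bullet> ?h)) + ?h \<bullet> (P *\<^sub>v ?h) / 2"
    unfolding e using V_line[OF m_carrier h, of 1] V_line[OF m_carrier h, of 0] fo
    by (simp add: m0 sum.distrib sum_subtractf algebra_simps) argo
  also have "\<dots> = sqn d x / 2 - L.r x"
    unfolding sq L.r_def srem_def
    by (simp add: lin_eq sum.distrib sum_subtractf sum_divide_distrib add_divide_distrib)
  finally show ?thesis by simp
qed

lemma argmin_unique:
  assumes b: "is_arg_min V (\<lambda>b. b \<in> carrier_vec d) b"
  shows "b = m"
proof -
  have bc: "b \<in> carrier_vec d" using b by (simp add: is_arg_min_def)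
  obtain x where x: "emb m x = b" using emb_surj[OF m_carrier bc] by blast
  have "V b \<le> V m" using b m_carrier by (auto simp: is_arg_min_linorder)
  then have "\<not> 0 < sqn d x / 2 - L.r x" using V_emb[of x] x by simp
  then have "sqn d x = 0" using L.potential_pos[of x] sqn_nonneg[of d x] by linarith
  then have "x j = 0" if "j < d" for j using that by (simp add: sqn_def sum_nonneg_eq_0_iff)
  then have "ax x = 0\<^sub>v d" by (intro eq_vecI) (simp_all add: ax_index carrier_vecD[OF ax_carrier])
  then show ?thesis using x m_carrier by (simp add: emb_def)
qed

end

section \<open>Nets and truncated moments\<close>

text \<open>Rounding toward zero, so that no coordinate grows in modulus and net points of the unit
  ball stay in it.\<close>

definition itrunc :: "real \<Rightarrow> int" where
  "itrunc y = (if 0 \<le> y then \<lfloor>y\<rfloor> else \<lceil>y\<rceil>)"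

lemma itrunc: "\<bar>real_of_int (itrunc y)\<bar> \<le> \<bar>y\<bar>" "\<bar>y - real_of_int (itrunc y)\<bar> \<le> 1"
proof -
  have "\<bar>real_of_int (itrunc y)\<bar> \<le> \<bar>y\<bar> \<and> \<bar>y - real_of_int (itrunc y)\<bar> \<le> 1"
  proof (cases "0 \<le> y")
    case True
    then have "0 \<le> real_of_int \<lfloor>y\<rfloor>" by simp
    then show ?thesis using True of_int_floor_le[of y] floor_correct[of y] by (simp add: itrunc_def) linarith
  next
    case False
    then have "\<lceil>y\<rceil> \<le> 0" by simp
    then have "real_of_int \<lceil>y\<rceil> \<le> 0" by linarith
    then show ?thesis using False ceiling_correct[of y] by (simp add: itrunc_def)
  qed
  then show "\<bar>real_of_int (itrunc y)\<bar> \<le> \<bar>y\<bar>" "\<bar>y - real_of_int (itrunc y)\<bar> \<le> 1" by auto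
qed

text \<open>Integer points of an l1-ball. The Euclidean unit ball, scaled by
  \<open>R * sqrt d\<close>, has l1-norm at most \<open>R * d\<close>, and this many lattice points
  are only exponential in \<open>d\<close>.\<close>

definition grid :: "nat \<Rightarrow> real \<Rightarrow> (nat \<Rightarrow> int) set" where
  "grid d R = {k \<in> (\<Pi>\<^sub>E j\<in>{..<d}. {- \<lfloor>R * real d\<rfloor>..\<lfloor>R * real d\<rfloor>}). (\<Sum>j<d. \<bar>real_of_int (k j)\<bar>) \<le> R * real d}"

lemma finite_grid: "finite (grid d R)"
  unfolding grid_def by (intro finite_subset[OF _ finite_PiE[of "{..<d}" "\<lambda>_. {- \<lfloor>R * real d\<rfloor>..\<lfloor>R * real d\<rfloor>}"]]) auto

lemma sum_exp_neg_abs_le: "(\<Sum>k\<in>{- m..m}. exp (- \<bar>real_of_int k\<bar>)) \<le> 3" for m :: int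
proof (cases "0 \<le> m")
  case True
  have e1: "exp (- 1) \<le> (1 / 2 :: real)"
    using exp_ge_add_one_self[of 1] by (auto simp: exp_minus field_simps)
  \<comment> \<open>The subtracted term makes the claim inductive: each step adds
    \<open>2 * exp (- real (Suc n))\<close>, and \<open>exp (- 1) \<le> 1 / 2\<close>.\<close>
  have "(\<Sum>k\<in>{- int n..int n}. exp (- \<bar>real_of_int k\<bar>)) \<le> 3 - 2 * exp (- real n)" for n
  proof (induction n)
    case (Suc n)
    have i: "{- int (Suc n)..int (Suc n)} = insert (- int (Suc n)) (insert (int (Suc n)) {- int n..int n})"
      by auto
    have "exp (- real (Suc n)) = exp (- real n) * exp (- 1)" by (simp add: mult_exp_exp)
    also have "\<dots> \<le> exp (- real n) * (1 / 2)" using e1 by (intro mult_left_mono) auto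
    finally have "2 * exp (- real (Suc n)) \<le> exp (- real n)" by simp
    moreover have "(\<Sum>k\<in>{- int (Suc n)..int (Suc n)}. exp (- \<bar>real_of_int k\<bar>))
        = exp (- real (Suc n)) + (exp (- real (Suc n)) + (\<Sum>k\<in>{- int n..int n}. exp (- \<bar>real_of_int k\<bar>)))"
    proof -
      let ?f = "\<lambda>k :: int. exp (- \<bar>real_of_int k\<bar>)"
      have "sum ?f (insert (- int (Suc n)) (insert (int (Suc n)) {- int n..int n})) = ?f (- int (Suc n)) + (?f (int (Suc n)) + sum ?f {- int n..int n})"
        by (simp del: of_nat_Suc)
      then show ?thesis unfolding i by (simp only: of_int_minus of_int_of_nat_eq abs_minus_cancel abs_of_nat)
    qed
    ultimately show ?case using Suc by linarith
  qed simp
  from this[of "nat m"] True have "(\<Sum>k\<in>{- m..m}. exp (- \<bar>real_of_int k\<bar>)) \<le> 3 - 2 * exp (- real (nat m))" by simp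
  then show ?thesis using exp_gt_zero[of "- real (nat m)"] by linarith
qed simp

text \<open>Each point is given the weight \<open>exp (R * d)\<close> times the product of
  \<open>exp (- |k j|)\<close>, which is at least one on the grid; over the whole box the sum
  factorizes, with factors at most \<open>3 \<le> exp 2\<close>.\<close>

lemma card_grid: "real (card (grid d R)) \<le> exp ((R + 2) * real d)"
proof -
  let ?I = "{- \<lfloor>R * real d\<rfloor>..\<lfloor>R * real d\<rfloor>}"
  have "real (card (grid d R)) = (\<Sum>k\<in>grid d R. 1)" by simp
  also have "\<dots> \<le> (\<Sum>k\<in>grid d R. exp (R * real d) * (\<Prod>j<d. exp (- \<bar>real_of_int (k j)\<bar>)))"
  proof (rule sum_mono)
    fix k assume "k \<in> grid d R"
    then have "0 \<le> R * real d + (\<Sum>j<d. - \<bar>real_of_int (k j)\<bar>)" by (simp add: grid_def sum_negf)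
    then have "1 \<le> exp (R * real d + (\<Sum>j<d. - \<bar>real_of_int (k j)\<bar>))" by simp
    then show "1 \<le> exp (R * real d) * (\<Prod>j<d. exp (- \<bar>real_of_int (k j)\<bar>))"
      unfolding exp_add by (simp only: exp_sum finite_lessThan)
  qed
  also have "\<dots> \<le> (\<Sum>k\<in>(\<Pi>\<^sub>E j\<in>{..<d}. ?I). exp (R * real d) * (\<Prod>j<d. exp (- \<bar>real_of_int (k j)\<bar>)))"
  proof (rule sum_mono2)
    show "finite (\<Pi>\<^sub>E j\<in>{..<d}. ?I)" by (intro finite_PiE) auto
    show "grid d R \<subseteq> (\<Pi>\<^sub>E j\<in>{..<d}. ?I)" unfolding grid_def by blast
  qed (intro mult_nonneg_nonneg prod_nonneg; simp)
  also have "\<dots> = exp (R * real d) * (\<Prod>j<d. \<Sum>k\<in>?I. exp (- \<bar>real_of_int k\<bar>))"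
    unfolding sum_distrib_left[symmetric] by (subst prod_sum_PiE) auto
  also have "\<dots> \<le> exp (R * real d) * (\<Prod>j<d. exp 2)"
  proof (intro mult_left_mono prod_mono conjI sum_nonneg)
    have "(3 :: real) \<le> exp 2" using exp_ge_add_one_self[of 2] by simp
    then show "(\<Sum>k\<in>?I. exp (- \<bar>real_of_int k\<bar>)) \<le> exp 2"
      using sum_exp_neg_abs_le order_trans by blast
  qed auto
  also have "\<dots> = exp ((R + 2) * real d)"
    by (simp add: exp_of_nat_mult[symmetric] exp_add[symmetric] algebra_simps)
  finally show ?thesis .
qed

definition netpt :: "nat \<Rightarrow> real \<Rightarrow> (nat \<Rightarrow> int) \<Rightarrow> nat \<Rightarrow> real" where
  "netpt d R k = (\<lambda>j. real_of_int (k j) / (R * sqrt (real d)))"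

lemma netpt_approx:
  assumes d: "1 \<le> d" and R: "0 < R" and x: "sqn d x \<le> 1"
  shows "\<exists>k\<in>grid d R. sqn d (netpt d R k) \<le> 1 \<and> sqn d (\<lambda>j. x j - netpt d R k j) \<le> 1 / R\<^sup>2"
proof -
  define c where "c = R * sqrt (real d)"
  have c: "0 < c" using d R by (simp add: c_def)
  define k where "k = (\<lambda>j\<in>{..<d}. itrunc (c * x j))"
  have k1: "\<bar>real_of_int (k j)\<bar> \<le> c * \<bar>x j\<bar>" if "j < d" for j
    using itrunc(1)[of "c * x j"] that c by (simp add: k_def abs_mult)
  have "(\<Sum>j<d. \<bar>real_of_int (k j)\<bar>) \<le> (\<Sum>j<d. c * \<bar>x j\<bar>)" by (intro sum_mono k1) auto
  also have "\<dots> \<le> c * (sqrt (real d) * sqrt (sqn d x))"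
    unfolding sum_distrib_left[symmetric] using c sum_abs_le_sqrt_sqn[where d = d and x = x] by (intro mult_left_mono) auto
  also have "\<dots> \<le> c * (sqrt (real d) * 1)" using c x by (intro mult_left_mono) auto
  also have "\<dots> = R * real d" by (simp add: c_def)
  finally have s: "(\<Sum>j<d. \<bar>real_of_int (k j)\<bar>) \<le> R * real d" .
  have "k j \<in> {- \<lfloor>R * real d\<rfloor>..\<lfloor>R * real d\<rfloor>}" if "j < d" for j
  proof -
    have "\<bar>real_of_int (k j)\<bar> \<le> (\<Sum>j<d. \<bar>real_of_int (k j)\<bar>)" using that by (intro member_le_sum) auto
    then have "real_of_int \<bar>k j\<bar> \<le> R * real d" using s by simp
    then have "\<bar>k j\<bar> \<le> \<lfloor>R * real d\<rfloor>" by (simp add: le_floor_iff)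
    then show ?thesis by auto
  qed
  then have "k \<in> grid d R" using s by (auto simp: grid_def k_def)
  moreover have "sqn d (netpt d R k) \<le> 1"
  proof -
    have "\<bar>netpt d R k j\<bar> \<le> \<bar>x j\<bar>" if "j < d" for j
      using k1[OF that] c by (simp add: netpt_def c_def[symmetric] divide_le_eq mult.commute)
    then have "sqn d (netpt d R k) \<le> sqn d x"
      unfolding sqn_def by (intro sum_mono) (simp add: abs_le_square_iff)
    then show ?thesis using x by simp
  qed
  moreover have "sqn d (\<lambda>j. x j - netpt d R k j) \<le> 1 / R\<^sup>2"
  proof -
    have "(x j - netpt d R k j)\<^sup>2 \<le> 1 / c\<^sup>2" if "j < d" for j
    proof -
      have "x j - netpt d R k j = (c * x j - real_of_int (itrunc (c * x j))) / c"
        using that c by (simp add: netpt_def c_def[symmetric] k_def diff_divide_distrib)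
      then have "(x j - netpt d R k j)\<^sup>2 = (c * x j - real_of_int (itrunc (c * x j)))\<^sup>2 / c\<^sup>2"
        by (simp add: power_divide)
      also have "\<dots> \<le> 1 / c\<^sup>2"
        using itrunc(2)[of "c * x j"] by (intro divide_right_mono) (auto simp: abs_square_le_1)
      finally show ?thesis .
    qed
    then have "sqn d (\<lambda>j. x j - netpt d R k j) \<le> (\<Sum>j<d. 1 / c\<^sup>2)"
      unfolding sqn_def by (intro sum_mono) auto
    also have "\<dots> = 1 / R\<^sup>2" using d by (simp add: c_def power_mult_distrib)
    finally show ?thesis .
  qed
  ultimately show ?thesis by blast
qed

text \<open>
  The truncation \<open>t\<^sup>2 / 4\<close> makes the exponential moment finite; conversely a bound on the sum of the truncated
  powers forces all \<open>|t|\<close> to be so small that the truncation costs only a constant factor.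
\<close>

definition tpow :: "nat \<Rightarrow> real \<Rightarrow> real \<Rightarrow> real" where
  "tpow k l t = min (l * t ^ (2 * k)) (t\<^sup>2 / 4)"

lemma tpow_nonneg: "0 \<le> l \<Longrightarrow> 0 \<le> tpow k l t"
  by (simp add: tpow_def zero_le_even_power)

lemma measurable_tpow [measurable]: "tpow k l \<in> borel_measurable borel"
  unfolding tpow_def[abs_def] by measurable

definition ctp :: "nat \<Rightarrow> real" where "ctp k = 2 * fact k * 8 ^ k"

text \<open>From \<open>exp y \<le> 1 + y * exp y\<close>, with each branch of the truncation used
  once: \<open>y \<le> l * t ^ (2 * k)\<close> in the linear factor keeps the result linear in
  \<open>l\<close>, while \<open>y \<le> t ^ 2 / 4\<close> in the exponent keeps it integrable. The
  exponents add to \<open>3 / 8 < 1 / 2\<close>, and the resulting Gaussian integral equals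
  two.\<close>

lemma nn_integral_exp_tpow:
  assumes l: "0 \<le> l" and s: "0 \<le> s" "s \<le> 1"
  shows "(\<integral>\<^sup>+t. ennreal (exp (tpow k l (s * t))) \<partial>std_gauss) \<le> ennreal (exp (l * ctp k))"
proof -
  let ?c = "l * (fact k * 8 ^ k)"
  have c: "0 \<le> ?c" using l by simp
  have pt: "exp (tpow k l (s * t)) \<le> 1 + ?c * exp (3 / 8 * t\<^sup>2)" for t
  proof -
    define y where "y = tpow k l (s * t)"
    have st: "(s * t)\<^sup>2 \<le> t\<^sup>2"
      using s by (simp add: power_mult_distrib mult_left_le_one_le power_le_one)
    have y0: "0 \<le> y" unfolding y_def by (rule tpow_nonneg[OF l])
    have "y \<le> l * (s * t) ^ (2 * k)" by (simp add: y_def tpow_def)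
    also have "\<dots> \<le> l * (fact k * 8 ^ k * exp (t\<^sup>2 / 8))"
    proof (rule mult_left_mono[OF _ l])
      have "(s * t) ^ (2 * k) \<le> (t\<^sup>2) ^ k" unfolding power_mult by (intro power_mono st) simp
      also have "\<dots> = fact k * 8 ^ k * ((t\<^sup>2 / 8) ^ k / fact k)" by (simp add: power_divide)
      also have "\<dots> \<le> fact k * 8 ^ k * exp (t\<^sup>2 / 8)"
        by (intro mult_left_mono power_div_fact_le_exp) auto
      finally show "(s * t) ^ (2 * k) \<le> fact k * 8 ^ k * exp (t\<^sup>2 / 8)" .
    qed
    finally have y1: "y \<le> ?c * exp (t\<^sup>2 / 8)" by (simp add: mult.assoc)
    have "y \<le> (s * t)\<^sup>2 / 4" by (simp add: y_def tpow_def)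
    then have y2: "exp y \<le> exp (t\<^sup>2 / 4)" using st by simp
    have "1 - y \<le> exp (- y)" using exp_ge_add_one_self[of "- y"] by simp
    then have "(1 - y) * exp y \<le> exp (- y) * exp y" by (intro mult_right_mono) auto
    then have "exp y \<le> 1 + y * exp y" by (simp add: exp_minus algebra_simps)
    also have "\<dots> \<le> 1 + (?c * exp (t\<^sup>2 / 8)) * exp (t\<^sup>2 / 4)"
      using y0 y1 y2 c by (intro add_left_mono mult_mono) auto
    also have "\<dots> = 1 + ?c * exp (3 / 8 * t\<^sup>2)" by (simp add: mult_exp_exp)
    finally show ?thesis by (simp add: y_def)
  qed
  have "(\<integral>\<^sup>+t. ennreal (exp (tpow k l (s * t))) \<partial>std_gauss) \<le> (\<integral>\<^sup>+t. 1 + ennreal ?c * ennreal (exp (3 / 8 * t\<^sup>2)) \<partial>std_gauss)"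
  proof (rule nn_integral_mono)
    fix t
    have "ennreal (exp (tpow k l (s * t))) \<le> ennreal (1 + ?c * exp (3 / 8 * t\<^sup>2))"
      by (rule ennreal_leI[OF pt])
    then show "ennreal (exp (tpow k l (s * t))) \<le> 1 + ennreal ?c * ennreal (exp (3 / 8 * t\<^sup>2))"
      using c by (simp add: ennreal_plus ennreal_mult)
  qed
  also have "\<dots> = 1 + ennreal ?c * ennreal (1 / sqrt (1 - 2 * (3 / 8)))"
  proof -
    have "(\<integral>\<^sup>+t. 1 + ennreal ?c * ennreal (exp (3 / 8 * t\<^sup>2)) \<partial>std_gauss)
        = (\<integral>\<^sup>+t. 1 \<partial>std_gauss) + (\<integral>\<^sup>+t. ennreal ?c * ennreal (exp (3 / 8 * t\<^sup>2)) \<partial>std_gauss)"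
      by (rule nn_integral_add) auto
    also have "(\<integral>\<^sup>+t. ennreal ?c * ennreal (exp (3 / 8 * t\<^sup>2)) \<partial>std_gauss) = ennreal ?c * ennreal (1 / sqrt (1 - 2 * (3 / 8)))"
      by (subst nn_integral_cmult) (auto simp only: nn_integral_std_gauss_exp_sq, auto)
    finally show ?thesis using std_gauss.emeasure_space_1 by simp
  qed
  also have "\<dots> = ennreal (1 + l * ctp k)"
  proof -
    have "1 / sqrt (1 - 2 * (3 / 8)) = (2 :: real)" by (simp add: real_sqrt_divide)
    then have "1 + ennreal ?c * ennreal (1 / sqrt (1 - 2 * (3 / 8))) = ennreal (1 + ?c * 2)"
      using c by (simp only: ennreal_plus ennreal_mult ennreal_1 zero_le_one mult_nonneg_nonneg zero_le_numeral)
    then show ?thesis by (simp add: ctp_def mult_ac)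
  qed
  also have "\<dots> \<le> ennreal (exp (l * ctp k))" by (intro ennreal_leI exp_ge_add_one_self)
  finally show ?thesis .
qed

lemma sum_power_le_of_tpow:
  fixes t :: "'i \<Rightarrow> real"
  assumes I: "finite I" and L: "0 < L" and K: "1 \<le> K" and k: "0 < k"
    and l: "l = 1 / (4 * L ^ (k - 1))" and s: "(\<Sum>i\<in>I. tpow k l (t i)) \<le> K * L / 4"
  shows "(\<Sum>i\<in>I. t i ^ (2 * k)) \<le> K ^ k * L ^ k"
proof -
  have l0: "0 < l" using L by (simp add: l)
  have term_le: "l * t i ^ (2 * k) \<le> K ^ (k - 1) * tpow k l (t i)" if i: "i \<in> I" for i
  proof (cases "l * t i ^ (2 * k) \<le> (t i)\<^sup>2 / 4")
    case True
    then have "tpow k l (t i) = l * t i ^ (2 * k)" by (simp add: tpow_def)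
    moreover have "1 * tpow k l (t i) \<le> K ^ (k - 1) * tpow k l (t i)"
      using K l0 by (intro mult_right_mono tpow_nonneg) auto
    ultimately show ?thesis by simp
  next
    case False
    then have e: "tpow k l (t i) = (t i)\<^sup>2 / 4" by (simp add: tpow_def)
    \<comment> \<open>A single truncated term is at most the whole sum, so
      \<open>t i ^ 2 \<le> K * L\<close>. The value of \<open>l\<close> puts the crossing of the two
      branches at \<open>t ^ 2 = L\<close>, so even there the truncation loses at most
      \<open>K ^ (k - 1)\<close>.\<close>
    have "tpow k l (t i) \<le> (\<Sum>i\<in>I. tpow k l (t i))"
      using l0 i I by (intro member_le_sum tpow_nonneg) auto
    then have "(t i)\<^sup>2 \<le> K * L" using s e by simp
    then have "((t i)\<^sup>2) ^ (k - 1) \<le> (K * L) ^ (k - 1)" by (intro power_mono) auto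
    then have "l * ((t i)\<^sup>2 * ((t i)\<^sup>2) ^ (k - 1)) \<le> l * ((t i)\<^sup>2 * (K * L) ^ (k - 1))"
      using l0 by (intro mult_left_mono) auto
    also have "(t i)\<^sup>2 * ((t i)\<^sup>2) ^ (k - 1) = t i ^ (2 * k)"
      unfolding power_Suc[symmetric] Suc_diff_1[OF k] power_mult ..
    also have "l * ((t i)\<^sup>2 * (K * L) ^ (k - 1)) = K ^ (k - 1) * ((t i)\<^sup>2 / 4)"
      using L by (simp add: l power_mult_distrib)
    finally show ?thesis by (simp add: e)
  qed
  have "l * (\<Sum>i\<in>I. t i ^ (2 * k)) \<le> (\<Sum>i\<in>I. K ^ (k - 1) * tpow k l (t i))"
    unfolding sum_distrib_left by (intro sum_mono term_le)
  also have "\<dots> \<le> K ^ (k - 1) * (K * L / 4)"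
    unfolding sum_distrib_left[symmetric] using s K by (intro mult_left_mono) auto
  also have "\<dots> = l * (K ^ k * L ^ k)"
  proof -
    have "x ^ k = x * x ^ (k - 1)" for x :: real
      unfolding power_Suc[symmetric] Suc_diff_1[OF k] ..
    note this[of K] this[of L]
    then show ?thesis using L by (simp only: l) simp
  qed
  finally show ?thesis using l0 by simp
qed

text \<open>The power mean inequality of order three from two applications of Cauchy-Schwarz; square
  roots of the terms split \<open>2\<close> as \<open>1 / 2 + 3 / 2\<close>.\<close>

lemma sum_cube_le_card:
  fixes a :: "nat \<Rightarrow> real"
  assumes d: "1 \<le> d" and a: "\<And>j. j < d \<Longrightarrow> 0 \<le> a j"
  shows "(\<Sum>j<d. a j) ^ 3 \<le> (real d)\<^sup>2 * (\<Sum>j<d. a j ^ 3)"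
proof -
  have s0: "0 \<le> (\<Sum>j<d. a j)" by (intro sum_nonneg a) auto
  have 1: "(\<Sum>j<d. a j)\<^sup>2 \<le> real d * (\<Sum>j<d. (a j)\<^sup>2)"
    using Cauchy_Schwarz_ineq_sum[of "\<lambda>_. 1" a "{..<d}"] by simp
  have 2: "(\<Sum>j<d. (a j)\<^sup>2)\<^sup>2 \<le> (\<Sum>j<d. a j) * (\<Sum>j<d. a j ^ 3)"
  proof -
    have "(\<Sum>j<d. sqrt (a j) * sqrt (a j ^ 3))\<^sup>2 \<le> (\<Sum>j<d. (sqrt (a j))\<^sup>2) * (\<Sum>j<d. (sqrt (a j ^ 3))\<^sup>2)"
      by (rule Cauchy_Schwarz_ineq_sum)
    moreover have "(\<Sum>j<d. sqrt (a j) * sqrt (a j ^ 3)) = (\<Sum>j<d. (a j)\<^sup>2)"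
    proof (rule sum.cong)
      fix j assume "j \<in> {..<d}"
      then have "0 \<le> a j" using a by simp
      moreover have "a j * a j ^ 3 = ((a j)\<^sup>2)\<^sup>2" by (simp add: eval_nat_numeral)
      ultimately show "sqrt (a j) * sqrt (a j ^ 3) = (a j)\<^sup>2"
        by (simp only: real_sqrt_mult[symmetric] real_sqrt_abs) simp
    qed simp
    moreover have "(\<Sum>j<d. (sqrt (a j))\<^sup>2) = (\<Sum>j<d. a j)" "(\<Sum>j<d. (sqrt (a j ^ 3))\<^sup>2) = (\<Sum>j<d. a j ^ 3)"
      using a by (auto intro!: sum.cong)
    ultimately show ?thesis by simp
  qed
  show ?thesis
  proof (cases "(\<Sum>j<d. a j) = 0")
    case True
    then show ?thesis using a by (auto intro!: mult_nonneg_nonneg sum_nonneg)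
  next
    case False
    then have pos: "0 < (\<Sum>j<d. a j)" using s0 by simp
    have "(\<Sum>j<d. a j) * (\<Sum>j<d. a j) ^ 3 = ((\<Sum>j<d. a j)\<^sup>2)\<^sup>2" by (simp add: eval_nat_numeral)
    also have "\<dots> \<le> (real d * (\<Sum>j<d. (a j)\<^sup>2))\<^sup>2" using 1 by (intro power_mono) auto
    also have "\<dots> = (real d)\<^sup>2 * (\<Sum>j<d. (a j)\<^sup>2)\<^sup>2" by (simp add: power_mult_distrib)
    also have "\<dots> \<le> (real d)\<^sup>2 * ((\<Sum>j<d. a j) * (\<Sum>j<d. a j ^ 3))" using 2 by (intro mult_left_mono) auto
    finally have "(\<Sum>j<d. a j) * (\<Sum>j<d. a j) ^ 3 \<le> (\<Sum>j<d. a j) * ((real d)\<^sup>2 * (\<Sum>j<d. a j ^ 3))" by (simp add: mult_ac)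
    then show ?thesis using pos by simp
  qed
qed

text \<open>
  A point of the unit ball is a net point \<open>v\<close> plus \<open>h\<close> with \<open>|h| \<le> 1 / 2\<close>, and \<open>(p + q) ^ 4 \<le> 8 p ^ 4 + 8 q ^ 4\<close>:
  the contribution of \<open>h\<close> is at most half of the supremum and is absorbed.
\<close>

lemma fourth_moment_from_net:
  fixes Z :: "nat \<Rightarrow> nat \<Rightarrow> real"
  assumes d: "1 \<le> d"
    and net: "\<And>k. k \<in> grid d 2 \<Longrightarrow> sqn d (netpt d 2 k) \<le> 1 \<Longrightarrow> (\<Sum>i<n. dot d (Z i) (netpt d 2 k) ^ 4) \<le> b"
  shows "(\<Sum>i<n. dot d (Z i) x ^ 4) \<le> 16 * b * (sqn d x)\<^sup>2"
proof -
  define F where "F x = (\<Sum>i<n. dot d (Z i) x ^ 4)" for x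
  have Fs: "F (\<lambda>j. c * x j) = c ^ 4 * F x" for c x
    by (simp add: F_def dot_scale power_mult_distrib sum_distrib_left)
  have F4: "F x \<le> (\<Sum>i<n. (sqn d (Z i))\<^sup>2) * (sqn d x)\<^sup>2" for x
  proof -
    have "dot d (Z i) x ^ 4 \<le> (sqn d (Z i))\<^sup>2 * (sqn d x)\<^sup>2" for i
      using power_mono[OF dot_Cauchy_Schwarz[of d "Z i" x], of 2] by (simp add: power_mult_distrib power_mult[symmetric])
    then show ?thesis unfolding F_def sum_distrib_right by (intro sum_mono)
  qed
  define s where "s = (SUP x\<in>{x. sqn d x \<le> 1}. F x)"
  \<comment> \<open>The crude bound makes the supremum finite, without which absorbing
    \<open>s / 2\<close> would be void.\<close>
  have bdd: "bdd_above (F ` {x. sqn d x \<le> 1})"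
  proof (rule bdd_aboveI2)
    fix x assume "x \<in> {x. sqn d x \<le> 1}"
    then have "(sqn d x)\<^sup>2 \<le> 1" by (simp add: power_le_one)
    then have "(\<Sum>i<n. (sqn d (Z i))\<^sup>2) * (sqn d x)\<^sup>2 \<le> (\<Sum>i<n. (sqn d (Z i))\<^sup>2) * 1"
      by (intro mult_left_mono sum_nonneg) auto
    then show "F x \<le> (\<Sum>i<n. (sqn d (Z i))\<^sup>2)" using F4[of x] by simp
  qed
  have le_s: "F x \<le> s" if "sqn d x \<le> 1" for x
    unfolding s_def using that bdd by (intro cSUP_upper) auto
  have "F x \<le> 8 * b + s / 2" if x: "sqn d x \<le> 1" for x
  proof -
    obtain k where k: "k \<in> grid d 2" "sqn d (netpt d 2 k) \<le> 1" "sqn d (\<lambda>j. x j - netpt d 2 k j) \<le> 1 / 2\<^sup>2"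
      using netpt_approx[OF d _ x, of 2] by auto
    define v where "v = netpt d 2 k"
    define h where "h j = x j - v j" for j
    have four: "(p + q) ^ 4 \<le> 8 * p ^ 4 + 8 * q ^ 4" for p q :: real
    proof -
      have "(p + q)\<^sup>2 \<le> 2 * p\<^sup>2 + 2 * q\<^sup>2"
        using zero_le_power2[of "p - q"] by (simp add: power2_eq_square algebra_simps)
      then have "((p + q)\<^sup>2)\<^sup>2 \<le> (2 * p\<^sup>2 + 2 * q\<^sup>2)\<^sup>2" by (intro power_mono) auto
      also have "\<dots> \<le> 8 * (p\<^sup>2)\<^sup>2 + 8 * (q\<^sup>2)\<^sup>2"
        using zero_le_power2[of "p\<^sup>2 - q\<^sup>2"] by (simp add: power2_eq_square algebra_simps)
      finally show ?thesis by (simp add: power_mult[symmetric])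
    qed
    have "dot d (Z i) x = dot d (Z i) v + dot d (Z i) h" for i
      using dot_add[of d "Z i" 1 v 1 h] by (simp add: h_def)
    then have "F x \<le> (\<Sum>i<n. 8 * dot d (Z i) v ^ 4 + 8 * dot d (Z i) h ^ 4)"
      unfolding F_def by (intro sum_mono) (simp add: four)
    also have "\<dots> = 8 * F v + 8 * F h" by (simp add: F_def sum.distrib sum_distrib_left)
    also have "F h = (1 / 2) ^ 4 * F (\<lambda>j. 2 * h j)"
      using Fs[of "1 / 2" "\<lambda>j. 2 * h j"] by simp
    also have "F (\<lambda>j. 2 * h j) \<le> s"
    proof (intro le_s)
      have "sqn d h \<le> 1 / 4" using k(3) by (simp add: h_def[abs_def] v_def)
      then show "sqn d (\<lambda>j. 2 * h j) \<le> 1" by (simp only: sqn_scale) simp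
    qed
    also have "F v \<le> b" using net[OF k(1,2)] by (simp add: F_def v_def)
    finally show ?thesis by (simp add: field_simps)
  qed
  then have "s \<le> 8 * b + s / 2"
    unfolding s_def[symmetric] by (subst s_def, intro cSUP_least) (auto intro: exI[of _ "\<lambda>_. 0"] simp: sqn_def)
  then have s: "s \<le> 16 * b" by simp
  show ?thesis
  proof (cases "sqn d x = 0")
    case True
    then show ?thesis using F4[of x] by (simp add: F_def)
  next
    case False
    then have pos: "0 < sqn d x" using sqn_nonneg[of d x] by linarith
    define c where "c = sqrt (sqn d x)"
    have c: "0 < c" "c\<^sup>2 = sqn d x" using pos by (auto simp: c_def)
    have "F x = c ^ 4 * F (\<lambda>j. (1 / c) * x j)"
      using Fs[of c "\<lambda>j. (1 / c) * x j"] c by simp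
    also have "\<dots> \<le> c ^ 4 * s"
    proof (intro mult_left_mono le_s)
      show "sqn d (\<lambda>j. (1 / c) * x j) \<le> 1"
        unfolding sqn_scale using c pos by (simp add: power_divide)
    qed simp
    also have "\<dots> \<le> c ^ 4 * (16 * b)" using s by (intro mult_left_mono) auto
    also have "c ^ 4 = (sqn d x)\<^sup>2" using c(2) by (metis power_mult numeral_times_numeral semiring_norm(13) semiring_norm(12) mult_2 numeral_Bit0)
    finally show ?thesis by (simp add: F_def mult_ac)
  qed
qed

text \<open>The fourth-moment bound makes the total margin Lipschitz with constant
  \<open>n * C\<close>, so a net of mesh \<open>1 / R = c / (8 * C)\<close> loses at most
  \<open>c * n / 8\<close>, half of what the net points provide. Homogeneity extends the bound from
  the unit sphere.\<close>

lemma margin_from_net: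
  fixes Z :: "nat \<Rightarrow> nat \<Rightarrow> real" and s :: "nat \<Rightarrow> real"
  assumes d: "1 \<le> d" and n: "1 \<le> n" and s: "\<And>i. \<bar>s i\<bar> = 1" and C: "1 \<le> C" and c: "0 < c" "c \<le> 1"
    and F: "\<And>x. (\<Sum>i<n. dot d (Z i) x ^ 4) \<le> C * real n * (sqn d x)\<^sup>2"
    and R: "R = 8 * C / c"
    and net: "\<And>k. k \<in> grid d R \<Longrightarrow> sqn d (netpt d R k) \<le> 1 \<Longrightarrow> 1 / 4 \<le> sqn d (netpt d R k) \<Longrightarrow>
        c / 4 * real n \<le> (\<Sum>i<n. max 0 (- s i * dot d (Z i) (netpt d R k)))"
  shows "c / 8 * real n * sqrt (sqn d x) \<le> (\<Sum>i<n. max 0 (- s i * dot d (Z i) x))"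
proof -
  have n0: "0 < real n" using n by simp
  have R8: "8 \<le> R" "0 < R"
  proof -
    have "8 * 1 / 1 \<le> 8 * C / c" using C c by (intro frac_le mult_left_mono) auto
    then show "8 \<le> R" by (simp add: R)
    then show "0 < R" by simp
  qed
  have abs_sum: "(\<Sum>i<n. \<bar>dot d (Z i) h\<bar>) \<le> real n * C * sqrt (sqn d h)" for h
  proof (rule power2_le_imp_le)
    have "((\<Sum>i<n. (dot d (Z i) h)\<^sup>2))\<^sup>2 \<le> (real n * (C * sqn d h))\<^sup>2"
    proof -
      have "(\<Sum>i<n. 1 * (dot d (Z i) h)\<^sup>2)\<^sup>2 \<le> (\<Sum>i<n. 1\<^sup>2) * (\<Sum>i<n. ((dot d (Z i) h)\<^sup>2)\<^sup>2)"
        by (rule Cauchy_Schwarz_ineq_sum)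
      also have "\<dots> = real n * (\<Sum>i<n. dot d (Z i) h ^ 4)" by (simp add: power_mult[symmetric])
      also have "\<dots> \<le> real n * (C * real n * (sqn d h)\<^sup>2)" by (intro mult_left_mono F) auto
      also have "\<dots> = (real n)\<^sup>2 * ((sqn d h)\<^sup>2 * C)" by (simp add: power2_eq_square)
      also have "\<dots> \<le> (real n)\<^sup>2 * ((sqn d h)\<^sup>2 * C\<^sup>2)"
        using C by (intro mult_left_mono) (auto simp: self_le_power)
      finally show ?thesis by (simp add: power_mult_distrib mult_ac)
    qed
    then have 2: "(\<Sum>i<n. (dot d (Z i) h)\<^sup>2) \<le> real n * (C * sqn d h)"
    proof (rule power2_le_imp_le)
      show "0 \<le> real n * (C * sqn d h)"
        using C by (intro mult_nonneg_nonneg sqn_nonneg) auto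
    qed
    have "(\<Sum>i<n. 1 * \<bar>dot d (Z i) h\<bar>)\<^sup>2 \<le> (\<Sum>i<n. 1\<^sup>2) * (\<Sum>i<n. \<bar>dot d (Z i) h\<bar>\<^sup>2)"
      by (rule Cauchy_Schwarz_ineq_sum)
    also have "\<dots> \<le> real n * (real n * (C * sqn d h))" using 2 by (simp add: mult_left_mono)
    also have "\<dots> = (real n)\<^sup>2 * (sqn d h * C)" by (simp add: power2_eq_square)
    also have "\<dots> \<le> (real n)\<^sup>2 * (sqn d h * C\<^sup>2)" using C by (intro mult_left_mono) (auto simp: self_le_power)
    finally show "(\<Sum>i<n. \<bar>dot d (Z i) h\<bar>)\<^sup>2 \<le> (real n * C * sqrt (sqn d h))\<^sup>2"
      by (simp add: power_mult_distrib mult_ac)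
  qed (use C in simp)
  have unit: "c / 8 * real n \<le> (\<Sum>i<n. max 0 (- s i * dot d (Z i) x))" if x: "sqn d x = 1" for x
  proof -
    obtain k where k: "k \<in> grid d R" "sqn d (netpt d R k) \<le> 1" "sqn d (\<lambda>j. x j - netpt d R k j) \<le> 1 / R\<^sup>2"
      using netpt_approx[OF d R8(2), of x] x by auto
    define v where "v = netpt d R k"
    define h where "h j = x j - v j" for j
    have hR: "sqrt (sqn d h) \<le> 1 / R"
      using k(3) R8 by (intro real_le_lsqrt) (auto simp: h_def[abs_def] v_def power_divide)
    have dx: "dot d (Z i) x = dot d (Z i) v + dot d (Z i) h" for i
      using dot_add[of d "Z i" 1 v 1 h] by (simp add: h_def)
    \<comment> \<open>A net point close to a unit vector is not short, so the margin is requested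
      only at net points of norm at least one half.\<close>
    have "1 / 4 \<le> sqn d v"
    proof -
      have "sqn d x = sqn d v + 2 * dot d v h + sqn d h"
        by (simp add: sqn_def dot_def h_def sum.distrib[symmetric] sum_distrib_left power2_eq_square algebra_simps)
      moreover have "2 * dot d v h \<le> sqn d v + sqn d h"
      proof -
        have "2 * (v j * h j) \<le> (v j)\<^sup>2 + (h j)\<^sup>2" for j
          using zero_le_power2[of "v j - h j"] by (simp add: power2_diff)
        then show ?thesis unfolding dot_def sqn_def sum_distrib_left sum.distrib[symmetric] by (intro sum_mono)
      qed
      moreover have "sqn d h \<le> 1 / 4"
      proof -
        have "1 / R\<^sup>2 \<le> 1 / 8\<^sup>2" using R8 by (intro divide_left_mono power_mono) auto
        then show ?thesis using k(3) by (simp add: h_def[abs_def] v_def)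
      qed
      ultimately show ?thesis using x by linarith
    qed
    then have "c / 4 * real n \<le> (\<Sum>i<n. max 0 (- s i * dot d (Z i) v))"
      using net[OF k(1,2)] by (simp add: v_def)
    also have "\<dots> \<le> (\<Sum>i<n. max 0 (- s i * dot d (Z i) x) + \<bar>dot d (Z i) h\<bar>)"
    proof (rule sum_mono)
      fix i
      have "s i = 1 \<or> s i = - 1" using s[of i] by (simp add: abs_if split: if_splits)
      then show "max 0 (- s i * dot d (Z i) v) \<le> max 0 (- s i * dot d (Z i) x) + \<bar>dot d (Z i) h\<bar>"
        unfolding dx by (auto simp: max_def abs_if)
    qed
    also have "\<dots> \<le> (\<Sum>i<n. max 0 (- s i * dot d (Z i) x)) + real n * C * (1 / R)"
    proof -
      have "real n * C * sqrt (sqn d h) \<le> real n * C * (1 / R)" using C hR by (intro mult_left_mono) auto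
      then show ?thesis using abs_sum[of h] by (simp add: sum.distrib)
    qed
    also have "real n * C * (1 / R) = c / 8 * real n" using C c by (simp add: R)
    finally show ?thesis by simp
  qed
  show ?thesis
  proof (cases "sqn d x = 0")
    case True
    then show ?thesis by (auto intro!: sum_nonneg)
  next
    case False
    then have pos: "0 < sqn d x" using sqn_nonneg[of d x] by linarith
    define e where "e = sqrt (sqn d x)"
    have e: "0 < e" "e\<^sup>2 = sqn d x" using pos by (auto simp: e_def)
    have "c / 8 * real n \<le> (\<Sum>i<n. max 0 (- s i * dot d (Z i) (\<lambda>j. (1 / e) * x j)))"
    proof (rule unit)
      show "sqn d (\<lambda>j. (1 / e) * x j) = 1"
        unfolding sqn_scale using e pos by (simp add: power_divide)
    qed
    also have "\<dots> = (\<Sum>i<n. (1 / e) * max 0 (- s i * dot d (Z i) x))"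
    proof (rule sum.cong)
      fix i
      have "max 0 ((1 / e) * t) = (1 / e) * max 0 t" for t
        using e by (simp add: max_mult_distrib_left)
      from this[of "- s i * dot d (Z i) x"]
      show "max 0 (- s i * dot d (Z i) (\<lambda>j. (1 / e) * x j)) = (1 / e) * max 0 (- s i * dot d (Z i) x)"
        unfolding dot_scale by (simp only: mult.left_commute)
    qed simp
    finally show ?thesis
      using e by (simp add: sum_divide_distrib[symmetric] e_def[symmetric] field_simps)
  qed
qed

section \<open>The good event\<close>

lemma ennreal_power_mono:
  fixes a b :: ennreal
  shows "a \<le> b \<Longrightarrow> a ^ n \<le> b ^ n"
  by (induction n) (auto intro!: mult_mono)

lemma pos_def_mat_inv:
  assumes M: "pos_def d M"
  shows "pos_def d (mat_inv M)" "mat_inv (mat_inv M) = M"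
proof -
  obtain A where "whitening d M A" using pos_def_imp_whitening[OF M] by blast
  then interpret W: whitening d M A .
  show "mat_inv (mat_inv M) = M" by (rule W.mat_inv_mat_inv_H)
  show "pos_def d (mat_inv M)"
    unfolding pos_def_def
  proof (intro conjI ballI impI)
    fix u :: rvec assume u: "u \<in> carrier_vec d" "u \<noteq> 0\<^sub>v d"
    define v where "v = mat_inv M *\<^sub>v u"
    have v: "v \<in> carrier_vec d" using W.mat_inv_H_carrier u by (simp add: v_def)
    have Mv: "M *\<^sub>v v = u"
      using W.H_mat_inv(1) W.H W.mat_inv_H_carrier u
      by (simp add: v_def assoc_mult_mat_vec[symmetric, of _ d d _ d])
    have "v \<noteq> 0\<^sub>v d"
    proof
      assume "v = 0\<^sub>v d"
      then have "u = M *\<^sub>v 0\<^sub>v d" using Mv by simp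
      also have "\<dots> = 0\<^sub>v d" using W.H by (intro eq_vecI) auto
      finally show False using u by simp
    qed
    then have "0 < v \<bullet> (M *\<^sub>v v)" using M v by (simp add: pos_def_def)
    then show "0 < u \<bullet> (mat_inv M *\<^sub>v u)"
      using u v by (simp add: Mv v_def[symmetric] comm_scalar_prod[of v d u])
  qed (use W.mat_inv_H_carrier W.transpose_mat_inv_H in auto)
qed

section \<open>Gaussian moments and the law of one observation\<close>

lemma has_bochner_integral_gauss_dot_even:
  "has_bochner_integral (gauss d) (\<lambda>z. dot d v z ^ (2 * k)) (gmom k * sqn d v ^ k)"
proof -
  have e: "(sqrt (sqn d v) * t) ^ (2 * k) = sqn d v ^ k * t ^ (2 * k)" for t
    by (simp add: power_mult_distrib power_mult)
  have h: "has_bochner_integral std_gauss (\<lambda>t. (sqrt (sqn d v) * t) ^ (2 * k)) (sqn d v ^ k * gmom k)"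
    unfolding e by (intro has_bochner_integral_mult_right has_bochner_integral_std_gauss_even)
  show ?thesis
    unfolding has_bochner_integral_iff
    using h integral_gauss_dot[of "\<lambda>t. t ^ (2 * k)" d v] by (simp add: has_bochner_integral_iff mult.commute)
qed

lemma has_bochner_integral_gauss_dot_2: "has_bochner_integral (gauss d) (\<lambda>z. (dot d v z)\<^sup>2) (sqn d v)"
  using has_bochner_integral_gauss_dot_even[of d v 1] by (simp add: gmom_def)

lemma has_bochner_integral_gauss_dot_4: "has_bochner_integral (gauss d) (\<lambda>z. dot d v z ^ 4) (3 * (sqn d v)\<^sup>2)"
  using has_bochner_integral_gauss_dot_even[of d v 2] by (simp add: gmom_def eval_nat_numeral)

lemma measurable_scalar_prod [measurable]:
  "u \<in> carrier_vec d \<Longrightarrow> (\<lambda>x. u \<bullet> x) \<in> borel_measurable (lborel_vec d)"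
proof -
  assume u: "u \<in> carrier_vec d"
  have "(\<lambda>x. \<Sum>j<d. u $ j * x $ j) \<in> borel_measurable (lborel_vec d)" by measurable
  moreover have "u \<bullet> x = (\<Sum>j<d. u $ j * x $ j)" if "x \<in> space (lborel_vec d)" for x
    using that u by (simp add: space_lborel_vec scalar_prod_def lessThan_atLeast0)
  ultimately show ?thesis by (simp cong: measurable_cong)
qed

text \<open>The precision matrix \<open>mat_inv M\<close> is whitened, so that \<open>ax z\<close>
  has law \<open>N(0, M)\<close> for a standard Gaussian \<open>z\<close>.\<close>

locale obs_model = whitening d "mat_inv M" A for d :: nat and M A :: rmat +
  fixes \<beta> :: rvec
  assumes d1: "1 \<le> d" and M: "pos_def d M" and \<beta>: "\<beta> \<in> carrier_vec d"
begin

lemma MM: "mat_inv (mat_inv M) = M" by (rule pos_def_mat_inv[OF M])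

lemma M_carrier: "M \<in> carrier_mat d d" using M by (simp add: pos_def_def)

lemma sqn_co_M: "u \<in> carrier_vec d \<Longrightarrow> sqn d (co u) = u \<bullet> (M *\<^sub>v u)"
  by (simp add: sqn_co MM)

abbreviation "zv \<equiv> (0\<^sub>v d :: rvec)"

lemma emb_zero: "emb zv x = ax x"
  by (simp add: emb_def)

lemma gaussian_M: "gaussian d zv M = distr (gauss d) (lborel_vec d) ax"
  using gaussian_eq_distr[of zv] by (simp add: MM emb_zero[abs_def])

lemma measurable_ax: "ax \<in> gauss d \<rightarrow>\<^sub>M lborel_vec d"
  using measurable_emb_gauss[of zv] by (simp add: emb_zero[abs_def])

abbreviation "obs \<equiv> obs_law d M \<beta>"

lemma measurable_sigmoid [measurable]: "sigmoid \<in> borel_measurable borel"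
  unfolding sigmoid_def[abs_def] by measurable

lemma pmf_bernoulli_sigmoid: "pmf (bernoulli_pmf (sigmoid t)) y = (if y then sigmoid t else 1 - sigmoid t)"
  using sigmoid_bounds[of t] by simp

lemma obs_density_measurable [measurable]:
  "(\<lambda>(x, y). ennreal (pmf (bernoulli_pmf (sigmoid (\<beta> \<bullet> x))) y)) \<in> borel_measurable (lborel_vec d \<Otimes>\<^sub>M count_space UNIV)"
proof -
  have [measurable]: "(\<lambda>x. \<beta> \<bullet> x) \<in> borel_measurable (lborel_vec d)" by (rule measurable_scalar_prod[OF \<beta>])
  show ?thesis unfolding pmf_bernoulli_sigmoid by measurable
qed

lemma sets_obs [measurable_cong]: "sets obs = sets (lborel_vec d \<Otimes>\<^sub>M count_space UNIV)"
  unfolding obs_law_def sets_density by (intro sets_pair_measure_cong) (simp_all add: gaussian_def)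

lemma space_obs: "space obs = carrier_vec d \<times> UNIV"
  unfolding obs_law_def gaussian_def by (simp add: space_pair_measure space_lborel_vec)

lemma nn_integral_obs:
  assumes F[measurable]: "F \<in> borel_measurable (lborel_vec d \<Otimes>\<^sub>M count_space UNIV)"
  shows "(\<integral>\<^sup>+p. F p \<partial>obs) = (\<integral>\<^sup>+z. ennreal (sigmoid (\<beta> \<bullet> ax z)) * F (ax z, True)
    + ennreal (1 - sigmoid (\<beta> \<bullet> ax z)) * F (ax z, False) \<partial>gauss d)"
proof -
  let ?G = "gaussian d zv M"
  interpret C: sigma_finite_measure "count_space (UNIV :: bool set)"
    by (rule sigma_finite_measure_count_space_finite) simp
  have [measurable]: "(\<lambda>x. \<beta> \<bullet> x) \<in> borel_measurable (lborel_vec d)" by (rule measurable_scalar_prod[OF \<beta>])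
  have sG: "sets (?G \<Otimes>\<^sub>M count_space (UNIV :: bool set)) = sets (lborel_vec d \<Otimes>\<^sub>M count_space UNIV)"
    by (intro sets_pair_measure_cong) (simp_all add: gaussian_def)
  let ?f = "\<lambda>(x, y). ennreal (pmf (bernoulli_pmf (sigmoid (\<beta> \<bullet> x))) y)"
  have m: "F \<in> borel_measurable (?G \<Otimes>\<^sub>M count_space UNIV)" "?f \<in> borel_measurable (?G \<Otimes>\<^sub>M count_space UNIV)"
    using F obs_density_measurable by (simp_all cong: measurable_cong_sets add: sG)
  have "(\<integral>\<^sup>+p. F p \<partial>obs) = (\<integral>\<^sup>+p. ?f p * F p \<partial>(?G \<Otimes>\<^sub>M count_space UNIV))"
    unfolding obs_law_def by (rule nn_integral_density[OF m(2,1)])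
  also have "\<dots> = (\<integral>\<^sup>+x. \<integral>\<^sup>+y. ?f (x, y) * F (x, y) \<partial>count_space UNIV \<partial>?G)"
    by (rule C.nn_integral_fst[symmetric]) (intro borel_measurable_times_ennreal m)
  also have "\<dots> = (\<integral>\<^sup>+x. ennreal (sigmoid (\<beta> \<bullet> x)) * F (x, True) + ennreal (1 - sigmoid (\<beta> \<bullet> x)) * F (x, False) \<partial>?G)"
    by (simp add: nn_integral_count_space_finite UNIV_bool pmf_bernoulli_sigmoid add.commute)
  also have "\<dots> = (\<integral>\<^sup>+z. ennreal (sigmoid (\<beta> \<bullet> ax z)) * F (ax z, True)
    + ennreal (1 - sigmoid (\<beta> \<bullet> ax z)) * F (ax z, False) \<partial>gauss d)"
    unfolding gaussian_M by (rule nn_integral_distr[OF measurable_ax]) measurable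
  finally show ?thesis .
qed

lemma nn_integral_obs_fst:
  assumes [measurable]: "f \<in> borel_measurable (lborel_vec d)"
  shows "(\<integral>\<^sup>+p. f (fst p) \<partial>obs) = (\<integral>\<^sup>+z. f (ax z) \<partial>gauss d)"
proof -
  have "ennreal (sigmoid t) * c + ennreal (1 - sigmoid t) * c = c" for t and c :: ennreal
    using sigmoid_bounds[of t] by (simp add: distrib_right[symmetric] ennreal_plus[symmetric] del: ennreal_plus)
  moreover have "(\<lambda>p. f (fst p)) \<in> borel_measurable (lborel_vec d \<Otimes>\<^sub>M count_space (UNIV :: bool set))"
    by measurable
  ultimately show ?thesis
    by (subst nn_integral_obs) simp_all
qed

lemma prob_space_obs: "prob_space obs"
proof
  have "emeasure obs (space obs) = (\<integral>\<^sup>+p. 1 \<partial>obs)" by simp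
  also have "\<dots> = (\<integral>\<^sup>+z. 1 \<partial>gauss d)" using nn_integral_obs_fst[of "\<lambda>_. 1"] by simp
  also have "\<dots> = 1" using gauss.emeasure_space_1[of d] by simp
  finally show "emeasure obs (space obs) = 1" .
qed

text \<open>\<open>dual\<close> inverts \<open>co\<close>, and \<open>Zc\<close> recovers from a
  covariate \<open>ax z\<close> its standard Gaussian coordinates \<open>z\<close>; thus
  \<open>X \<bullet> u\<close> becomes the pairing of \<open>Zc X\<close> with
  \<open>co u\<close>.\<close>

definition dual :: "(nat \<Rightarrow> real) \<Rightarrow> rvec" where "dual x = (mat_inv M * A) *\<^sub>v vec d x"

definition Zc :: "rvec \<Rightarrow> nat \<Rightarrow> real" where "Zc X = (\<lambda>i. (transpose_mat (mat_inv M * A) *\<^sub>v X) $ i)"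

lemma HA: "mat_inv M * A \<in> carrier_mat d d" using H A by simp

lemma dual_carrier [simp]: "dual x \<in> carrier_vec d" using HA by (simp add: dual_def)

lemma scalar_prod_dual: "X \<in> carrier_vec d \<Longrightarrow> X \<bullet> dual x = dot d (Zc X) x"
proof -
  assume X: "X \<in> carrier_vec d"
  have t: "transpose_mat (mat_inv M * A) *\<^sub>v X \<in> carrier_vec d"
    using HA by (intro mult_mat_vec_carrier[OF _ X]) simp
  have "X \<bullet> dual x = (transpose_mat (mat_inv M * A) *\<^sub>v X) \<bullet> vec d x"
    unfolding dual_def using HA X by (intro transpose_vec_mult_scalar[symmetric, of _ d d]) auto
  also have "\<dots> = dot d (Zc X) x"
    using t by (subst scalar_prod_eq_dot[of _ d]) (auto simp: Zc_def dot_def)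
  finally show ?thesis .
qed

lemma dual_co: "u \<in> carrier_vec d \<Longrightarrow> dual (co u) = u"
proof -
  assume u: "u \<in> carrier_vec d"
  have "vec d (co u) = transpose_mat A *\<^sub>v u"
    using A by (intro eq_vecI) (auto simp: co_def)
  moreover have "(mat_inv M * A) *\<^sub>v (transpose_mat A *\<^sub>v u) = (mat_inv M * (A * transpose_mat A)) *\<^sub>v u"
    using H A At u by (simp add: assoc_mult_mat_vec[of _ d d _ d])
  ultimately show ?thesis using HAAt u by (simp add: dual_def)
qed

lemma scalar_prod_Zc: "X \<in> carrier_vec d \<Longrightarrow> u \<in> carrier_vec d \<Longrightarrow> X \<bullet> u = dot d (Zc X) (co u)"
  using scalar_prod_dual[of X "co u"] dual_co[of u] by simp

lemma Zc_ax: "j < d \<Longrightarrow> Zc (ax z) j = z j"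
proof -
  assume j: "j < d"
  have "transpose_mat (mat_inv M * A) *\<^sub>v (A *\<^sub>v vec d z) = (transpose_mat (mat_inv M * A) * A) *\<^sub>v vec d z"
    using HA A by (subst assoc_mult_mat_vec[of _ d d _ d]) auto
  also have "transpose_mat (mat_inv M * A) * A = transpose_mat A * (mat_inv M * A)"
    using H A by (simp add: transpose_mult[of _ d d _ d] assoc_mult_mat[of _ d d _ d _ d])
  finally show ?thesis using j white by (simp add: Zc_def ax_def)
qed

lemma dot_Zc_ax: "dot d (Zc (ax z)) x = dot d x z"
  unfolding dot_def by (intro sum.cong) (auto simp: Zc_ax)

lemma measurable_Zc [measurable]: "j < d \<Longrightarrow> (\<lambda>X. Zc X j) \<in> borel_measurable (lborel_vec d)"
proof -
  assume j: "j < d"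
  have "(\<lambda>X. \<Sum>i<d. transpose_mat (mat_inv M * A) $$ (j, i) * X $ i) \<in> borel_measurable (lborel_vec d)"
    by measurable
  moreover have "Zc X j = (\<Sum>i<d. transpose_mat (mat_inv M * A) $$ (j, i) * X $ i)" if "X \<in> space (lborel_vec d)" for X
    unfolding Zc_def using that HA j by (intro mult_mat_vec_index) (auto simp: space_lborel_vec)
  ultimately show ?thesis by (simp cong: measurable_cong)
qed

lemma measurable_dot_Zc [measurable]: "(\<lambda>X. dot d (Zc X) x) \<in> borel_measurable (lborel_vec d)"
  unfolding dot_def by measurable

abbreviation sgn_of :: "rvec \<times> bool \<Rightarrow> real" where "sgn_of p \<equiv> (if snd p then 1 else - 1)"

abbreviation lf :: "(nat \<Rightarrow> real) \<Rightarrow> rvec \<times> bool \<Rightarrow> real" where "lf x p \<equiv> dot d (Zc (fst p)) x"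

lemma obs_exp_tpow:
  assumes "0 \<le> l" "sqn d v \<le> 1"
  shows "(\<integral>\<^sup>+p. ennreal (exp (tpow k l (lf v p))) \<partial>obs) \<le> ennreal (exp (l * ctp k))"
proof -
  have "(\<integral>\<^sup>+p. ennreal (exp (tpow k l (lf v p))) \<partial>obs) = (\<integral>\<^sup>+z. ennreal (exp (tpow k l (dot d v z))) \<partial>gauss d)"
    by (subst nn_integral_obs_fst[where f = "\<lambda>X. ennreal (exp (tpow k l (dot d (Zc X) v)))"]) (measurable, simp add: dot_Zc_ax)
  also have "\<dots> = (\<integral>\<^sup>+t. ennreal (exp (tpow k l (sqrt (sqn d v) * t))) \<partial>std_gauss)"
    by (rule nn_integral_gauss_dot) measurable
  also have "\<dots> \<le> ennreal (exp (l * ctp k))"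
    using assms by (intro nn_integral_exp_tpow) auto
  finally show ?thesis .
qed

lemma obs_exp_sum_tpow:
  assumes "0 \<le> l"
  shows "(\<integral>\<^sup>+p. ennreal (exp (\<Sum>j<d. tpow k l (Zc (fst p) j))) \<partial>obs) \<le> ennreal (exp (real d * (l * ctp k)))"
proof -
  have "(\<integral>\<^sup>+p. ennreal (exp (\<Sum>j<d. tpow k l (Zc (fst p) j))) \<partial>obs) = (\<integral>\<^sup>+z. ennreal (exp (\<Sum>j<d. tpow k l (z j))) \<partial>gauss d)"
    by (subst nn_integral_obs_fst[where f = "\<lambda>X. ennreal (exp (\<Sum>j<d. tpow k l (Zc X j)))"]) (measurable, simp add: Zc_ax)
  also have "\<dots> = (\<integral>\<^sup>+z. (\<Prod>j<d. ennreal (exp (tpow k l (z j)))) \<partial>gauss d)"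
    by (simp add: exp_sum prod_ennreal)
  also have "\<dots> = (\<Prod>j<d. \<integral>\<^sup>+t. ennreal (exp (tpow k l t)) \<partial>std_gauss)"
    unfolding gauss_def by (rule gauss_prod.product_nn_integral_prod) auto
  also have "\<dots> \<le> (\<Prod>j<d. ennreal (exp (l * ctp k)))"
    using nn_integral_exp_tpow[OF assms, of 1 k] by (simp add: ennreal_power_mono)
  also have "\<dots> = ennreal (exp (real d * (l * ctp k)))"
    by (simp add: ennreal_power exp_of_nat_mult)
  finally show ?thesis .
qed

text \<open>The left side averages over the label, given the form \<open>l\<close> and the predictor
  \<open>b\<close> under the true parameter. The bound is polynomial in \<open>l\<close> and
  \<open>b\<close>, so its Gaussian mean needs no more than second and fourth moments of single
  linear forms. Either label has probability at least \<open>exp (- |b|) / 2\<close>; the remaining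
  estimates replace this and \<open>|l|\<close> by polynomial minorants.\<close>

lemma exp_margin_pointwise:
  fixes c K l b :: real
  assumes c: "0 \<le> c" and K: "0 < K"
  shows "sigmoid b * exp (- c * max 0 (- l)) + (1 - sigmoid b) * exp (- c * max 0 l)
    \<le> 1 - c / 2 * exp (- 32 * K) * ((l\<^sup>2 - l ^ 4 / 4) - (K * l\<^sup>2 + b\<^sup>2 / K) / (64 * K)) + c\<^sup>2 * l\<^sup>2 / 2"
proof -
  let ?k = "K * l\<^sup>2 + b\<^sup>2 / K"
  let ?m = "(l\<^sup>2 - l ^ 4 / 4) - ?k / (64 * K)"
  have ex: "exp (- c * \<bar>l\<bar>) \<le> 1 - c * \<bar>l\<bar> + c\<^sup>2 * l\<^sup>2 / 2"
  proof -
    obtain t where t: "\<bar>t\<bar> \<le> \<bar>- (c * \<bar>l\<bar>)\<bar>" "exp (- (c * \<bar>l\<bar>)) = (\<Sum>m<3. (- (c * \<bar>l\<bar>)) ^ m / fact m) + exp t / fact 3 * (- (c * \<bar>l\<bar>)) ^ 3"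
      using Maclaurin_exp_le[of "- (c * \<bar>l\<bar>)" 3] by auto
    have "exp t / fact 3 * (- (c * \<bar>l\<bar>)) ^ 3 \<le> 0"
      using c by (intro mult_nonneg_nonpos) auto
    then have "exp (- (c * \<bar>l\<bar>)) \<le> (\<Sum>m<3. (- (c * \<bar>l\<bar>)) ^ m / fact m)" using t(2) by linarith
    then show ?thesis by (simp add: eval_nat_numeral algebra_simps)
  qed
  have sg: "exp (- \<bar>b\<bar>) / 2 \<le> sigmoid b" "exp (- \<bar>b\<bar>) / 2 \<le> 1 - sigmoid b"
  proof -
    have g: "exp (- \<bar>b\<bar>) / 2 \<le> sigmoid b" for b :: real
    proof -
      have "exp (- b) \<le> exp \<bar>b\<bar>" "1 \<le> exp \<bar>b\<bar>" by auto
      then have "1 + exp (- b) \<le> 2 * exp \<bar>b\<bar>" by linarith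
      then have "1 / (2 * exp \<bar>b\<bar>) \<le> 1 / (1 + exp (- b))" by (intro divide_left_mono mult_pos_pos add_pos_pos) auto
      then show ?thesis by (simp add: sigmoid_def exp_minus field_simps)
    qed
    show "exp (- \<bar>b\<bar>) / 2 \<le> sigmoid b" by (rule g)
    show "exp (- \<bar>b\<bar>) / 2 \<le> 1 - sigmoid b" using g[of "- b"] by (simp add: sigmoid_minus)
  qed
  have s01: "0 < sigmoid b" "sigmoid b < 1" by (rule sigmoid_bounds)+
  have "sigmoid b * exp (- c * max 0 (- l)) + (1 - sigmoid b) * exp (- c * max 0 l) \<le> 1 - c * \<bar>l\<bar> * (exp (- \<bar>b\<bar>) / 2) + c\<^sup>2 * l\<^sup>2 / 2"
  proof -
    have gen: "(1 - \<sigma>) + \<sigma> * exp (- c * \<bar>l\<bar>) \<le> 1 - c * \<bar>l\<bar> * (exp (- \<bar>b\<bar>) / 2) + c\<^sup>2 * l\<^sup>2 / 2"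
      if "exp (- \<bar>b\<bar>) / 2 \<le> \<sigma>" "0 \<le> \<sigma>" "\<sigma> \<le> 1" for \<sigma>
    proof -
      have "\<sigma> * exp (- c * \<bar>l\<bar>) \<le> \<sigma> * (1 - c * \<bar>l\<bar> + c\<^sup>2 * l\<^sup>2 / 2)" using ex that by (intro mult_left_mono) auto
      moreover have "(c * \<bar>l\<bar>) * (exp (- \<bar>b\<bar>) / 2) \<le> (c * \<bar>l\<bar>) * \<sigma>" using c that by (intro mult_left_mono) auto
      moreover have "\<sigma> * (c\<^sup>2 * l\<^sup>2 / 2) \<le> 1 * (c\<^sup>2 * l\<^sup>2 / 2)" using that by (intro mult_right_mono) auto
      ultimately show ?thesis by (simp add: algebra_simps)
    qed
    show ?thesis
    proof (cases "0 \<le> l")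
      case True
      then show ?thesis using gen[OF sg(2)] s01 by (simp add: max_def)
    next
      case False
      then show ?thesis using gen[OF sg(1)] s01 by (simp add: max_def)
    qed
  qed
  also have "\<dots> \<le> 1 - c / 2 * exp (- 32 * K) * ?m + c\<^sup>2 * l\<^sup>2 / 2"
  proof -
    \<comment> \<open>The minorant of \<open>exp (- |b|)\<close> is affine in \<open>|b|\<close>:
      below \<open>32 * K\<close> its second factor is at most one, beyond it is negative.\<close>
    have A: "exp (- (32 * K)) * (1 - \<bar>b\<bar> / (32 * K)) \<le> exp (- \<bar>b\<bar>)"
    proof (cases "\<bar>b\<bar> \<le> 32 * K")
      case True
      have "exp (- (32 * K)) * (1 - \<bar>b\<bar> / (32 * K)) \<le> exp (- (32 * K)) * 1"
        using K by (intro mult_left_mono) auto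
      moreover have "exp (- (32 * K)) \<le> exp (- \<bar>b\<bar>)" using True by simp
      ultimately show ?thesis by linarith
    next
      case False
      then have "1 - \<bar>b\<bar> / (32 * K) \<le> 0" using K by (simp add: field_simps)
      then have "exp (- (32 * K)) * (1 - \<bar>b\<bar> / (32 * K)) \<le> 0" by (simp add: mult_le_0_iff)
      moreover have "0 < exp (- \<bar>b\<bar>)" by simp
      ultimately show ?thesis by linarith
    qed
    \<comment> \<open>A polynomial minorant of \<open>|l|\<close>: always at most one by completing
      the square, and at most \<open>l ^ 2\<close> when \<open>|l| \<le> 1\<close>.\<close>
    have "l\<^sup>2 - l ^ 4 / 4 \<le> \<bar>l\<bar>"
    proof -
      have "0 \<le> (\<bar>l\<bar>\<^sup>2 / 2 - 1)\<^sup>2 + (\<bar>l\<bar> / 1 - 1) * 0" by simp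
      then have "l\<^sup>2 - l ^ 4 / 4 \<le> 1" by (simp add: power2_diff power_divide power_mult[symmetric])
      moreover have "l\<^sup>2 - l ^ 4 / 4 \<le> \<bar>l\<bar>" if "\<bar>l\<bar> \<le> 1"
      proof -
        have "\<bar>l\<bar> * \<bar>l\<bar> \<le> \<bar>l\<bar> * 1" using that by (intro mult_left_mono) auto
        then have "l\<^sup>2 \<le> \<bar>l\<bar>" by (simp add: power2_eq_square)
        moreover have "0 \<le> l ^ 4" by (simp add: zero_le_even_power)
        ultimately show ?thesis by linarith
      qed
      ultimately show ?thesis by linarith
    qed
    moreover have "\<bar>l\<bar> * \<bar>b\<bar> / (32 * K) \<le> ?k / (64 * K)"
    proof -
      have "2 * (\<bar>b\<bar> * \<bar>l\<bar>) \<le> \<bar>b\<bar>\<^sup>2 / K + K * \<bar>l\<bar>\<^sup>2" by (rule two_mult_le_scaled[OF K])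
      then have "2 * (\<bar>b\<bar> * \<bar>l\<bar>) / (64 * K) \<le> ?k / (64 * K)" using K by (intro divide_right_mono) auto
      then show ?thesis by (simp add: mult.commute)
    qed
    ultimately have "(l\<^sup>2 - l ^ 4 / 4) - ?k / (64 * K) \<le> \<bar>l\<bar> - \<bar>l\<bar> * \<bar>b\<bar> / (32 * K)" by linarith
    then have "exp (- (32 * K)) * ?m \<le> exp (- (32 * K)) * (\<bar>l\<bar> - \<bar>l\<bar> * \<bar>b\<bar> / (32 * K))"
      by (rule mult_left_mono) simp
    also have "\<dots> = \<bar>l\<bar> * (exp (- (32 * K)) * (1 - \<bar>b\<bar> / (32 * K)))" by (simp add: algebra_simps)
    also have "\<dots> \<le> \<bar>l\<bar> * exp (- \<bar>b\<bar>)" by (rule mult_left_mono[OF A]) simp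
    finally have "c / 2 * (exp (- (32 * K)) * ?m) \<le> c / 2 * (\<bar>l\<bar> * exp (- \<bar>b\<bar>))"
      using c by (intro mult_left_mono) auto
    then show ?thesis by (simp add: mult_ac)
  qed
  finally show ?thesis .
qed

text \<open>For \<open>sqn d v\<close> between \<open>1 / 4\<close> and \<open>1\<close> the
  difference of second and fourth moments is at least \<open>1 / 16\<close> and the cross term at
  most \<open>1 / 32\<close>, so \<open>?m \<ge> 1 / 32\<close>. The constant \<open>c\<close> is
  exactly \<open>exp (- 32 * K) / 2\<close> times \<open>1 / 32\<close>: the linear gain is then at
  least \<open>c ^ 2\<close>, twice the largest quadratic loss.\<close>

lemma obs_exp_margin:
  assumes K: "0 < K" "wnorm M \<beta> \<le> K" and v: "sqn d v \<le> 1" "1 / 4 \<le> sqn d v" and c: "c = exp (- 32 * K) / 64"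
  shows "(\<integral>\<^sup>+p. ennreal (exp (- c * max 0 (- sgn_of p * lf v p))) \<partial>obs) \<le> ennreal (exp (- c\<^sup>2 / 2))"
proof -
  let ?k = "K * sqn d v + sqn d (co \<beta>) / K"
  let ?m = "(sqn d v - 3 * (sqn d v)\<^sup>2 / 4) - ?k / (64 * K)"
  have c0: "0 < c" by (simp add: c)
  let ?l = "\<lambda>z. dot d v z" and ?b = "\<lambda>z. dot d (co \<beta>) z"
  let ?p = "\<lambda>z. 1 - c / 2 * exp (- 32 * K) * (((?l z)\<^sup>2 - ?l z ^ 4 / 4) - (K * (?l z)\<^sup>2 + (?b z)\<^sup>2 / K) / (64 * K)) + c\<^sup>2 * (?l z)\<^sup>2 / 2"
  define q where "q = 1 - c / 2 * exp (- 32 * K) * ?m + c\<^sup>2 * sqn d v / 2"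
  have hb: "has_bochner_integral (gauss d) ?p q"
    unfolding q_def
    by (intro has_bochner_integral_add has_bochner_integral_diff has_bochner_integral_mult_right has_bochner_integral_divide_zero
        has_bochner_integral_gauss_dot_2 has_bochner_integral_gauss_dot_4)
      (simp add: has_bochner_integral_iff gauss.prob_space)
  have pt: "sigmoid (?b z) * exp (- c * max 0 (- ?l z)) + (1 - sigmoid (?b z)) * exp (- c * max 0 (?l z)) \<le> ?p z" for z
    using c0 K(1) by (intro exp_margin_pointwise) auto
  have p0: "0 \<le> ?p z" for z
    using order_trans[OF _ pt[of z], of 0] sigmoid_bounds[of "?b z"] by (simp add: add_nonneg_nonneg)
  have [measurable]: "(\<lambda>p. ennreal (exp (- c * max 0 (- sgn_of p * lf v p)))) \<in> borel_measurable (lborel_vec d \<Otimes>\<^sub>M count_space UNIV)"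
    by measurable
  have "(\<integral>\<^sup>+p. ennreal (exp (- c * max 0 (- sgn_of p * lf v p))) \<partial>obs)
      = (\<integral>\<^sup>+z. ennreal (sigmoid (?b z)) * ennreal (exp (- c * max 0 (- ?l z))) + ennreal (1 - sigmoid (?b z)) * ennreal (exp (- c * max 0 (?l z))) \<partial>gauss d)"
    by (subst nn_integral_obs) (measurable, simp add: dot_Zc_ax scalar_prod_ax[OF \<beta>])
  also have "\<dots> = (\<integral>\<^sup>+z. ennreal (sigmoid (?b z) * exp (- c * max 0 (- ?l z)) + (1 - sigmoid (?b z)) * exp (- c * max 0 (?l z))) \<partial>gauss d)"
    using sigmoid_bounds by (intro nn_integral_cong) (simp add: ennreal_mult[symmetric] ennreal_plus[symmetric] less_imp_le del: ennreal_plus)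
  also have "\<dots> \<le> (\<integral>\<^sup>+z. ennreal (?p z) \<partial>gauss d)"
    by (intro nn_integral_mono ennreal_leI pt)
  also have "\<dots> = ennreal q"
    using hb p0 by (simp add: has_bochner_integral_iff nn_integral_eq_integral)
  also have "\<dots> \<le> ennreal (exp (- c\<^sup>2 / 2))"
  proof (rule ennreal_leI)
    have "(wnorm M \<beta>)\<^sup>2 = sqn d (co \<beta>)"
      using sqn_co_M[OF \<beta>] sqn_nonneg[of d "co \<beta>"] by (simp add: wnorm_def)
    moreover have "0 \<le> wnorm M \<beta>"
      using sqn_co_M[OF \<beta>] sqn_nonneg[of d "co \<beta>"] by (simp add: wnorm_def)
    ultimately have "sqn d (co \<beta>) \<le> K\<^sup>2" using K power_mono[of "wnorm M \<beta>" K 2] by simp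
    then have "sqn d (co \<beta>) / K \<le> K" using K by (simp add: power2_eq_square divide_le_eq)
    moreover have "K * sqn d v \<le> K * 1" using K v by (intro mult_left_mono) auto
    ultimately have "?k / (64 * K) \<le> (2 * K) / (64 * K)"
      using K by (intro divide_right_mono) linarith+
    then have 1: "?k / (64 * K) \<le> 1 / 32" using K by simp
    have "1 / 4 * (1 / 4) \<le> sqn d v * (1 - 3 * sqn d v / 4)" using v by (intro mult_mono) auto
    then have 2: "1 / 16 \<le> sqn d v - 3 * (sqn d v)\<^sup>2 / 4" by (simp add: power2_eq_square algebra_simps)
    have "32 * c * (1 / 32) \<le> exp (- 32 * K) / 2 * ?m"
      using 1 2 by (intro mult_mono) (auto simp: c)
    then have "c * c \<le> c * (exp (- 32 * K) / 2 * ?m)"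
      using c0 by (intro mult_left_mono) auto
    moreover have "c\<^sup>2 * sqn d v / 2 \<le> c\<^sup>2 * 1 / 2" using v by (intro divide_right_mono mult_left_mono) auto
    moreover have "q = 1 - c * (exp (- 32 * K) / 2 * ?m) + c\<^sup>2 * sqn d v / 2"
      unfolding q_def by simp
    ultimately have "q \<le> 1 - c\<^sup>2 / 2" unfolding power2_eq_square[of c] by argo
    also have "\<dots> \<le> exp (- c\<^sup>2 / 2)" using exp_ge_add_one_self[of "- c\<^sup>2 / 2"] by simp
    finally show "q \<le> exp (- c\<^sup>2 / 2)" .
  qed
  finally show ?thesis .
qed

end

section \<open>Chernoff bounds and the union over the nets\<close>

lemma Chernoff_iid:
  fixes Q :: "'a measure"
  assumes Q: "prob_space Q" and h[measurable]: "h \<in> borel_measurable Q"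
    and e: "(\<integral>\<^sup>+x. ennreal (exp (h x)) \<partial>Q) \<le> ennreal (exp a)"
  shows "measure (\<Pi>\<^sub>M i\<in>{..<n}. Q) {D \<in> space (\<Pi>\<^sub>M i\<in>{..<n}. Q). s \<le> (\<Sum>i<n. h (D i))} \<le> exp (real n * a - s)"
proof -
  interpret Q: prob_space Q by fact
  interpret P: product_sigma_finite "\<lambda>_ :: nat. Q"
    by standard
  let ?P = "\<Pi>\<^sub>M i\<in>{..<n}. Q" and ?B = "{D \<in> space (\<Pi>\<^sub>M i\<in>{..<n}. Q). s \<le> (\<Sum>i<n. h (D i))}"
  have B: "?B \<in> sets ?P" by measurable
  have "emeasure ?P ?B = (\<integral>\<^sup>+D. indicator ?B D \<partial>?P)" using B by simp
  also have "\<dots> \<le> (\<integral>\<^sup>+D. ennreal (exp (- s)) * (\<Prod>i<n. ennreal (exp (h (D i)))) \<partial>?P)"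
  proof (rule nn_integral_mono)
    fix D assume "D \<in> space ?P"
    have "(1 :: ennreal) \<le> ennreal (exp (- s)) * (\<Prod>i<n. ennreal (exp (h (D i))))" if "D \<in> ?B"
    proof -
      have "0 \<le> - s + (\<Sum>i<n. h (D i))" using that by simp
      then have "1 \<le> exp (- s) * (\<Prod>i<n. exp (h (D i)))"
        by (simp only: exp_sum[OF finite_lessThan, symmetric] mult_exp_exp one_le_exp_iff)
      then have "ennreal 1 \<le> ennreal (exp (- s) * (\<Prod>i<n. exp (h (D i))))" by (rule ennreal_leI)
      then show ?thesis by (simp add: ennreal_mult prod_nonneg prod_ennreal)
    qed
    then show "indicator ?B D \<le> ennreal (exp (- s)) * (\<Prod>i<n. ennreal (exp (h (D i))))"
      by (cases "D \<in> ?B") auto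
  qed
  also have "\<dots> = ennreal (exp (- s)) * (\<integral>\<^sup>+D. (\<Prod>i<n. ennreal (exp (h (D i)))) \<partial>?P)"
    by (rule nn_integral_cmult) measurable
  also have "(\<integral>\<^sup>+D. (\<Prod>i<n. ennreal (exp (h (D i)))) \<partial>?P) = (\<Prod>i<n. \<integral>\<^sup>+x. ennreal (exp (h x)) \<partial>Q)"
    by (rule P.product_nn_integral_prod) auto
  also have "\<dots> \<le> (\<Prod>i<n. ennreal (exp a))"
    using e by (simp add: ennreal_power_mono)
  also have "ennreal (exp (- s)) * \<dots> = ennreal (exp (real n * a - s))"
    by (simp add: ennreal_power ennreal_mult[symmetric] exp_of_nat_mult[symmetric] mult_exp_exp)
  finally have "emeasure ?P ?B \<le> ennreal (exp (real n * a - s))"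
    by (simp add: mult_left_mono)
  then show ?thesis unfolding measure_def by (intro enn2real_leI) auto
qed

text \<open>Reconciles the three failure exponents with the one claimed. With \<open>p\<close> the
  cube root of \<open>n\<close>, \<open>ln n = 3 * ln p \<le> 3 * p\<close> and
  \<open>sqrt d \<le> n ^ (1 / 4) \<le> p\<close>, and \<open>p\<close> is below each of the three
  rates.\<close>

lemma max_sqrt_ln_le:
  fixes n d :: nat
  assumes n: "1 \<le> n" and d: "1 \<le> d" "real d \<le> sqrt (real n)"
  shows "max (sqrt (real d)) (ln (real n)) \<le> 3 * root 3 (real n * real d)"
    and "max (sqrt (real d)) (ln (real n)) \<le> 3 * sqrt (real n)"
    and "max (sqrt (real d)) (ln (real n)) \<le> 3 * real n"
proof -
  define p where "p = root 3 (real n)"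
  have p3: "p ^ 3 = real n" by (simp add: p_def)
  have p1: "1 \<le> p" using n by (simp add: p_def)
  have m: "max (sqrt (real d)) (ln (real n)) \<le> 3 * p"
  proof (rule max.boundedI)
    have "ln (real n) = 3 * ln p" using p1 by (simp add: p3[symmetric] ln_realpow)
    also have "\<dots> \<le> 3 * p" using ln_le_minus_one[of p] p1 by simp
    finally show "ln (real n) \<le> 3 * p" .
    have "(real d)\<^sup>2 \<le> (sqrt (real n))\<^sup>2" using d by (intro power_mono) auto
    also have "\<dots> \<le> p ^ 4" using power_increasing[of 3 4 p] p1 by (simp add: p3)
    finally have "(sqrt (real d)) ^ 4 \<le> p ^ 4" using power_mult[of "sqrt (real d)" 2 2] by simp
    then have "sqrt (real d) \<le> p" using p1 by (simp add: power_mono_iff)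
    then show "sqrt (real d) \<le> 3 * p" using p1 by linarith
  qed
  have "real n * 1 \<le> real n * real d" using d by (intro mult_left_mono) auto
  then have "p \<le> root 3 (real n * real d)" unfolding p_def by simp
  then show "max (sqrt (real d)) (ln (real n)) \<le> 3 * root 3 (real n * real d)" using m by linarith
  have "p\<^sup>2 \<le> real n" unfolding p3[symmetric] using p1 by (intro power_increasing) auto
  then have "p \<le> sqrt (real n)" by (rule real_le_rsqrt)
  then show "max (sqrt (real d)) (ln (real n)) \<le> 3 * sqrt (real n)" using m by linarith
  have "p \<le> real n" unfolding p3[symmetric] using p1 by (simp add: self_le_power)
  then show "max (sqrt (real d)) (ln (real n)) \<le> 3 * real n" using m by linarith
qed

lemma (in finite_measure) measure_UN_grid_le:
  assumes I: "I \<subseteq> grid d R" and B: "\<And>k. k \<in> I \<Longrightarrow> B k \<in> sets M" "\<And>k. k \<in> I \<Longrightarrow> measure M (B k) \<le> exp (- x)"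
  shows "measure M (\<Union>k\<in>I. B k) \<le> exp ((R + 2) * real d - x)"
proof -
  have fin: "finite I" by (rule finite_subset[OF I finite_grid])
  have "measure M (\<Union>k\<in>I. B k) \<le> (\<Sum>k\<in>I. measure M (B k))"
    using B fin by (intro finite_measure_subadditive_finite) auto
  also have "\<dots> \<le> real (card I) * exp (- x)" using sum_bounded_above[of I "\<lambda>k. measure M (B k)" "exp (- x)"] B(2) by simp
  also have "\<dots> \<le> exp ((R + 2) * real d) * exp (- x)"
    using card_mono[OF finite_grid I] card_grid[of d R] by (intro mult_right_mono) (auto intro: order_trans[OF of_nat_mono])
  finally show ?thesis by (simp add: mult_exp_exp)
qed

context obs_model
begin

lemma fst_mem_carrier: "D \<in> space (data_law n d M \<beta>) \<Longrightarrow> i < n \<Longrightarrow> fst (D i) \<in> carrier_vec d"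
proof -
  assume "D \<in> space (data_law n d M \<beta>)" "i < n"
  then have "D i \<in> space obs" by (auto simp: data_law_def space_PiM)
  then show ?thesis by (auto simp: space_obs)
qed

text \<open>Fourth powers whose sum is of order \<open>n\<close> force squares below order
  \<open>sqrt n\<close>, so \<open>sqrt n\<close> is their truncation level; for the sixth powers of
  all \<open>n * d\<close> coordinates the level is the cube root of \<open>n * d\<close>. The
  \<open>20\<close> in \<open>K1\<close> leaves the exponent \<open>5 * sqrt n\<close>, which beats
  the entropy \<open>4 * d\<close> of the net; the \<open>4\<close> in \<open>K3\<close> leaves the
  exponent \<open>L\<close>, with no net involved. For margins the entropy is at most half of the
  exponent \<open>n * c ^ 2 / 4\<close>. The event does not depend on \<open>P\<close>.\<close>

lemma good_event:
  assumes n: "1 \<le> n" and K: "0 < K" "wnorm M \<beta> \<le> K"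
    and c: "c = exp (- 32 * K) / 64" and K1: "K1 = ctp 2 + 20" and K3: "K3 = ctp 3 + 4"
    and R: "R = 8 * (16 * K1\<^sup>2) / c"
    and small: "real d \<le> sqrt (real n)" "(R + 2) * real d \<le> real n * c\<^sup>2 / 8"
    and C2: "C2 = min 1 (c\<^sup>2 / 8) / 3"
  shows "\<exists>E\<in>sets (data_law n d M \<beta>).
    measure (data_law n d M \<beta>) E \<ge> 1 - 3 * exp (- C2 * max (sqrt (real d)) (ln (real n))) \<and>
    (\<forall>D\<in>E. \<forall>P. pos_semidef d P \<longrightarrow> good_data d n P D M (16 * K1\<^sup>2) (c / 8) (K3 ^ 3))"
proof -
  let ?Q = "data_law n d M \<beta>"
  have Q: "?Q = (\<Pi>\<^sub>M i\<in>{..<n}. obs)" by (simp add: data_law_def)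
  have pQ: "prob_space ?Q" unfolding Q by (intro prob_space_PiM prob_space_obs)
  interpret P: prob_space ?Q by (rule pQ)
  have n0: "0 < real n" and d0: "0 < real d" using n d1 by auto
  define L where "L = root 3 (real n * real d)"
  have L: "0 < L" "L ^ 3 = real n * real d" using n0 d0 by (auto simp: L_def)
  define l1 where "l1 = 1 / (4 * sqrt (real n) ^ (2 - 1))"
  define l3 where "l3 = 1 / (4 * L ^ (3 - 1))"
  have l0: "0 \<le> l1" "0 \<le> l3" using L by (auto simp: l1_def l3_def)
  have ctp0: "0 \<le> ctp k" for k by (simp add: ctp_def)
  have c0: "0 < c" by (simp add: c)
  have "exp (- 32 * K) \<le> 1" using K by simp
  then have c1: "c \<le> 1" unfolding c by linarith
  have K1': "1 \<le> K1" "1 \<le> K3" using ctp0[of 2] ctp0[of 3] by (auto simp: K1 K3)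
  have K1sq: "1 \<le> 16 * K1\<^sup>2" using one_le_power[OF K1'(1), of 2] by linarith
  define I1 where "I1 = {k \<in> grid d 2. sqn d (netpt d 2 k) \<le> 1}"
  define I2 where "I2 = {k \<in> grid d R. sqn d (netpt d R k) \<le> 1 \<and> 1 / 4 \<le> sqn d (netpt d R k)}"
  define B1 where "B1 k = {D \<in> space ?Q. K1 * sqrt (real n) / 4 \<le> (\<Sum>i<n. tpow 2 l1 (lf (netpt d 2 k) (D i)))}" for k
  \<comment> \<open>A lower deviation of the margins, written as an upper deviation of
    \<open>- c\<close> times them to fit the Chernoff bound. An exponential moment
    \<open>- c ^ 2 / 2\<close> per observation against the threshold \<open>c / 4\<close> leaves
    \<open>c ^ 2 / 4\<close>.\<close>
  define B2 where "B2 k = {D \<in> space ?Q. - c * (c / 4 * real n) \<le> (\<Sum>i<n. - c * max 0 (- sgn_of (D i) * lf (netpt d R k) (D i)))}" for k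
  define B3 where "B3 = {D \<in> space ?Q. K3 * L / 4 \<le> (\<Sum>i<n. \<Sum>j<d. tpow 3 l3 (Zc (fst (D i)) j))}"
  have fin: "finite I1" "finite I2" unfolding I1_def I2_def by (auto intro: finite_subset[OF _ finite_grid])
  have meas: "B1 k \<in> sets ?Q" "B2 k \<in> sets ?Q" "B3 \<in> sets ?Q" for k
    unfolding B1_def B2_def B3_def Q by measurable
  have b1: "measure ?Q (B1 k) \<le> exp (- (5 * sqrt (real n)))" if k: "k \<in> I1" for k
  proof -
    have "measure ?Q (B1 k) \<le> exp (real n * (l1 * ctp 2) - K1 * sqrt (real n) / 4)"
      unfolding B1_def Q
      by (rule Chernoff_iid[OF prob_space_obs _ obs_exp_tpow]) (use k l0 in \<open>auto simp: I1_def\<close>)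
    also have "real n * (l1 * ctp 2) = sqrt (real n) * ctp 2 / 4"
      using n0 by (simp add: l1_def field_simps)
    also have "sqrt (real n) * ctp 2 / 4 - K1 * sqrt (real n) / 4 = - (5 * sqrt (real n))"
      by (simp add: K1 algebra_simps)
    finally show ?thesis .
  qed
  have b2: "measure ?Q (B2 k) \<le> exp (- (real n * c\<^sup>2 / 4))" if k: "k \<in> I2" for k
  proof -
    have "measure ?Q (B2 k) \<le> exp (real n * (- c\<^sup>2 / 2) - (- c * (c / 4 * real n)))"
      unfolding B2_def Q
      by (rule Chernoff_iid[OF prob_space_obs _ obs_exp_margin[OF K _ _ c]]) (use k in \<open>auto simp: I2_def\<close>)
    also have "real n * (- c\<^sup>2 / 2) - (- c * (c / 4 * real n)) = - (real n * c\<^sup>2 / 4)"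
      by (simp add: power2_eq_square)
    finally show ?thesis .
  qed
  have b3: "measure ?Q B3 \<le> exp (- L)"
  proof -
    have "measure ?Q B3 \<le> exp (real n * (real d * (l3 * ctp 3)) - K3 * L / 4)"
      unfolding B3_def Q
      by (rule Chernoff_iid[OF prob_space_obs _ obs_exp_sum_tpow]) (use l0 in auto)
    also have "real n * (real d * (l3 * ctp 3)) = L ^ 3 * (l3 * ctp 3)" by (simp add: L(2))
    also have "\<dots> = L * ctp 3 / 4" using L(1) by (simp add: l3_def eval_nat_numeral)
    also have "L * ctp 3 / 4 - K3 * L / 4 = - L" by (simp add: K3 algebra_simps)
    finally show ?thesis .
  qed
  let ?m = "max (sqrt (real d)) (ln (real n))"
  have e1: "measure ?Q (\<Union>k\<in>I1. B1 k) \<le> exp (- C2 * ?m)"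
  proof -
    have "measure ?Q (\<Union>k\<in>I1. B1 k) \<le> exp ((2 + 2) * real d - 5 * sqrt (real n))"
      using b1 meas by (intro P.measure_UN_grid_le) (auto simp: I1_def)
    also have "\<dots> \<le> exp (- C2 * ?m)"
    proof -
      have "C2 * ?m \<le> 1 / 3 * (3 * sqrt (real n))"
        using max_sqrt_ln_le(2)[OF n d1 small(1)] n
        by (intro mult_mono) (auto simp: C2 le_max_iff_disj)
      then show ?thesis using small(1) by simp
    qed
    finally show ?thesis .
  qed
  have e2: "measure ?Q (\<Union>k\<in>I2. B2 k) \<le> exp (- C2 * ?m)"
  proof -
    have "measure ?Q (\<Union>k\<in>I2. B2 k) \<le> exp ((R + 2) * real d - real n * c\<^sup>2 / 4)"
      using b2 meas by (intro P.measure_UN_grid_le) (auto simp: I2_def)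
    also have "\<dots> \<le> exp (- C2 * ?m)"
    proof -
      have "C2 * ?m \<le> (c\<^sup>2 / 8) / 3 * (3 * real n)"
        using max_sqrt_ln_le(3)[OF n d1 small(1)] n
        by (intro mult_mono) (auto simp: C2 le_max_iff_disj)
      then have "C2 * ?m \<le> real n * c\<^sup>2 / 8" by (simp add: mult_ac)
      then show ?thesis using small(2) by simp
    qed
    finally show ?thesis .
  qed
  have e3: "measure ?Q B3 \<le> exp (- C2 * ?m)"
  proof -
    have "C2 * ?m \<le> 1 / 3 * (3 * L)"
      using max_sqrt_ln_le(1)[OF n d1 small(1)] n
      by (intro mult_mono) (auto simp: C2 L_def le_max_iff_disj)
    then have "exp (- L) \<le> exp (- C2 * ?m)" by simp
    then show ?thesis using b3 by linarith
  qed
  let ?Bad = "(\<Union>k\<in>I1. B1 k) \<union> (\<Union>k\<in>I2. B2 k) \<union> B3"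
  define E where "E = space ?Q - ?Bad"
  have U: "(\<Union>k\<in>I1. B1 k) \<in> sets ?Q" "(\<Union>k\<in>I2. B2 k) \<in> sets ?Q"
    by (intro sets.finite_UN fin meas)+
  then have Bad: "?Bad \<in> sets ?Q" using meas(3) by (intro sets.Un)
  have "measure ?Q ?Bad \<le> 3 * exp (- C2 * ?m)"
  proof -
    have "measure ?Q ?Bad \<le> measure ?Q ((\<Union>k\<in>I1. B1 k) \<union> (\<Union>k\<in>I2. B2 k)) + measure ?Q B3"
      using U meas(3) by (intro measure_Un_le sets.Un)
    moreover have "measure ?Q ((\<Union>k\<in>I1. B1 k) \<union> (\<Union>k\<in>I2. B2 k)) \<le> measure ?Q (\<Union>k\<in>I1. B1 k) + measure ?Q (\<Union>k\<in>I2. B2 k)"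
      using U meas(3) by (intro measure_Un_le sets.Un)
    ultimately show ?thesis using e1 e2 e3 by linarith
  qed
  then have mE: "measure ?Q E \<ge> 1 - 3 * exp (- C2 * ?m)"
    unfolding E_def P.prob_compl[OF Bad] by linarith
  have good: "good_data d n P D M (16 * K1\<^sup>2) (c / 8) (K3 ^ 3)" if D: "D \<in> E" and P: "pos_semidef d P" for D P
  proof -
    have Ds: "D \<in> space ?Q" using D by (simp add: E_def)
    have X: "fst (D i) \<in> carrier_vec d" if "i < n" for i by (rule fst_mem_carrier[OF Ds that])
    define Z where "Z i = Zc (fst (D i))" for i
    have XZ: "fst (D i) \<bullet> u = dot d (Z i) (co u)" if "i < n" "u \<in> carrier_vec d" for i u
      unfolding Z_def by (rule scalar_prod_Zc[OF X[OF that(1)] that(2)])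
    have F: "(\<Sum>i<n. dot d (Z i) x ^ 4) \<le> 16 * (K1\<^sup>2 * real n) * (sqn d x)\<^sup>2" for x
    proof (rule fourth_moment_from_net[OF d1])
      fix k assume "k \<in> grid d 2" "sqn d (netpt d 2 k) \<le> 1"
      then have "k \<in> I1" by (simp add: I1_def)
      then have "D \<notin> B1 k" using D by (auto simp: E_def)
      then have "(\<Sum>i\<in>{..<n}. tpow 2 l1 (dot d (Z i) (netpt d 2 k))) \<le> K1 * sqrt (real n) / 4"
        using Ds by (simp add: B1_def Z_def)
      then have "(\<Sum>i\<in>{..<n}. dot d (Z i) (netpt d 2 k) ^ (2 * 2)) \<le> K1 ^ 2 * sqrt (real n) ^ 2"
        using n0 K1' by (intro sum_power_le_of_tpow[where l = l1]) (auto simp: l1_def)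
      then show "(\<Sum>i<n. dot d (Z i) (netpt d 2 k) ^ 4) \<le> K1\<^sup>2 * real n" by simp
    qed
    have G2: "c / 8 * real n * sqrt (sqn d x) \<le> (\<Sum>i<n. max 0 (- sgn_of (D i) * dot d (Z i) x))" for x
    proof (rule margin_from_net[OF d1 n _ K1sq c0 c1 _ R])
      show "\<bar>sgn_of (D i)\<bar> = 1" for i by simp
      show "(\<Sum>i<n. dot d (Z i) x ^ 4) \<le> 16 * K1\<^sup>2 * real n * (sqn d x)\<^sup>2" for x using F[of x] by (simp add: mult_ac)
      fix k assume "k \<in> grid d R" "sqn d (netpt d R k) \<le> 1" "1 / 4 \<le> sqn d (netpt d R k)"
      then have "k \<in> I2" by (simp add: I2_def)
      then have "D \<notin> B2 k" using D by (auto simp: E_def)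
      then have "(\<Sum>i<n. - c * max 0 (- sgn_of (D i) * dot d (Z i) (netpt d R k))) \<le> - c * (c / 4 * real n)"
        using Ds unfolding B2_def Z_def by force
      then have "c * (c / 4 * real n) \<le> c * (\<Sum>i<n. max 0 (- sgn_of (D i) * dot d (Z i) (netpt d R k)))"
        unfolding sum_distrib_left[symmetric] by linarith
      then show "c / 4 * real n \<le> (\<Sum>i<n. max 0 (- sgn_of (D i) * dot d (Z i) (netpt d R k)))"
        using c0 by (simp only: mult_le_cancel_left_pos)
    qed
    have six: "(\<Sum>i<n. sqn d (Z i) ^ 3) \<le> K3 ^ 3 * real n * real d ^ 3"
    proof -
      have "D \<notin> B3" using D by (auto simp: E_def)
      \<comment> \<open>The coordinates of all observations form one family of \<open>n * d\<close>
        numbers, to which the truncation argument applies as a whole.\<close>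
      then have "(\<Sum>p\<in>{..<n} \<times> {..<d}. tpow 3 l3 (Z (fst p) (snd p))) \<le> K3 * L / 4"
        using Ds by (simp add: B3_def Z_def sum.cartesian_product split_def)
      then have "(\<Sum>p\<in>{..<n} \<times> {..<d}. Z (fst p) (snd p) ^ (2 * 3)) \<le> K3 ^ 3 * L ^ 3"
        using L K1' by (intro sum_power_le_of_tpow[where l = l3]) (auto simp: l3_def)
      then have 1: "(\<Sum>i<n. \<Sum>j<d. Z i j ^ 6) \<le> K3 ^ 3 * (real n * real d)"
        by (simp add: L(2) sum.cartesian_product split_def)
      have "(\<Sum>i<n. sqn d (Z i) ^ 3) \<le> (\<Sum>i<n. (real d)\<^sup>2 * (\<Sum>j<d. Z i j ^ 6))"
      proof (rule sum_mono)
        fix i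
        have "(\<Sum>j<d. (Z i j)\<^sup>2) ^ 3 \<le> (real d)\<^sup>2 * (\<Sum>j<d. ((Z i j)\<^sup>2) ^ 3)"
          by (rule sum_cube_le_card[OF d1]) simp
        then show "sqn d (Z i) ^ 3 \<le> (real d)\<^sup>2 * (\<Sum>j<d. Z i j ^ 6)"
          by (simp add: sqn_def power_mult[symmetric])
      qed
      also have "\<dots> \<le> (real d)\<^sup>2 * (K3 ^ 3 * (real n * real d))"
        unfolding sum_distrib_left[symmetric] using 1 by (intro mult_left_mono) auto
      finally show ?thesis by (simp add: eval_nat_numeral mult_ac)
    qed
    show ?thesis
    proof
      show "1 \<le> n" "1 \<le> d" "pos_def d M" "pos_semidef d P" "0 < c / 8" "0 \<le> K3 ^ 3" "0 < 16 * K1\<^sup>2"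
        using n d1 M P c0 K1' K1sq by auto
      show "fst (D i) \<in> carrier_vec d" if "i < n" for i by (rule X[OF that])
    next
      fix u :: rvec assume u: "u \<in> carrier_vec d"
      have "(\<Sum>i<n. (fst (D i) \<bullet> u) ^ 4) = (\<Sum>i<n. dot d (Z i) (co u) ^ 4)" using u by (simp add: XZ)
      also have "\<dots> \<le> 16 * (K1\<^sup>2 * real n) * (sqn d (co u))\<^sup>2" by (rule F)
      finally show "(\<Sum>i<n. (fst (D i) \<bullet> u) ^ 4) \<le> 16 * K1\<^sup>2 * real n * (u \<bullet> (M *\<^sub>v u))\<^sup>2"
        using u by (simp add: sqn_co_M mult_ac)
    next
      fix u :: rvec assume u: "u \<in> carrier_vec d"
      have "c / 8 * real n * wnorm M u = c / 8 * real n * sqrt (sqn d (co u))"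
        using u by (simp add: wnorm_def sqn_co_M)
      also have "\<dots> \<le> (\<Sum>i<n. max 0 (- sgn_of (D i) * dot d (Z i) (co u)))" by (rule G2)
      also have "\<dots> = (\<Sum>i<n. max 0 (- sgn_of (D i) * (fst (D i) \<bullet> u)))" using u by (intro sum.cong refl) (simp add: XZ)
      finally show "c / 8 * real n * wnorm M u \<le> (\<Sum>i<n. max 0 (- sgn_of (D i) * (fst (D i) \<bullet> u)))" .
    next
      show "\<exists>\<rho>. (\<forall>i<n. 0 \<le> \<rho> i \<and> (\<forall>u\<in>carrier_vec d. (fst (D i) \<bullet> u)\<^sup>2 \<le> \<rho> i * (u \<bullet> (M *\<^sub>v u))))
        \<and> (\<Sum>i<n. \<rho> i ^ 3) \<le> K3 ^ 3 * real n * real d ^ 3"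
      proof (intro exI[of _ "\<lambda>i. sqn d (Z i)"] conjI allI impI ballI)
        fix i :: nat and u :: rvec assume i: "i < n" and u: "u \<in> carrier_vec d"
        show "(fst (D i) \<bullet> u)\<^sup>2 \<le> sqn d (Z i) * (u \<bullet> (M *\<^sub>v u))"
          using dot_Cauchy_Schwarz[of d "Z i" "co u"] by (simp add: XZ[OF i u] sqn_co_M[OF u])
      qed (use six sqn_nonneg in auto)
    qed
  qed
  show ?thesis
    using mE good Bad by (intro bexI[of _ E]) (auto simp: E_def)
qed

end

section \<open>Expansion of the posterior\<close>

lemma measurable_bf_vec: "H \<in> carrier_mat d d \<Longrightarrow>
  (\<lambda>b. b \<bullet> (H *\<^sub>v b)) \<in> borel_measurable (lborel_vec d)"
proof -
  assume H: "H \<in> carrier_mat d d"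
  have "(\<lambda>b. bf d (\<lambda>i j. H $$ (i, j)) (\<lambda>i. b $ i) (\<lambda>i. b $ i)) \<in> borel_measurable (lborel_vec d)"
    unfolding bf_def by measurable
  moreover have "b \<bullet> (H *\<^sub>v b) = bf d (\<lambda>i j. H $$ (i, j)) (\<lambda>i. b $ i) (\<lambda>i. b $ i)"
    if "b \<in> space (lborel_vec d)" for b
    using that H by (intro quadratic_form_bf) (auto simp: space_lborel_vec)
  ultimately show ?thesis by (simp cong: measurable_cong)
qed

context whitening
begin

lemma ax_reflect: "ax (\<lambda>i\<in>{..<d}. - x i) = - ax x"
  by (rule eq_vecI) (simp_all add: ax_index sum_negf carrier_vecD[OF ax_carrier])

end

context coord_data
begin

lemma measurable_V [measurable]: "V \<in> borel_measurable (lborel_vec d)"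
proof -
  have sm[measurable]: "(\<lambda>b. Xv i \<bullet> b) \<in> borel_measurable (lborel_vec d)" if "i < n" for i
    by (rule measurable_scalar_prod[OF X[OF that]])
  have [measurable]: "(\<lambda>b. b \<bullet> (P *\<^sub>v b)) \<in> borel_measurable (lborel_vec d)"
    by (rule measurable_bf_vec[OF P_carrier])
  have [measurable]: "softplus \<in> borel_measurable borel"
    unfolding softplus_def[abs_def] by measurable
  show ?thesis unfolding potential_def[abs_def] by measurable
qed

abbreviation "\<pi> \<equiv> gibbs d V"
abbreviation "\<gamma> \<equiv> laplace d V m"
abbreviation "e \<equiv> emb m"

lemma measurable_e [measurable]: "e \<in> leb d \<rightarrow>\<^sub>M lborel_vec d" "e \<in> gauss d \<rightarrow>\<^sub>M lborel_vec d"
  using measurable_emb[OF m_carrier] measurable_emb_gauss[OF m_carrier] by auto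

lemma e_carrier [simp]: "e x \<in> carrier_vec d"
  by (rule emb_carrier[OF m_carrier])

lemma laplace_eq: "\<gamma> = distr (gauss d) (lborel_vec d) e"
  unfolding laplace_def by (rule gaussian_eq_distr[OF m_carrier])

lemma e_reflect: "e (L.refl x) = m - ax x" and e_eq: "e x = m + ax x"
  using m_carrier by (auto simp: emb_def ax_reflect intro!: eq_vecI)

lemma Zr_pos: "0 < L.Zr" using L.Zr_ge by linarith

lemma nn_integral_exp_r: "(\<integral>\<^sup>+x. ennreal (exp (L.r x)) \<partial>gauss d) = ennreal L.Zr"
  unfolding L.Zr_def by (rule nn_integral_eq_integral[OF L.integrable_exp_r]) simp

text \<open>By \<open>V_emb\<close>, \<open>exp (- V)\<close> is the Gaussian density times
  \<open>exp r\<close> times a constant; the constant and the determinant cancel against the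
  normalization, which leaves \<open>L.Zr\<close>.\<close>

lemma gibbs_eq: "\<pi> = distr (density (gauss d) (\<lambda>x. ennreal (exp (L.r x) / L.Zr))) (lborel_vec d) e"
proof -
  define a where "a = (\<Prod>i<d. A $$ (i, i))"
  have a: "0 < a" unfolding a_def by (rule prod_diag_pos)
  define s where "s = sqrt (2 * pi) ^ d"
  have s: "0 < s" by (simp add: s_def)
  have eV: "exp (- V (e x)) = exp (- V m) * s * (exp (- sqn d x / 2) / s * exp (L.r x))" for x
    using s by (simp add: V_emb mult_exp_exp algebra_simps)
  have "(\<integral>\<^sup>+b. ennreal (exp (- V b)) \<partial>lborel_vec d) = ennreal a * (\<integral>\<^sup>+x. ennreal (exp (- V (e x))) \<partial>leb d)"
    unfolding a_def by (rule nn_integral_emb[OF m_carrier]) measurable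
  also have "(\<integral>\<^sup>+x. ennreal (exp (- V (e x))) \<partial>leb d)
      = (\<integral>\<^sup>+x. ennreal (exp (- V m) * s) * (ennreal (exp (- sqn d x / 2) / s) * ennreal (exp (L.r x))) \<partial>leb d)"
  proof (rule nn_integral_cong)
    fix x
    have nn: "0 \<le> exp (- V m) * s" "0 \<le> exp (- sqn d x / 2) / s" using s by auto
    show "ennreal (exp (- V (e x))) = ennreal (exp (- V m) * s) * (ennreal (exp (- sqn d x / 2) / s) * ennreal (exp (L.r x)))"
      unfolding eV by (simp only: ennreal_mult[OF nn(1) mult_nonneg_nonneg[OF nn(2) exp_ge_zero]] ennreal_mult[OF nn(2) exp_ge_zero])
  qed
  also have "\<dots> = ennreal (exp (- V m) * s) * (\<integral>\<^sup>+x. ennreal (exp (- sqn d x / 2) / s) * ennreal (exp (L.r x)) \<partial>leb d)"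
    by (rule nn_integral_cmult) measurable
  also have "(\<integral>\<^sup>+x. ennreal (exp (- sqn d x / 2) / s) * ennreal (exp (L.r x)) \<partial>leb d) = ennreal L.Zr"
    unfolding s_def by (subst nn_integral_gauss[symmetric]) (measurable, rule nn_integral_exp_r)
  finally have "(\<integral>\<^sup>+b. ennreal (exp (- V b)) \<partial>lborel_vec d) = ennreal (a * (exp (- V m) * s * L.Zr))"
    using a s Zr_pos by (simp add: ennreal_mult)
  then have Z: "(\<integral>b. exp (- V b) \<partial>lborel_vec d) = a * (exp (- V m) * s * L.Zr)"
    using a s Zr_pos by (subst integral_eq_nn_integral) auto
  show ?thesis
    unfolding gibbs_def Z
  proof (rule density_emb_gauss[OF m_carrier])
    show "exp (- V (e x)) / (a * (exp (- V m) * s * L.Zr)) * (\<Prod>i<d. A $$ (i, i))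
        = gdens d x * (exp (L.r x) / L.Zr)" for x
      unfolding eV a_def[symmetric] s_def[symmetric] using a s Zr_pos by simp
  qed (use Zr_pos in auto)
qed

lemma sets_gibbs [measurable_cong]: "sets \<pi> = sets (lborel_vec d)"
  by (simp add: gibbs_def)

lemma prob_space_gibbs: "prob_space \<pi>"
  unfolding gibbs_eq
proof (rule prob_space.prob_space_distr)
  show "prob_space (density (gauss d) (\<lambda>x. ennreal (exp (L.r x) / L.Zr)))"
  proof
    have "(\<integral>\<^sup>+x. ennreal (exp (L.r x) / L.Zr) \<partial>gauss d) = (\<integral>\<^sup>+x. ennreal (1 / L.Zr) * ennreal (exp (L.r x)) \<partial>gauss d)"
      using Zr_pos by (simp add: ennreal_mult[symmetric])
    also have "\<dots> = ennreal (1 / L.Zr) * ennreal L.Zr"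
      by (subst nn_integral_cmult) (measurable, simp add: nn_integral_exp_r)
    also have "\<dots> = 1" using Zr_pos by (simp add: ennreal_mult[symmetric])
    finally show "emeasure (density (gauss d) (\<lambda>x. ennreal (exp (L.r x) / L.Zr))) (space (density (gauss d) (\<lambda>x. ennreal (exp (L.r x) / L.Zr)))) = 1"
      by (simp add: emeasure_density cong: nn_integral_cong)
  qed
  show "e \<in> density (gauss d) (\<lambda>x. ennreal (exp (L.r x) / L.Zr)) \<rightarrow>\<^sub>M lborel_vec d"
    by measurable
qed

lemma prob_space_laplace: "prob_space \<gamma>"
  unfolding laplace_eq by (rule gauss.prob_space_distr) measurable

lemma measurable_comp_e: "g \<in> borel_measurable (lborel_vec d) \<Longrightarrow> (\<lambda>x. g (e x)) \<in> borel_measurable (leb d)"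
  by (rule measurable_compose[OF measurable_e(1)])

lemma
  fixes g :: "rvec \<Rightarrow> real"
  assumes g[measurable]: "g \<in> borel_measurable (lborel_vec d)"
  shows integrable_laplace: "integrable \<gamma> g \<longleftrightarrow> integrable (gauss d) (\<lambda>x. g (e x))"
    and integral_laplace: "(\<integral>b. g b \<partial>\<gamma>) = (\<integral>x. g (e x) \<partial>gauss d)"
  unfolding laplace_eq by (auto intro!: integrable_distr_eq integral_distr)

lemma
  fixes g :: "rvec \<Rightarrow> real"
  assumes g[measurable]: "g \<in> borel_measurable (lborel_vec d)"
  shows integrable_gibbs: "integrable (gauss d) (\<lambda>x. g (e x) * exp (L.r x)) \<Longrightarrow> integrable \<pi> g"
    and integral_gibbs: "(\<integral>b. g b \<partial>\<pi>) = L.post (\<lambda>x. g (e x))"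
proof -
  let ?D = "density (gauss d) (\<lambda>x. ennreal (exp (L.r x) / L.Zr))"
  have m: "(\<lambda>x. g (e x)) \<in> borel_measurable (gauss d)" by measurable
  have 1: "integrable \<pi> g \<longleftrightarrow> integrable ?D (\<lambda>x. g (e x))"
    unfolding gibbs_eq by (rule integrable_distr_eq) measurable
  have 2: "integrable ?D (\<lambda>x. g (e x)) \<longleftrightarrow> integrable (gauss d) (\<lambda>x. exp (L.r x) / L.Zr * g (e x))"
    using m Zr_pos by (subst integrable_density) auto
  show "integrable \<pi> g" if "integrable (gauss d) (\<lambda>x. g (e x) * exp (L.r x))"
  proof -
    have "integrable (gauss d) (\<lambda>x. (1 / L.Zr) * (g (e x) * exp (L.r x)))"
      using that by (rule integrable_mult_right)
    then show ?thesis unfolding 1 2 by (simp add: mult_ac)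
  qed
  have "(\<integral>b. g b \<partial>\<pi>) = (\<integral>x. g (e x) \<partial>?D)"
    unfolding gibbs_eq by (rule integral_distr) measurable
  also have "\<dots> = (\<integral>x. exp (L.r x) / L.Zr * g (e x) \<partial>gauss d)"
    using m Zr_pos by (subst integral_density) auto
  also have "\<dots> = (\<integral>x. g (e x) * exp (L.r x) / L.Zr \<partial>gauss d)" by (simp add: mult_ac)
  also have "\<dots> = L.post (\<lambda>x. g (e x))" unfolding L.post_def by simp
  finally show "(\<integral>b. g b \<partial>\<pi>) = L.post (\<lambda>x. g (e x))" .
qed

lemma measurable_skew [measurable]: "skew d V m \<in> borel_measurable (lborel_vec d)"
proof -
  have [measurable]: "(\<lambda>b. Xv i \<bullet> b) \<in> borel_measurable (lborel_vec d)" if "i < n" for i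
    by (rule measurable_scalar_prod[OF X[OF that]])
  have "(\<lambda>b. - (\<Sum>l<n. dsig 3 (Xv l \<bullet> m) * (Xv l \<bullet> b - Xv l \<bullet> m) ^ 3) / 6) \<in> borel_measurable (lborel_vec d)"
    by measurable
  moreover have "skew d V m b = - (\<Sum>l<n. dsig 3 (Xv l \<bullet> m) * (Xv l \<bullet> b - Xv l \<bullet> m) ^ 3) / 6"
    if "b \<in> space (lborel_vec d)" for b
    using that m_carrier X by (simp add: space_lborel_vec skew_eq scalar_prod_minus_distrib[of _ d])
  ultimately show ?thesis by (simp cong: measurable_cong)
qed

lemma growth_e: "wnorm Hm (e x - m) = sqrt (sqn d x)"
  by (simp add: emb_minus[OF m_carrier] wnorm_ax)

context
  fixes g :: "rvec \<Rightarrow> real" and a :: real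
  assumes g[measurable]: "g \<in> borel_measurable (lborel_vec d)"
    and bd: "\<And>b. b \<in> carrier_vec d \<Longrightarrow> \<bar>g b\<bar> \<le> a * exp (sqrt (real d) * wnorm Hm (b - m) / 2)"
    and a: "1 \<le> a" and g2: "EG d (\<lambda>x. (g (e x))\<^sup>2) \<le> ennreal 1" and g0: "(\<integral>b. g b \<partial>\<gamma>) = 0"
begin

lemma bd_e: "\<bar>g (e x)\<bar> \<le> a * exp (sqrt (real d) * sqrt (sqn d x) / 2)"
  using bd[of "e x"] by (simp add: growth_e)

lemma g0_e: "(\<integral>x. g (e x) \<partial>gauss d) = 0"
  using g0 by (simp add: integral_laplace)

lemma integrable_g: "integrable \<pi> g"
  using L.post_expansion(1)[OF measurable_comp_e[OF g] bd_e a g2 g0_e] by (intro integrable_gibbs) auto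

lemma integrable_g_laplace: "integrable \<gamma> g"
  using L.integrable_of_square[OF measurable_comp_e[OF g] g2] by (simp add: integrable_laplace)

lemma integrable_gS: "integrable \<gamma> (\<lambda>b. g b * skew d V m b)"
  using L.gS_bound(1)[OF measurable_comp_e[OF g] g2] by (simp add: integrable_laplace skew_emb)

lemma integral_gS: "(\<integral>b. g b * skew d V m b \<partial>\<gamma>) = (\<integral>x. g (e x) * L.S x \<partial>gauss d)"
  by (simp add: integral_laplace skew_emb)

lemma gS_le: "\<bar>\<integral>b. g b * skew d V m b \<partial>\<gamma>\<bar> \<le> L.LS * L.eps"
  unfolding integral_gS by (rule L.gS_bound(2)[OF measurable_comp_e[OF g] g2])

lemma gibbs_expansion:
  "\<bar>(\<integral>b. g b \<partial>\<pi>) - (\<integral>b. g b * skew d V m b \<partial>\<gamma>)\<bar> \<le> L.Lm * (a * L.tau + L.eps\<^sup>2)"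
  "odd_about d m g \<Longrightarrow> \<bar>(\<integral>b. g b \<partial>\<pi>) - (\<integral>b. g b * skew d V m b \<partial>\<gamma>)\<bar> \<le> L.Lm * (a * L.tau + L.eps ^ 3)"
proof -
  note P = L.post_expansion[OF measurable_comp_e[OF g] bd_e a g2 g0_e]
  show "\<bar>(\<integral>b. g b \<partial>\<pi>) - (\<integral>b. g b * skew d V m b \<partial>\<gamma>)\<bar> \<le> L.Lm * (a * L.tau + L.eps\<^sup>2)"
    unfolding integral_gS integral_gibbs[OF g] by (rule P(2))
  assume odd: "odd_about d m g"
  have "g (e (L.refl x)) = - g (e x)" for x
    unfolding e_reflect e_eq[of x] using odd ax_carrier[of x] by (simp add: odd_about_def)
  then show "\<bar>(\<integral>b. g b \<partial>\<pi>) - (\<integral>b. g b * skew d V m b \<partial>\<gamma>)\<bar> \<le> L.Lm * (a * L.tau + L.eps ^ 3)"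
    unfolding integral_gS integral_gibbs[OF g] by (intro P(3)) auto
qed

text \<open>\<open>S\<close> is odd, so an even test function sees no first-order term: this is the
  gain from \<open>eps\<close> to \<open>eps ^ 2\<close> in the even case.\<close>

lemma gS_even: "even_about d m g \<Longrightarrow> (\<integral>b. g b * skew d V m b \<partial>\<gamma>) = 0"
proof -
  assume ev: "even_about d m g"
  have ge: "g (e (L.refl x)) = g (e x)" for x
    unfolding e_reflect e_eq[of x] using ev ax_carrier[of x] by (simp add: even_about_def)
  note [measurable] = measurable_comp_e[OF g]
  show ?thesis
    unfolding integral_gS by (rule integral_gauss_odd) (measurable, simp add: ge)
qed

lemma skew_laplace_integral_eq: "skew_laplace_integral d V m g = (\<integral>b. g b * skew d V m b \<partial>\<gamma>)"
proof -
  have "skew_laplace_integral d V m g = (\<integral>b. g b + g b * skew d V m b \<partial>\<gamma>)"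
    by (simp add: skew_laplace_integral_def distrib_left)
  then show ?thesis
    using integrable_g_laplace integrable_gS by (simp add: g0)
qed

end

text \<open>One constant for all bounds, generous enough to dominate sums and products of
  \<open>L.Lm\<close> and \<open>L.LS\<close>, including the squares that the covariance brings
  in.\<close>

definition LL :: real where "LL = 2 * L.LS + 100 * (1 + L.Lm)\<^sup>2 * (1 + L.LS)\<^sup>2"

lemma Lm_nonneg: "0 \<le> L.Lm"
  using L.LS_nonneg L.cw_nonneg L.cwo_nonneg by (simp add: L.Lm_def)

lemma LL_ge: "L.Lm + L.LS \<le> LL" "L.Lm \<le> LL" "L.LS \<le> LL" "0 \<le> LL"
proof -
  have 1: "1 + x \<le> (1 + x)\<^sup>2" "1 \<le> (1 + x)\<^sup>2" if "0 \<le> x" for x :: real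
    using that by (auto simp: power2_eq_square algebra_simps)
  have "(1 + L.Lm) * 1 \<le> (1 + L.Lm)\<^sup>2 * (1 + L.LS)\<^sup>2"
    using 1 Lm_nonneg L.LS_nonneg by (intro mult_mono) auto
  moreover have "1 + L.Lm \<le> X \<Longrightarrow> 1 + L.Lm \<le> 100 * X" for X using Lm_nonneg by linarith
  ultimately have "1 + L.Lm \<le> 100 * ((1 + L.Lm)\<^sup>2 * (1 + L.LS)\<^sup>2)" by simp
  then show "L.Lm + L.LS \<le> LL" "L.Lm \<le> LL" "L.LS \<le> LL" "0 \<le> LL"
    using L.LS_nonneg Lm_nonneg by (auto simp: LL_def mult.assoc)
qed

section \<open>Standardized test functions and total variation\<close>

context
  fixes g :: "rvec \<Rightarrow> real" and a :: real
  assumes st: "standardized d V m g a"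
begin

lemma standardized_facts:
  "g \<in> borel_measurable (lborel_vec d)"
  "\<And>b. b \<in> carrier_vec d \<Longrightarrow> \<bar>g b\<bar> \<le> max a 1 * exp (sqrt (real d) * wnorm Hm (b - m) / 2)"
  "EG d (\<lambda>x. (g (e x))\<^sup>2) \<le> ennreal 1" "(\<integral>b. g b \<partial>\<gamma>) = 0"
proof -
  interpret \<gamma>: prob_space \<gamma> by (rule prob_space_laplace)
  obtain G aG where G[measurable]: "G \<in> borel_measurable (lborel_vec d)" and v: "0 < var \<gamma> G" and aG: "0 \<le> aG"
    and bG: "\<And>b. b \<in> carrier_vec d \<Longrightarrow> \<bar>G b - (\<integral>x. G x \<partial>\<gamma>)\<bar> \<le> aG * exp (sqrt (real d) * wnorm Hm (b - m) / 2)"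
    and g: "g = (\<lambda>b. (G b - (\<integral>x. G x \<partial>\<gamma>)) / sqrt (var \<gamma> G))" and aa: "a = aG / sqrt (var \<gamma> G)"
    using st unfolding standardized_def by blast
  let ?\<mu> = "\<integral>x. G x \<partial>\<gamma>" and ?s = "sqrt (var \<gamma> G)"
  have s: "0 < ?s" using v by simp
  show gm: "g \<in> borel_measurable (lborel_vec d)" unfolding g by measurable
  show "\<bar>g b\<bar> \<le> max a 1 * exp (sqrt (real d) * wnorm Hm (b - m) / 2)" if b: "b \<in> carrier_vec d" for b
  proof -
    have "\<bar>g b\<bar> = \<bar>G b - ?\<mu>\<bar> / ?s" unfolding g by (rule abs_div_pos[OF s, symmetric])
    also have "\<dots> \<le> aG * exp (sqrt (real d) * wnorm Hm (b - m) / 2) / ?s"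
      using bG[OF b] s by (intro divide_right_mono) auto
    also have "\<dots> = a * exp (sqrt (real d) * wnorm Hm (b - m) / 2)" by (simp add: aa)
    also have "\<dots> \<le> max a 1 * exp (sqrt (real d) * wnorm Hm (b - m) / 2)" by (intro mult_right_mono) auto
    finally show ?thesis .
  qed
  \<comment> \<open>Positivity of the variance already entails integrability, because the Bochner
    integral of a function that is not integrable is zero.\<close>
  have i2: "integrable \<gamma> (\<lambda>b. (G b - ?\<mu>)\<^sup>2)"
    using v not_integrable_integral_eq unfolding var_def by fastforce
  then have i2': "integrable \<gamma> (\<lambda>b. (g b)\<^sup>2)"
    unfolding g power_divide by simp
  have "EG d (\<lambda>x. (g (e x))\<^sup>2) = ennreal (\<integral>x. (g (e x))\<^sup>2 \<partial>gauss d)"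
    unfolding EG_def using i2' gm by (intro nn_integral_eq_integral) (auto simp: integrable_laplace)
  also have "(\<integral>x. (g (e x))\<^sup>2 \<partial>gauss d) = (\<integral>b. (g b)\<^sup>2 \<partial>\<gamma>)"
    using gm by (simp add: integral_laplace)
  also have "\<dots> = (\<integral>b. (G b - ?\<mu>)\<^sup>2 \<partial>\<gamma>) / var \<gamma> G"
    using v by (simp add: g power_divide)
  also have "\<dots> = 1" using v by (simp add: var_def)
  finally show g2: "EG d (\<lambda>x. (g (e x))\<^sup>2) \<le> ennreal 1" by simp
  have ig: "integrable \<gamma> g"
    using L.integrable_of_square[OF measurable_comp_e[OF gm] g2] gm by (simp add: integrable_laplace)
  have "integrable \<gamma> (\<lambda>b. ?s * g b + ?\<mu>)" using ig by simp
  moreover have "(\<lambda>b. ?s * g b + ?\<mu>) = G" using s by (simp add: g)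
  ultimately have iG: "integrable \<gamma> G" by simp
  show "(\<integral>b. g b \<partial>\<gamma>) = 0"
    unfolding g using iG by (simp add: \<gamma>.prob_space)
qed

lemma standardized_bounds:
  "integrable \<pi> g"
  "\<bar>(\<integral>b. g b \<partial>\<pi>) - (\<integral>b. g b \<partial>\<gamma>)\<bar> \<le> LL * (max a 1 * L.tau + L.eps)"
  "even_about d m g \<Longrightarrow> \<bar>(\<integral>b. g b \<partial>\<pi>) - (\<integral>b. g b \<partial>\<gamma>)\<bar> \<le> LL * (max a 1 * L.tau + L.eps\<^sup>2)"
  "\<bar>(\<integral>b. g b \<partial>\<pi>) - skew_laplace_integral d V m g\<bar> \<le> LL * (max a 1 * L.tau + L.eps\<^sup>2)"
  "odd_about d m g \<Longrightarrow> \<bar>(\<integral>b. g b \<partial>\<pi>) - skew_laplace_integral d V m g\<bar> \<le> LL * (max a 1 * L.tau + L.eps ^ 3)"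
proof -
  note h = standardized_facts(1,2) max.cobounded2[of 1 a] standardized_facts(3,4)
  let ?s = "\<integral>b. g b * skew d V m b \<partial>\<gamma>"
  have x1: "\<bar>(\<integral>b. g b \<partial>\<pi>) - ?s\<bar> \<le> L.Lm * (max a 1 * L.tau + L.eps\<^sup>2)" by (rule gibbs_expansion(1)[OF h])
  have x2: "\<bar>(\<integral>b. g b \<partial>\<pi>) - ?s\<bar> \<le> L.Lm * (max a 1 * L.tau + L.eps ^ 3)" if "odd_about d m g"
    by (rule gibbs_expansion(2)[OF h that])
  have x3: "\<bar>?s\<bar> \<le> L.LS * L.eps" by (rule gS_le[OF h])
  have x4: "?s = 0" if "even_about d m g" by (rule gS_even[OF h that])
  have x5: "skew_laplace_integral d V m g = ?s" by (rule skew_laplace_integral_eq[OF h])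
  show "integrable \<pi> g" by (rule integrable_g[OF h])
  have p0: "0 \<le> max a 1 * L.tau + L.eps ^ k" for k
    using L.tau_pos L.eps_pos by (intro add_nonneg_nonneg mult_nonneg_nonneg) auto
  have up: "L.Lm * (max a 1 * L.tau + L.eps ^ k) \<le> LL * (max a 1 * L.tau + L.eps ^ k)" for k
    using LL_ge p0[of k] by (intro mult_right_mono)
  have e2: "L.eps\<^sup>2 \<le> L.eps" using L.eps_pos L.eps_small by (simp add: power2_eq_square mult_left_le)
  have m0: "0 \<le> max a 1 * L.tau" using L.tau_pos by (intro mult_nonneg_nonneg) auto
  have "\<bar>\<integral>b. g b \<partial>\<pi>\<bar> \<le> L.Lm * (max a 1 * L.tau + L.eps\<^sup>2) + L.LS * L.eps"
    using x1 x3 by linarith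
  also have "\<dots> \<le> L.Lm * (max a 1 * L.tau + L.eps) + L.LS * (max a 1 * L.tau + L.eps)"
    using e2 m0 Lm_nonneg L.LS_nonneg by (intro add_mono mult_left_mono) auto
  also have "\<dots> = (L.Lm + L.LS) * (max a 1 * L.tau + L.eps)" by (simp add: distrib_right)
  also have "\<dots> \<le> LL * (max a 1 * L.tau + L.eps)"
    using LL_ge p0[of 1] by (intro mult_right_mono) auto
  finally show "\<bar>(\<integral>b. g b \<partial>\<pi>) - (\<integral>b. g b \<partial>\<gamma>)\<bar> \<le> LL * (max a 1 * L.tau + L.eps)"
    using h(5) by simp
  show "\<bar>(\<integral>b. g b \<partial>\<pi>) - skew_laplace_integral d V m g\<bar> \<le> LL * (max a 1 * L.tau + L.eps\<^sup>2)"
    unfolding x5 using x1 up[of 2] by linarith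
  show "\<bar>(\<integral>b. g b \<partial>\<pi>) - (\<integral>b. g b \<partial>\<gamma>)\<bar> \<le> LL * (max a 1 * L.tau + L.eps\<^sup>2)" if "even_about d m g"
    using x1 up[of 2] x4[OF that] h(5) by linarith
  show "\<bar>(\<integral>b. g b \<partial>\<pi>) - skew_laplace_integral d V m g\<bar> \<le> LL * (max a 1 * L.tau + L.eps ^ 3)" if "odd_about d m g"
    unfolding x5 using x2[OF that] up[of 3] by linarith
qed

end

text \<open>Probabilities are expectations of centred indicators, which are bounded by one and hence
  have growth constant one. The first-order term is the integral of \<open>S\<close> over
  \<open>A\<close>; since \<open>S\<close> has mean zero, its largest modulus is half the L1-norm,
  that is \<open>tv_leading\<close>. The comparison of distances is then the triangle inequality, in
  one direction at the extremal set.\<close>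

lemma tv_bounds:
  "0 \<le> tv_leading d V m" "tv_leading d V m \<le> LL * L.eps"
  "\<bar>tv d (measure \<pi>) (measure \<gamma>) - tv_leading d V m\<bar> \<le> tv d (measure \<pi>) (skew_laplace d V m)"
  "tv d (measure \<pi>) (skew_laplace d V m) \<le> LL * (L.eps\<^sup>2 + L.tau)"
proof -
  interpret \<gamma>: prob_space \<gamma> by (rule prob_space_laplace)
  interpret \<pi>: prob_space \<pi> by (rule prob_space_gibbs)
  let ?S = "skew d V m"
  have sg: "sets \<gamma> = sets (lborel_vec d)" by (simp add: laplace_eq)
  have [measurable]: "?S \<in> borel_measurable \<gamma>" by (simp cong: measurable_cong_sets add: sg)
  have iS: "integrable \<gamma> ?S"
    using L.integrable_S by (simp add: integrable_laplace skew_emb)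
  have S0: "(\<integral>b. ?S b \<partial>\<gamma>) = 0"
    using L.integral_S by (simp add: integral_laplace skew_emb)
  define T where "T A = (\<integral>b. indicator A b * ?S b \<partial>\<gamma>)" for A
  have iT: "integrable \<gamma> (\<lambda>b. indicator A b * ?S b)" if "A \<in> sets (lborel_vec d)" for A
    using integrable_real_mult_indicator[OF _ iS, of A] that sg by (simp add: mult.commute)
  have sk: "skew_laplace d V m A = measure \<gamma> A + T A" if A: "A \<in> sets (lborel_vec d)" for A
  proof -
    have "skew_laplace d V m A = (\<integral>b. indicator A b + indicator A b * ?S b \<partial>\<gamma>)"
      by (simp add: skew_laplace_def set_lebesgue_integral_def distrib_left)
    then show ?thesis
      using A iT[OF A] sg by (simp add: T_def \<gamma>.emeasure_eq_measure)
  qed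
  have key: "\<bar>measure \<pi> A - skew_laplace d V m A\<bar> \<le> L.Lm * (1 * L.tau + L.eps\<^sup>2)" if A: "A \<in> sets (lborel_vec d)" for A
  proof -
    define p where "p = measure \<gamma> A"
    have p: "0 \<le> p" "p \<le> 1" by (auto simp: p_def)
    define g where "g b = indicator A b - p" for b
    have gm: "g \<in> borel_measurable (lborel_vec d)" unfolding g_def[abs_def] using A by measurable
    have g1: "\<bar>g b\<bar> \<le> 1" for b using p by (auto simp: g_def split: split_indicator)
    have gb: "\<bar>g b\<bar> \<le> 1 * exp (sqrt (real d) * wnorm Hm (b - m) / 2)" if "b \<in> carrier_vec d" for b
    proof -
      obtain x where "e x = b" using emb_surj[OF m_carrier \<open>b \<in> _\<close>] by blast
      then have "0 \<le> wnorm Hm (b - m)" using growth_e[of x] by simp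
      then have "1 \<le> exp (sqrt (real d) * wnorm Hm (b - m) / 2)" by simp
      then show ?thesis using g1[of b] by linarith
    qed
    have "EG d (\<lambda>x. (g (e x))\<^sup>2) \<le> EG d (\<lambda>x. 1\<^sup>2)"
      using g1 by (intro EG_mono) (simp add: abs_square_le_1)
    then have g2: "EG d (\<lambda>x. (g (e x))\<^sup>2) \<le> ennreal 1" using L.EG_one by (rule order_trans)
    have g0: "(\<integral>b. g b \<partial>\<gamma>) = 0"
      unfolding g_def using A sg by (simp add: p_def \<gamma>.emeasure_eq_measure \<gamma>.prob_space)
    have "(\<integral>b. g b \<partial>\<pi>) = measure \<pi> A - p"
      unfolding g_def using A sets_gibbs by (simp add: \<pi>.emeasure_eq_measure \<pi>.prob_space)
    moreover have "(\<integral>b. g b * ?S b \<partial>\<gamma>) = T A"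
      unfolding g_def T_def left_diff_distrib using iS iT[OF A] by (simp add: S0)
    ultimately show ?thesis
      using gibbs_expansion(1)[OF gm gb order_refl g2 g0] by (simp add: sk[OF A] p_def)
  qed
  have ne: "sets (lborel_vec d) \<noteq> {}" by auto
  define K where "K = L.Lm * (1 * L.tau + L.eps\<^sup>2)"
  have le1: "\<bar>measure \<pi> A - skew_laplace d V m A\<bar> \<le> tv d (measure \<pi>) (skew_laplace d V m)" if "A \<in> sets (lborel_vec d)" for A
    unfolding tv_def using that key by (intro cSUP_upper bdd_aboveI2[of _ _ K]) (auto simp: K_def)
  have le2: "\<bar>measure \<pi> A - measure \<gamma> A\<bar> \<le> tv d (measure \<pi>) (measure \<gamma>)" if "A \<in> sets (lborel_vec d)" for A
    unfolding tv_def
  proof (rule cSUP_upper[OF that bdd_aboveI2])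
    show "\<bar>measure \<pi> B - measure \<gamma> B\<bar> \<le> 1" for B
      using \<pi>.prob_le_1[of B] \<gamma>.prob_le_1[of B] measure_nonneg[of \<pi> B] measure_nonneg[of \<gamma> B] by linarith
  qed
  have "tv d (measure \<pi>) (skew_laplace d V m) \<le> K"
    unfolding tv_def using key ne by (intro cSUP_least) (auto simp: K_def)
  also have "K \<le> LL * (L.eps\<^sup>2 + L.tau)"
    using LL_ge L.tau_pos unfolding K_def by (simp add: add.commute mult_right_mono)
  finally show "tv d (measure \<pi>) (skew_laplace d V m) \<le> LL * (L.eps\<^sup>2 + L.tau)" .
  show lead0: "0 \<le> tv_leading d V m" by (simp add: tv_leading_def)
  show "tv_leading d V m \<le> LL * L.eps"
  proof -
    \<comment> \<open>Tested against its own sign, \<open>S\<close> yields its L1-norm, so the bound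
      for a test function with second moment at most one applies.\<close>
    let ?g = "\<lambda>x. sgn (L.S x)"
    have gm: "?g \<in> borel_measurable (leb d)" by measurable
    have "EG d (\<lambda>x. (?g x)\<^sup>2) \<le> EG d (\<lambda>x. 1\<^sup>2)"
      by (intro EG_mono) (simp add: sgn_if)
    then have g2: "EG d (\<lambda>x. (?g x)\<^sup>2) \<le> ennreal 1" using L.EG_one by (rule order_trans)
    have "\<bar>t\<bar> = sgn t * t" for t :: real by (simp add: sgn_if)
    then have "(\<integral>b. \<bar>?S b\<bar> \<partial>\<gamma>) = (\<integral>x. ?g x * L.S x \<partial>gauss d)"
      by (simp add: integral_laplace skew_emb)
    then have "(\<integral>b. \<bar>?S b\<bar> \<partial>\<gamma>) \<le> L.LS * L.eps"
      using L.gS_bound(2)[OF gm g2] by linarith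
    also have "\<dots> \<le> LL * L.eps" using LL_ge L.eps_pos by (intro mult_right_mono) auto
    finally have "(\<integral>b. \<bar>?S b\<bar> \<partial>\<gamma>) \<le> LL * L.eps" .
    moreover have "0 \<le> (\<integral>b. \<bar>?S b\<bar> \<partial>\<gamma>)" by simp
    ultimately show ?thesis unfolding tv_leading_def by argo
  qed
  have T_abs: "(\<integral>b. \<bar>?S b\<bar> \<partial>\<gamma>) = 2 * tv_leading d V m" by (simp add: tv_leading_def)
  \<comment> \<open>The function \<open>2 * indicator A - 1\<close> has modulus one, and subtracting
    \<open>S\<close> changes nothing as \<open>S\<close> has mean zero.\<close>
  have T_le: "\<bar>T A\<bar> \<le> tv_leading d V m" if A: "A \<in> sets (lborel_vec d)" for A
  proof -
    have "2 * T A = (\<integral>b. 2 * (indicator A b * ?S b) - ?S b \<partial>\<gamma>)"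
      unfolding T_def using iT[OF A] iS by (simp add: S0)
    also have "\<bar>\<dots>\<bar> \<le> (\<integral>b. \<bar>2 * (indicator A b * ?S b) - ?S b\<bar> \<partial>\<gamma>)" by (rule integral_abs_bound)
    also have "(\<lambda>b. \<bar>2 * (indicator A b * ?S b) - ?S b\<bar>) = (\<lambda>b. \<bar>?S b\<bar>)"
      by (auto split: split_indicator)
    finally show ?thesis using T_abs by (simp add: abs_mult)
  qed
  \<comment> \<open>The extremal set: there \<open>2 * indicator A0 - 1\<close> is a sign of
    \<open>S\<close>, and the preceding bound is attained.\<close>
  define A0 where "A0 = {b \<in> space (lborel_vec d). 0 \<le> ?S b}"
  have A0: "A0 \<in> sets (lborel_vec d)" unfolding A0_def by measurable
  have T0: "T A0 = tv_leading d V m"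
  proof -
    have "2 * T A0 = (\<integral>b. 2 * (indicator A0 b * ?S b) - ?S b \<partial>\<gamma>)"
      unfolding T_def using iT[OF A0] iS by (simp add: S0)
    also have "\<dots> = (\<integral>b. \<bar>?S b\<bar> \<partial>\<gamma>)"
      by (intro Bochner_Integration.integral_cong refl) (auto simp: A0_def laplace_eq split: split_indicator)
    finally show ?thesis using T_abs by simp
  qed
  have "tv d (measure \<pi>) (measure \<gamma>) \<le> tv d (measure \<pi>) (skew_laplace d V m) + tv_leading d V m"
    unfolding tv_def[of d "measure \<pi>" "measure \<gamma>"]
  proof (rule cSUP_least[OF ne])
    fix A assume A: "A \<in> sets (lborel_vec d)"
    show "\<bar>measure \<pi> A - measure \<gamma> A\<bar> \<le> tv d (measure \<pi>) (skew_laplace d V m) + tv_leading d V m"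
      using le1[OF A] T_le[OF A] sk[OF A] by linarith
  qed
  moreover have "tv_leading d V m \<le> tv d (measure \<pi>) (skew_laplace d V m) + tv d (measure \<pi>) (measure \<gamma>)"
    using le1[OF A0] le2[OF A0] sk[OF A0] T0 by linarith
  ultimately show "\<bar>tv d (measure \<pi>) (measure \<gamma>) - tv_leading d V m\<bar> \<le> tv d (measure \<pi>) (skew_laplace d V m)"
    by linarith
qed

end

section \<open>Mean and covariance\<close>

lemma le_exp_half: "t \<le> exp (t / 2)" if "0 \<le> t" for t :: real
proof -
  have "t \<le> (1 + t / 4)\<^sup>2" using zero_le_power2[of "1 - t / 4"] by (simp add: power2_eq_square algebra_simps)
  also have "\<dots> \<le> (exp (t / 4))\<^sup>2" using that exp_ge_add_one_self[of "t / 4"] by (intro power_mono) auto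
  also have "\<dots> = exp (t / 2)" by (simp add: power2_eq_square mult_exp_exp)
  finally show ?thesis .
qed

lemma power2_le_exp_half: "t\<^sup>2 \<le> 8 * exp (t / 2)" if "0 \<le> t" for t :: real
  using power_div_fact_le_exp[of "t / 2" 2] that by (simp add: power_divide)

text \<open>Polarization: fourth powers of \<open>p + q\<close>, \<open>p - q\<close>,
  \<open>p + 2 q\<close> and \<open>p - 2 q\<close> combine so that \<open>p * q ^ 3\<close> cancels
  and \<open>q * p ^ 3\<close> remains, which reduces the mixed moment to fourth moments of single
  linear forms.\<close>

lemma has_bochner_integral_gauss_dot_cubic:
  "has_bochner_integral (gauss d) (\<lambda>x. dot d w x * dot d z x ^ 3) (3 * dot d w z * sqn d z)"
proof -
  let ?v = "\<lambda>c i. z i + c * w i"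
  have dv: "dot d (?v c) x = dot d z x + c * dot d w x" for c x
    by (simp add: dot_def sum.distrib sum_distrib_left algebra_simps)
  have sv: "sqn d (?v c) = sqn d z + 2 * c * dot d w z + c\<^sup>2 * sqn d w" for c
    by (simp add: dot_def sqn_def sum.distrib sum_distrib_left power2_eq_square algebra_simps)
  have id: "q * p ^ 3 = (8 * ((p + 1 * q) ^ 4 - (p + - 1 * q) ^ 4) - ((p + 2 * q) ^ 4 - (p + - 2 * q) ^ 4)) / 48" for p q :: real
    by (simp add: eval_nat_numeral field_simps)
  have "has_bochner_integral (gauss d) (\<lambda>x. (8 * (dot d (?v 1) x ^ 4 - dot d (?v (- 1)) x ^ 4) - (dot d (?v 2) x ^ 4 - dot d (?v (- 2)) x ^ 4)) / 48)
    ((8 * (3 * (sqn d (?v 1))\<^sup>2 - 3 * (sqn d (?v (- 1)))\<^sup>2) - (3 * (sqn d (?v 2))\<^sup>2 - 3 * (sqn d (?v (- 2)))\<^sup>2)) / 48)"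
    by (intro has_bochner_integral_divide_zero has_bochner_integral_diff has_bochner_integral_mult_right has_bochner_integral_gauss_dot_4)
  moreover have "(8 * (3 * (sqn d (?v 1))\<^sup>2 - 3 * (sqn d (?v (- 1)))\<^sup>2) - (3 * (sqn d (?v 2))\<^sup>2 - 3 * (sqn d (?v (- 2)))\<^sup>2)) / 48
      = 3 * dot d w z * sqn d z"
    unfolding sv by (simp add: power2_eq_square field_simps)
  ultimately show ?thesis unfolding dv id[of "dot d w _" "dot d z _"] by (simp only:)
qed

context whitening
begin

lemma dot_co: "u \<in> carrier_vec d \<Longrightarrow> v \<in> carrier_vec d \<Longrightarrow> u \<bullet> (mat_inv H *\<^sub>v v) = dot d (co u) (co v)"
proof -
  assume u: "u \<in> carrier_vec d" and v: "v \<in> carrier_vec d"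
  have "dot d (co u) (co v) = (transpose_mat A *\<^sub>v u) \<bullet> (transpose_mat A *\<^sub>v v)"
    using mult_mat_vec_carrier[OF At u] mult_mat_vec_carrier[OF At v]
    by (subst scalar_prod_eq_dot[of _ d]) (auto simp: co_def)
  also have "\<dots> = u \<bullet> (A *\<^sub>v (transpose_mat A *\<^sub>v v))"
    using A u v by (intro transpose_vec_mult_scalar[of _ d d]) auto
  also have "\<dots> = u \<bullet> (mat_inv H *\<^sub>v v)"
    using A v by (simp add: mat_inv_H assoc_mult_mat_vec[of _ d d _ d])
  finally show ?thesis by simp
qed

text \<open>The functional \<open>u = H *\<^sub>v v\<close> is extremal: both its pairing with
  \<open>v\<close> and the squared norm of \<open>co u\<close> equal the square of
  \<open>wnorm H v\<close>.\<close>

lemma wnorm_le_dual: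
  assumes v: "v \<in> carrier_vec d" and c: "0 \<le> c"
    and le: "\<And>u. u \<in> carrier_vec d \<Longrightarrow> u \<bullet> v \<le> sqrt (sqn d (co u)) * c"
  shows "wnorm H v \<le> c"
proof -
  obtain x where x: "ax x = v" using ax_surj[OF v] by blast
  have q: "v \<bullet> (H *\<^sub>v v) = sqn d x" by (simp add: x[symmetric] quadratic_ax dot_self)
  define u where "u = H *\<^sub>v v"
  have u: "u \<in> carrier_vec d" using H v by (simp add: u_def)
  have "mat_inv H *\<^sub>v u = v"
    using H_mat_inv(2) H mat_inv_H_carrier v
    by (simp add: u_def assoc_mult_mat_vec[symmetric, of _ d d _ d])
  then have "sqn d (co u) = u \<bullet> v" using sqn_co[OF u] by simp
  also have uv: "u \<bullet> v = sqn d x" using u v by (simp add: q[symmetric] u_def comm_scalar_prod[of _ d])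
  finally have "sqn d x \<le> sqrt (sqn d x) * c" using le[OF u] uv by simp
  then have le': "sqrt (sqn d x) * sqrt (sqn d x) \<le> sqrt (sqn d x) * c" by simp
  have "sqrt (sqn d x) \<le> c"
  proof (cases "sqn d x = 0")
    case False
    then have "0 < sqn d x" by (metis sqn_nonneg less_eq_real_def)
    then show ?thesis by (intro mult_left_le_imp_le[OF le']) simp
  qed (use c in simp)
  then show ?thesis by (simp add: wnorm_def q)
qed

end

section \<open>Linear and quadratic test functions\<close>

context logistic_coords
begin

lemma Zr_positive: "0 < Zr" using Zr_ge by linarith

lemma post_cmult: "post (\<lambda>x. c * g x) = c * post g"
  by (simp add: post_def mult.assoc)

lemma post_const: "post (\<lambda>x. c) = c"
  using Zr_positive by (simp add: post_def Zr_def)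

lemma post_add:
  assumes "integrable (gauss d) (\<lambda>x. f x * exp (r x))" "integrable (gauss d) (\<lambda>x. g x * exp (r x))"
  shows "post (\<lambda>x. f x + g x) = post f + post g"
  using assms by (simp add: post_def distrib_right add_divide_distrib)

lemma sqrt_d_growth: "sqrt (sqn d x) \<le> growth x" "sqn d x \<le> 8 * growth x"
proof -
  have "1 * sqrt (sqn d x) \<le> sqrt (real d) * sqrt (sqn d x)"
    using d1 by (intro mult_right_mono) auto
  then have e: "exp (sqrt (sqn d x) / 2) \<le> growth x" by simp
  show "sqrt (sqn d x) \<le> growth x"
    by (rule order_trans[OF le_exp_half e]) simp
  have "sqn d x = (sqrt (sqn d x))\<^sup>2" by simp
  also have "\<dots> \<le> 8 * exp (sqrt (sqn d x) / 2)" by (rule power2_le_exp_half) simp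
  also have "\<dots> \<le> 8 * growth x" using e by linarith
  finally show "sqn d x \<le> 8 * growth x" .
qed

lemma EG_eq:
  assumes "has_bochner_integral (gauss d) f c" "\<And>x. 0 \<le> f x"
  shows "EG d f = ennreal c"
  using assms by (simp add: EG_def has_bochner_integral_iff nn_integral_eq_integral)

lemma dot_sq_le: "(dot d u x)\<^sup>2 \<le> sqn d x" if "sqn d u = 1"
  using dot_Cauchy_Schwarz[of d u x] that by simp

lemma dot_refl: "dot d u (refl x) = - dot d u x"
  by (simp add: dot_minus)

text \<open>A unit linear form is an odd test function of variance one with growth constant one,
  hence the error of third order.\<close>

lemma post_dot_unit:
  assumes u: "sqn d u = 1"
  shows "integrable (gauss d) (\<lambda>x. dot d u x * exp (r x))"
    and "\<bar>post (dot d u) - (\<integral>x. dot d u x * S x \<partial>gauss d)\<bar> \<le> Lm * (tau + eps ^ 3)"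
    and "\<bar>\<integral>x. dot d u x * S x \<partial>gauss d\<bar> \<le> LS * eps"
    and "integrable (gauss d) (\<lambda>x. dot d u x * S x)"
proof -
  have g: "dot d u \<in> borel_measurable (leb d)" by measurable
  have bd: "\<bar>dot d u x\<bar> \<le> 1 * growth x" for x
  proof -
    have "\<bar>dot d u x\<bar> \<le> sqrt (sqn d x)" using dot_sq_le[OF u, of x] by (intro real_le_rsqrt) simp
    then show ?thesis using sqrt_d_growth(1)[of x] by linarith
  qed
  have g2: "EG d (\<lambda>x. (dot d u x)\<^sup>2) \<le> ennreal 1"
    using EG_eq[OF has_bochner_integral_gauss_dot_2[of d u]] u by simp
  have g0: "(\<integral>x. dot d u x \<partial>gauss d) = 0"
    by (rule integral_gauss_odd[OF g]) (rule dot_refl)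
  note p = post_expansion[OF g bd order_refl g2 g0]
  show "integrable (gauss d) (\<lambda>x. dot d u x * exp (r x))" by (rule p(1))
  show "\<bar>post (dot d u) - (\<integral>x. dot d u x * S x \<partial>gauss d)\<bar> \<le> Lm * (tau + eps ^ 3)"
    using p(3) dot_refl by simp
  show "\<bar>\<integral>x. dot d u x * S x \<partial>gauss d\<bar> \<le> LS * eps" "integrable (gauss d) (\<lambda>x. dot d u x * S x)"
    by (rule gS_bound[OF g g2])+
qed

text \<open>The square of a unit form has Gaussian mean one and variance two, so \<open>g\<close> is
  its standardization. It is even, hence has no first-order term and the error is of second
  order.\<close>

lemma post_dot_sq_unit:
  assumes u: "sqn d u = 1"
  shows "integrable (gauss d) (\<lambda>x. (dot d u x)\<^sup>2 * exp (r x))"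
    and "\<bar>post (\<lambda>x. (dot d u x)\<^sup>2) - 1\<bar> \<le> 2 * (Lm * (9 * tau + eps\<^sup>2))"
proof -
  define g where "g x = ((dot d u x)\<^sup>2 - 1) / sqrt 2" for x
  have g: "g \<in> borel_measurable (leb d)" unfolding g_def[abs_def] by measurable
  have sq2: "1 \<le> sqrt (2 :: real)" "sqrt (2 :: real) \<le> 2" by (auto intro: real_le_lsqrt)
  have bd: "\<bar>g x\<bar> \<le> 9 * growth x" for x
  proof -
    have "\<bar>g x\<bar> \<le> \<bar>(dot d u x)\<^sup>2 - 1\<bar>"
      using sq2 by (simp add: g_def abs_div_pos[symmetric] divide_le_eq mult_le_cancel_left1)
    also have "\<dots> \<le> sqn d x + 1" using dot_sq_le[OF u, of x] zero_le_power2[of "dot d u x"] by linarith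
    also have "\<dots> \<le> 9 * growth x"
    proof -
      have "1 \<le> growth x" by simp
      then show ?thesis using sqrt_d_growth(2)[of x] by linarith
    qed
    finally show ?thesis .
  qed
  have h2: "has_bochner_integral (gauss d) (\<lambda>x. (dot d u x)\<^sup>2) 1" and h4: "has_bochner_integral (gauss d) (\<lambda>x. dot d u x ^ 4) 3"
    and h1: "has_bochner_integral (gauss d) (\<lambda>x. 1) (1 :: real)"
    using has_bochner_integral_gauss_dot_2[of d u] has_bochner_integral_gauss_dot_4[of d u]
    by (simp_all add: u has_bochner_integral_iff gauss.prob_space)
  have "has_bochner_integral (gauss d) (\<lambda>x. (dot d u x ^ 4 - 2 * (dot d u x)\<^sup>2 + 1) / 2) ((3 - 2 * 1 + 1) / 2)"
    by (intro has_bochner_integral_divide_zero has_bochner_integral_add has_bochner_integral_diff has_bochner_integral_mult_right h1 h2 h4)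
  moreover have "(g x)\<^sup>2 = (dot d u x ^ 4 - 2 * (dot d u x)\<^sup>2 + 1) / 2" for x
    by (simp add: g_def power_divide power2_diff power_mult[symmetric])
  ultimately have "has_bochner_integral (gauss d) (\<lambda>x. (g x)\<^sup>2) ((3 - 2 * 1 + 1) / 2)" by (simp only:)
  then have g2: "EG d (\<lambda>x. (g x)\<^sup>2) \<le> ennreal 1" using EG_eq[of "\<lambda>x. (g x)\<^sup>2"] by simp
  have "has_bochner_integral (gauss d) g ((1 - 1) / sqrt 2)"
    unfolding g_def by (intro has_bochner_integral_divide_zero has_bochner_integral_diff h1 h2)
  then have g0: "(\<integral>x. g x \<partial>gauss d) = 0" by (simp add: has_bochner_integral_iff)
  have gr: "g (refl x) = g x" for x by (simp add: g_def dot_minus)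
  have gS: "(\<integral>x. g x * S x \<partial>gauss d) = 0"
    using g by (intro integral_gauss_odd) (auto simp: gr)
  note p = post_expansion[OF g bd _ g2 g0]
  have e: "(dot d u x)\<^sup>2 = sqrt 2 * g x + 1" for x by (simp add: g_def)
  have ig: "integrable (gauss d) (\<lambda>x. (sqrt 2 * g x) * exp (r x))"
    using integrable_mult_right[OF p(1), of "sqrt 2"] by (simp add: mult.assoc)
  show "integrable (gauss d) (\<lambda>x. (dot d u x)\<^sup>2 * exp (r x))"
    unfolding e distrib_right using ig integrable_exp_r by simp
  have "post (\<lambda>x. (dot d u x)\<^sup>2) = sqrt 2 * post g + 1"
    unfolding e using ig integrable_exp_r by (subst post_add) (auto simp: post_cmult post_const)
  then have "\<bar>post (\<lambda>x. (dot d u x)\<^sup>2) - 1\<bar> = sqrt 2 * \<bar>post g\<bar>" by (simp add: abs_mult)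
  also have "\<dots> \<le> 2 * (Lm * (9 * tau + eps\<^sup>2))"
    using p(2) sq2 by (intro mult_mono) (auto simp: gS)
  finally show "\<bar>post (\<lambda>x. (dot d u x)\<^sup>2) - 1\<bar> \<le> 2 * (Lm * (9 * tau + eps\<^sup>2))" .
qed

lemma dot_normalize:
  assumes "sqn d u \<noteq> 0"
  obtains v where "sqn d v = 1" "\<And>x. dot d u x = sqrt (sqn d u) * dot d v x"
proof
  have "0 < sqn d u" using assms by (metis sqn_nonneg less_eq_real_def)
  then have pos: "0 < sqrt (sqn d u)" by simp
  show "sqn d (\<lambda>i. (1 / sqrt (sqn d u)) * u i) = 1"
    unfolding sqn_scale using pos assms by (simp add: power_divide)
  show "dot d u x = sqrt (sqn d u) * dot d (\<lambda>i. (1 / sqrt (sqn d u)) * u i) x" for x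
    using pos by (simp add: dot_def sum_distrib_left)
qed

lemma dot_zero: "sqn d u = 0 \<Longrightarrow> dot d u x = 0"
  using dot_Cauchy_Schwarz[of d u x] by simp

lemma post_dot_conj:
  "integrable (gauss d) (\<lambda>x. dot d u x * exp (r x)) \<and>
    \<bar>post (dot d u) - (\<integral>x. dot d u x * S x \<partial>gauss d)\<bar> \<le> sqrt (sqn d u) * (Lm * (tau + eps ^ 3)) \<and>
    \<bar>\<integral>x. dot d u x * S x \<partial>gauss d\<bar> \<le> sqrt (sqn d u) * (LS * eps)"
proof (cases "sqn d u = 0")
  case True
  have "dot d u = (\<lambda>x. 0)" using dot_zero[OF True] by auto
  then show ?thesis using True by (simp add: post_const)
next
  case False
  then obtain v where v: "sqn d v = 1" and wv: "\<And>x. dot d u x = sqrt (sqn d u) * dot d v x"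
    by (rule dot_normalize) blast
  note u = post_dot_unit[OF v]
  have wv': "dot d u = (\<lambda>x. sqrt (sqn d u) * dot d v x)" using wv by auto
  have i: "(\<integral>x. dot d u x * S x \<partial>gauss d) = sqrt (sqn d u) * (\<integral>x. dot d v x * S x \<partial>gauss d)"
    unfolding wv' by (simp add: mult.assoc)
  have p: "post (dot d u) = sqrt (sqn d u) * post (dot d v)"
    unfolding wv' by (rule post_cmult)
  have "integrable (gauss d) (\<lambda>x. dot d u x * exp (r x))"
    unfolding wv' mult.assoc using u(1) by (intro integrable_mult_right)
  moreover have "\<bar>post (dot d u) - (\<integral>x. dot d u x * S x \<partial>gauss d)\<bar> \<le> sqrt (sqn d u) * (Lm * (tau + eps ^ 3))"
    unfolding i p right_diff_distrib[symmetric] abs_mult using u(2) by (intro mult_mono) auto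
  moreover have "\<bar>\<integral>x. dot d u x * S x \<partial>gauss d\<bar> \<le> sqrt (sqn d u) * (LS * eps)"
    unfolding i abs_mult using u(3) by (intro mult_mono) auto
  ultimately show ?thesis by blast
qed

lemmas post_dot = post_dot_conj[THEN conjunct1] post_dot_conj[THEN conjunct2, THEN conjunct1]
  post_dot_conj[THEN conjunct2, THEN conjunct2]

lemma post_dot_sq_conj:
  "integrable (gauss d) (\<lambda>x. (dot d u x)\<^sup>2 * exp (r x)) \<and>
    \<bar>post (\<lambda>x. (dot d u x)\<^sup>2) - sqn d u\<bar> \<le> sqn d u * (2 * (Lm * (9 * tau + eps\<^sup>2)))"
proof (cases "sqn d u = 0")
  case True
  then show ?thesis using dot_zero[OF True] by (simp add: post_const)
next
  case False
  then obtain v where v: "sqn d v = 1" and wv: "\<And>x. dot d u x = sqrt (sqn d u) * dot d v x"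
    by (rule dot_normalize) blast
  note u = post_dot_sq_unit[OF v]
  have wv': "(\<lambda>x. (dot d u x)\<^sup>2) = (\<lambda>x. sqn d u * (dot d v x)\<^sup>2)"
    using sqn_nonneg[of d u] by (simp add: wv power_mult_distrib)
  have p: "post (\<lambda>x. (dot d u x)\<^sup>2) - sqn d u = sqn d u * (post (\<lambda>x. (dot d v x)\<^sup>2) - 1)"
    unfolding wv' post_cmult by (simp add: right_diff_distrib)
  have fe: "(\<lambda>x. (dot d u x)\<^sup>2 * exp (r x)) = (\<lambda>x. sqn d u * ((dot d v x)\<^sup>2 * exp (r x)))"
    using wv' by (simp add: fun_eq_iff mult.assoc)
  have "integrable (gauss d) (\<lambda>x. (dot d u x)\<^sup>2 * exp (r x))"
    unfolding fe by (intro integrable_mult_right u(1))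
  moreover have "\<bar>post (\<lambda>x. (dot d u x)\<^sup>2) - sqn d u\<bar> \<le> sqn d u * (2 * (Lm * (9 * tau + eps\<^sup>2)))"
    unfolding p abs_mult using u(2) sqn_nonneg[of d u] by (intro mult_mono) auto
  ultimately show ?thesis by blast
qed

lemmas post_dot_sq = post_dot_sq_conj[THEN conjunct1] post_dot_sq_conj[THEN conjunct2]

lemma integrable_dot_mult: "integrable (gauss d) (\<lambda>x. (dot d v x * dot d u x) * exp (r x))"
proof -
  let ?p = "\<lambda>i. v i + 1 * u i" and ?q = "\<lambda>i. v i + - 1 * u i"
  have e: "dot d ?p x = dot d v x + dot d u x" "dot d ?q x = dot d v x - dot d u x" for x
    by (simp_all add: dot_def sum.distrib sum_subtractf algebra_simps)
  have "integrable (gauss d) (\<lambda>x. ((dot d ?p x)\<^sup>2 * exp (r x) - (dot d ?q x)\<^sup>2 * exp (r x)) / 4)"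
    by (intro integrable_divide_zero Bochner_Integration.integrable_diff post_dot_sq(1))
  moreover have "((dot d ?p x)\<^sup>2 * exp (r x) - (dot d ?q x)\<^sup>2 * exp (r x)) / 4 = (dot d v x * dot d u x) * exp (r x)" for x
    unfolding e by (simp add: power2_eq_square field_simps)
  ultimately show ?thesis by simp
qed

definition Lc :: real where "Lc = 18 * Lm + 4 * Lm\<^sup>2 + 2 * LS\<^sup>2"

text \<open>The squared posterior mean enters with the square of its first-order size and is thus no
  larger than the error of the second moment; products with \<open>tau\<close> are absorbed since
  \<open>eps ^ 2 + tau \<le> 2\<close>.\<close>

lemma post_variance:
  "\<bar>post (\<lambda>x. (dot d u x)\<^sup>2) - (post (dot d u))\<^sup>2 - sqn d u\<bar> \<le> sqn d u * (Lc * (eps\<^sup>2 + tau))"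
proof -
  have Lm0: "0 \<le> Lm" using LS_nonneg cw_nonneg cwo_nonneg by (simp add: Lm_def)
  define t where "t = eps\<^sup>2 + tau"
  have t0: "0 \<le> t" using tau_pos by (simp add: t_def)
  have ee: "eps ^ 3 \<le> eps\<^sup>2" "eps\<^sup>2 \<le> 1" using eps_pos eps_small by (auto intro!: power_decreasing simp: power_le_one)
  have t2: "t \<le> 2" using ee tau_le_1 by (simp add: t_def)
  have s0: "0 \<le> sqn d u" by (rule sqn_nonneg)
  have "\<bar>post (dot d u)\<bar> \<le> sqrt (sqn d u) * (Lm * (tau + eps ^ 3)) + sqrt (sqn d u) * (LS * eps)"
    using post_dot(2,3)[of u] by linarith
  also have "\<dots> \<le> sqrt (sqn d u) * (Lm * t + LS * eps)"
  proof -
    have "Lm * (tau + eps ^ 3) \<le> Lm * t" using Lm0 ee by (intro mult_left_mono) (auto simp: t_def)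
    then have "Lm * (tau + eps ^ 3) + LS * eps \<le> Lm * t + LS * eps" by simp
    then have "sqrt (sqn d u) * (Lm * (tau + eps ^ 3) + LS * eps) \<le> sqrt (sqn d u) * (Lm * t + LS * eps)"
      using s0 by (intro mult_left_mono) auto
    then show ?thesis by (simp add: distrib_left)
  qed
  finally have "\<bar>post (dot d u)\<bar>\<^sup>2 \<le> (sqrt (sqn d u) * (Lm * t + LS * eps))\<^sup>2" by (intro power_mono) auto
  then have m: "(post (dot d u))\<^sup>2 \<le> sqn d u * (Lm * t + LS * eps)\<^sup>2"
    using s0 by (simp add: power_mult_distrib)
  have "(Lm * t + LS * eps)\<^sup>2 \<le> 2 * (Lm * t)\<^sup>2 + 2 * (LS * eps)\<^sup>2"
    using zero_le_power2[of "Lm * t - LS * eps"] by (simp add: power2_eq_square algebra_simps)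
  also have "\<dots> \<le> 4 * Lm\<^sup>2 * t + 2 * LS\<^sup>2 * t"
  proof -
    have "t * t \<le> 2 * t" using t2 t0 by (intro mult_right_mono)
    then have "2 * (Lm\<^sup>2 * (t * t)) \<le> 2 * (Lm\<^sup>2 * (2 * t))" by (intro mult_left_mono) auto
    moreover have "2 * (LS\<^sup>2 * eps\<^sup>2) \<le> 2 * (LS\<^sup>2 * t)" using tau_pos by (intro mult_left_mono) (auto simp: t_def)
    ultimately show ?thesis by (simp add: power_mult_distrib power2_eq_square mult_ac)
  qed
  finally have "sqn d u * (Lm * t + LS * eps)\<^sup>2 \<le> sqn d u * (4 * Lm\<^sup>2 * t + 2 * LS\<^sup>2 * t)"
    using s0 by (intro mult_left_mono)
  moreover have "sqn d u * (2 * (Lm * (9 * tau + eps\<^sup>2))) \<le> sqn d u * (18 * Lm * t)"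
  proof -
    have "Lm * (9 * tau + eps\<^sup>2) \<le> Lm * (9 * t)" using Lm0 by (intro mult_left_mono) (auto simp: t_def)
    then have "2 * (Lm * (9 * tau + eps\<^sup>2)) \<le> 18 * Lm * t" by argo
    then show ?thesis using s0 by (intro mult_left_mono)
  qed
  moreover have "sqn d u * (Lc * t) = sqn d u * (18 * Lm * t) + sqn d u * (4 * Lm\<^sup>2 * t + 2 * LS\<^sup>2 * t)"
    by (simp add: Lc_def algebra_simps)
  ultimately show ?thesis
    using post_dot_sq(2)[of u] m zero_le_power2[of "post (dot d u)"] unfolding t_def[symmetric] by linarith
qed

end

section \<open>Posterior mean and covariance in the original coordinates\<close>

context coord_data
begin

lemma ax_index_dot: "i < d \<Longrightarrow> ax x $ i = dot d (co (unit_vec d i)) x"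
proof -
  assume i: "i < d"
  have "unit_vec d i \<bullet> ax x = ax x $ i" using i by (intro scalar_prod_left_unit[of _ d]) auto
  then show ?thesis using i by (simp add: scalar_prod_ax)
qed

lemma integrable_coord: "i < d \<Longrightarrow> integrable \<pi> (\<lambda>b. b $ i - m $ i)"
proof -
  assume i: "i < d"
  have mm: "(\<lambda>b. b $ i - m $ i) \<in> borel_measurable (lborel_vec d)" using i by measurable
  have "e x $ i - m $ i = dot d (co (unit_vec d i)) x" for x
    using i m_carrier ax_carrier[of x] by (simp add: e_eq ax_index_dot del: ax_carrier)
  then show ?thesis by (intro integrable_gibbs[OF mm]) (simp add: L.post_dot(1))
qed

lemma integrable_index: "i < d \<Longrightarrow> integrable \<pi> (\<lambda>b. b $ i)"
proof -
  assume i: "i < d"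
  interpret \<pi>: prob_space \<pi> by (rule prob_space_gibbs)
  from Bochner_Integration.integrable_add[OF integrable_coord[OF i] \<pi>.integrable_const[of "m $ i"]]
  show ?thesis by simp
qed

lemma integrable_coord_mult: "i < d \<Longrightarrow> j < d \<Longrightarrow> integrable \<pi> (\<lambda>b. (b $ i - m $ i) * (b $ j - m $ j))"
proof -
  assume i: "i < d" and j: "j < d"
  have mm: "(\<lambda>b. (b $ i - m $ i) * (b $ j - m $ j)) \<in> borel_measurable (lborel_vec d)"
    using i j by measurable
  have "e x $ i - m $ i = dot d (co (unit_vec d i)) x" "e x $ j - m $ j = dot d (co (unit_vec d j)) x" for x
    using i j m_carrier ax_carrier[of x] by (simp_all add: e_eq ax_index_dot del: ax_carrier)
  then show ?thesis by (intro integrable_gibbs[OF mm]) (simp add: L.integrable_dot_mult)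
qed

text \<open>Arbitrary shifts serve both the covariance, centred at the posterior mean, and the plain
  products, with shifts zero.\<close>

lemma integrable_index_shift_mult:
  assumes "i < d" "j < d"
  shows "integrable \<pi> (\<lambda>b. (b $ i - s) * (b $ j - t))"
proof -
  interpret \<pi>: prob_space \<pi> by (rule prob_space_gibbs)
  have "integrable \<pi> (\<lambda>b. (b $ i - m $ i) * (b $ j - m $ j) + (m $ j - t) * (b $ i - m $ i) + (m $ i - s) * (b $ j - m $ j) + (m $ i - s) * (m $ j - t))"
    using assms integrable_coord_mult integrable_coord by simp
  moreover have "(b $ i - m $ i) * (b $ j - m $ j) + (m $ j - t) * (b $ i - m $ i) + (m $ i - s) * (b $ j - m $ j) + (m $ i - s) * (m $ j - t)
      = (b $ i - s) * (b $ j - t)" for b :: rvec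
    by (simp add: algebra_simps)
  ultimately show ?thesis by simp
qed

abbreviation "bm \<equiv> mean_vec d \<pi>"

lemma mean_carrier: "bm \<in> carrier_vec d" by (simp add: mean_vec_def)

lemma scalar_mean:
  assumes u: "u \<in> carrier_vec d"
  shows "u \<bullet> (bm - m) = L.post (dot d (co u))"
proof -
  interpret \<pi>: prob_space \<pi> by (rule prob_space_gibbs)
  have mi: "bm $ i - m $ i = (\<integral>b. b $ i - m $ i \<partial>\<pi>)" if "i < d" for i
    using that integrable_index[OF that] by (simp add: mean_vec_def \<pi>.prob_space)
  have "u \<bullet> (bm - m) = (\<Sum>i<d. u $ i * (bm $ i - m $ i))"
    using u m_carrier mean_carrier by (subst scalar_prod_eq_dot[of _ d]) (auto simp: dot_def)
  also have "\<dots> = (\<Sum>i<d. \<integral>b. u $ i * (b $ i - m $ i) \<partial>\<pi>)" by (simp add: mi)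
  also have "\<dots> = (\<integral>b. (\<Sum>i<d. u $ i * (b $ i - m $ i)) \<partial>\<pi>)"
    using integrable_coord by (intro Bochner_Integration.integral_sum[symmetric]) auto
  also have "\<dots> = L.post (\<lambda>x. \<Sum>i<d. u $ i * (e x $ i - m $ i))"
    by (rule integral_gibbs) measurable
  also have "(\<lambda>x. \<Sum>i<d. u $ i * (e x $ i - m $ i)) = dot d (co u)"
  proof
    fix x
    have "(\<Sum>i<d. u $ i * (e x $ i - m $ i)) = u \<bullet> (e x - m)"
      using u m_carrier e_carrier[of x] by (subst scalar_prod_eq_dot[of _ d]) (auto simp: dot_def simp del: e_carrier)
    then show "(\<Sum>i<d. u $ i * (e x $ i - m $ i)) = dot d (co u) x"
      using u m_carrier by (simp add: emb_minus scalar_prod_ax)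
  qed
  finally show ?thesis .
qed

lemma mean_shift_carrier: "mean_shift d V m \<in> carrier_vec d"
  using mat_inv_H_carrier by (auto simp: mean_shift_def Let_def tensor_mat_def)

text \<open>The mean shift is exactly the first-order term of the expansion for linear test
  functions: the mixed moment contributes the factor three, and \<open>3 / 6\<close> is the
  \<open>1 / 2\<close> of its definition.\<close>

lemma scalar_mean_shift:
  assumes u: "u \<in> carrier_vec d"
  shows "u \<bullet> mean_shift d V m = (\<integral>x. dot d (co u) x * L.S x \<partial>gauss d)"
proof -
  let ?K = "mat_inv Hm" and ?T = "tensor_mat d (third_deriv d V m) (mat_inv Hm)"
  let ?c = "\<lambda>i. dsig 3 (Xv i \<bullet> m)"
  let ?s = "\<Sum>l<n. ?c l * dot d (co (Xv l)) (co u) * sqn d (co (Xv l))"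
  let ?s3 = "\<Sum>l<n. ?c l * (3 * dot d (co u) (co (Xv l)) * sqn d (co (Xv l)))"
  have T: "?T \<in> carrier_vec d" by (simp add: tensor_mat_def)
  have K: "?K \<in> carrier_mat d d" "transpose_mat ?K = ?K" by (rule mat_inv_H_carrier, rule transpose_mat_inv_H)
  have Ku: "?K *\<^sub>v u \<in> carrier_vec d" using K u by simp
  have "u \<bullet> mean_shift d V m = - (1 / 2) * (u \<bullet> (?K *\<^sub>v ?T))"
    using u K T by (simp add: mean_shift_def Let_def)
  also have "u \<bullet> (?K *\<^sub>v ?T) = (?K *\<^sub>v u) \<bullet> ?T"
    using transpose_vec_mult_scalar[of ?K d d ?T u] K T u by simp
  also have "\<dots> = (\<Sum>l<n. ?c l * (Xv l \<bullet> (?K *\<^sub>v u)) * (Xv l \<bullet> (?K *\<^sub>v Xv l)))"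
    by (rule tensor_mat_dot[OF m_carrier Ku K(1)])
  also have "\<dots> = ?s"
    using X u by (intro sum.cong refl) (simp add: dot_co sqn_co)
  finally have 1: "u \<bullet> mean_shift d V m = - (1 / 2) * ?s" .
  have "has_bochner_integral (gauss d) (\<lambda>x. (\<Sum>l<n. ?c l * (dot d (co u) x * dot d (co (Xv l)) x ^ 3)) / 6)
    (?s3 / 6)"
    by (intro has_bochner_integral_divide_zero has_bochner_integral_sum has_bochner_integral_mult_right has_bochner_integral_gauss_dot_cubic)
  then have "(\<integral>x. - ((\<Sum>l<n. ?c l * (dot d (co u) x * dot d (co (Xv l)) x ^ 3)) / 6) \<partial>gauss d)
    = - (?s3 / 6)"
    by (simp add: has_bochner_integral_iff)
  moreover have "dot d (co u) x * L.S x = - ((\<Sum>l<n. ?c l * (dot d (co u) x * dot d (co (Xv l)) x ^ 3)) / 6)" for x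
    unfolding L.S_def L.lin_def by (simp add: sum_distrib_left mult_ac)
  moreover have "- (?s3 / 6)
      = - (1 / 2) * ?s"
  proof -
    have "?s3
        = 3 * ?s"
      unfolding sum_distrib_left by (intro sum.cong refl) (simp add: dot_commute[of d "co u"])
    then show ?thesis by simp
  qed
  ultimately show ?thesis using 1 by simp
qed

lemma mean_bounds:
  "wnorm Hm (mean_shift d V m) \<le> LL * L.eps"
  "wnorm Hm (bm - m - mean_shift d V m) \<le> LL * (L.eps ^ 3 + L.tau)"
proof -
  have e0: "0 \<le> L.eps ^ 3 + L.tau" using L.eps_pos L.tau_pos by (simp add: add_nonneg_nonneg)
  have "wnorm Hm (mean_shift d V m) \<le> L.LS * L.eps"
  proof (rule wnorm_le_dual[OF mean_shift_carrier])
    fix u :: rvec assume u: "u \<in> carrier_vec d"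
    show "u \<bullet> mean_shift d V m \<le> sqrt (sqn d (co u)) * (L.LS * L.eps)"
      unfolding scalar_mean_shift[OF u] using L.post_dot(3)[of "co u"] by linarith
  qed (use L.LS_nonneg L.eps_pos in simp)
  also have "\<dots> \<le> LL * L.eps" using LL_ge L.eps_pos by (intro mult_right_mono) auto
  finally show "wnorm Hm (mean_shift d V m) \<le> LL * L.eps" .
  have "wnorm Hm (bm - m - mean_shift d V m) \<le> L.Lm * (L.tau + L.eps ^ 3)"
  proof (rule wnorm_le_dual)
    show c: "bm - m - mean_shift d V m \<in> carrier_vec d"
      using mean_carrier m_carrier mean_shift_carrier by auto
    fix u :: rvec assume u: "u \<in> carrier_vec d"
    have "u \<bullet> (bm - m - mean_shift d V m) = u \<bullet> (bm - m) - u \<bullet> mean_shift d V m"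
      using u mean_carrier m_carrier mean_shift_carrier by (intro scalar_prod_minus_distrib[of _ d]) auto
    then show "u \<bullet> (bm - m - mean_shift d V m) \<le> sqrt (sqn d (co u)) * (L.Lm * (L.tau + L.eps ^ 3))"
      unfolding scalar_mean_shift[OF u] scalar_mean[OF u] using L.post_dot(2)[of "co u"] by linarith
  qed (use Lm_nonneg L.eps_pos L.tau_pos in auto)
  also have "\<dots> \<le> LL * (L.eps ^ 3 + L.tau)"
    using LL_ge e0 by (simp add: add.commute mult_right_mono)
  finally show "wnorm Hm (bm - m - mean_shift d V m) \<le> LL * (L.eps ^ 3 + L.tau)" .
qed

lemma cov_carrier: "cov_mat d \<pi> \<in> carrier_mat d d" by (simp add: cov_mat_def)

lemma cov_sym: "transpose_mat (cov_mat d \<pi>) = cov_mat d \<pi>"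
  by (rule eq_matI) (auto simp: cov_mat_def mult.commute)

lemma cov_quadratic:
  assumes u: "u \<in> carrier_vec d"
  shows "u \<bullet> (cov_mat d \<pi> *\<^sub>v u) = L.post (\<lambda>x. (dot d (co u) x)\<^sup>2) - (L.post (dot d (co u)))\<^sup>2"
proof -
  let ?\<mu> = "L.post (dot d (co u))" and ?w = "co u"
  let ?f = "\<lambda>b i. b $ i - bm $ i"
  have "u \<bullet> (cov_mat d \<pi> *\<^sub>v u) = (\<Sum>i<d. \<Sum>j<d. u $ i * cov_mat d \<pi> $$ (i, j) * u $ j)"
    using u cov_carrier by (subst quadratic_form_bf[of _ d]) (auto simp: bf_def)
  also have "\<dots> = (\<Sum>i<d. \<Sum>j<d. \<integral>b. u $ i * u $ j * (?f b i * ?f b j) \<partial>\<pi>)"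
    by (intro sum.cong refl) (simp add: cov_mat_def mult_ac)
  also have "\<dots> = (\<Sum>i<d. \<integral>b. (\<Sum>j<d. u $ i * u $ j * (?f b i * ?f b j)) \<partial>\<pi>)"
    using integrable_index_shift_mult by (intro sum.cong refl Bochner_Integration.integral_sum[symmetric]) auto
  also have "\<dots> = (\<integral>b. (\<Sum>i<d. \<Sum>j<d. u $ i * u $ j * (?f b i * ?f b j)) \<partial>\<pi>)"
    using integrable_index_shift_mult by (intro Bochner_Integration.integral_sum[symmetric]) auto
  also have "\<dots> = L.post (\<lambda>x. \<Sum>i<d. \<Sum>j<d. u $ i * u $ j * (?f (e x) i * ?f (e x) j))"
    by (rule integral_gibbs) measurable
  also have "(\<lambda>x. \<Sum>i<d. \<Sum>j<d. u $ i * u $ j * (?f (e x) i * ?f (e x) j)) = (\<lambda>x. (dot d ?w x)\<^sup>2 + ((- 2 * ?\<mu>) * dot d ?w x + ?\<mu>\<^sup>2))"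
  proof
    fix x
    have "(\<Sum>i<d. u $ i * ?f (e x) i) = u \<bullet> ((e x - m) - (bm - m))"
      using u m_carrier mean_carrier e_carrier[of x] by (subst scalar_prod_eq_dot[of _ d]) (auto simp: dot_def simp del: e_carrier)
    also have "\<dots> = u \<bullet> (e x - m) - u \<bullet> (bm - m)"
      using u m_carrier mean_carrier e_carrier[of x] by (intro scalar_prod_minus_distrib[of _ d]) auto
    also have "\<dots> = dot d ?w x - ?\<mu>"
      using u m_carrier by (simp add: emb_minus scalar_prod_ax scalar_mean)
    finally have 1: "(\<Sum>i<d. u $ i * ?f (e x) i) = dot d ?w x - ?\<mu>" .
    have "(\<Sum>i<d. \<Sum>j<d. u $ i * u $ j * (?f (e x) i * ?f (e x) j)) = (\<Sum>i<d. u $ i * ?f (e x) i) * (\<Sum>j<d. u $ j * ?f (e x) j)"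
      by (simp add: sum_product mult_ac)
    also have "\<dots> = (dot d ?w x)\<^sup>2 + ((- 2 * ?\<mu>) * dot d ?w x + ?\<mu>\<^sup>2)"
      unfolding 1 by (simp add: power2_eq_square algebra_simps)
    finally show "(\<Sum>i<d. \<Sum>j<d. u $ i * u $ j * (?f (e x) i * ?f (e x) j)) = (dot d ?w x)\<^sup>2 + ((- 2 * ?\<mu>) * dot d ?w x + ?\<mu>\<^sup>2)" .
  qed
  also have "L.post \<dots> = L.post (\<lambda>x. (dot d ?w x)\<^sup>2) + ((- 2 * ?\<mu>) * ?\<mu> + ?\<mu>\<^sup>2)"
  proof -
    have i1: "integrable (gauss d) (\<lambda>x. (- 2 * ?\<mu>) * dot d ?w x * exp (L.r x))"
      unfolding mult.assoc[of "- 2 * ?\<mu>"] by (intro integrable_mult_right L.post_dot(1))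
    have i2: "integrable (gauss d) (\<lambda>x. ?\<mu>\<^sup>2 * exp (L.r x))"
      by (intro integrable_mult_right L.integrable_exp_r)
    have i3: "integrable (gauss d) (\<lambda>x. ((- 2 * ?\<mu>) * dot d ?w x + ?\<mu>\<^sup>2) * exp (L.r x))"
      unfolding distrib_right by (intro Bochner_Integration.integrable_add i1 i2)
    show ?thesis
      unfolding L.post_add[OF L.post_dot_sq(1) i3] L.post_add[OF i1 i2] L.post_cmult L.post_const ..
  qed
  finally show ?thesis by (simp add: power2_eq_square)
qed

lemma cov_bound:
  assumes u: "u \<in> carrier_vec d"
  shows "\<bar>u \<bullet> ((cov_mat d \<pi> - mat_inv Hm) *\<^sub>v u)\<bar> \<le> LL * (L.eps\<^sup>2 + L.tau) * (u \<bullet> (mat_inv Hm *\<^sub>v u))"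
proof -
  have "u \<bullet> ((cov_mat d \<pi> - mat_inv Hm) *\<^sub>v u) = u \<bullet> (cov_mat d \<pi> *\<^sub>v u) - u \<bullet> (mat_inv Hm *\<^sub>v u)"
    using u cov_carrier mat_inv_H_carrier
    by (simp add: minus_mult_distrib_mat_vec[of _ d d] scalar_prod_minus_distrib[of _ d])
  then have "\<bar>u \<bullet> ((cov_mat d \<pi> - mat_inv Hm) *\<^sub>v u)\<bar> \<le> sqn d (co u) * (L.Lc * (L.eps\<^sup>2 + L.tau))"
    using L.post_variance[of "co u"] u by (simp add: cov_quadratic sqn_co[symmetric])
  also have "\<dots> \<le> sqn d (co u) * (LL * (L.eps\<^sup>2 + L.tau))"
  proof (intro mult_left_mono mult_right_mono sqn_nonneg)
    have "(1 + 2 * L.Lm + L.Lm\<^sup>2) * (1 + L.LS\<^sup>2) \<le> (1 + L.Lm)\<^sup>2 * (1 + L.LS)\<^sup>2"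
      using L.LS_nonneg Lm_nonneg by (intro mult_mono) (auto simp: power2_eq_square algebra_simps)
    moreover have "0 \<le> (2 * L.Lm + L.Lm\<^sup>2) * L.LS\<^sup>2" using Lm_nonneg by simp
    ultimately have "1 + 2 * L.Lm + L.Lm\<^sup>2 + L.LS\<^sup>2 \<le> (1 + L.Lm)\<^sup>2 * (1 + L.LS)\<^sup>2" by (simp add: algebra_simps)
    then show "L.Lc \<le> LL"
      using L.LS_nonneg Lm_nonneg zero_le_power2[of "L.Lm"] zero_le_power2[of "L.LS"] unfolding L.Lc_def LL_def by argo
  qed (use L.tau_pos in simp)
  finally show ?thesis using u by (simp add: sqn_co mult_ac)
qed

end

section \<open>The matrix square root\<close>

lemma scalar_prod_self_nonneg: "0 \<le> (u :: rvec) \<bullet> u"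
  by (simp add: scalar_prod_def sum_nonneg)

lemma scalar_prod_self_eq_0: "u \<in> carrier_vec d \<Longrightarrow> u \<bullet> u = 0 \<Longrightarrow> u = (0\<^sub>v d :: rvec)"
proof -
  assume u: "u \<in> carrier_vec d" and 0: "u \<bullet> u = 0"
  then have "(\<Sum>i<d. (u $ i)\<^sup>2) = 0" by (simp add: scalar_prod_def lessThan_atLeast0 power2_eq_square)
  then have "u $ i = 0" if "i < d" for i using that by (simp add: sum_nonneg_eq_0_iff)
  then show ?thesis using u by (intro eq_vecI) auto
qed

lemma sym_scalar_prod:
  assumes N: "N \<in> carrier_mat d d" "transpose_mat N = N" and "y \<in> carrier_vec d" "z \<in> carrier_vec d"
  shows "z \<bullet> (N *\<^sub>v y) = (N *\<^sub>v z) \<bullet> (y :: rvec)"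
  using transpose_vec_mult_scalar[of N d d y z] assms by simp

text \<open>Polarization: subtract the values of the form at \<open>z + y\<close> and \<open>z - y\<close>.\<close>

lemma sym_mat_bilinear_le:
  fixes N :: rmat
  assumes N: "N \<in> carrier_mat d d" "transpose_mat N = N" and c: "0 \<le> c"
    and q: "\<And>y. y \<in> carrier_vec d \<Longrightarrow> \<bar>y \<bullet> (N *\<^sub>v y)\<bar> \<le> c * (y \<bullet> y)"
    and y: "y \<in> carrier_vec d" and z: "z \<in> carrier_vec d"
  shows "2 * (z \<bullet> (N *\<^sub>v y)) \<le> c * (z \<bullet> z + y \<bullet> y)"
proof -
  have Ny: "N *\<^sub>v y \<in> carrier_vec d" and Nz: "N *\<^sub>v z \<in> carrier_vec d" using N y z by auto
  have p: "(z + y) \<bullet> (N *\<^sub>v (z + y)) = z \<bullet> (N *\<^sub>v z) + y \<bullet> (N *\<^sub>v y) + 2 * (z \<bullet> (N *\<^sub>v y))"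
    using N y z Ny Nz sym_scalar_prod[OF N z y] comm_scalar_prod[of "N *\<^sub>v y" d z]
    by (simp add: mult_add_distrib_mat_vec[of _ d d] add_scalar_prod_distrib[of _ d] scalar_prod_add_distrib[of _ d])
  have m: "(z - y) \<bullet> (N *\<^sub>v (z - y)) = z \<bullet> (N *\<^sub>v z) + y \<bullet> (N *\<^sub>v y) - 2 * (z \<bullet> (N *\<^sub>v y))"
    using N y z Ny Nz sym_scalar_prod[OF N z y] comm_scalar_prod[of "N *\<^sub>v y" d z]
    by (simp add: mult_minus_distrib_mat_vec[of _ d d] minus_scalar_prod_distrib[of _ d] scalar_prod_minus_distrib[of _ d])
  have p1: "(z + y) \<bullet> (z + y) = z \<bullet> z + y \<bullet> y + 2 * (z \<bullet> y)"
    using y z comm_scalar_prod[of y d z]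
    by (simp add: add_scalar_prod_distrib[of _ d] scalar_prod_add_distrib[of _ d])
  have m1: "(z - y) \<bullet> (z - y) = z \<bullet> z + y \<bullet> y - 2 * (z \<bullet> y)"
    using y z comm_scalar_prod[of y d z]
    by (simp add: minus_scalar_prod_distrib[of _ d] scalar_prod_minus_distrib[of _ d])
  have "(z + y) \<bullet> (N *\<^sub>v (z + y)) - (z - y) \<bullet> (N *\<^sub>v (z - y)) \<le> c * ((z + y) \<bullet> (z + y)) + c * ((z - y) \<bullet> (z - y))"
    using q[of "z + y"] q[of "z - y"] y z by (simp add: abs_le_iff)
  then show ?thesis unfolding p m p1 m1 by (simp add: algebra_simps)
qed

text \<open>The bilinear bound is optimal for vectors of equal length, so it is applied to
  \<open>N y\<close> scaled by the length of \<open>y\<close> and to \<open>y\<close> scaled by the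
  length of \<open>N y\<close>.\<close>

lemma sym_mat_norm_le:
  fixes N :: rmat
  assumes N: "N \<in> carrier_mat d d" "transpose_mat N = N" and c: "0 \<le> c"
    and q: "\<And>y. y \<in> carrier_vec d \<Longrightarrow> \<bar>y \<bullet> (N *\<^sub>v y)\<bar> \<le> c * (y \<bullet> y)"
    and y: "y \<in> carrier_vec d"
  shows "enorm (N *\<^sub>v y) \<le> c * enorm y"
proof -
  let ?z = "N *\<^sub>v y"
  have z: "?z \<in> carrier_vec d" using N y by simp
  define a where "a = enorm y" define b where "b = enorm ?z"
  have ab: "0 \<le> a" "0 \<le> b" "a\<^sup>2 = y \<bullet> y" "b\<^sup>2 = ?z \<bullet> ?z"
    using scalar_prod_self_nonneg by (auto simp: a_def b_def enorm_def)
  have "2 * ((a \<cdot>\<^sub>v ?z) \<bullet> (N *\<^sub>v (b \<cdot>\<^sub>v y))) \<le> c * ((a \<cdot>\<^sub>v ?z) \<bullet> (a \<cdot>\<^sub>v ?z) + (b \<cdot>\<^sub>v y) \<bullet> (b \<cdot>\<^sub>v y))"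
    using y z by (intro sym_mat_bilinear_le[OF N c q]) auto
  moreover have "N *\<^sub>v (b \<cdot>\<^sub>v y) = b \<cdot>\<^sub>v ?z" using N y by (intro mult_mat_vec[of _ d d]) auto
  ultimately have "2 * (a * (b * b\<^sup>2)) \<le> c * (a * (a * b\<^sup>2) + b * (b * a\<^sup>2))"
    using y z ab by (simp add: mult.left_commute)
  then have "b ^ 3 * a \<le> (c * a) * (b\<^sup>2 * a)" by (simp add: power2_eq_square power3_eq_cube algebra_simps)
  then have 1: "b \<le> c * a" if "a \<noteq> 0" "b \<noteq> 0"
    using that ab by (simp add: power3_eq_cube power2_eq_square mult_ac)
  show ?thesis
  proof (cases "a = 0")
    case True
    then have "y = 0\<^sub>v d" using y ab by (intro scalar_prod_self_eq_0) auto
    then have "?z = 0\<^sub>v d" using N by (intro eq_vecI) auto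
    then show ?thesis using c scalar_prod_self_nonneg[of y] by (simp add: enorm_def)
  next
    case False
    then show ?thesis using 1 ab c by (cases "b = 0") (auto simp: a_def[symmetric] b_def[symmetric])
  qed
qed

text \<open>The coefficients of the power series of \<open>sqrt (1 - x)\<close>.\<close>

definition tco :: "nat \<Rightarrow> real" where "tco k = (- 1) ^ k * ((1 / 2) gchoose k)"

lemma tco_0: "tco 0 = 1" by (simp add: tco_def)

lemma tco_Suc: "tco (Suc k) = tco k * ((real k - 1 / 2) / (real k + 1))"
proof -
  have "real (Suc k) * ((1 / 2 :: real) gchoose Suc k) = (1 / 2 - real k) * ((1 / 2) gchoose k)"
    using gbinomial_mult_1[of "1 / 2 :: real" k] by (simp add: algebra_simps)
  then have G: "((1 / 2 :: real) gchoose Suc k) = - (real k - 1 / 2) * ((1 / 2) gchoose k) / (real k + 1)"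
    by (simp add: field_simps)
  show ?thesis unfolding tco_def G power_Suc by (simp add: algebra_simps add_divide_distrib diff_divide_distrib)
qed

text \<open>The sign is what makes the power series positive definite: replacing each power of the
  matrix by its largest possible value only decreases the sum.\<close>

lemma tco_neg: "tco (Suc k) \<le> 0"
proof (induction k)
  case (Suc k)
  show ?case unfolding tco_Suc[of "Suc k"] by (rule mult_nonpos_nonneg[OF Suc]) simp
qed (simp add: tco_0 tco_Suc)

lemma abs_tco_le: "\<bar>tco k\<bar> \<le> 1"
proof (induction k)
  case (Suc k)
  have "\<bar>(real k - 1 / 2) / (real k + 1)\<bar> \<le> 1" by (simp add: abs_le_iff field_simps)
  then have "\<bar>tco k\<bar> * \<bar>(real k - 1 / 2) / (real k + 1)\<bar> \<le> 1 * 1" using Suc by (intro mult_mono) auto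
  then show ?case by (simp add: tco_Suc abs_mult)
qed (simp add: tco_0)

text \<open>Coefficientwise form of squaring \<open>sqrt (1 - x)\<close>, by Vandermonde's identity
  for the binomial coefficients of \<open>1 / 2\<close>.\<close>

lemma tco_convolution: "(\<Sum>i\<le>k. tco i * tco (k - i)) = (if k = 0 then 1 else if k = 1 then - 1 else 0)"
proof -
  have "(\<Sum>i\<le>k. tco i * tco (k - i)) = (\<Sum>i\<le>k. (- 1) ^ k * (((1 / 2) gchoose i) * ((1 / 2) gchoose (k - i))))"
  proof (rule sum.cong)
    fix i assume "i \<in> {..k}"
    then have "(- 1 :: real) ^ i * (- 1) ^ (k - i) = (- 1) ^ k" by (simp add: power_add[symmetric])
    then show "tco i * tco (k - i) = (- 1) ^ k * (((1 / 2) gchoose i) * ((1 / 2) gchoose (k - i)))"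
      unfolding tco_def by (metis mult.assoc mult.left_commute)
  qed simp
  also have "\<dots> = (- 1) ^ k * (1 gchoose k)"
    unfolding sum_distrib_left[symmetric] using gbinomial_Vandermonde[of "1 / 2 :: real" "1 / 2" k]
    by (simp add: atMost_atLeast0)
  also have "(1 :: real) gchoose k = of_nat (1 choose k)" using binomial_gbinomial[of 1 k, where 'a = real] by simp
  finally show ?thesis by (cases k) (auto simp: binomial_eq_0)
qed

lemma tco_sums: "0 \<le> q \<Longrightarrow> q < 1 \<Longrightarrow> (\<lambda>k. tco k * q ^ k) sums sqrt (1 - q)"
proof -
  assume q: "0 \<le> q" "q < 1"
  have "(\<lambda>k. ((1 / 2) gchoose k) * (- q) ^ k) sums (1 + - q) powr (1 / 2)"
    using q by (intro gen_binomial_real) auto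
  moreover have "((1 / 2) gchoose k) * (- q) ^ k = tco k * q ^ k" for k
    by (simp add: tco_def power_minus[of q])
  ultimately show ?thesis using q by (simp add: powr_half_sqrt)
qed

text \<open>Powers of a \<open>d \<times> d\<close> kernel, entrywise, so that its power series are scalar series.\<close>

primrec kpow :: "nat \<Rightarrow> (nat \<Rightarrow> nat \<Rightarrow> real) \<Rightarrow> nat \<Rightarrow> nat \<Rightarrow> nat \<Rightarrow> real" where
  "kpow d B 0 = (\<lambda>i j. if i = j then 1 else 0)"
| "kpow d B (Suc k) = (\<lambda>i j. \<Sum>l<d. B i l * kpow d B k l j)"

lemma kpow_add: "i < d \<Longrightarrow> kpow d B (p + q) i j = (\<Sum>l<d. kpow d B p i l * kpow d B q l j)"
proof (induction p arbitrary: i)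
  case 0
  then show ?case by (simp add: if_distrib[of "\<lambda>x. x * _"] cong: if_cong)
next
  case (Suc p)
  have "kpow d B (Suc p + q) i j = (\<Sum>a<d. B i a * (\<Sum>l<d. kpow d B p a l * kpow d B q l j))"
    by (simp add: Suc.IH)
  also have "\<dots> = (\<Sum>l<d. \<Sum>a<d. B i a * kpow d B p a l * kpow d B q l j)"
    unfolding sum_distrib_left mult.assoc[symmetric] by (rule sum.swap)
  finally show ?case by (simp add: sum_distrib_right)
qed

lemma kpow_sym:
  assumes "\<And>i j. i < d \<Longrightarrow> j < d \<Longrightarrow> B i j = B j i" "i < d" "j < d"
  shows "kpow d B k i j = kpow d B k j i"
  using assms(2,3)
proof (induction k arbitrary: i j)
  case (Suc k)
  have "kpow d B (Suc k) j i = kpow d B (k + 1) j i" by simp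
  also have "\<dots> = (\<Sum>l<d. kpow d B k j l * kpow d B 1 l i)" using Suc.prems by (intro kpow_add)
  also have "\<dots> = (\<Sum>l<d. kpow d B k l j * B i l)"
  proof (intro sum.cong refl arg_cong2[where f = times])
    fix l assume "l \<in> {..<d}"
    then have l: "l < d" by simp
    show "kpow d B k j l = kpow d B k l j" using Suc.IH l Suc.prems by simp
    show "kpow d B 1 l i = B i l" using assms(1)[OF l Suc.prems(1)] Suc.prems
      by (simp add: if_distrib[of "\<lambda>x. _ * x"] cong: if_cong)
  qed
  finally show ?case by (simp add: mult.commute)
qed auto

definition kmat :: "nat \<Rightarrow> (nat \<Rightarrow> nat \<Rightarrow> real) \<Rightarrow> rmat" where
  "kmat d B = Matrix.mat d d (\<lambda>(i, j). B i j)"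

lemma kmat_carrier [simp]: "kmat d B \<in> carrier_mat d d" by (simp add: kmat_def)

lemma kmat_Suc: "kmat d (kpow d B (Suc k)) = kmat d B * kmat d (kpow d B k)"
  by (rule eq_matI) (auto simp: kmat_def scalar_prod_def lessThan_atLeast0)

lemma enorm_kpow_le:
  assumes q: "0 \<le> q" and B: "\<And>y. y \<in> carrier_vec d \<Longrightarrow> enorm (kmat d B *\<^sub>v y) \<le> q * enorm y" and y: "y \<in> carrier_vec d"
  shows "enorm (kmat d (kpow d B k) *\<^sub>v y) \<le> q ^ k * enorm y"
proof (induction k)
  case 0
  have "kmat d (kpow d B 0) = 1\<^sub>m d" by (rule eq_matI) (auto simp: kmat_def)
  then show ?case using y by simp
next
  case (Suc k)
  have c: "kmat d (kpow d B k) *\<^sub>v y \<in> carrier_vec d" using y by (intro mult_mat_vec_carrier[of _ d d]) auto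
  have "kmat d (kpow d B (Suc k)) *\<^sub>v y = kmat d B *\<^sub>v (kmat d (kpow d B k) *\<^sub>v y)"
    unfolding kmat_Suc using y by (intro assoc_mult_mat_vec[of _ d d _ d]) auto
  then have "enorm (kmat d (kpow d B (Suc k)) *\<^sub>v y) \<le> q * enorm (kmat d (kpow d B k) *\<^sub>v y)"
    using B[OF c] by simp
  also have "\<dots> \<le> q * (q ^ k * enorm y)" using q Suc by (intro mult_left_mono)
  finally show ?case by simp
qed

lemma scalar_prod_le_enorm: "u \<in> carrier_vec d \<Longrightarrow> v \<in> carrier_vec d \<Longrightarrow> \<bar>u \<bullet> v\<bar> \<le> enorm u * enorm (v :: rvec)"
proof -
  assume u: "u \<in> carrier_vec d" and v: "v \<in> carrier_vec d"
  have "(u \<bullet> v)\<^sup>2 \<le> (u \<bullet> u) * (v \<bullet> v)"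
    using dot_Cauchy_Schwarz[of d "\<lambda>i. u $ i" "\<lambda>i. v $ i"] u v by (simp add: scalar_prod_eq_dot[of _ d] dot_self)
  then have "\<bar>u \<bullet> v\<bar> \<le> sqrt ((u \<bullet> u) * (v \<bullet> v))" by (intro real_le_rsqrt) simp
  then show ?thesis by (simp add: enorm_def real_sqrt_mult)
qed

text \<open>\<open>R\<close> is the binomial series of \<open>sqrt (1 - x)\<close> at a symmetric
  matrix of norm at most \<open>q < 1\<close>, which converges entrywise like a geometric series.
  Its square follows from the Cauchy product, and its form is at least
  \<open>sqrt (1 - q) * (u \<bullet> u)\<close> by the signs of the coefficients.\<close>

lemma matrix_sqrt_series:
  fixes B :: "nat \<Rightarrow> nat \<Rightarrow> real"
  assumes sym: "\<And>i j. i < d \<Longrightarrow> j < d \<Longrightarrow> B i j = B j i" and q: "0 \<le> q" "q < 1"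
    and B: "\<And>y. y \<in> carrier_vec d \<Longrightarrow> enorm (kmat d B *\<^sub>v y) \<le> q * enorm y"
  shows "\<exists>R. pos_def d R \<and> R * R = 1\<^sub>m d - kmat d B"
proof -
  define E where "E k = kmat d (kpow d B k)" for k
  have E: "E k \<in> carrier_mat d d" for k by (simp add: E_def)
  have form_le: "\<bar>u \<bullet> (E k *\<^sub>v u)\<bar> \<le> q ^ k * (u \<bullet> u)" if u: "u \<in> carrier_vec d" for u k
  proof -
    have "\<bar>u \<bullet> (E k *\<^sub>v u)\<bar> \<le> enorm u * enorm (E k *\<^sub>v u)"
      using u E by (intro scalar_prod_le_enorm[of _ d]) (auto intro!: mult_mat_vec_carrier[of _ d d])
    also have "\<dots> \<le> enorm u * (q ^ k * enorm u)"
      unfolding E_def by (intro mult_left_mono enorm_kpow_le q(1) B u) (auto simp: enorm_def scalar_prod_self_nonneg)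
    also have "\<dots> = q ^ k * (u \<bullet> u)" using scalar_prod_self_nonneg[of u] by (simp add: enorm_def mult_ac)
    finally show ?thesis .
  qed
  have entry_le: "\<bar>kpow d B k i j\<bar> \<le> q ^ k" if i: "i < d" and j: "j < d" for k i j
  proof -
    have c: "E k *\<^sub>v unit_vec d j \<in> carrier_vec d" using E by (intro mult_mat_vec_carrier[of _ d d]) auto
    have n1: "enorm (unit_vec d l) = 1" if "l < d" for l using that by (simp add: enorm_def)
    have "kpow d B k i j = unit_vec d i \<bullet> (E k *\<^sub>v unit_vec d j)"
      using i j E c by (simp add: scalar_prod_left_unit[of _ d] E_def kmat_def scalar_prod_right_unit[of _ d])
    also have "\<bar>\<dots>\<bar> \<le> enorm (unit_vec d i) * enorm (E k *\<^sub>v unit_vec d j)"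
      using c by (intro scalar_prod_le_enorm[of _ d]) auto
    also have "\<dots> \<le> 1 * (q ^ k * 1)"
      unfolding E_def using enorm_kpow_le[OF q(1) B, of "unit_vec d j" k] i j n1 by (intro mult_mono) (auto simp: enorm_def scalar_prod_self_nonneg)
    finally show ?thesis by simp
  qed
  define a where "a i j k = tco k * kpow d B k i j" for i j k
  have a_le: "norm (a i j k) \<le> q ^ k" if "i < d" "j < d" for i j k
  proof -
    have "\<bar>tco k\<bar> * \<bar>kpow d B k i j\<bar> \<le> 1 * q ^ k" using abs_tco_le entry_le[OF that] by (intro mult_mono) auto
    then show ?thesis by (simp add: a_def abs_mult)
  qed
  have geo: "summable (\<lambda>k. q ^ k)" using q by (intro summable_geometric) auto
  have sn: "summable (\<lambda>k. norm (a i j k))" if "i < d" "j < d" for i j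
    using a_le[OF that] by (intro summable_comparison_test'[OF geo]) auto
  have sa: "summable (a i j)" if "i < d" "j < d" for i j
    using sn[OF that] by (rule summable_norm_cancel)
  define r where "r i j = (\<Sum>k. a i j k)" for i j
  define R where "R = kmat d r"
  have R: "R \<in> carrier_mat d d" by (simp add: R_def)
  have "transpose_mat R = R"
  proof (rule eq_matI)
    fix i j assume ij: "i < dim_row R" "j < dim_col R"
    then have "a i j = a j i" using kpow_sym[of d B i j] sym R by (auto simp: a_def fun_eq_iff)
    then show "transpose_mat R $$ (i, j) = R $$ (i, j)" using ij by (simp add: R_def kmat_def r_def)
  qed (use R in auto)
  moreover have "0 < u \<bullet> (R *\<^sub>v u)" if u: "u \<in> carrier_vec d" "u \<noteq> 0\<^sub>v d" for u
  proof -
    have u0: "0 < u \<bullet> u" using u scalar_prod_self_eq_0[OF u(1)] scalar_prod_self_nonneg[of u] by fastforce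
    have "(\<lambda>k. \<Sum>i<d. \<Sum>j<d. u $ i * a i j k * u $ j) sums (\<Sum>i<d. \<Sum>j<d. u $ i * r i j * u $ j)"
      unfolding r_def by (intro sums_sum sums_mult2 sums_mult summable_sums sa) auto
    also have "(\<Sum>i<d. \<Sum>j<d. u $ i * r i j * u $ j) = u \<bullet> (R *\<^sub>v u)"
      using u R by (subst quadratic_form_bf[of _ d]) (auto simp: bf_def R_def kmat_def)
    also have "(\<lambda>k. \<Sum>i<d. \<Sum>j<d. u $ i * a i j k * u $ j) = (\<lambda>k. tco k * (u \<bullet> (E k *\<^sub>v u)))"
    proof
      fix k
      have "u \<bullet> (E k *\<^sub>v u) = (\<Sum>i<d. \<Sum>j<d. u $ i * kpow d B k i j * u $ j)"
        using u E by (subst quadratic_form_bf[of _ d]) (auto simp: bf_def E_def kmat_def)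
      then show "(\<Sum>i<d. \<Sum>j<d. u $ i * a i j k * u $ j) = tco k * (u \<bullet> (E k *\<^sub>v u))"
        by (simp add: a_def sum_distrib_left mult_ac)
    qed
    finally have s1: "(\<lambda>k. tco k * (u \<bullet> (E k *\<^sub>v u))) sums (u \<bullet> (R *\<^sub>v u))" .
    have s2: "(\<lambda>k. tco k * q ^ k * (u \<bullet> u)) sums (sqrt (1 - q) * (u \<bullet> u))"
      by (intro sums_mult2 tco_sums q)
    have "tco k * q ^ k * (u \<bullet> u) \<le> tco k * (u \<bullet> (E k *\<^sub>v u))" for k
    proof (cases k)
      case 0
      have "E 0 = 1\<^sub>m d" unfolding E_def by (rule eq_matI) (auto simp: kmat_def)
      then show ?thesis using 0 u by simp
    next
      case (Suc k')
      have "u \<bullet> (E k *\<^sub>v u) \<le> q ^ k * (u \<bullet> u)" using form_le[OF u(1), of k] by (simp add: abs_le_iff)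
      then have "tco k * (q ^ k * (u \<bullet> u)) \<le> tco k * (u \<bullet> (E k *\<^sub>v u))"
        using tco_neg[of k'] Suc by (intro mult_left_mono_neg) auto
      then show ?thesis by (simp add: mult.assoc)
    qed
    then have "sqrt (1 - q) * (u \<bullet> u) \<le> u \<bullet> (R *\<^sub>v u)" by (rule sums_le[OF _ s2 s1])
    moreover have "0 < sqrt (1 - q) * (u \<bullet> u)" using q u0 by simp
    ultimately show ?thesis by linarith
  qed
  moreover have "R * R = 1\<^sub>m d - kmat d B"
  proof (rule eq_matI)
    fix i j assume "i < dim_row (1\<^sub>m d - kmat d B)" "j < dim_col (1\<^sub>m d - kmat d B)"
    then have ij: "i < d" "j < d" by (auto simp: kmat_def)
    have "(\<lambda>k. \<Sum>l<d. \<Sum>p\<le>k. a i l p * a l j (k - p)) sums (\<Sum>l<d. r i l * r l j)"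
      unfolding r_def using ij by (intro sums_sum Cauchy_product_sums sn) auto
    also have "(\<lambda>k. \<Sum>l<d. \<Sum>p\<le>k. a i l p * a l j (k - p)) = (\<lambda>k. (if k = 0 then 1 else if k = 1 then - 1 else 0) * kpow d B k i j)"
    proof
      fix k
      have "(\<Sum>l<d. \<Sum>p\<le>k. a i l p * a l j (k - p)) = (\<Sum>p\<le>k. tco p * tco (k - p) * (\<Sum>l<d. kpow d B p i l * kpow d B (k - p) l j))"
        unfolding a_def sum_distrib_left by (subst sum.swap) (simp add: mult_ac)
      also have "\<dots> = (\<Sum>p\<le>k. tco p * tco (k - p) * kpow d B k i j)"
        using ij by (intro sum.cong refl) (simp add: kpow_add[symmetric])
      finally show "(\<Sum>l<d. \<Sum>p\<le>k. a i l p * a l j (k - p)) = (if k = 0 then 1 else if k = 1 then - 1 else 0) * kpow d B k i j"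
        by (simp only: sum_distrib_right[symmetric] tco_convolution)
    qed
    finally have 1: "(\<lambda>k. (if k = 0 then 1 else if k = 1 then - 1 else 0) * kpow d B k i j) sums (\<Sum>l<d. r i l * r l j)" .
    have "(\<lambda>k. (if k = 0 then 1 else if k = 1 then - 1 else 0) * kpow d B k i j) sums (\<Sum>k\<in>{0, 1}. (if k = 0 then 1 else if k = 1 then - 1 else 0) * kpow d B k i j)"
      by (rule sums_finite) auto
    then have "(\<Sum>l<d. r i l * r l j) = kpow d B 0 i j - kpow d B 1 i j"
      using sums_unique2[OF 1] by simp
    also have "kpow d B 1 i j = B i j" using ij by (simp add: if_distrib[of "\<lambda>x. _ * x"] cong: if_cong)
    finally show "(R * R) $$ (i, j) = (1\<^sub>m d - kmat d B) $$ (i, j)"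
      using ij by (simp add: R_def kmat_def scalar_prod_def lessThan_atLeast0)
  qed (auto simp: R_def kmat_def)
  ultimately show ?thesis using R by (auto simp: pos_def_def)
qed

lemma smult_mat_mult_vec:
  "N \<in> carrier_mat d d \<Longrightarrow> u \<in> carrier_vec d \<Longrightarrow> (c \<cdot>\<^sub>m N) *\<^sub>v u = c \<cdot>\<^sub>v (N *\<^sub>v u)" for c :: real
  by (rule eq_vecI) auto

text \<open>Scaling brings the matrix into the range of the series: with \<open>\<mu>\<close> and
  \<open>\<Lambda>\<close> lower and upper bounds for the quadratic form of \<open>H\<close>, the
  matrix \<open>1 - H / \<Lambda>\<close> has norm at most \<open>1 - \<mu> / \<Lambda>\<close>. No
  eigenvalues are needed: the entries of \<open>H\<close> give \<open>\<Lambda>\<close>, the squared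
  entries of a whitening matrix give \<open>\<mu>\<close>.\<close>

lemma pos_def_sqrt_exists:
  assumes H: "pos_def d H"
  shows "\<exists>R. pos_def d R \<and> R * R = H"
proof -
  obtain A where "whitening d H A" using pos_def_imp_whitening[OF H] by blast
  then interpret W: whitening d H A .
  define \<Lambda> where "\<Lambda> = 1 + (\<Sum>i<d. \<Sum>j<d. \<bar>H $$ (i, j)\<bar>)"
  define \<mu> where "\<mu> = 1 / (1 + (\<Sum>i<d. \<Sum>j<d. (A $$ (i, j))\<^sup>2))"
  have l0: "0 < \<Lambda>" "0 < \<mu>" by (auto simp: \<Lambda>_def \<mu>_def intro!: add_pos_nonneg sum_nonneg)
  have up: "u \<bullet> (H *\<^sub>v u) \<le> \<Lambda> * (u \<bullet> u)" if u: "u \<in> carrier_vec d" for u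
  proof -
    have uu: "u \<bullet> u = (\<Sum>i<d. (u $ i)\<^sup>2)" using u by (simp add: scalar_prod_def lessThan_atLeast0 power2_eq_square)
    have "u $ i * H $$ (i, j) * u $ j \<le> \<bar>H $$ (i, j)\<bar> * (u \<bullet> u)" if "i < d" "j < d" for i j
    proof -
      have le: "(u $ l)\<^sup>2 \<le> u \<bullet> u" if "l < d" for l unfolding uu using that by (intro member_le_sum) auto
      have "2 * \<bar>u $ i * u $ j\<bar> \<le> (u $ i)\<^sup>2 + (u $ j)\<^sup>2"
        using zero_le_power2[of "\<bar>u $ i\<bar> - \<bar>u $ j\<bar>"] by (simp add: power2_diff abs_mult)
      then have "\<bar>u $ i * u $ j\<bar> \<le> u \<bullet> u" using le[OF that(1)] le[OF that(2)] by linarith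
      then have "\<bar>H $$ (i, j)\<bar> * \<bar>u $ i * u $ j\<bar> \<le> \<bar>H $$ (i, j)\<bar> * (u \<bullet> u)" by (intro mult_left_mono) auto
      moreover have "u $ i * H $$ (i, j) * u $ j \<le> \<bar>H $$ (i, j)\<bar> * \<bar>u $ i * u $ j\<bar>"
        using abs_ge_self[of "u $ i * H $$ (i, j) * u $ j"] by (simp add: abs_mult mult_ac)
      ultimately show ?thesis by linarith
    qed
    then have "u \<bullet> (H *\<^sub>v u) \<le> (\<Sum>i<d. \<Sum>j<d. \<bar>H $$ (i, j)\<bar> * (u \<bullet> u))"
      unfolding quadratic_form_bf[OF W.H(1) u u] bf_def by (intro sum_mono) auto
    also have "\<dots> \<le> \<Lambda> * (u \<bullet> u)"
      using scalar_prod_self_nonneg[of u] by (simp add: \<Lambda>_def sum_distrib_right[symmetric] mult_right_mono)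
    finally show ?thesis .
  qed
  have low: "\<mu> * (u \<bullet> u) \<le> u \<bullet> (H *\<^sub>v u)" if u: "u \<in> carrier_vec d" for u
  proof -
    obtain x where x: "W.ax x = u" using W.ax_surj[OF u] by blast
    let ?s = "\<Sum>i<d. \<Sum>j<d. (A $$ (i, j))\<^sup>2"
    have s0: "0 \<le> ?s" by (intro sum_nonneg) auto
    have "u \<bullet> u = (\<Sum>i<d. (W.ax x $ i)\<^sup>2)"
      using u by (simp add: x scalar_prod_def lessThan_atLeast0 power2_eq_square)
    also have "\<dots> \<le> (\<Sum>i<d. (\<Sum>j<d. (A $$ (i, j))\<^sup>2) * sqn d x)"
      by (intro sum_mono) (simp add: W.ax_index sqn_def Cauchy_Schwarz_ineq_sum)
    also have "\<dots> \<le> (1 + ?s) * sqn d x"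
      using sqn_nonneg[of d x] by (simp add: sum_distrib_right[symmetric] distrib_right)
    also have "sqn d x = u \<bullet> (H *\<^sub>v u)" by (simp add: x[symmetric] W.quadratic_ax dot_self)
    finally show ?thesis using s0 by (simp add: \<mu>_def divide_le_eq mult.commute add_pos_nonneg)
  qed
  define q where "q = max 0 (1 - \<mu> / \<Lambda>)"
  have q: "0 \<le> q" "q < 1" using l0 by (auto simp: q_def)
  define B where "B i j = (if i = j then 1 else 0) - H $$ (i, j) / \<Lambda>" for i j
  have KB: "kmat d B = 1\<^sub>m d - (1 / \<Lambda>) \<cdot>\<^sub>m H"
    using W.H by (intro eq_matI) (auto simp: kmat_def B_def)
  have symB: "B i j = B j i" if "i < d" "j < d" for i j
    using sym_matD[OF W.H(2,1) that] by (simp add: B_def)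
  have Bc: "kmat d B \<in> carrier_mat d d" "transpose_mat (kmat d B) = kmat d B"
    using symB by (auto simp: kmat_def intro!: eq_matI)
  have nB: "enorm (kmat d B *\<^sub>v y) \<le> q * enorm y" if y: "y \<in> carrier_vec d" for y
  proof (rule sym_mat_norm_le[OF Bc q(1) _ y])
    fix u :: rvec assume u: "u \<in> carrier_vec d"
    have "kmat d B *\<^sub>v u = u - (1 / \<Lambda>) \<cdot>\<^sub>v (H *\<^sub>v u)"
      using W.H u by (simp add: KB minus_mult_distrib_mat_vec[of _ d d] smult_mat_mult_vec[of _ d])
    then have e: "u \<bullet> (kmat d B *\<^sub>v u) = u \<bullet> u - u \<bullet> (H *\<^sub>v u) / \<Lambda>"
      using W.H u by (simp add: scalar_prod_minus_distrib[of _ d])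
    have "u \<bullet> (H *\<^sub>v u) / \<Lambda> \<le> u \<bullet> u" using up[OF u] l0 by (simp add: divide_le_eq mult.commute)
    then have "0 \<le> u \<bullet> (kmat d B *\<^sub>v u)" unfolding e by simp
    moreover have "\<mu> * (u \<bullet> u) / \<Lambda> \<le> u \<bullet> (H *\<^sub>v u) / \<Lambda>" using low[OF u] l0 by (intro divide_right_mono) auto
    then have "u \<bullet> (kmat d B *\<^sub>v u) \<le> (1 - \<mu> / \<Lambda>) * (u \<bullet> u)" unfolding e by (simp add: algebra_simps)
    moreover have "(1 - \<mu> / \<Lambda>) * (u \<bullet> u) \<le> q * (u \<bullet> u)"
      using scalar_prod_self_nonneg[of u] by (intro mult_right_mono) (auto simp: q_def)
    ultimately show "\<bar>u \<bullet> (kmat d B *\<^sub>v u)\<bar> \<le> q * (u \<bullet> u)" by linarith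
  qed
  have "\<exists>R. pos_def d R \<and> R * R = 1\<^sub>m d - kmat d B"
    by (rule matrix_sqrt_series[OF _ q]) (rule symB nB, assumption+)+
  then obtain R0 where R0: "pos_def d R0" "R0 * R0 = 1\<^sub>m d - kmat d B" by blast
  have R0c: "R0 \<in> carrier_mat d d" using R0 by (simp add: pos_def_def)
  let ?R = "sqrt \<Lambda> \<cdot>\<^sub>m R0"
  have "?R * ?R = \<Lambda> \<cdot>\<^sub>m (R0 * R0)"
  proof (rule eq_matI)
    fix i j assume "i < dim_row (\<Lambda> \<cdot>\<^sub>m (R0 * R0))" "j < dim_col (\<Lambda> \<cdot>\<^sub>m (R0 * R0))"
    then have ij: "i < d" "j < d" using R0c by auto
    have "sqrt \<Lambda> * (sqrt \<Lambda> * x) = \<Lambda> * x" for x using l0 by (simp add: mult.assoc[symmetric])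
    then show "(?R * ?R) $$ (i, j) = (\<Lambda> \<cdot>\<^sub>m (R0 * R0)) $$ (i, j)"
      using ij R0c by (simp add: mult_smult_assoc_mat[of _ d d _ d] mult_smult_distrib[of _ d d _ d] del: index_mult_mat(1))
  qed (use R0c in auto)
  also have "\<dots> = H"
    unfolding R0(2) KB using W.H l0 by (intro eq_matI) auto
  finally have "?R * ?R = H" .
  moreover have "pos_def d ?R"
    unfolding pos_def_def
  proof (intro conjI ballI impI)
    show "transpose_mat ?R = ?R"
      using R0 R0c sym_matD[of R0 d] by (intro eq_matI) (auto simp: pos_def_def)
    fix u :: rvec assume u: "u \<in> carrier_vec d" "u \<noteq> 0\<^sub>v d"
    then have "0 < u \<bullet> (R0 *\<^sub>v u)" using R0 by (simp add: pos_def_def)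
    then show "0 < u \<bullet> (?R *\<^sub>v u)" using u R0c l0 by (simp add: smult_mat_mult_vec[of _ d])
  qed (use R0c in simp)
  ultimately show ?thesis by blast
qed

text \<open>
  With \<open>D = R - S\<close> the identity \<open>R\<^sup>2 = S\<^sup>2\<close> gives \<open>R D = - D S\<close>, hence
  \<open>tr (D R D) = - tr (D D S) = - tr (D S D) \<le> 0\<close>.
\<close>

lemma pos_def_sqrt_unique:
  assumes R: "pos_def d R" and S: "pos_semidef d S" and eq: "R * R = S * S"
  shows "S = R"
proof -
  have Rc: "R \<in> carrier_mat d d" and Sc: "S \<in> carrier_mat d d" using R S by (auto simp: pos_def_def pos_semidef_def)
  define D where "D = R - S"
  have Dc: "D \<in> carrier_mat d d" using Rc Sc by (auto simp: D_def)
  have Dsym: "transpose_mat D = D"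
    using R S Rc Sc by (simp add: D_def transpose_minus[of _ d d] pos_def_def pos_semidef_def)
  have RD: "R * D + D * S = 0\<^sub>m d d"
  proof -
    have "R * D + D * S = (R * R - R * S) + (R * S - S * S)"
      using Rc Sc by (simp add: D_def mult_minus_distrib_mat[of _ d d _ d] minus_mult_distrib_mat[of _ d d _ _ d])
    then show ?thesis using Rc Sc eq by (auto intro!: eq_matI)
  qed
  have tr: "(\<Sum>i<d. (\<Sum>k<d. D $$ (i, k) * (R * D) $$ (k, i))) = - (\<Sum>i<d. (\<Sum>k<d. D $$ (i, k) * (D * S) $$ (k, i)))"
  proof -
    have "(R * D) $$ (k, i) = - (D * S) $$ (k, i)" if "k < d" "i < d" for k i
    proof -
      have "(R * D + D * S) $$ (k, i) = 0" unfolding RD using that by simp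
      then show ?thesis using that Rc Dc Sc by (simp add: index_add_mat)
    qed
    then show ?thesis by (simp add: sum_negf)
  qed
  have form: "(\<Sum>k<d. D $$ (i, k) * (N * D) $$ (k, i)) = col D i \<bullet> (N *\<^sub>v col D i)" if i: "i < d" and N: "N \<in> carrier_mat d d" for i N
  proof -
    have "(N * D) $$ (k, i) = (N *\<^sub>v col D i) $ k" if "k < d" for k using that i N Dc by simp
    moreover have "D $$ (i, k) = col D i $ k" if "k < d" for k
      using that i Dc sym_matD[OF Dsym Dc i that] by simp
    ultimately show ?thesis
      using i N Dc by (subst scalar_prod_eq_dot[of _ d]) (auto simp: dot_def simp del: index_mult_mat_vec index_mult_mat)
  qed
  have cyc: "(\<Sum>i<d. (\<Sum>k<d. D $$ (i, k) * (D * S) $$ (k, i))) = (\<Sum>i<d. (\<Sum>k<d. D $$ (i, k) * (S * D) $$ (k, i)))"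
  proof -
    have "(\<Sum>i<d. (\<Sum>k<d. D $$ (i, k) * (D * S) $$ (k, i))) = (\<Sum>i<d. \<Sum>k<d. \<Sum>l<d. D $$ (i, k) * (D $$ (k, l) * S $$ (l, i)))"
      using Dc Sc by (simp add: mult_mat_index[of _ d] sum_distrib_left del: index_mult_mat)
    also have "\<dots> = (\<Sum>k<d. \<Sum>l<d. \<Sum>i<d. D $$ (i, k) * (D $$ (k, l) * S $$ (l, i)))"
      by (subst sum.swap) (intro sum.cong refl sum.swap)
    also have "\<dots> = (\<Sum>i<d. (\<Sum>k<d. D $$ (i, k) * (S * D) $$ (k, i)))"
      using Dc Sc by (simp add: mult_mat_index[of _ d] sum_distrib_left mult_ac del: index_mult_mat)
    finally show ?thesis .
  qed
  have Rn: "0 \<le> col D i \<bullet> (R *\<^sub>v col D i)" and Sn: "0 \<le> col D i \<bullet> (S *\<^sub>v col D i)" if "i < d" for i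
  proof -
    have c: "col D i \<in> carrier_vec d" using Dc that by simp
    show "0 \<le> col D i \<bullet> (S *\<^sub>v col D i)" using S c by (simp add: pos_semidef_def)
    have "0\<^sub>v d \<bullet> (R *\<^sub>v 0\<^sub>v d) = 0" using Rc by simp
    then show "0 \<le> col D i \<bullet> (R *\<^sub>v col D i)"
      using R c by (cases "col D i = 0\<^sub>v d") (auto simp: pos_def_def intro: less_imp_le)
  qed
  have "(\<Sum>i<d. col D i \<bullet> (R *\<^sub>v col D i)) = - (\<Sum>i<d. col D i \<bullet> (S *\<^sub>v col D i))"
    using tr unfolding cyc using Rc Sc by (simp add: form)
  moreover have "0 \<le> (\<Sum>i<d. col D i \<bullet> (S *\<^sub>v col D i))" "0 \<le> (\<Sum>i<d. col D i \<bullet> (R *\<^sub>v col D i))"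
    using Rn Sn by (auto intro!: sum_nonneg)
  ultimately have "(\<Sum>i<d. col D i \<bullet> (R *\<^sub>v col D i)) = 0" by linarith
  then have z: "col D i \<bullet> (R *\<^sub>v col D i) = 0" if "i < d" for i
    using that Rn by (subst (asm) sum_nonneg_eq_0_iff) auto
  have "col D i = 0\<^sub>v d" if i: "i < d" for i
    using z[OF i] R Dc i by (auto simp: pos_def_def dest!: bspec[of _ _ "col D i"])
  then have "D $$ (k, i) = 0" if "k < d" "i < d" for k i
    using that Dc by (metis carrier_matD index_col index_zero_vec(1))
  then show ?thesis
    using Rc Sc Dc unfolding D_def by (intro eq_matI) auto
qed

text \<open>The definite description ranges over positive semidefinite roots, so the positive
  definite root constructed above has to be unique among semidefinite competitors.\<close>

lemma mat_sqrt_pos_def: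
  assumes "pos_def d H"
  shows "pos_def d (mat_sqrt d H)" "mat_sqrt d H * mat_sqrt d H = H"
proof -
  obtain R where R: "pos_def d R" "R * R = H" using pos_def_sqrt_exists[OF assms] by blast
  have psd: "pos_semidef d R"
    unfolding pos_semidef_def
  proof (intro conjI ballI)
    fix u :: rvec assume "u \<in> carrier_vec d"
    then show "0 \<le> u \<bullet> (R *\<^sub>v u)"
      using R by (cases "u = 0\<^sub>v d") (auto simp: pos_def_def intro: less_imp_le)
  qed (use R in \<open>auto simp: pos_def_def\<close>)
  have "mat_sqrt d H = R"
    unfolding mat_sqrt_def
  proof (rule the_equality)
    show "S = R" if "pos_semidef d S \<and> S * S = H" for S
      using that R(2) by (intro pos_def_sqrt_unique[OF R(1)]) simp_all
  qed (use R(2) psd in simp)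
  then show "pos_def d (mat_sqrt d H)" "mat_sqrt d H * mat_sqrt d H = H" using R by auto
qed

text \<open>With \<open>R\<close> the square root of \<open>H\<close>, the substitution
  \<open>u = R y\<close> turns the form of \<open>mat_inv H\<close> into the Euclidean one, because
  \<open>R * mat_inv H * R = 1\<close>; the norm of a symmetric matrix is then controlled by its
  quadratic form.\<close>

lemma op_norm_whitened_le:
  assumes d: "1 \<le> d" and H: "pos_def d H" and F: "F \<in> carrier_mat d d" "transpose_mat F = F" and c: "0 \<le> c"
    and le: "\<And>u. u \<in> carrier_vec d \<Longrightarrow> \<bar>u \<bullet> (F *\<^sub>v u)\<bar> \<le> c * (u \<bullet> (mat_inv H *\<^sub>v u))"
  shows "op_norm d (mat_sqrt d H * F * mat_sqrt d H) \<le> c"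
proof -
  obtain A where "whitening d H A" using pos_def_imp_whitening[OF H] by blast
  then interpret W: whitening d H A .
  define R where "R = mat_sqrt d H"
  have R: "R \<in> carrier_mat d d" "transpose_mat R = R" "R * R = H"
    using mat_sqrt_pos_def[OF H] by (auto simp: R_def pos_def_def)
  note K = W.mat_inv_H_carrier
  have "R * (R * mat_inv H) = 1\<^sub>m d" using R K W.H_mat_inv by (simp add: assoc_mult_mat[symmetric, of _ d d _ d _ d])
  then have RKR: "(R * mat_inv H) * R = 1\<^sub>m d"
    using R K by (intro mat_mult_left_right_inverse[of R d]) auto
  let ?N = "R * F * R"
  have N: "?N \<in> carrier_mat d d" using R F by auto
  have Nsym: "transpose_mat ?N = ?N"
    using R F by (simp add: transpose_mult[of _ d d _ d] assoc_mult_mat[of _ d d _ d _ d])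
  have conj: "y \<bullet> ((R * G * R) *\<^sub>v y) = (R *\<^sub>v y) \<bullet> (G *\<^sub>v (R *\<^sub>v y))" if G: "G \<in> carrier_mat d d" and y: "y \<in> carrier_vec d" for G and y :: rvec
  proof -
    have Ry: "R *\<^sub>v y \<in> carrier_vec d" using R y by simp
    have "(R * G * R) *\<^sub>v y = R *\<^sub>v (G *\<^sub>v (R *\<^sub>v y))"
      using R G y Ry by (simp add: assoc_mult_mat_vec[of _ d d _ d] assoc_mult_mat[of _ d d _ d _ d])
    then show ?thesis using sym_scalar_prod[OF R(1,2) _ y, of "G *\<^sub>v (R *\<^sub>v y)"] G Ry by simp
  qed
  have bound: "enorm (?N *\<^sub>v y) \<le> c * enorm y" if y: "y \<in> carrier_vec d" for y
  proof (rule sym_mat_norm_le[OF N Nsym c _ y])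
    fix y :: rvec assume y: "y \<in> carrier_vec d"
    have Ry: "R *\<^sub>v y \<in> carrier_vec d" using R y by simp
    have "\<bar>y \<bullet> (?N *\<^sub>v y)\<bar> \<le> c * ((R *\<^sub>v y) \<bullet> (mat_inv H *\<^sub>v (R *\<^sub>v y)))"
      unfolding conj[OF F(1) y] by (rule le[OF Ry])
    also have "(R *\<^sub>v y) \<bullet> (mat_inv H *\<^sub>v (R *\<^sub>v y)) = y \<bullet> y"
      unfolding conj[OF K y, symmetric] RKR using y by simp
    finally show "\<bar>y \<bullet> (?N *\<^sub>v y)\<bar> \<le> c * (y \<bullet> y)" .
  qed
  have "enorm (unit_vec d 0) = 1" "unit_vec d 0 \<in> carrier_vec d" using d by (auto simp: enorm_def)
  then have ne: "{u \<in> carrier_vec d. enorm u = 1} \<noteq> {}" by blast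
  show ?thesis
    unfolding op_norm_def R_def[symmetric] using bound by (intro cSUP_least[OF ne]) fastforce
qed

section \<open>Assembly of the bounds and of the absolute constants\<close>

context coord_data
begin

text \<open>The \<tau> of the statement has a factor \<open>d \<ge> 1\<close> by which it dominates
  \<open>L.tau\<close>; its exponent is \<open>rho2 / 16\<close>.\<close>

lemma posterior_bounds:
  assumes \<epsilon>: "\<epsilon> = real d / sqrt (real n)"
    and \<Lambda>: "LL \<le> \<Lambda>"
    and \<tau>: "\<tau> = real d * exp (- (1 / 16) * real n powr (1 / 4) * sqrt (real d))"
  shows "pos_def d Hm \<and> prob_space \<pi> \<and>
    (\<forall>g a. standardized d V m g a \<longrightarrow>
       integrable \<pi> g \<and>
       \<bar>(\<integral>b. g b \<partial>\<pi>) - (\<integral>b. g b \<partial>\<gamma>)\<bar> \<le> \<Lambda> * (max a 1 * \<tau> + \<epsilon>) \<and>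
       (even_about d m g \<longrightarrow> \<bar>(\<integral>b. g b \<partial>\<pi>) - (\<integral>b. g b \<partial>\<gamma>)\<bar> \<le> \<Lambda> * (max a 1 * \<tau> + \<epsilon>\<^sup>2)) \<and>
       \<bar>(\<integral>b. g b \<partial>\<pi>) - skew_laplace_integral d V m g\<bar> \<le> \<Lambda> * (max a 1 * \<tau> + \<epsilon>\<^sup>2) \<and>
       (odd_about d m g \<longrightarrow> \<bar>(\<integral>b. g b \<partial>\<pi>) - skew_laplace_integral d V m g\<bar> \<le> \<Lambda> * (max a 1 * \<tau> + \<epsilon> ^ 3))) \<and>
    \<bar>tv_leading d V m\<bar> \<le> \<Lambda> * \<epsilon> \<and>
    \<bar>tv d (measure \<pi>) (measure \<gamma>) - tv_leading d V m\<bar> \<le> tv d (measure \<pi>) (skew_laplace d V m) \<and>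
    tv d (measure \<pi>) (skew_laplace d V m) \<le> \<Lambda> * (\<epsilon>\<^sup>2 + \<tau>) \<and>
    (\<forall>i<d. integrable \<pi> (\<lambda>b. b $ i)) \<and>
    wnorm Hm (mean_shift d V m) \<le> \<Lambda> * \<epsilon> \<and>
    wnorm Hm (bm - m - mean_shift d V m) \<le> \<Lambda> * (\<epsilon> ^ 3 + \<tau>) \<and>
    (\<forall>i<d. \<forall>j<d. integrable \<pi> (\<lambda>b. b $ i * b $ j)) \<and>
    op_norm d (mat_sqrt d Hm * (cov_mat d \<pi> - mat_inv Hm) * mat_sqrt d Hm) \<le> \<Lambda> * (\<epsilon>\<^sup>2 + \<tau>)"
proof -
  have e: "L.eps = \<epsilon>" by (simp add: \<epsilon> L.eps_def)
  have t: "L.tau \<le> \<tau>"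
  proof -
    have "1 * L.tau \<le> real d * L.tau" using d1 L.tau_pos by (intro mult_right_mono) auto
    then show ?thesis by (simp add: \<tau> L.tau_def L.rho2_def mult.assoc)
  qed
  have \<epsilon>0: "0 \<le> \<epsilon>" using L.eps_pos e by simp
  have \<tau>0: "0 \<le> \<tau>" using t L.tau_pos by linarith
  have gen: "z \<le> LL * (x * L.tau + y) \<Longrightarrow> z \<le> \<Lambda> * (x * \<tau> + y)" if "0 \<le> x" "0 \<le> y" for x y z
  proof -
    have "LL * (x * L.tau + y) \<le> \<Lambda> * (x * \<tau> + y)"
      using that t \<Lambda> LL_ge(4) L.tau_pos by (intro mult_mono add_right_mono mult_left_mono add_nonneg_nonneg mult_nonneg_nonneg) auto
    then show "z \<le> LL * (x * L.tau + y) \<Longrightarrow> z \<le> \<Lambda> * (x * \<tau> + y)" by linarith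
  qed
  have gen': "z \<le> LL * (y + L.tau) \<Longrightarrow> z \<le> \<Lambda> * (y + \<tau>)" "z \<le> LL * y \<Longrightarrow> z \<le> \<Lambda> * y" if "0 \<le> y" for y z
    using gen[of 1 y z] gen[of 0 y z] that by (simp_all add: add.commute)
  have mx: "0 \<le> max a (1 :: real)" for a by simp
  have bb: "integrable \<pi> (\<lambda>b. b $ i * b $ j)" if "i < d" "j < d" for i j
    using integrable_index_shift_mult[OF that, of 0 0] by simp
  have "op_norm d (mat_sqrt d Hm * (cov_mat d \<pi> - mat_inv Hm) * mat_sqrt d Hm) \<le> LL * (L.eps\<^sup>2 + L.tau)"
  proof (rule op_norm_whitened_le[OF d1 pos_def_H _ _ _ cov_bound])
    show "cov_mat d \<pi> - mat_inv Hm \<in> carrier_mat d d" using mat_inv_H_carrier by auto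
    show "transpose_mat (cov_mat d \<pi> - mat_inv Hm) = cov_mat d \<pi> - mat_inv Hm"
      using cov_carrier mat_inv_H_carrier by (simp add: transpose_minus[of _ d d] cov_sym transpose_mat_inv_H)
    show "0 \<le> LL * (L.eps\<^sup>2 + L.tau)" using LL_ge(4) L.tau_pos by (intro mult_nonneg_nonneg) auto
  qed
  note cov = gen'(1)[OF zero_le_power2 this[unfolded e]]
  show ?thesis
  proof (intro conjI allI impI)
    show "pos_def d Hm" "prob_space \<pi>" by (rule pos_def_H, rule prob_space_gibbs)
    show "\<bar>tv_leading d V m\<bar> \<le> \<Lambda> * \<epsilon>"
      using gen'(2)[OF \<epsilon>0] tv_bounds(1,2) by (simp add: e)
    show "op_norm d (mat_sqrt d Hm * (cov_mat d \<pi> - mat_inv Hm) * mat_sqrt d Hm) \<le> \<Lambda> * (\<epsilon>\<^sup>2 + \<tau>)"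
      by (rule cov)
    show "wnorm Hm (bm - m - mean_shift d V m) \<le> \<Lambda> * (\<epsilon> ^ 3 + \<tau>)"
      using gen'(1)[OF _ mean_bounds(2)[unfolded e]] \<epsilon>0 by simp
    fix g a assume st: "standardized d V m g a"
    note b = standardized_bounds[OF st, unfolded e]
    show "integrable \<pi> g" "\<bar>(\<integral>b. g b \<partial>\<pi>) - (\<integral>b. g b \<partial>\<gamma>)\<bar> \<le> \<Lambda> * (max a 1 * \<tau> + \<epsilon>)"
      by (rule b(1), rule gen[OF mx \<epsilon>0 b(2)])
    show "\<bar>(\<integral>b. g b \<partial>\<pi>) - skew_laplace_integral d V m g\<bar> \<le> \<Lambda> * (max a 1 * \<tau> + \<epsilon> ^ 3)" if "odd_about d m g"
      using gen[OF mx _ b(5)[OF that]] \<epsilon>0 by simp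
    show "\<bar>(\<integral>b. g b \<partial>\<pi>) - (\<integral>b. g b \<partial>\<gamma>)\<bar> \<le> \<Lambda> * (max a 1 * \<tau> + \<epsilon>\<^sup>2)" if "even_about d m g"
      by (rule gen[OF mx zero_le_power2 b(3)[OF that]])
    show "\<bar>(\<integral>b. g b \<partial>\<pi>) - skew_laplace_integral d V m g\<bar> \<le> \<Lambda> * (max a 1 * \<tau> + \<epsilon>\<^sup>2)"
      by (rule gen[OF mx zero_le_power2 b(4)])
  qed (rule tv_bounds(3) gen'(1)[OF zero_le_power2 tv_bounds(4)[unfolded e]] integrable_index
      gen'(2)[OF \<epsilon>0 mean_bounds(1)[unfolded e]] bb, assumption?)+
qed

end

lemma prior_precision_psd: "prior_precision d P \<Longrightarrow> pos_semidef d P"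
proof -
  assume "prior_precision d P"
  then consider "P = 0\<^sub>m d d" | \<Sigma> where "pos_def d \<Sigma>" "P = mat_inv \<Sigma>"
    unfolding prior_precision_def by blast
  then show ?thesis
  proof cases
    case 1
    have "0\<^sub>m d d *\<^sub>v u = 0\<^sub>v d" if "u \<in> carrier_vec d" for u :: rvec using that by (intro eq_vecI) auto
    then show ?thesis using 1 by (auto simp: pos_semidef_def)
  next
    case 2
    then have "pos_def d P" using pos_def_mat_inv by blast
    then have "P \<in> carrier_mat d d" "transpose_mat P = P" "\<forall>u\<in>carrier_vec d. u \<noteq> 0\<^sub>v d \<longrightarrow> 0 < u \<bullet> (P *\<^sub>v u)"
      by (auto simp: pos_def_def)
    moreover have "0 \<le> u \<bullet> (P *\<^sub>v u)" if "u \<in> carrier_vec d" for u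
      using that calculation by (cases "u = 0\<^sub>v d") (auto intro: less_imp_le)
    ultimately show ?thesis by (simp add: pos_semidef_def)
  qed
qed

lemma is_arg_min_divide:
  fixes f :: "'a \<Rightarrow> real"
  shows "0 < c \<Longrightarrow> is_arg_min (\<lambda>x. f x / c) P m \<longleftrightarrow> is_arg_min f P m"
  by (simp add: is_arg_min_def divide_less_cancel)

text \<open>The bound on the signal, \<open>K\<close>, is quantified outermost and all constants
  after it, before dimension, sample size and data: this is what absolute and deterministic mean
  here. Integrability and positive definiteness are part of the conclusion, so that the integrals
  and inverses in the bounds are not default values.\<close>

theorem corollary5p4:
  shows "\<forall>K>0. \<exists>eps0>0. \<exists>rho0>0. \<exists>C1>0. \<exists>C2>0. \<exists>C3>0. \<exists>L>0.
    \<forall>(d::nat) (n::nat) (M::rmat) (\<beta>::rvec) (P::rmat).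
      1 \<le> d \<longrightarrow> 1 \<le> n \<longrightarrow> pos_def d M \<longrightarrow> \<beta> \<in> carrier_vec d \<longrightarrow> wnorm M \<beta> \<le> K \<longrightarrow>
      prior_precision d P \<longrightarrow>
      real d / sqrt (real n) < eps0 \<longrightarrow> mat_wnorm d M P / real n < rho0 \<longrightarrow>
      (\<exists>E \<in> sets (data_law n d M \<beta>).
        measure (data_law n d M \<beta>) E
          \<ge> 1 - C1 * exp (- C2 * max (sqrt (real d)) (ln (real n))) \<and>
        (\<forall>D\<in>E.
          let \<epsilon> = real d / sqrt (real n);
              \<tau> = real d * exp (- C3 * real n powr (1 / 4) * sqrt (real d));
              V = potential n P D;
              v = (\<lambda>b. V b / real n);
              \<pi> = gibbs d V
          in (\<exists>!m. is_arg_min v (\<lambda>b. b \<in> carrier_vec d) m) \<and>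
             (\<forall>m. is_arg_min v (\<lambda>b. b \<in> carrier_vec d) m \<longrightarrow>
               (let H = hessian d V m; \<gamma> = laplace d V m in
                 pos_def d H \<and> prob_space \<pi> \<and>
                 (\<forall>g a. standardized d V m g a \<longrightarrow>
                    integrable \<pi> g \<and>
                    \<bar>(\<integral>b. g b \<partial>\<pi>) - (\<integral>b. g b \<partial>\<gamma>)\<bar> \<le> L * (max a 1 * \<tau> + \<epsilon>) \<and>
                    (even_about d m g \<longrightarrow>
                      \<bar>(\<integral>b. g b \<partial>\<pi>) - (\<integral>b. g b \<partial>\<gamma>)\<bar> \<le> L * (max a 1 * \<tau> + \<epsilon>\<^sup>2)) \<and>
                    \<bar>(\<integral>b. g b \<partial>\<pi>) - skew_laplace_integral d V m g\<bar>
                      \<le> L * (max a 1 * \<tau> + \<epsilon>\<^sup>2) \<and>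
                    (odd_about d m g \<longrightarrow>
                      \<bar>(\<integral>b. g b \<partial>\<pi>) - skew_laplace_integral d V m g\<bar>
                        \<le> L * (max a 1 * \<tau> + \<epsilon> ^ 3))) \<and>
                 \<bar>tv_leading d V m\<bar> \<le> L * \<epsilon> \<and>
                 \<bar>tv d (measure \<pi>) (measure \<gamma>) - tv_leading d V m\<bar>
                   \<le> tv d (measure \<pi>) (skew_laplace d V m) \<and>
                 tv d (measure \<pi>) (skew_laplace d V m) \<le> L * (\<epsilon>\<^sup>2 + \<tau>) \<and>
                 (\<forall>i<d. integrable \<pi> (\<lambda>b. b $ i)) \<and>
                 wnorm H (mean_shift d V m) \<le> L * \<epsilon> \<and>
                 wnorm H (mean_vec d \<pi> - m - mean_shift d V m) \<le> L * (\<epsilon> ^ 3 + \<tau>) \<and>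
                 (\<forall>i<d. \<forall>j<d. integrable \<pi> (\<lambda>b. b $ i * b $ j)) \<and>
                 op_norm d (mat_sqrt d H * (cov_mat d \<pi> - mat_inv H) * mat_sqrt d H)
                   \<le> L * (\<epsilon>\<^sup>2 + \<tau>)))))"
proof -
  let "\<forall>K>0. ?G K" = ?thesis
  let "\<forall>K>0. \<exists>eps0>0. \<exists>rho0>0. \<exists>C1>0. \<exists>C2>0. \<exists>C3>0. \<exists>L>0. \<forall>d n M \<beta> P.
    _ \<longrightarrow> _ \<longrightarrow> _ \<longrightarrow> _ \<longrightarrow> _ \<longrightarrow> _ \<longrightarrow> _ \<longrightarrow> _ \<longrightarrow> ?E C1 C2 C3 L d n M \<beta> P" = ?thesis
  have "?G K" if K: "0 < K" for K :: real
  proof -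
    define c where "c = exp (- 32 * K) / 64"
    define K1 where "K1 = ctp 2 + 20"
    define K3 where "K3 = ctp 3 + 4"
    define R where "R = 8 * (16 * K1\<^sup>2) / c"
    define C2 where "C2 = min 1 (c\<^sup>2 / 8) / 3"
    \<comment> \<open>Outside their locales \<open>BB\<close> and \<open>LL\<close> are functions of
      the three constants of the design alone, hence of \<open>K\<close>.\<close>
    define B where "B = max 1 (good_data.BB (16 * K1\<^sup>2) (c / 8) (K3 ^ 3))"
    define L where "L = max 1 (coord_data.LL (16 * K1\<^sup>2) (c / 8) (K3 ^ 3))"
    \<comment> \<open>The three terms give, in this order, \<open>d \<le> sqrt n\<close>, the
      smallness required in whitened coordinates, and a sample large enough to beat the entropy of
      the net for the margins.\<close>
    define eps0 where "eps0 = min 1 (min (1 / (2 ^ 20 * B\<^sup>2)) (c\<^sup>2 / 8 / (R + 2)))"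
    have c: "0 < c" by (simp add: c_def)
    have R: "0 \<le> R" using c by (simp add: R_def)
    have C2: "0 < C2" using c by (simp add: C2_def)
    have B: "1 \<le> B" and L: "0 < L" by (simp_all add: B_def L_def)
    have eps0: "0 < eps0" using B R c by (simp add: eps0_def)
    have key: "?E 3 C2 (1 / 16) L d n M \<beta> P"
      (is "\<exists>E\<in>_. _ \<and> (\<forall>D\<in>E. ?goal D)")
      if d1: "1 \<le> d" and n1: "1 \<le> n" and M: "pos_def d M" and \<beta>: "\<beta> \<in> carrier_vec d" and \<beta>K: "wnorm M \<beta> \<le> K"
        and P: "prior_precision d P" and small: "real d / sqrt (real n) < eps0"
      for d n :: nat and M P :: rmat and \<beta> :: rvec
    proof -
      have n0: "0 < real n" using n1 by simp
      have sn: "0 < sqrt (real n)" "sqrt (real n) \<le> real n" using n1 by (auto intro: real_le_lsqrt simp: self_le_power)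
      have small1: "real d \<le> sqrt (real n)"
        using small sn by (simp add: eps0_def divide_less_eq)
      have small2: "(R + 2) * real d \<le> real n * c\<^sup>2 / 8"
      proof -
        have "real d / sqrt (real n) \<le> c\<^sup>2 / 8 / (R + 2)" using small by (simp add: eps0_def)
        then have "(R + 2) * real d \<le> c\<^sup>2 / 8 * sqrt (real n)" using sn R by (simp add: field_simps)
        also have "\<dots> \<le> c\<^sup>2 / 8 * real n" using sn by (intro mult_left_mono) auto
        finally show ?thesis by (simp add: mult.commute)
      qed
      have small3: "2 ^ 20 * B\<^sup>2 * (real d / sqrt (real n)) \<le> 1"
      proof -
        have B2: "0 < 2 ^ 20 * B\<^sup>2" using B by simp
        have "2 ^ 20 * B\<^sup>2 * (real d / sqrt (real n)) \<le> 2 ^ 20 * B\<^sup>2 * (1 / (2 ^ 20 * B\<^sup>2))"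
          using small B2 by (intro mult_left_mono) (auto simp: eps0_def)
        then show ?thesis using B2 by simp
      qed
      obtain A0 where "whitening d (mat_inv M) A0"
        using pos_def_imp_whitening[OF pos_def_mat_inv(1)[OF M]] by blast
      then interpret O: obs_model d M A0 \<beta>
        using d1 M \<beta> by (simp add: obs_model_def obs_model_axioms_def)
      obtain E where E: "E \<in> sets (data_law n d M \<beta>)"
        and pE: "1 - 3 * exp (- C2 * max (sqrt (real d)) (ln (real n))) \<le> measure (data_law n d M \<beta>) E"
        and good: "\<And>D. D \<in> E \<Longrightarrow> good_data d n P D M (16 * K1\<^sup>2) (c / 8) (K3 ^ 3)"
        using O.good_event[OF n1 K \<beta>K c_def K1_def K3_def R_def small1 small2 C2_def] prior_precision_psd[OF P] by blast
      show ?thesis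
      proof (intro bexI[OF _ E] conjI pE ballI)
        fix D assume D: "D \<in> E"
        interpret G: good_data d n P D M "16 * K1\<^sup>2" "c / 8" "K3 ^ 3" by (rule good[OF D])
        {
          fix m assume m: "is_arg_min (potential n P D) (\<lambda>b. b \<in> carrier_vec d) m"
          interpret m: minimized_data d n P D M "16 * K1\<^sup>2" "c / 8" "K3 ^ 3" m
            by unfold_locales (rule m)
          obtain A where "whitening d (hessian d (potential n P D) m) A"
            using pos_def_imp_whitening[OF m.pos_def_H] by blast
          then interpret W: whitening d "hessian d (potential n P D) m" A .
          interpret coord_data d n P D M "16 * K1\<^sup>2" "c / 8" "K3 ^ 3" m A
          proof unfold_locales
            have "B = G.BB" by (simp add: B_def G.BB_def)
            then show "2 ^ 20 * G.BB\<^sup>2 * (real d / sqrt (real n)) \<le> 1" using small3 by simp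
          qed
          have "LL \<le> L" by (simp add: L_def)
          note argmin_unique posterior_bounds[OF refl this refl]
        }
        note ok = this
        have ex1: "\<exists>!m. is_arg_min (potential n P D) (\<lambda>b. b \<in> carrier_vec d) m"
          using G.argmin_exists ok(1) by blast
        show "?goal D"
          unfolding Let_def is_arg_min_divide[OF n0] by (rule conjI[OF ex1], intro allI impI, rule ok(2))
      qed
    qed
    show ?thesis
      by (rule exI[of _ eps0], rule conjI[OF eps0], rule exI[of _ "1 :: real"], rule conjI, simp,
          rule exI[of _ "3 :: real"], rule conjI, simp, rule exI[of _ C2], rule conjI[OF C2],
          rule exI[of _ "1 / 16"], rule conjI, simp, rule exI[of _ L], rule conjI[OF L],
          intro allI impI, rule key)
  qed
  then show ?thesis by blast
qed

end
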